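(* Let $\mathcal{C}'$ be either $\{C_4^3,C_5^3\}$ or $\{C_4^3,F_1,F_2\}$. Then $\pi(\mathcal{C}')\le 2\sqrt3-3$.
   Context: A $3$-graph is a set of $3$-element subsets of a vertex set. $C_4^3$ is the complete $3$-graph on $4$ vertices; $C_5^3$ is the $3$-graph on $\{1,\dots,5\}$ with edges $\{i,i+1,i+2\}$ (indices mod $5$). $F_1$ is the $3$-graph on $\{1,\dots,5\}$ with edges $\{1,2,3\},\{1,3,4\},\{1,4,2\},\{1,4,5\},\{2,3,4\}$; $F_2$ is the $3$-graph on $\{1,\dots,6\}$ with edges $\{1,2,3\},\{1,3,4\},\{1,4,5\},\{1,5,6\},\{1,6,2\},\{2,3,4\}$. $\mathrm{ex}(n,\mathcal{F})$ is the maximum number of edges in an $n$-vertex $3$-graph with no member of $\mathcal{F}$ as a subgraph, and $\pi(\mathcal{F})=\lim_{n\to\infty}\mathrm{ex}(n,\mathcal{F})/\binom n3$. *)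

theory Defs
  imports Complex_Main
begin

text \<open>A 3-graph is given as a pair of its vertex set and its edge set.\<close>

type_synonym 'a hgraph = "'a set \<times> 'a set set"

abbreviation verts :: "'a hgraph \<Rightarrow> 'a set" where "verts \<equiv> fst"
abbreviation edges :: "'a hgraph \<Rightarrow> 'a set set" where "edges \<equiv> snd"

definition three_graph :: "'a hgraph \<Rightarrow> bool" where
  "three_graph H \<longleftrightarrow> finite (verts H) \<and> (\<forall>e\<in>edges H. e \<subseteq> verts H \<and> card e = 3)"

text \<open>Subgraph containment is meant up to isomorphism and is not required to be induced.\<close>

definition contains_copy :: "'a hgraph \<Rightarrow> 'b hgraph \<Rightarrow> bool" where
  "contains_copy H F \<longleftrightarrow>
     (\<exists>f. inj_on f (verts F) \<and> f ` verts F \<subseteq> verts H \<and> (\<forall>e\<in>edges F. f ` e \<in> edges H))"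

definition free_of :: "'b hgraph set \<Rightarrow> 'a hgraph \<Rightarrow> bool" where
  "free_of \<F> H \<longleftrightarrow> (\<forall>F\<in>\<F>. \<not> contains_copy H F)"

text \<open>Every finite 3-graph is isomorphic to one whose vertices are natural numbers, so it
  suffices to let the host 3-graphs range over those.\<close>

definition turan_number :: "nat \<Rightarrow> 'b hgraph set \<Rightarrow> nat" where
  "turan_number n \<F> =
     Max {card (edges H) | H :: nat hgraph. three_graph H \<and> card (verts H) = n \<and> free_of \<F> H}"

definition turan_density :: "'b hgraph set \<Rightarrow> real" where
  "turan_density \<F> = lim (\<lambda>n. real (turan_number n \<F>) / real (n choose 3))"

definition C43 :: "nat hgraph" where
  "C43 = ({1..4}, {e. e \<subseteq> {1..4} \<and> card e = 3})"

definition C53 :: "nat hgraph" where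
  "C53 = ({1..5}, {{1,2,3}, {2,3,4}, {3,4,5}, {4,5,1}, {5,1,2}})"

definition F1 :: "nat hgraph" where
  "F1 = ({1..5}, {{1,2,3}, {1,3,4}, {1,4,2}, {1,4,5}, {2,3,4}})"

definition F2 :: "nat hgraph" where
  "F2 = ({1..6}, {{1,2,3}, {1,3,4}, {1,4,5}, {1,5,6}, {1,6,2}, {2,3,4}})"

end

theory Submission
  imports Defs "HOL-Analysis.Analysis"
begin

text \<open>Let \<open>\<lambda>\<close> be the largest edge density of a weighted 3-graph with the forbidden homomorphic
  images. For optimal weights every vertex has link density exactly \<open>\<lambda>\<close>, and restricting to a
  vertex set of measure \<open>b\<close> gives at most \<open>\<lambda> b\<^sup>3\<close>. A positive semidefinite certificate on six
  vertices produces a partition of the vertices into parts \<open>A\<close> and \<open>B\<close> in which the triples of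
  type \<open>AAB\<close> are dense; choose the partition that maximises their number. Local optimality
  of the partition and further certificates on five vertices (first to show that no vertex deviates
  much from the partition, then globally) show that the missing triples of type \<open>AAB\<close> outweigh the
  edges of type \<open>AAA\<close> and \<open>ABB\<close>. Hence \<open>\<lambda> \<le> \<lambda> b\<^sup>3 + 3 a\<^sup>2 b\<close> where \<open>a + b = 1\<close>, and
  maximising over \<open>b\<close> yields \<open>\<lambda> \<le> 2 \<surd>3 - 3\<close>. Random sampling transfers the bound from
  homomorphic images to copies.\<close>

text \<open>Equality in the recursion is the iterated construction: all triples of type AAB, then
  the same structure again inside B. No pattern of bounded size sees all its levels, so no
  certificate aims at 2 \<surd>3 - 3 directly: \<open>defect\<close> gives edges inside B weight 0,
  and the irrational constant enters only when b is optimised. The construction also tells where to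
  look for A. If abc is an edge with a and b in A and c in B, then A is the set of vertices that
  form edges with both ac and bc; so the candidates for A are the pairwise intersections of the
  three pair neighbourhoods of an edge. In the construction the AAB edges have density about 0.441,
  and the pairs completing a vertex to an AAB edge have density about 0.464 at A and 0.402 at B. The
  thresholds 403, 370 and 255, in thousandths, lie below these values and leave slack; only the last
  inequality, for \<open>defect\<close>, is tight. One set of certificates serves both families: a
  pattern is discarded only if each family forbids something in it.\<close>

fun dot :: "int list \<Rightarrow> int list \<Rightarrow> int" where
  "dot (x # xs) (y # ys) = x * y + dot xs ys"
| "dot _ _ = 0"

lemma dot_Nil2 [simp]: "dot xs [] = 0"
  by (cases xs) auto

lemma dot_commute: "dot xs ys = dot ys xs"
  by (induction xs ys rule: dot.induct) auto

text \<open>Coordinate k contributes the square of the sum of \<open>u i\<close> times the entry k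
  of \<open>F i\<close>. Since \<open>dot\<close> stops at the end of the shorter list, missing
  entries act as zeros; in particular a pattern with the vector \<open>[]\<close> drops out of the
  form.\<close>

lemma dot_psd:
  fixes u :: "'i \<Rightarrow> real"
  assumes "finite I"
  shows "0 \<le> (\<Sum>i\<in>I. \<Sum>j\<in>I. u i * u j * real_of_int (dot (F i) (F j)))"
proof -
  have "0 \<le> (\<Sum>i\<in>I. \<Sum>j\<in>I. u i * u j * real_of_int (dot (F i) (F j)))"
    if "\<forall>i\<in>I. length (F i) \<le> n" for n
    using that
  proof (induction n arbitrary: F)
    case 0
    then show ?case by (auto intro!: sum_nonneg)
  next
    case (Suc n)
    define g where "g i = (case F i of [] \<Rightarrow> 0 | x # _ \<Rightarrow> real_of_int x)" for i
    have split: "real_of_int (dot (F i) (F j)) = g i * g j + real_of_int (dot (tl (F i)) (tl (F j)))" for i j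
      unfolding g_def by (cases "F i"; cases "F j") auto
    have "0 \<le> (\<Sum>i\<in>I. \<Sum>j\<in>I. u i * u j * real_of_int (dot (tl (F i)) (tl (F j))))"
      using Suc.prems by (intro Suc.IH) auto
    moreover have "(\<Sum>i\<in>I. \<Sum>j\<in>I. u i * u j * (g i * g j)) = (\<Sum>i\<in>I. u i * g i)\<^sup>2"
      by (simp add: power2_eq_square sum_product algebra_simps)
    ultimately show ?case
      by (simp add: split distrib_left sum.distrib)
  qed
  moreover have "\<forall>i\<in>I. length (F i) \<le> (\<Sum>i\<in>I. length (F i))"
    using assms by (auto intro: member_le_sum)
  ultimately show ?thesis by blast
qed

fun wdot :: "int list \<Rightarrow> int list \<Rightarrow> int list \<Rightarrow> int" where
  "wdot (d # ds) (x # xs) (y # ys) = d * (x * y) + wdot ds xs ys"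
| "wdot _ _ _ = 0"

lemma wdot_Nil [simp]: "wdot ds [] ys = 0" "wdot ds xs [] = 0"
  by (cases ds; simp) (cases ds; cases xs; simp)

lemma wdot_commute: "wdot ds xs ys = wdot ds ys xs"
  by (induction ds xs ys rule: wdot.induct) (auto simp: mult.commute)

text \<open>Nonnegative diagonal weights \<open>ds\<close> turn the sum of squares into a weighted
  sum of squares, as in an LDL decomposition with integer data.\<close>

lemma wdot_psd:
  fixes u :: "'i \<Rightarrow> real"
  assumes "\<forall>d\<in>set ds. 0 \<le> d"
  shows "0 \<le> (\<Sum>i\<in>I. \<Sum>j\<in>I. u i * u j * real_of_int (wdot ds (F i) (F j)))"
  using assms
proof (induction ds arbitrary: F)
  case (Cons d ds)
  define g where "g i = (case F i of [] \<Rightarrow> 0 | x # _ \<Rightarrow> real_of_int x)" for i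
  have split: "real_of_int (wdot (d # ds) (F i) (F j)) = d * (g i * g j) + real_of_int (wdot ds (tl (F i)) (tl (F j)))" for i j
    unfolding g_def by (cases "F i"; cases "F j") auto
  have "0 \<le> (\<Sum>i\<in>I. \<Sum>j\<in>I. u i * u j * real_of_int (wdot ds (tl (F i)) (tl (F j))))"
    using Cons.prems by (intro Cons.IH) auto
  moreover have "(\<Sum>i\<in>I. \<Sum>j\<in>I. u i * u j * (d * (g i * g j))) = d * (\<Sum>i\<in>I. u i * g i)\<^sup>2"
    by (simp add: power2_eq_square sum_product sum_distrib_left algebra_simps)
  ultimately show ?case
    using Cons.prems by (simp add: split distrib_left sum.distrib)
qed simp

fun add2 :: "int list \<Rightarrow> int list \<Rightarrow> int list" where
  "add2 (x # xs) (y # ys) = (x + y) # add2 xs ys"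
| "add2 [] ys = ys"
| "add2 xs [] = xs"

fun mul2 :: "int list \<Rightarrow> int list \<Rightarrow> int list" where
  "mul2 (x # xs) (y # ys) = (x * y) # mul2 xs ys"
| "mul2 _ _ = []"

lemma dot_add2: "dot ds (add2 xs ys) = dot ds xs + dot ds ys"
proof (induction xs ys arbitrary: ds rule: add2.induct)
  case (1 x xs y ys)
  then show ?case by (cases ds) (auto simp: algebra_simps)
qed auto

lemma dot_mul2: "dot ds (mul2 xs ys) = wdot ds xs ys"
  by (induction ds xs ys rule: wdot.induct) auto

section \<open>Lexicographic comparison of bit patterns\<close>

fun lexle :: "bool list \<Rightarrow> bool list \<Rightarrow> bool" where
  "lexle (x # xs) (y # ys) = (if x then (if y then lexle xs ys else False)
     else (if y then True else lexle xs ys))"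
| "lexle _ _ = True"

fun bcode :: "bool list \<Rightarrow> nat" where
  "bcode [] = 0"
| "bcode (x # xs) = (if x then 2 ^ length xs else 0) + bcode xs"

lemma bcode_less: "bcode xs < 2 ^ length xs"
  by (induction xs) auto

text \<open>\<open>bcode\<close> reads the list as a binary number with the most significant bit
  first. The number serves as a well-founded measure, while the finite checks only evaluate
  \<open>lexle\<close>.\<close>

lemma lexle_if_bcode_le: "length xs = length ys \<Longrightarrow> bcode xs \<le> bcode ys \<Longrightarrow> lexle xs ys"
proof (induction xs ys rule: lexle.induct)
  case (1 x xs y ys)
  then show ?case
    using bcode_less[of xs] bcode_less[of ys] by (auto split: if_splits)
qed auto

section \<open>Averages with respect to a probability weight\<close>

locale weighted =
  fixes V :: "'v set" and w :: "'v \<Rightarrow> real"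
  assumes finite_V: "finite V"
    and w_nonneg: "x \<in> V \<Longrightarrow> 0 \<le> w x"
    and w_sum: "sum w V = 1"
begin

definition avg :: "('v \<Rightarrow> real) \<Rightarrow> real" where
  "avg f = (\<Sum>x\<in>V. w x * f x)"

lemma avg_add: "avg (\<lambda>x. f x + g x) = avg f + avg g"
  by (simp add: avg_def distrib_left sum.distrib)

lemma avg_diff: "avg (\<lambda>x. f x - g x) = avg f - avg g"
  by (simp add: avg_def right_diff_distrib sum_subtractf)

lemma avg_cmult: "avg (\<lambda>x. c * f x) = c * avg f"
  by (simp add: avg_def sum_distrib_left algebra_simps)

lemma avg_const [simp]: "avg (\<lambda>x. c) = c"
  by (simp add: avg_def flip: sum_distrib_right) (simp add: w_sum)

lemma avg_mono: "(\<And>x. x \<in> V \<Longrightarrow> f x \<le> g x) \<Longrightarrow> avg f \<le> avg g"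
  unfolding avg_def by (intro sum_mono mult_left_mono w_nonneg)

lemma avg_cong: "(\<And>x. x \<in> V \<Longrightarrow> f x = g x) \<Longrightarrow> avg f = avg g"
  unfolding avg_def by (intro sum.cong) auto

lemma avg_nonneg: "(\<And>x. x \<in> V \<Longrightarrow> 0 \<le> f x) \<Longrightarrow> 0 \<le> avg f"
  using avg_mono[of "\<lambda>_. 0" f] by simp

lemma avg_swap: "avg (\<lambda>x. avg (\<lambda>y. f x y)) = avg (\<lambda>y. avg (\<lambda>x. f x y))"
  unfolding avg_def sum_distrib_left
  by (subst sum.swap) (simp add: algebra_simps)

text \<open>Expectation over independent random choices of the listed coordinates of an assignment;
  \<open>\<phi>\<close> supplies the coordinates that are not listed, such as a fixed root.\<close>

fun avgs :: "nat list \<Rightarrow> ((nat \<Rightarrow> 'v) \<Rightarrow> real) \<Rightarrow> (nat \<Rightarrow> 'v) \<Rightarrow> real" where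
  "avgs [] g \<phi> = g \<phi>"
| "avgs (i # is) g \<phi> = avg (\<lambda>x. avgs is g (\<phi>(i := x)))"

lemma avgs_add: "avgs is (\<lambda>\<phi>. f \<phi> + g \<phi>) \<phi> = avgs is f \<phi> + avgs is g \<phi>"
  by (induction "is" arbitrary: \<phi>) (auto simp: avg_add)

lemma avgs_cmult: "avgs is (\<lambda>\<phi>. c * f \<phi>) \<phi> = c * avgs is f \<phi>"
  by (induction "is" arbitrary: \<phi>) (auto simp: avg_cmult)

lemma avgs_const [simp]: "avgs is (\<lambda>\<phi>. c) \<phi> = c"
  by (induction "is" arbitrary: \<phi>) auto

lemma avgs_mono:
  assumes "\<And>\<psi>. (\<And>i. \<psi> i = \<phi> i \<or> \<psi> i \<in> V) \<Longrightarrow> f \<psi> \<le> g \<psi>"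
  shows "avgs is f \<phi> \<le> avgs is g \<phi>"
  using assms
proof (induction "is" arbitrary: \<phi>)
  case (Cons i "is")
  show ?case
    unfolding avgs.simps
  proof (intro avg_mono Cons.IH)
    fix x \<psi> assume "x \<in> V" and *: "\<And>j. \<psi> j = (\<phi>(i := x)) j \<or> \<psi> j \<in> V"
    have "\<psi> j = \<phi> j \<or> \<psi> j \<in> V" for j
      using *[of j] \<open>x \<in> V\<close> by (cases "j = i") auto
    then show "f \<psi> \<le> g \<psi>" by (rule Cons.prems)
  qed
qed auto

lemma avgs_swap: "i \<noteq> j \<Longrightarrow> avgs (i # j # is) g \<phi> = avgs (j # i # is) g \<phi>"
  by (simp add: fun_upd_twist) (subst avg_swap, simp)

lemma avgs_move_front: "i \<notin> set us \<Longrightarrow> avgs (us @ i # vs) g \<phi> = avgs (i # us @ vs) g \<phi>"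
proof (induction us arbitrary: \<phi>)
  case (Cons u us)
  then have "avgs ((u # us) @ i # vs) g \<phi> = avgs (u # i # us @ vs) g \<phi>" by simp
  also have "\<dots> = avgs (i # u # us @ vs) g \<phi>" using Cons.prems by (intro avgs_swap) auto
  finally show ?case by simp
qed simp

text \<open>Fubini for iterated averages. All terms of a certificate share one tuple of random
  vertices, yet each can be averaged in the order of variables that suits it.\<close>

lemma avgs_perm:
  assumes "distinct is" "distinct js" "set is = set js"
  shows "avgs is g \<phi> = avgs js g \<phi>"
  using assms
proof (induction "is" arbitrary: js \<phi>)
  case (Cons i "is")
  then obtain us vs where js: "js = us @ i # vs"
    by (metis list.set_intros(1) split_list)
  have "avgs is g \<psi> = avgs (us @ vs) g \<psi>" for \<psi>
    using Cons.prems unfolding js by (intro Cons.IH) auto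
  then have "avgs (i # is) g \<phi> = avgs (i # us @ vs) g \<phi>" by simp
  also have "\<dots> = avgs js g \<phi>"
    unfolding js using Cons.prems js by (intro avgs_move_front[symmetric]) auto
  finally show ?case .
qed auto

lemma avg_dot_nonneg: "0 \<le> avg (\<lambda>x. avg (\<lambda>y. real_of_int (dot (F x) (F y))))"
proof -
  have "avg (\<lambda>x. avg (\<lambda>y. real_of_int (dot (F x) (F y)))) =
      (\<Sum>x\<in>V. \<Sum>y\<in>V. w x * w y * real_of_int (dot (F x) (F y)))"
    by (simp add: avg_def sum_distrib_left algebra_simps)
  then show ?thesis using dot_psd[OF finite_V] by simp
qed

lemma avg_wdot_nonneg:
  assumes "\<forall>d\<in>set ds. 0 \<le> d"
  shows "0 \<le> avg (\<lambda>x. avg (\<lambda>y. real_of_int (wdot ds (F x) (F y))))"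
proof -
  have "avg (\<lambda>x. avg (\<lambda>y. real_of_int (wdot ds (F x) (F y)))) =
      (\<Sum>x\<in>V. \<Sum>y\<in>V. w x * w y * real_of_int (wdot ds (F x) (F y)))"
    by (simp add: avg_def sum_distrib_left algebra_simps)
  then show ?thesis using wdot_psd[OF assms, where I = V] by simp
qed

text \<open>The pairs (a, b) and (c, d) are independent and identically distributed, so this is a
  Gram form indexed by pairs, with weights \<open>w a * w b\<close>.\<close>

lemma avg2_dot_nonneg:
  "0 \<le> avg (\<lambda>a. avg (\<lambda>b. avg (\<lambda>c. avg (\<lambda>d. real_of_int (dot (F a b) (F c d))))))"
proof -
  have "avg (\<lambda>a. avg (\<lambda>b. avg (\<lambda>c. avg (\<lambda>d. real_of_int (dot (F a b) (F c d)))))) =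
      (\<Sum>p\<in>V\<times>V. \<Sum>q\<in>V\<times>V. (w (fst p) * w (snd p)) * (w (fst q) * w (snd q))
        * real_of_int (dot (F (fst p) (snd p)) (F (fst q) (snd q))))"
    by (simp add: avg_def sum_distrib_left sum.cartesian_product' algebra_simps)
  also have "\<dots> \<ge> 0" using finite_V by (intro dot_psd) auto
  finally show ?thesis .
qed

end

section \<open>Forbidden configurations as Boolean functions of the edges\<close>

definition has_K4 :: "bool \<Rightarrow> bool \<Rightarrow> bool \<Rightarrow> bool \<Rightarrow> bool \<Rightarrow> bool \<Rightarrow> bool \<Rightarrow> bool \<Rightarrow> bool \<Rightarrow> bool \<Rightarrow> bool" where
  "has_K4 e012 e013 e023 e123 e014 e024 e124 e034 e134 e234 \<longleftrightarrow>
    e012 \<and> e013 \<and> e023 \<and> e123 \<or>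
    e012 \<and> e014 \<and> e024 \<and> e124 \<or>
    e013 \<and> e014 \<and> e034 \<and> e134 \<or>
    e023 \<and> e024 \<and> e034 \<and> e234 \<or>
    e123 \<and> e124 \<and> e134 \<and> e234"

text \<open>One disjunct for each of the 12 five-cycles on five labelled vertices; the variable
  \<open>eijk\<close> records whether the triple ijk is an edge.\<close>

definition has_C5 :: "bool \<Rightarrow> bool \<Rightarrow> bool \<Rightarrow> bool \<Rightarrow> bool \<Rightarrow> bool \<Rightarrow> bool \<Rightarrow> bool \<Rightarrow> bool \<Rightarrow> bool \<Rightarrow> bool" where
  "has_C5 e012 e013 e023 e123 e014 e024 e124 e034 e134 e234 \<longleftrightarrow>
    e012 \<and> e123 \<and> e014 \<and> e034 \<and> e234 \<or>
    e012 \<and> e013 \<and> e124 \<and> e034 \<and> e234 \<or>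
    e013 \<and> e123 \<and> e014 \<and> e024 \<and> e234 \<or>
    e012 \<and> e013 \<and> e024 \<and> e134 \<and> e234 \<or>
    e013 \<and> e023 \<and> e014 \<and> e124 \<and> e234 \<or>
    e012 \<and> e023 \<and> e014 \<and> e134 \<and> e234 \<or>
    e012 \<and> e123 \<and> e024 \<and> e034 \<and> e134 \<or>
    e012 \<and> e023 \<and> e124 \<and> e034 \<and> e134 \<or>
    e023 \<and> e123 \<and> e014 \<and> e024 \<and> e134 \<or>
    e013 \<and> e023 \<and> e024 \<and> e124 \<and> e134 \<or>
    e013 \<and> e123 \<and> e024 \<and> e124 \<and> e034 \<or>
    e023 \<and> e123 \<and> e014 \<and> e124 \<and> e034"

text \<open>The 60 labelled copies of the pattern abc, acd, bcd, ace, ade. It is the image of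
  \<open>F2\<close> under identification of the sixth vertex with the third, and differs from the
  graph \<open>F1\<close>.\<close>

definition has_F1 :: "bool \<Rightarrow> bool \<Rightarrow> bool \<Rightarrow> bool \<Rightarrow> bool \<Rightarrow> bool \<Rightarrow> bool \<Rightarrow> bool \<Rightarrow> bool \<Rightarrow> bool \<Rightarrow> bool" where
  "has_F1 e012 e013 e023 e123 e014 e024 e124 e034 e134 e234 \<longleftrightarrow>
    e012 \<and> e023 \<and> e123 \<and> e024 \<and> e034 \<or>
    e012 \<and> e023 \<and> e024 \<and> e124 \<and> e034 \<or>
    e013 \<and> e023 \<and> e123 \<and> e024 \<and> e034 \<or>
    e013 \<and> e023 \<and> e024 \<and> e034 \<and> e134 \<or>
    e023 \<and> e014 \<and> e024 \<and> e124 \<and> e034 \<or>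
    e023 \<and> e014 \<and> e024 \<and> e034 \<and> e134 \<or>
    e012 \<and> e013 \<and> e123 \<and> e014 \<and> e034 \<or>
    e012 \<and> e013 \<and> e014 \<and> e124 \<and> e034 \<or>
    e013 \<and> e023 \<and> e123 \<and> e014 \<and> e034 \<or>
    e013 \<and> e023 \<and> e014 \<and> e034 \<and> e234 \<or>
    e013 \<and> e014 \<and> e024 \<and> e124 \<and> e034 \<or>
    e013 \<and> e014 \<and> e024 \<and> e034 \<and> e234 \<or>
    e012 \<and> e013 \<and> e123 \<and> e014 \<and> e024 \<or>
    e012 \<and> e013 \<and> e014 \<and> e024 \<and> e134 \<or>
    e012 \<and> e023 \<and> e123 \<and> e014 \<and> e024 \<or>
    e012 \<and> e023 \<and> e014 \<and> e024 \<and> e234 \<or>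
    e012 \<and> e014 \<and> e024 \<and> e034 \<and> e134 \<or>
    e012 \<and> e014 \<and> e024 \<and> e034 \<and> e234 \<or>
    e012 \<and> e013 \<and> e023 \<and> e014 \<and> e124 \<or>
    e012 \<and> e013 \<and> e023 \<and> e014 \<and> e134 \<or>
    e012 \<and> e013 \<and> e023 \<and> e024 \<and> e124 \<or>
    e012 \<and> e013 \<and> e023 \<and> e024 \<and> e234 \<or>
    e012 \<and> e013 \<and> e023 \<and> e034 \<and> e134 \<or>
    e012 \<and> e013 \<and> e023 \<and> e034 \<and> e234 \<or>
    e012 \<and> e023 \<and> e123 \<and> e124 \<and> e134 \<or>
    e012 \<and> e123 \<and> e024 \<and> e124 \<and> e134 \<or>
    e013 \<and> e023 \<and> e123 \<and> e124 \<and> e134 \<or>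
    e013 \<and> e123 \<and> e124 \<and> e034 \<and> e134 \<or>
    e123 \<and> e014 \<and> e024 \<and> e124 \<and> e134 \<or>
    e123 \<and> e014 \<and> e124 \<and> e034 \<and> e134 \<or>
    e013 \<and> e023 \<and> e123 \<and> e014 \<and> e134 \<or>
    e013 \<and> e123 \<and> e014 \<and> e134 \<and> e234 \<or>
    e013 \<and> e014 \<and> e024 \<and> e124 \<and> e134 \<or>
    e013 \<and> e014 \<and> e124 \<and> e134 \<and> e234 \<or>
    e012 \<and> e023 \<and> e123 \<and> e014 \<and> e124 \<or>
    e012 \<and> e123 \<and> e014 \<and> e124 \<and> e234 \<or>
    e012 \<and> e014 \<and> e124 \<and> e034 \<and> e134 \<or>
    e012 \<and> e014 \<and> e124 \<and> e134 \<and> e234 \<or>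
    e012 \<and> e013 \<and> e123 \<and> e024 \<and> e124 \<or>
    e012 \<and> e013 \<and> e123 \<and> e124 \<and> e234 \<or>
    e012 \<and> e013 \<and> e123 \<and> e034 \<and> e134 \<or>
    e012 \<and> e013 \<and> e123 \<and> e134 \<and> e234 \<or>
    e013 \<and> e023 \<and> e123 \<and> e124 \<and> e234 \<or>
    e023 \<and> e123 \<and> e124 \<and> e034 \<and> e234 \<or>
    e123 \<and> e014 \<and> e024 \<and> e124 \<and> e234 \<or>
    e123 \<and> e024 \<and> e124 \<and> e034 \<and> e234 \<or>
    e013 \<and> e023 \<and> e123 \<and> e024 \<and> e234 \<or>
    e023 \<and> e123 \<and> e024 \<and> e134 \<and> e234 \<or>
    e023 \<and> e014 \<and> e024 \<and> e124 \<and> e234 \<or>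
    e023 \<and> e024 \<and> e124 \<and> e134 \<and> e234 \<or>
    e012 \<and> e024 \<and> e124 \<and> e034 \<and> e234 \<or>
    e012 \<and> e024 \<and> e124 \<and> e134 \<and> e234 \<or>
    e012 \<and> e023 \<and> e123 \<and> e034 \<and> e234 \<or>
    e012 \<and> e023 \<and> e123 \<and> e134 \<and> e234 \<or>
    e123 \<and> e014 \<and> e034 \<and> e134 \<and> e234 \<or>
    e123 \<and> e024 \<and> e034 \<and> e134 \<and> e234 \<or>
    e023 \<and> e014 \<and> e034 \<and> e134 \<and> e234 \<or>
    e023 \<and> e124 \<and> e034 \<and> e134 \<and> e234 \<or>
    e013 \<and> e024 \<and> e034 \<and> e134 \<and> e234 \<or>
    e013 \<and> e124 \<and> e034 \<and> e134 \<and> e234"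

text \<open>A pattern containing both a five-cycle and the five-vertex image of \<open>F2\<close>
  occurs in neither family, whereas a pattern with just one of them occurs in one of the families
  and must be covered. The restriction is thus valid for both families at once.\<close>

definition allowed5 :: "bool \<Rightarrow> bool \<Rightarrow> bool \<Rightarrow> bool \<Rightarrow> bool \<Rightarrow> bool \<Rightarrow> bool \<Rightarrow> bool \<Rightarrow> bool \<Rightarrow> bool \<Rightarrow> bool" where
  "allowed5 e012 e013 e023 e123 e014 e024 e124 e034 e134 e234 \<longleftrightarrow>
    (if has_K4 e012 e013 e023 e123 e014 e024 e124 e034 e134 e234 then False
     else if has_C5 e012 e013 e023 e123 e014 e024 e124 e034 e134 e234
     then \<not> has_F1 e012 e013 e023 e123 e014 e024 e124 e034 e134 e234 else True)"

text \<open>Vertex 0 is the root and stays fixed; minimality is tested against the six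
  transpositions of 1, 2, 3, 4.\<close>

definition lexmin4 :: "bool \<Rightarrow> bool \<Rightarrow> bool \<Rightarrow> bool \<Rightarrow> bool \<Rightarrow> bool \<Rightarrow> bool \<Rightarrow> bool \<Rightarrow> bool \<Rightarrow> bool \<Rightarrow> bool \<Rightarrow> bool \<Rightarrow> bool \<Rightarrow> bool \<Rightarrow> bool" where
  "lexmin4 c1 c2 c3 c4 e012 e013 e023 e123 e014 e024 e124 e034 e134 e234 \<longleftrightarrow>
    (if \<not> lexle [c1, c2, c3, c4, e012, e013, e023, e123, e014, e024, e124, e034, e134, e234] [c2, c1, c3, c4, e012, e023, e013, e123, e024, e014, e124, e034, e234, e134] then False else
     if \<not> lexle [c1, c2, c3, c4, e012, e013, e023, e123, e014, e024, e124, e034, e134, e234] [c3, c2, c1, c4, e023, e013, e012, e123, e034, e024, e234, e014, e134, e124] then False else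
     if \<not> lexle [c1, c2, c3, c4, e012, e013, e023, e123, e014, e024, e124, e034, e134, e234] [c4, c2, c3, c1, e024, e034, e023, e234, e014, e012, e124, e013, e134, e123] then False else
     if \<not> lexle [c1, c2, c3, c4, e012, e013, e023, e123, e014, e024, e124, e034, e134, e234] [c1, c3, c2, c4, e013, e012, e023, e123, e014, e034, e134, e024, e124, e234] then False else
     if \<not> lexle [c1, c2, c3, c4, e012, e013, e023, e123, e014, e024, e124, e034, e134, e234] [c1, c4, c3, c2, e014, e013, e034, e134, e012, e024, e124, e023, e123, e234] then False else
     if \<not> lexle [c1, c2, c3, c4, e012, e013, e023, e123, e014, e024, e124, e034, e134, e234] [c1, c2, c4, c3, e012, e014, e024, e124, e013, e023, e123, e034, e134, e234] then False else True)"

definition lexmin5 :: "bool \<Rightarrow> bool \<Rightarrow> bool \<Rightarrow> bool \<Rightarrow> bool \<Rightarrow> bool \<Rightarrow> bool \<Rightarrow> bool \<Rightarrow> bool \<Rightarrow> bool \<Rightarrow> bool \<Rightarrow> bool \<Rightarrow> bool \<Rightarrow> bool \<Rightarrow> bool \<Rightarrow> bool" where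
  "lexmin5 c0 c1 c2 c3 c4 e012 e013 e023 e123 e014 e024 e124 e034 e134 e234 \<longleftrightarrow>
    (if \<not> lexle [c0, c1, c2, c3, c4, e012, e013, e023, e123, e014, e024, e124, e034, e134, e234] [c1, c0, c2, c3, c4, e012, e013, e123, e023, e014, e124, e024, e134, e034, e234] then False else
     if \<not> lexle [c0, c1, c2, c3, c4, e012, e013, e023, e123, e014, e024, e124, e034, e134, e234] [c2, c1, c0, c3, c4, e012, e123, e023, e013, e124, e024, e014, e234, e134, e034] then False else
     if \<not> lexle [c0, c1, c2, c3, c4, e012, e013, e023, e123, e014, e024, e124, e034, e134, e234] [c3, c1, c2, c0, c4, e123, e013, e023, e012, e134, e234, e124, e034, e014, e024] then False else
     if \<not> lexle [c0, c1, c2, c3, c4, e012, e013, e023, e123, e014, e024, e124, e034, e134, e234] [c4, c1, c2, c3, c0, e124, e134, e234, e123, e014, e024, e012, e034, e013, e023] then False else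
     if \<not> lexle [c0, c1, c2, c3, c4, e012, e013, e023, e123, e014, e024, e124, e034, e134, e234] [c0, c2, c1, c3, c4, e012, e023, e013, e123, e024, e014, e124, e034, e234, e134] then False else
     if \<not> lexle [c0, c1, c2, c3, c4, e012, e013, e023, e123, e014, e024, e124, e034, e134, e234] [c0, c3, c2, c1, c4, e023, e013, e012, e123, e034, e024, e234, e014, e134, e124] then False else
     if \<not> lexle [c0, c1, c2, c3, c4, e012, e013, e023, e123, e014, e024, e124, e034, e134, e234] [c0, c4, c2, c3, c1, e024, e034, e023, e234, e014, e012, e124, e013, e134, e123] then False else
     if \<not> lexle [c0, c1, c2, c3, c4, e012, e013, e023, e123, e014, e024, e124, e034, e134, e234] [c0, c1, c3, c2, c4, e013, e012, e023, e123, e014, e034, e134, e024, e124, e234] then False else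
     if \<not> lexle [c0, c1, c2, c3, c4, e012, e013, e023, e123, e014, e024, e124, e034, e134, e234] [c0, c1, c4, c3, c2, e014, e013, e034, e134, e012, e024, e124, e023, e123, e234] then False else
     if \<not> lexle [c0, c1, c2, c3, c4, e012, e013, e023, e123, e014, e024, e124, e034, e134, e234] [c0, c1, c2, c4, c3, e012, e014, e024, e124, e013, e023, e123, e034, e134, e234] then False else True)"

section \<open>Colourings, weights of triples, and certificates at a root vertex\<close>

definition two :: "bool \<Rightarrow> bool \<Rightarrow> bool \<Rightarrow> bool" where
  "two a b c \<longleftrightarrow> (if a then (if b then \<not> c else c) else (if b then c else False))"

text \<open>1000 times the indicator of an AAB edge, minus 403: the mean is nonnegative exactly when
  the AAB edges have density at least 0.403.\<close>

definition cut_weight :: "bool \<Rightarrow> bool \<Rightarrow> bool \<Rightarrow> bool \<Rightarrow> int" where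
  "cut_weight a b c e = (if e then (if two a b c then 597 else - 403) else - 403)"

text \<open>Missing AAB triples count positively, edges AAA and ABB negatively. Edges inside B weigh
  0, since the recursion on B accounts for them.\<close>

definition defect :: "bool \<Rightarrow> bool \<Rightarrow> bool \<Rightarrow> bool \<Rightarrow> int" where
  "defect a b c e = (if two a b c then (if e then 0 else 1000)
     else if e then (if a then - 1000 else if b then - 1000 else if c then - 1000 else 0) else 0)"

text \<open>Equal to \<open>defect\<close> plus 700 for every AAB edge, minus 288: a variant with
  slack in the iterated construction, which can be proved before the vertices of B are under
  control.\<close>

definition defect_weight :: "bool \<Rightarrow> bool \<Rightarrow> bool \<Rightarrow> bool \<Rightarrow> int" where
  "defect_weight a b c e = (if two a b c then (if e then 412 else 712)
     else if e then (if a then - 1288 else if b then - 1288 else if c then - 1288 else - 288) else - 288)"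

text \<open>Data refuting that a root of colour \<open>rcol\<close> has its AAB link density, in
  thousandths, between \<open>rlo\<close> and \<open>rup\<close>. \<open>rV3\<close> and
  \<open>rV1\<close> give the vectors of squares, over the types formed by the root with two more
  vertices and by the root alone; \<open>rq\<close> is a weight of triples known to have nonnegative
  mean. The remaining fields are multipliers: of degree bounds (\<open>rdeg\<close> at the root,
  \<open>rdeg1\<close> elsewhere), of local optimality (\<open>rloc\<close>), of the bounds on the
  link density (\<open>rhi\<close>, \<open>rlohi\<close>), of the equality of degrees
  (\<open>req\<close>) and of the mean of \<open>rq\<close> (\<open>rtri\<close>).\<close>

record rcert =
  rcol :: bool
  rlo :: int
  rup :: int
  rq :: "bool \<Rightarrow> bool \<Rightarrow> bool \<Rightarrow> bool \<Rightarrow> int"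
  rV3 :: "bool \<Rightarrow> bool \<Rightarrow> bool \<Rightarrow> bool \<Rightarrow> bool \<Rightarrow> bool \<Rightarrow> bool \<Rightarrow> int list"
  rV1 :: "bool \<Rightarrow> bool \<Rightarrow> bool \<Rightarrow> int list"
  rdeg :: "bool \<Rightarrow> bool \<Rightarrow> bool \<Rightarrow> int"
  rloc :: "bool \<Rightarrow> bool \<Rightarrow> bool \<Rightarrow> int"
  rhi :: "bool \<Rightarrow> bool \<Rightarrow> bool \<Rightarrow> int"
  rlohi :: int
  rdeg1 :: "bool \<Rightarrow> bool \<Rightarrow> bool \<Rightarrow> int"
  req :: "bool \<Rightarrow> bool \<Rightarrow> bool \<Rightarrow> int"
  rtri :: "bool \<Rightarrow> int"

text \<open>1000 times the indicator that a pair completes a root of colour \<open>r\<close> to an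
  AAB edge. Here \<open>p\<close> means that both vertices of the pair lie in A, and
  \<open>q\<close> that at least one does.\<close>

definition xind :: "bool \<Rightarrow> bool \<Rightarrow> bool \<Rightarrow> bool \<Rightarrow> int" where
  "xind r p q e = (if e then if r then (if p then 0 else if q then 1000 else 0)
     else (if p then 1000 else 0) else 0)"

definition rt3 where
  "rt3 K c1 c2 e012 c3 e013 e023 e123 c4 e014 e024 e124 =
     dot (rV3 K c1 c2 e012 c3 e013 e023 e123) (rV3 K c1 c2 e012 c4 e014 e024 e124)"

text \<open>Two independent pairs around the root: the primed pair carries the multiplier, the other
  one samples the inequality. The values 536 and -464 express a link density of at least 0.464. The
  \<open>rlohi\<close> term is the product (up - x)(x - lo) of two bounds on the same density x,
  each factor being sampled by its own pair.\<close>

definition rtb_aux where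
  "rtb_aux K p q e p' q' e' =
     dot (rV1 K p q e) (rV1 K p' q' e')
     + rdeg K p' q' e' * (if e then 536 else - 464)
     + rloc K p' q' e' * (xind (rcol K) p q e - xind (\<not> rcol K) p q e)
     + rhi K p' q' e' * (rup K - xind (rcol K) p q e)
     + rlohi K * ((rup K - xind (rcol K) p q e) * (xind (rcol K) p' q' e' - rlo K))"

definition rtb where
  "rtb K c1 c2 e c3 c4 e' =
     rtb_aux K (c1 \<and> c2) (c1 \<or> c2) e (c3 \<and> c4) (c3 \<or> c4) e'
     + rtb_aux K (c3 \<and> c4) (c3 \<or> c4) e' (c1 \<and> c2) (c1 \<or> c2) e"

text \<open>The degree in question is that of vertex 1, sampled by the pair 2, 3; the multiplier
  depends on the colours of 1 and 4 and on the triple 014.\<close>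

definition rtc where
  "rtc K c1 c4 e014 e123 e023 =
     rdeg1 K c1 c4 e014 * (if e123 then 536 else - 464)
     + req K c1 c4 e014 * (if e123 then (if e023 then 0 else - 1000) else (if e023 then 1000 else 0))"

definition rtd where
  "rtd K c4 c1 c2 c3 e123 = rtri K c4 * rq K c1 c2 c3 e123"

text \<open>Sum of the basic expression over all 24 orderings of the vertices 1 to 4; the factors 2,
  4, 2, 6 count the orderings that produce the same term. Being symmetric, the sum needs to be
  checked only on representatives of the relabelling classes.\<close>

definition rS :: "rcert \<Rightarrow> bool \<Rightarrow> bool \<Rightarrow> bool \<Rightarrow> bool \<Rightarrow> bool \<Rightarrow> bool \<Rightarrow> bool \<Rightarrow> bool \<Rightarrow> bool \<Rightarrow> bool \<Rightarrow> bool \<Rightarrow> bool \<Rightarrow> bool \<Rightarrow> bool \<Rightarrow> int" where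
  "rS K c1 c2 c3 c4 e012 e013 e023 e123 e014 e024 e124 e034 e134 e234 =
    2 * (rt3 K c1 c2 e012 c3 e013 e023 e123 c4 e014 e024 e124 + rt3 K c1 c3 e013 c2 e012 e023 e123 c4 e014 e034 e134 + 
    rt3 K c1 c4 e014 c2 e012 e024 e124 c3 e013 e034 e134 + rt3 K c2 c1 e012 c3 e023 e013 e123 c4 e024 e014 e124 + 
    rt3 K c2 c3 e023 c1 e012 e013 e123 c4 e024 e034 e234 + rt3 K c2 c4 e024 c1 e012 e014 e124 c3 e023 e034 e234 + 
    rt3 K c3 c1 e013 c2 e023 e012 e123 c4 e034 e014 e134 + rt3 K c3 c2 e023 c1 e013 e012 e123 c4 e034 e024 e234 + 
    rt3 K c3 c4 e034 c1 e013 e014 e134 c2 e023 e024 e234 + rt3 K c4 c1 e014 c2 e024 e012 e124 c3 e034 e013 e134 + 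
    rt3 K c4 c2 e024 c1 e014 e012 e124 c3 e034 e023 e234 + rt3 K c4 c3 e034 c1 e014 e013 e134 c2 e024 e023 e234) +
    4 * (rtb K c1 c2 e012 c3 c4 e034 + rtb K c1 c3 e013 c2 c4 e024 + 
    rtb K c1 c4 e014 c2 c3 e023) +
    2 * (rtc K c1 c2 e012 e134 e034 + rtc K c1 c3 e013 e124 e024 + 
    rtc K c1 c4 e014 e123 e023 + rtc K c2 c1 e012 e234 e034 + 
    rtc K c2 c3 e023 e124 e014 + rtc K c2 c4 e024 e123 e013 + 
    rtc K c3 c1 e013 e234 e024 + rtc K c3 c2 e023 e134 e014 + 
    rtc K c3 c4 e034 e123 e012 + rtc K c4 c1 e014 e234 e023 + 
    rtc K c4 c2 e024 e134 e013 + rtc K c4 c3 e034 e124 e012) +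
    6 * (rtd K c1 c2 c3 c4 e234 + rtd K c2 c1 c3 c4 e134 + 
    rtd K c3 c1 c2 c4 e124 + rtd K c4 c1 c2 c3 e123)"

definition rcheck where
  "rcheck K c1 c2 c3 c4 e012 e013 e023 e123 e014 e024 e124 e034 e134 e234 =
    (if lexmin4 c1 c2 c3 c4 e012 e013 e023 e123 e014 e024 e124 e034 e134 e234
     then if allowed5 e012 e013 e023 e123 e014 e024 e124 e034 e134 e234 then rS K c1 c2 c3 c4 e012 e013 e023 e123 e014 e024 e124 e034 e134 e234 < 0 else True else True)"

section \<open>Finite checks and reduction to minimal representatives\<close>

definition all1 :: "(bool \<Rightarrow> bool) \<Rightarrow> bool" where "all1 f \<longleftrightarrow> f True \<and> f False"
definition all2 :: "(bool \<Rightarrow> bool \<Rightarrow> bool) \<Rightarrow> bool" where "all2 f \<longleftrightarrow> all1 (f True) \<and> all1 (f False)"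
definition all3 :: "(bool \<Rightarrow> bool \<Rightarrow> bool \<Rightarrow> bool) \<Rightarrow> bool" where "all3 f \<longleftrightarrow> all2 (f True) \<and> all2 (f False)"
definition all4 :: "(bool \<Rightarrow> bool \<Rightarrow> bool \<Rightarrow> bool \<Rightarrow> bool) \<Rightarrow> bool" where "all4 f \<longleftrightarrow> all3 (f True) \<and> all3 (f False)"
definition all5 :: "(bool \<Rightarrow> bool \<Rightarrow> bool \<Rightarrow> bool \<Rightarrow> bool \<Rightarrow> bool) \<Rightarrow> bool" where "all5 f \<longleftrightarrow> all4 (f True) \<and> all4 (f False)"
definition all6 :: "(bool \<Rightarrow> bool \<Rightarrow> bool \<Rightarrow> bool \<Rightarrow> bool \<Rightarrow> bool \<Rightarrow> bool) \<Rightarrow> bool" where "all6 f \<longleftrightarrow> all5 (f True) \<and> all5 (f False)"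
definition all7 :: "(bool \<Rightarrow> bool \<Rightarrow> bool \<Rightarrow> bool \<Rightarrow> bool \<Rightarrow> bool \<Rightarrow> bool \<Rightarrow> bool) \<Rightarrow> bool" where "all7 f \<longleftrightarrow> all6 (f True) \<and> all6 (f False)"
definition all8 :: "(bool \<Rightarrow> bool \<Rightarrow> bool \<Rightarrow> bool \<Rightarrow> bool \<Rightarrow> bool \<Rightarrow> bool \<Rightarrow> bool \<Rightarrow> bool) \<Rightarrow> bool" where "all8 f \<longleftrightarrow> all7 (f True) \<and> all7 (f False)"
definition all9 :: "(bool \<Rightarrow> bool \<Rightarrow> bool \<Rightarrow> bool \<Rightarrow> bool \<Rightarrow> bool \<Rightarrow> bool \<Rightarrow> bool \<Rightarrow> bool \<Rightarrow> bool) \<Rightarrow> bool" where "all9 f \<longleftrightarrow> all8 (f True) \<and> all8 (f False)"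
definition all10 :: "(bool \<Rightarrow> bool \<Rightarrow> bool \<Rightarrow> bool \<Rightarrow> bool \<Rightarrow> bool \<Rightarrow> bool \<Rightarrow> bool \<Rightarrow> bool \<Rightarrow> bool \<Rightarrow> bool) \<Rightarrow> bool" where "all10 f \<longleftrightarrow> all9 (f True) \<and> all9 (f False)"

lemmas all_defs = all1_def all2_def all3_def all4_def all5_def all6_def all7_def all8_def all9_def all10_def

lemma all1_iff: "all1 g \<longleftrightarrow> (\<forall>b. g b)"
  unfolding all1_def all_bool_eq ..

lemma all2_iff: "all2 g \<longleftrightarrow> (\<forall>b. all1 (g b))"
  unfolding all2_def all_bool_eq ..

lemma all3_iff: "all3 g \<longleftrightarrow> (\<forall>b. all2 (g b))"
  unfolding all3_def all_bool_eq ..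

lemma all4_iff: "all4 g \<longleftrightarrow> (\<forall>b. all3 (g b))"
  unfolding all4_def all_bool_eq ..

lemma all5_iff: "all5 g \<longleftrightarrow> (\<forall>b. all4 (g b))"
  unfolding all5_def all_bool_eq ..

lemma all6_iff: "all6 g \<longleftrightarrow> (\<forall>b. all5 (g b))"
  unfolding all6_def all_bool_eq ..

lemma all7_iff: "all7 g \<longleftrightarrow> (\<forall>b. all6 (g b))"
  unfolding all7_def all_bool_eq ..

lemma all8_iff: "all8 g \<longleftrightarrow> (\<forall>b. all7 (g b))"
  unfolding all8_def all_bool_eq ..

lemma all9_iff: "all9 g \<longleftrightarrow> (\<forall>b. all8 (g b))"
  unfolding all9_def all_bool_eq ..

lemma all10_iff: "all10 g \<longleftrightarrow> (\<forall>b. all9 (g b))"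
  unfolding all10_def all_bool_eq ..

lemmas all_iff = all1_iff all2_iff all3_iff all4_iff all5_iff all6_iff all7_iff all8_iff all9_iff all10_iff

lemma two_commute: "two a b c = two b a c" "two a b c = two a c b"
  by (auto simp: two_def)

text \<open>As long as some \<open>t\<close> lowers the code, the claim is pulled back from
  \<open>t p\<close> to \<open>p\<close>; the descent ends at a point that no \<open>t\<close>
  lowers. Comparison with a few generators is enough, at the price that a class may have several
  such end points.\<close>

lemma minimal_code_induct:
  fixes code :: "'p \<Rightarrow> nat"
  assumes "\<And>p. (\<And>t. t \<in> T \<Longrightarrow> code p \<le> code (t p)) \<Longrightarrow> Q p"
    and "\<And>p t. t \<in> T \<Longrightarrow> Q (t p) \<Longrightarrow> Q p"
  shows "Q p"
proof (induction "code p" arbitrary: p rule: less_induct)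
  case less
  then show ?case
    by (metis assms not_le)
qed

definition swap :: "nat \<Rightarrow> nat \<Rightarrow> (nat \<Rightarrow> 'a) \<Rightarrow> nat \<Rightarrow> 'a" where
  "swap i j \<phi> = \<phi>(i := \<phi> j, j := \<phi> i)"

text \<open>A transposition is a conjugate of a shorter one, so invariance under adjacent
  transpositions extends to all of them.\<close>

lemma swap_via: "i \<noteq> j \<Longrightarrow> j \<noteq> k \<Longrightarrow> i \<noteq> k \<Longrightarrow> swap i k \<phi> = swap i j (swap j k (swap i j \<phi>))"
  by (auto simp: swap_def fun_eq_iff)

lemma (in weighted) avgs_sum_list:
  "avgs is (\<lambda>\<phi>. \<Sum>x\<leftarrow>xs. f x \<phi>) \<phi> = (\<Sum>x\<leftarrow>xs. avgs is (f x) \<phi>)"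
  by (induction xs) (simp_all add: avgs_add)

lemma (in weighted) avgs_sum_list_nonneg:
  assumes "\<And>x. x \<in> set xs \<Longrightarrow> 0 \<le> avgs is (\<lambda>\<phi>. real_of_int (f x \<phi>)) \<phi>"
  shows "0 \<le> avgs is (\<lambda>\<phi>. real_of_int (\<Sum>x\<leftarrow>xs. f x \<phi>)) \<phi>"
proof -
  have "real_of_int (\<Sum>x\<leftarrow>xs. f x \<phi>) = (\<Sum>x\<leftarrow>xs. real_of_int (f x \<phi>))" for \<phi>
    by (induction xs) simp_all
  then show ?thesis using assms by (auto simp: avgs_sum_list intro!: sum_list_nonneg)
qed

section \<open>Weighted 3-graphs without the forbidden homomorphic images\<close>

locale trigraph = weighted V w for V :: "'v set" and w +
  fixes E :: "'v \<Rightarrow> 'v \<Rightarrow> 'v \<Rightarrow> bool"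
  assumes E_swap12: "E x y z = E y x z"
    and E_swap23: "E x y z = E x z y"
    and no_K4: "\<not> (E a b c \<and> E a b d \<and> E a c d \<and> E b c d)"
    and no_C5_or_no_F2:
      "(\<forall>a b c d e. \<not> (E a b c \<and> E b c d \<and> E c d e \<and> E d e a \<and> E e a b)) \<or>
       (\<forall>a b c d e f. \<not> (E a b c \<and> E a c d \<and> E a d e \<and> E a e f \<and> E a f b \<and> E b c d))"
begin

lemmas E_ac = E_swap12 E_swap23

lemma not_has_C5:
  assumes *: "\<forall>a b c d e. \<not> (E a b c \<and> E b c d \<and> E c d e \<and> E d e a \<and> E e a b)"
  shows "\<not> has_C5 (E a b c) (E a b d) (E a c d) (E b c d) (E a b e)
     (E a c e) (E b c e) (E a d e) (E b d e) (E c d e)"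
proof -
  have "\<not> (E a b c \<and> E b c d \<and> E a b e \<and> E a d e \<and> E c d e)"
      using *[rule_format, of a b c d e] by (auto simp: E_ac)
  moreover have "\<not> (E a b c \<and> E a b d \<and> E b c e \<and> E a d e \<and> E c d e)"
      using *[rule_format, of a b c e d] by (auto simp: E_ac)
  moreover have "\<not> (E a b d \<and> E b c d \<and> E a b e \<and> E a c e \<and> E c d e)"
      using *[rule_format, of a b d c e] by (auto simp: E_ac)
  moreover have "\<not> (E a b c \<and> E a b d \<and> E a c e \<and> E b d e \<and> E c d e)"
      using *[rule_format, of a b d e c] by (auto simp: E_ac)
  moreover have "\<not> (E a b d \<and> E a c d \<and> E a b e \<and> E b c e \<and> E c d e)"
      using *[rule_format, of a b e c d] by (auto simp: E_ac)
  moreover have "\<not> (E a b c \<and> E a c d \<and> E a b e \<and> E b d e \<and> E c d e)"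
      using *[rule_format, of a b e d c] by (auto simp: E_ac)
  moreover have "\<not> (E a b c \<and> E b c d \<and> E a c e \<and> E a d e \<and> E b d e)"
      using *[rule_format, of a c b d e] by (auto simp: E_ac)
  moreover have "\<not> (E a b c \<and> E a c d \<and> E b c e \<and> E a d e \<and> E b d e)"
      using *[rule_format, of a c b e d] by (auto simp: E_ac)
  moreover have "\<not> (E a c d \<and> E b c d \<and> E a b e \<and> E a c e \<and> E b d e)"
      using *[rule_format, of a c d b e] by (auto simp: E_ac)
  moreover have "\<not> (E a b d \<and> E a c d \<and> E a c e \<and> E b c e \<and> E b d e)"
      using *[rule_format, of a c e b d] by (auto simp: E_ac)
  moreover have "\<not> (E a b d \<and> E b c d \<and> E a c e \<and> E b c e \<and> E a d e)"
      using *[rule_format, of a d b c e] by (auto simp: E_ac)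
  moreover have "\<not> (E a c d \<and> E b c d \<and> E a b e \<and> E b c e \<and> E a d e)"
      using *[rule_format, of a d c b e] by (auto simp: E_ac)
  ultimately show ?thesis
    unfolding has_C5_def de_Morgan_disj by (intro conjI)
qed

text \<open>Each of the 60 cases is the hypothesis on \<open>F2\<close> with its sixth vertex set
  equal to the third, which merges two of the six edges.\<close>

lemma not_has_F1:
  assumes *: "\<forall>a b c d e f. \<not> (E a b c \<and> E a c d \<and> E a d e \<and> E a e f \<and> E a f b \<and> E b c d)"
  shows "\<not> has_F1 (E a b c) (E a b d) (E a c d) (E b c d) (E a b e)
     (E a c e) (E b c e) (E a d e) (E b d e) (E c d e)"
proof -
  have "\<not> (E a b c \<and> E a c d \<and> E b c d \<and> E a c e \<and> E a d e)"
      using *[rule_format, of a b c d e c] by (auto simp: E_ac)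
  moreover have "\<not> (E a b c \<and> E a c d \<and> E a c e \<and> E b c e \<and> E a d e)"
      using *[rule_format, of a b c e d c] by (auto simp: E_ac)
  moreover have "\<not> (E a b d \<and> E a c d \<and> E b c d \<and> E a c e \<and> E a d e)"
      using *[rule_format, of a b d c e d] by (auto simp: E_ac)
  moreover have "\<not> (E a b d \<and> E a c d \<and> E a c e \<and> E a d e \<and> E b d e)"
      using *[rule_format, of a b d e c d] by (auto simp: E_ac)
  moreover have "\<not> (E a c d \<and> E a b e \<and> E a c e \<and> E b c e \<and> E a d e)"
      using *[rule_format, of a b e c d e] by (auto simp: E_ac)
  moreover have "\<not> (E a c d \<and> E a b e \<and> E a c e \<and> E a d e \<and> E b d e)"
      using *[rule_format, of a b e d c e] by (auto simp: E_ac)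
  moreover have "\<not> (E a b c \<and> E a b d \<and> E b c d \<and> E a b e \<and> E a d e)"
      using *[rule_format, of a c b d e b] by (auto simp: E_ac)
  moreover have "\<not> (E a b c \<and> E a b d \<and> E a b e \<and> E b c e \<and> E a d e)"
      using *[rule_format, of a c b e d b] by (auto simp: E_ac)
  moreover have "\<not> (E a b d \<and> E a c d \<and> E b c d \<and> E a b e \<and> E a d e)"
      using *[rule_format, of a c d b e d] by (auto simp: E_ac)
  moreover have "\<not> (E a b d \<and> E a c d \<and> E a b e \<and> E a d e \<and> E c d e)"
      using *[rule_format, of a c d e b d] by (auto simp: E_ac)
  moreover have "\<not> (E a b d \<and> E a b e \<and> E a c e \<and> E b c e \<and> E a d e)"
      using *[rule_format, of a c e b d e] by (auto simp: E_ac)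
  moreover have "\<not> (E a b d \<and> E a b e \<and> E a c e \<and> E a d e \<and> E c d e)"
      using *[rule_format, of a c e d b e] by (auto simp: E_ac)
  moreover have "\<not> (E a b c \<and> E a b d \<and> E b c d \<and> E a b e \<and> E a c e)"
      using *[rule_format, of a d b c e b] by (auto simp: E_ac)
  moreover have "\<not> (E a b c \<and> E a b d \<and> E a b e \<and> E a c e \<and> E b d e)"
      using *[rule_format, of a d b e c b] by (auto simp: E_ac)
  moreover have "\<not> (E a b c \<and> E a c d \<and> E b c d \<and> E a b e \<and> E a c e)"
      using *[rule_format, of a d c b e c] by (auto simp: E_ac)
  moreover have "\<not> (E a b c \<and> E a c d \<and> E a b e \<and> E a c e \<and> E c d e)"
      using *[rule_format, of a d c e b c] by (auto simp: E_ac)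
  moreover have "\<not> (E a b c \<and> E a b e \<and> E a c e \<and> E a d e \<and> E b d e)"
      using *[rule_format, of a d e b c e] by (auto simp: E_ac)
  moreover have "\<not> (E a b c \<and> E a b e \<and> E a c e \<and> E a d e \<and> E c d e)"
      using *[rule_format, of a d e c b e] by (auto simp: E_ac)
  moreover have "\<not> (E a b c \<and> E a b d \<and> E a c d \<and> E a b e \<and> E b c e)"
      using *[rule_format, of a e b c d b] by (auto simp: E_ac)
  moreover have "\<not> (E a b c \<and> E a b d \<and> E a c d \<and> E a b e \<and> E b d e)"
      using *[rule_format, of a e b d c b] by (auto simp: E_ac)
  moreover have "\<not> (E a b c \<and> E a b d \<and> E a c d \<and> E a c e \<and> E b c e)"
      using *[rule_format, of a e c b d c] by (auto simp: E_ac)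
  moreover have "\<not> (E a b c \<and> E a b d \<and> E a c d \<and> E a c e \<and> E c d e)"
      using *[rule_format, of a e c d b c] by (auto simp: E_ac)
  moreover have "\<not> (E a b c \<and> E a b d \<and> E a c d \<and> E a d e \<and> E b d e)"
      using *[rule_format, of a e d b c d] by (auto simp: E_ac)
  moreover have "\<not> (E a b c \<and> E a b d \<and> E a c d \<and> E a d e \<and> E c d e)"
      using *[rule_format, of a e d c b d] by (auto simp: E_ac)
  moreover have "\<not> (E a b c \<and> E a c d \<and> E b c d \<and> E b c e \<and> E b d e)"
      using *[rule_format, of b a c d e c] by (auto simp: E_ac)
  moreover have "\<not> (E a b c \<and> E b c d \<and> E a c e \<and> E b c e \<and> E b d e)"
      using *[rule_format, of b a c e d c] by (auto simp: E_ac)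
  moreover have "\<not> (E a b d \<and> E a c d \<and> E b c d \<and> E b c e \<and> E b d e)"
      using *[rule_format, of b a d c e d] by (auto simp: E_ac)
  moreover have "\<not> (E a b d \<and> E b c d \<and> E b c e \<and> E a d e \<and> E b d e)"
      using *[rule_format, of b a d e c d] by (auto simp: E_ac)
  moreover have "\<not> (E b c d \<and> E a b e \<and> E a c e \<and> E b c e \<and> E b d e)"
      using *[rule_format, of b a e c d e] by (auto simp: E_ac)
  moreover have "\<not> (E b c d \<and> E a b e \<and> E b c e \<and> E a d e \<and> E b d e)"
      using *[rule_format, of b a e d c e] by (auto simp: E_ac)
  moreover have "\<not> (E a b d \<and> E a c d \<and> E b c d \<and> E a b e \<and> E b d e)"
      using *[rule_format, of b c d a e d] by (auto simp: E_ac)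
  moreover have "\<not> (E a b d \<and> E b c d \<and> E a b e \<and> E b d e \<and> E c d e)"
      using *[rule_format, of b c d e a d] by (auto simp: E_ac)
  moreover have "\<not> (E a b d \<and> E a b e \<and> E a c e \<and> E b c e \<and> E b d e)"
      using *[rule_format, of b c e a d e] by (auto simp: E_ac)
  moreover have "\<not> (E a b d \<and> E a b e \<and> E b c e \<and> E b d e \<and> E c d e)"
      using *[rule_format, of b c e d a e] by (auto simp: E_ac)
  moreover have "\<not> (E a b c \<and> E a c d \<and> E b c d \<and> E a b e \<and> E b c e)"
      using *[rule_format, of b d c a e c] by (auto simp: E_ac)
  moreover have "\<not> (E a b c \<and> E b c d \<and> E a b e \<and> E b c e \<and> E c d e)"
      using *[rule_format, of b d c e a c] by (auto simp: E_ac)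
  moreover have "\<not> (E a b c \<and> E a b e \<and> E b c e \<and> E a d e \<and> E b d e)"
      using *[rule_format, of b d e a c e] by (auto simp: E_ac)
  moreover have "\<not> (E a b c \<and> E a b e \<and> E b c e \<and> E b d e \<and> E c d e)"
      using *[rule_format, of b d e c a e] by (auto simp: E_ac)
  moreover have "\<not> (E a b c \<and> E a b d \<and> E b c d \<and> E a c e \<and> E b c e)"
      using *[rule_format, of b e c a d c] by (auto simp: E_ac)
  moreover have "\<not> (E a b c \<and> E a b d \<and> E b c d \<and> E b c e \<and> E c d e)"
      using *[rule_format, of b e c d a c] by (auto simp: E_ac)
  moreover have "\<not> (E a b c \<and> E a b d \<and> E b c d \<and> E a d e \<and> E b d e)"
      using *[rule_format, of b e d a c d] by (auto simp: E_ac)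
  moreover have "\<not> (E a b c \<and> E a b d \<and> E b c d \<and> E b d e \<and> E c d e)"
      using *[rule_format, of b e d c a d] by (auto simp: E_ac)
  moreover have "\<not> (E a b d \<and> E a c d \<and> E b c d \<and> E b c e \<and> E c d e)"
      using *[rule_format, of c a d b e d] by (auto simp: E_ac)
  moreover have "\<not> (E a c d \<and> E b c d \<and> E b c e \<and> E a d e \<and> E c d e)"
      using *[rule_format, of c a d e b d] by (auto simp: E_ac)
  moreover have "\<not> (E b c d \<and> E a b e \<and> E a c e \<and> E b c e \<and> E c d e)"
      using *[rule_format, of c a e b d e] by (auto simp: E_ac)
  moreover have "\<not> (E b c d \<and> E a c e \<and> E b c e \<and> E a d e \<and> E c d e)"
      using *[rule_format, of c a e d b e] by (auto simp: E_ac)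
  moreover have "\<not> (E a b d \<and> E a c d \<and> E b c d \<and> E a c e \<and> E c d e)"
      using *[rule_format, of c b d a e d] by (auto simp: E_ac)
  moreover have "\<not> (E a c d \<and> E b c d \<and> E a c e \<and> E b d e \<and> E c d e)"
      using *[rule_format, of c b d e a d] by (auto simp: E_ac)
  moreover have "\<not> (E a c d \<and> E a b e \<and> E a c e \<and> E b c e \<and> E c d e)"
      using *[rule_format, of c b e a d e] by (auto simp: E_ac)
  moreover have "\<not> (E a c d \<and> E a c e \<and> E b c e \<and> E b d e \<and> E c d e)"
      using *[rule_format, of c b e d a e] by (auto simp: E_ac)
  moreover have "\<not> (E a b c \<and> E a c e \<and> E b c e \<and> E a d e \<and> E c d e)"
      using *[rule_format, of c d e a b e] by (auto simp: E_ac)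
  moreover have "\<not> (E a b c \<and> E a c e \<and> E b c e \<and> E b d e \<and> E c d e)"
      using *[rule_format, of c d e b a e] by (auto simp: E_ac)
  moreover have "\<not> (E a b c \<and> E a c d \<and> E b c d \<and> E a d e \<and> E c d e)"
      using *[rule_format, of c e d a b d] by (auto simp: E_ac)
  moreover have "\<not> (E a b c \<and> E a c d \<and> E b c d \<and> E b d e \<and> E c d e)"
      using *[rule_format, of c e d b a d] by (auto simp: E_ac)
  moreover have "\<not> (E b c d \<and> E a b e \<and> E a d e \<and> E b d e \<and> E c d e)"
      using *[rule_format, of d a e b c e] by (auto simp: E_ac)
  moreover have "\<not> (E b c d \<and> E a c e \<and> E a d e \<and> E b d e \<and> E c d e)"
      using *[rule_format, of d a e c b e] by (auto simp: E_ac)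
  moreover have "\<not> (E a c d \<and> E a b e \<and> E a d e \<and> E b d e \<and> E c d e)"
      using *[rule_format, of d b e a c e] by (auto simp: E_ac)
  moreover have "\<not> (E a c d \<and> E b c e \<and> E a d e \<and> E b d e \<and> E c d e)"
      using *[rule_format, of d b e c a e] by (auto simp: E_ac)
  moreover have "\<not> (E a b d \<and> E a c e \<and> E a d e \<and> E b d e \<and> E c d e)"
      using *[rule_format, of d c e a b e] by (auto simp: E_ac)
  moreover have "\<not> (E a b d \<and> E b c e \<and> E a d e \<and> E b d e \<and> E c d e)"
      using *[rule_format, of d c e b a e] by (auto simp: E_ac)
  ultimately show ?thesis
    unfolding has_F1_def de_Morgan_disj by (intro conjI)
qed

lemma allowed5:
  "allowed5 (E a b c) (E a b d) (E a c d) (E b c d) (E a b e)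
     (E a c e) (E b c e) (E a d e) (E b d e) (E c d e)"
proof -
  have k: "\<not> has_K4 (E a b c) (E a b d) (E a c d) (E b c d) (E a b e)
     (E a c e) (E b c e) (E a d e) (E b d e) (E c d e)"
    unfolding has_K4_def using no_K4[of a b c d] no_K4[of a b c e] no_K4[of a b d e]
      no_K4[of a c d e] no_K4[of b c d e] by (simp only: de_Morgan_disj simp_thms)
  from no_C5_or_no_F2 show ?thesis
  proof
    assume *: "\<forall>a b c d e. \<not> (E a b c \<and> E b c d \<and> E c d e \<and> E d e a \<and> E e a b)"
    show ?thesis unfolding allowed5_def by (simp only: k not_has_C5[OF *] if_False if_True)
  next
    assume *: "\<forall>a b c d e f. \<not> (E a b c \<and> E a c d \<and> E a d e \<and> E a e f \<and> E a f b \<and> E b c d)"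
    show ?thesis unfolding allowed5_def by (simp only: k not_has_F1[OF *] if_False if_True simp_thms if_cancel)
  qed
qed

end

section \<open>Rooted certificates in a coloured 3-graph\<close>

locale coloured = trigraph V w E for V :: "'v set" and w E +
  fixes A :: "'v \<Rightarrow> bool"
begin

text \<open>The premise says, in a form decided by evaluation, that i, j, k, l is a permutation of
  1, 2, 3, 4. Coordinate 0 is never averaged: it is the root.\<close>

lemma avgs4:
  assumes "sort [i, j, k, l] = [1, 2, 3, 4]"
  shows "avgs [1, 2, 3, 4] (\<lambda>\<phi>. g (\<phi> 0) (\<phi> i) (\<phi> j) (\<phi> k) (\<phi> l)) \<phi> =
    avg (\<lambda>a. avg (\<lambda>b. avg (\<lambda>c. avg (\<lambda>d. g (\<phi> 0) a b c d))))"
proof -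
  have ix: "set [i, j, k, l] = {1, 2, 3, 4}" "distinct [i, j, k, l]"
    using arg_cong[OF assms, of set] arg_cong[OF assms, of distinct] unfolding set_sort distinct_sort by simp_all
  then have z: "i \<noteq> 0" "j \<noteq> 0" "k \<noteq> 0" "l \<noteq> 0"
    by (metis insertCI insertE list.simps(15) singletonD zero_neq_numeral zero_neq_one)+
  have "avgs [1, 2, 3, 4] (\<lambda>\<phi>. g (\<phi> 0) (\<phi> i) (\<phi> j) (\<phi> k) (\<phi> l)) \<phi> =
      avgs [i, j, k, l] (\<lambda>\<phi>. g (\<phi> 0) (\<phi> i) (\<phi> j) (\<phi> k) (\<phi> l)) \<phi>"
    using ix by (intro avgs_perm) simp_all
  then show ?thesis using ix(2) z by simp
qed

definition xdens :: "bool \<Rightarrow> 'v \<Rightarrow> real" where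
  "xdens r v = avg (\<lambda>x. avg (\<lambda>y. real_of_int (xind r (A x \<and> A y) (A x \<or> A y) (E v x y))))"

definition rsum :: "rcert \<Rightarrow> (nat \<Rightarrow> 'v) \<Rightarrow> int" where
  "rsum K \<phi> = rS K (A (\<phi> 1)) (A (\<phi> 2)) (A (\<phi> 3)) (A (\<phi> 4))
       (E (\<phi> 0) (\<phi> 1) (\<phi> 2)) (E (\<phi> 0) (\<phi> 1) (\<phi> 3)) (E (\<phi> 0) (\<phi> 2) (\<phi> 3)) (E (\<phi> 1) (\<phi> 2) (\<phi> 3)) (E (\<phi> 0) (\<phi> 1) (\<phi> 4))
       (E (\<phi> 0) (\<phi> 2) (\<phi> 4)) (E (\<phi> 1) (\<phi> 2) (\<phi> 4)) (E (\<phi> 0) (\<phi> 3) (\<phi> 4)) (E (\<phi> 1) (\<phi> 3) (\<phi> 4)) (E (\<phi> 2) (\<phi> 3) (\<phi> 4))"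

definition rbits :: "(nat \<Rightarrow> 'v) \<Rightarrow> bool list" where
  "rbits \<phi> = [A (\<phi> 1), A (\<phi> 2), A (\<phi> 3), A (\<phi> 4),
       (E (\<phi> 0) (\<phi> 1) (\<phi> 2)), (E (\<phi> 0) (\<phi> 1) (\<phi> 3)), (E (\<phi> 0) (\<phi> 2) (\<phi> 3)), (E (\<phi> 1) (\<phi> 2) (\<phi> 3)), (E (\<phi> 0) (\<phi> 1) (\<phi> 4)),
       (E (\<phi> 0) (\<phi> 2) (\<phi> 4)), (E (\<phi> 1) (\<phi> 2) (\<phi> 4)), (E (\<phi> 0) (\<phi> 3) (\<phi> 4)), (E (\<phi> 1) (\<phi> 3) (\<phi> 4)), (E (\<phi> 2) (\<phi> 3) (\<phi> 4))]"

lemma rt3_commute: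
  "rt3 K c1 c2 e012 c3 e013 e023 e123 c4 e014 e024 e124 = rt3 K c1 c2 e012 c4 e014 e024 e124 c3 e013 e023 e123"
  by (simp add: rt3_def dot_commute)

lemma rtb_commute:
  "rtb K c1 c2 e c3 c4 e' = rtb K c3 c4 e' c1 c2 e"
  "rtb K c1 c2 e c3 c4 e' = rtb K c2 c1 e c3 c4 e'"
  "rtb K c1 c2 e c3 c4 e' = rtb K c1 c2 e c4 c3 e'"
  by (simp_all add: rtb_def conj_commute disj_commute)

lemma rtd_commute:
  assumes "\<And>a b c e. rq K a b c e = rq K b a c e" "\<And>a b c e. rq K a b c e = rq K a c b e"
  shows "rtd K c4 c1 c2 c3 e = rtd K c4 c2 c1 c3 e" "rtd K c4 c1 c2 c3 e = rtd K c4 c1 c3 c2 e"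
  unfolding rtd_def using assms by metis+

lemma rsum_swap:
  assumes "\<And>a b c e. rq K a b c e = rq K b a c e" "\<And>a b c e. rq K a b c e = rq K a c b e"
  assumes "(i, j) \<in> {(1, 2), (1, 3), (1, 4), (2, 3), (2, 4), (3, 4)}"
  shows "rsum K (swap i j \<phi>) = rsum K \<phi>"
proof -
  note ac = rtd_commute[OF assms(1,2)]
  show ?thesis
    using assms(3)
    by (elim insertE emptyE)
      (simp_all add: rsum_def swap_def rS_def E_ac rt3_commute rtb_commute ac add_ac)
qed

text \<open>Symmetry of the sum moves the problem to an assignment whose pattern no transposition
  lowers, and such a pattern is covered by the finite check.\<close>

lemma rsum_neg:
  assumes "\<And>a b c e. rq K a b c e = rq K b a c e" "\<And>a b c e. rq K a b c e = rq K a c b e"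
    and chk: "\<And>c1 c2 c3 c4 e012 e013 e023 e123 e014 e024 e124 e034 e134 e234. rcheck K c1 c2 c3 c4 e012 e013 e023 e123 e014 e024 e124 e034 e134 e234"
  shows "rsum K \<phi> < 0"
proof (rule minimal_code_induct[where code = "\<lambda>\<phi>. bcode (rbits \<phi>)" and p = \<phi>
      and T = "(\<lambda>(i, j). swap i j) ` {(1, 2), (1, 3), (1, 4), (2, 3), (2, 4), (3, 4)}"])
  fix \<phi> t
  assume "t \<in> (\<lambda>(i, j). swap i j) ` {(1, 2), (1, 3), (1, 4), (2, 3), (2, 4), (3, 4)}"
    and "rsum K (t \<phi>) < 0"
  then show "rsum K \<phi> < 0" using rsum_swap[OF assms(1,2)] by auto
next
  fix \<phi>
  assume min: "bcode (rbits \<phi>) \<le> bcode (rbits (t \<phi>))"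
    if "t \<in> (\<lambda>(i, j). swap i j) ` {(1, 2), (1, 3), (1, 4), (2, 3), (2, 4), (3, 4)}" for t
  have le: "lexle (rbits \<phi>) (rbits (swap i j \<phi>))"
    if "(i, j) \<in> {(1, 2), (1, 3), (1, 4), (2, 3), (2, 4), (3, 4)}" for i j
    using that by (intro lexle_if_bcode_le min) (auto simp: rbits_def)
  have "lexmin4 (A (\<phi> 1)) (A (\<phi> 2)) (A (\<phi> 3)) (A (\<phi> 4))
       (E (\<phi> 0) (\<phi> 1) (\<phi> 2)) (E (\<phi> 0) (\<phi> 1) (\<phi> 3)) (E (\<phi> 0) (\<phi> 2) (\<phi> 3)) (E (\<phi> 1) (\<phi> 2) (\<phi> 3)) (E (\<phi> 0) (\<phi> 1) (\<phi> 4))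
       (E (\<phi> 0) (\<phi> 2) (\<phi> 4)) (E (\<phi> 1) (\<phi> 2) (\<phi> 4)) (E (\<phi> 0) (\<phi> 3) (\<phi> 4)) (E (\<phi> 1) (\<phi> 3) (\<phi> 4)) (E (\<phi> 2) (\<phi> 3) (\<phi> 4))"
    using le[of 1 2] le[of 1 3] le[of 1 4] le[of 2 3] le[of 2 4] le[of 3 4]
    unfolding lexmin4_def rbits_def swap_def
    by (simp add: E_ac del: lexle.simps)
  then show "rsum K \<phi> < 0"
    using chk[of "A (\<phi> 1)" "A (\<phi> 2)" "A (\<phi> 3)" "A (\<phi> 4)" "E (\<phi> 0) (\<phi> 1) (\<phi> 2)"
      "E (\<phi> 0) (\<phi> 1) (\<phi> 3)"
      "E (\<phi> 0) (\<phi> 2) (\<phi> 3)"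
      "E (\<phi> 1) (\<phi> 2) (\<phi> 3)"
      "E (\<phi> 0) (\<phi> 1) (\<phi> 4)"
      "E (\<phi> 0) (\<phi> 2) (\<phi> 4)"
      "E (\<phi> 1) (\<phi> 2) (\<phi> 4)"
      "E (\<phi> 0) (\<phi> 3) (\<phi> 4)"
      "E (\<phi> 1) (\<phi> 3) (\<phi> 4)"
      "E (\<phi> 2) (\<phi> 3) (\<phi> 4)"]
    unfolding rcheck_def rsum_def by (simp add: allowed5)
qed

end

context weighted
begin

lemma avg_cmult_right: "avg (\<lambda>x. f x * c) = avg f * c"
  using avg_cmult[of c f] by (simp add: mult.commute)

lemma avg2_mult_avg2:
  "avg (\<lambda>a. avg (\<lambda>b. avg (\<lambda>c. avg (\<lambda>d. h c d * s a b)))) =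
     avg (\<lambda>c. avg (\<lambda>d. h c d)) * avg (\<lambda>a. avg (\<lambda>b. s a b))"
  by (simp only: avg_cmult avg_cmult_right)

end

context coloured
begin

text \<open>Once the root and two vertices are fixed, the other two are independent and identically
  distributed, so averaging over them gives a Gram form.\<close>

lemma avg_rt3_nonneg:
  assumes "sort [i, j, k, l] = [1, 2, 3, 4]"
  shows "0 \<le> avgs [1, 2, 3, 4] (\<lambda>\<phi>. real_of_int
    (rt3 K (A (\<phi> i)) (A (\<phi> j)) (E (\<phi> 0) (\<phi> i) (\<phi> j))
       (A (\<phi> k)) (E (\<phi> 0) (\<phi> i) (\<phi> k)) (E (\<phi> 0) (\<phi> j) (\<phi> k)) (E (\<phi> i) (\<phi> j) (\<phi> k))
       (A (\<phi> l)) (E (\<phi> 0) (\<phi> i) (\<phi> l)) (E (\<phi> 0) (\<phi> j) (\<phi> l)) (E (\<phi> i) (\<phi> j) (\<phi> l)))) \<phi>"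
  unfolding rt3_def
  by (subst avgs4[OF assms, where g = "\<lambda>v a b c d. real_of_int (dot
        (rV3 K (A a) (A b) (E v a b) (A c) (E v a c) (E v b c) (E a b c))
        (rV3 K (A a) (A b) (E v a b) (A d) (E v a d) (E v b d) (E a b d)))"])
    (intro avg_nonneg avg_dot_nonneg)

lemma avg_rtb_aux_nonneg:
  assumes ix: "sort [i, j, k, l] = [1, 2, 3, 4]"
    and nn: "\<And>p q e. 0 \<le> rdeg K p q e" "\<And>p q e. 0 \<le> rloc K p q e" "\<And>p q e. 0 \<le> rhi K p q e" "0 \<le> rlohi K"
    and deg: "0 \<le> avg (\<lambda>x. avg (\<lambda>y. if E (\<phi> 0) x y then 536 else - 464))"
    and loc: "xdens (\<not> rcol K) (\<phi> 0) \<le> xdens (rcol K) (\<phi> 0)"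
    and lo: "rlo K \<le> xdens (rcol K) (\<phi> 0)" and up: "xdens (rcol K) (\<phi> 0) \<le> rup K"
  shows "0 \<le> avgs [1, 2, 3, 4] (\<lambda>\<phi>. real_of_int
    (rtb_aux K (A (\<phi> i) \<and> A (\<phi> j)) (A (\<phi> i) \<or> A (\<phi> j)) (E (\<phi> 0) (\<phi> i) (\<phi> j))
       (A (\<phi> k) \<and> A (\<phi> l)) (A (\<phi> k) \<or> A (\<phi> l)) (E (\<phi> 0) (\<phi> k) (\<phi> l)))) \<phi>"
proof -
  let ?P = "\<lambda>a b. A a \<and> A b" and ?Q = "\<lambda>a b. A a \<or> A b" and ?e = "E (\<phi> 0)"
  let ?x = "\<lambda>r a b. real_of_int (xind r (?P a b) (?Q a b) (?e a b))"
  have xd: "avg (\<lambda>a. avg (\<lambda>b. ?x r a b)) = xdens r (\<phi> 0)" for r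
    by (simp add: xdens_def)
  have h: "0 \<le> avg (\<lambda>c. avg (\<lambda>d. real_of_int (f (?P c d) (?Q c d) (?e c d))))"
    if "\<And>p q e. 0 \<le> f p q e" for f
    using that by (intro avg_nonneg) auto
  have eq: "real_of_int (rtb_aux K (?P a b) (?Q a b) (?e a b) (?P c d) (?Q c d) (?e c d)) =
      real_of_int (dot (rV1 K (?P a b) (?Q a b) (?e a b)) (rV1 K (?P c d) (?Q c d) (?e c d)))
      + real_of_int (rdeg K (?P c d) (?Q c d) (?e c d)) * (if ?e a b then 536 else - 464)
      + real_of_int (rloc K (?P c d) (?Q c d) (?e c d)) * (?x (rcol K) a b - ?x (\<not> rcol K) a b)
      + real_of_int (rhi K (?P c d) (?Q c d) (?e c d)) * (rup K - ?x (rcol K) a b)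
      + rlohi K * ((?x (rcol K) c d - rlo K) * (rup K - ?x (rcol K) a b))" for a b c d
    by (simp add: rtb_aux_def)
  have "avgs [1, 2, 3, 4] (\<lambda>\<phi>. real_of_int
    (rtb_aux K (A (\<phi> i) \<and> A (\<phi> j)) (A (\<phi> i) \<or> A (\<phi> j)) (E (\<phi> 0) (\<phi> i) (\<phi> j))
       (A (\<phi> k) \<and> A (\<phi> l)) (A (\<phi> k) \<or> A (\<phi> l)) (E (\<phi> 0) (\<phi> k) (\<phi> l)))) \<phi> =
    avg (\<lambda>a. avg (\<lambda>b. avg (\<lambda>c. avg (\<lambda>d. real_of_int
      (rtb_aux K (?P a b) (?Q a b) (?e a b) (?P c d) (?Q c d) (?e c d))))))"
    by (rule avgs4[OF ix, where g = "\<lambda>v a b c d. real_of_int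
      (rtb_aux K (?P a b) (?Q a b) (E v a b) (?P c d) (?Q c d) (E v c d))"])
  \<comment> \<open>The pairs (a, b) and (c, d) are independent, so each product averages to the
    mean of its multiplier times the slack of the inequality.\<close>
  also have "\<dots> =
      avg (\<lambda>a. avg (\<lambda>b. avg (\<lambda>c. avg (\<lambda>d. real_of_int (dot (rV1 K (?P a b) (?Q a b) (?e a b)) (rV1 K (?P c d) (?Q c d) (?e c d)))))))
      + avg (\<lambda>c. avg (\<lambda>d. real_of_int (rdeg K (?P c d) (?Q c d) (?e c d)))) * avg (\<lambda>a. avg (\<lambda>b. if ?e a b then 536 else - 464))
      + avg (\<lambda>c. avg (\<lambda>d. real_of_int (rloc K (?P c d) (?Q c d) (?e c d)))) * (xdens (rcol K) (\<phi> 0) - xdens (\<not> rcol K) (\<phi> 0))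
      + avg (\<lambda>c. avg (\<lambda>d. real_of_int (rhi K (?P c d) (?Q c d) (?e c d)))) * (rup K - xdens (rcol K) (\<phi> 0))
      + rlohi K * ((xdens (rcol K) (\<phi> 0) - rlo K) * (rup K - xdens (rcol K) (\<phi> 0)))"
    unfolding eq avg_add by (simp only: avg2_mult_avg2 avg_cmult avg_cmult_right avg_diff avg_const xd)
  also have "\<dots> \<ge> 0"
    using nn deg loc lo up
    by (intro add_nonneg_nonneg mult_nonneg_nonneg h avg2_dot_nonneg) auto
  finally show ?thesis .
qed

text \<open>For fixed a and b, averaging over c and d turns the \<open>rdeg1\<close> factor into the
  degree slack of a, and the \<open>req\<close> factor into 1000 times a difference of two link
  densities, which vanishes because both equal \<open>L\<close>.\<close>

lemma avg_rtc_nonneg: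
  assumes ix: "sort [i, l, j, k] = [1, 2, 3, 4]"
    and nn: "\<And>p q e. 0 \<le> rdeg1 K p q e" "\<And>p q e. 0 \<le> req K p q e"
    and deg: "\<And>u. u \<in> V \<Longrightarrow> 0 \<le> avg (\<lambda>x. avg (\<lambda>y. if E u x y then 536 else - 464))"
    and eq: "\<And>u. u \<in> V \<Longrightarrow> avg (\<lambda>x. avg (\<lambda>y. of_bool (E u x y))) = L"
    and v: "\<phi> 0 \<in> V"
  shows "0 \<le> avgs [1, 2, 3, 4] (\<lambda>\<phi>. real_of_int
    (rtc K (A (\<phi> i)) (A (\<phi> l)) (E (\<phi> 0) (\<phi> i) (\<phi> l)) (E (\<phi> i) (\<phi> j) (\<phi> k)) (E (\<phi> 0) (\<phi> j) (\<phi> k)))) \<phi>"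
proof -
  let ?v = "\<phi> 0"
  have "avgs [1, 2, 3, 4] (\<lambda>\<phi>. real_of_int
    (rtc K (A (\<phi> i)) (A (\<phi> l)) (E (\<phi> 0) (\<phi> i) (\<phi> l)) (E (\<phi> i) (\<phi> j) (\<phi> k)) (E (\<phi> 0) (\<phi> j) (\<phi> k)))) \<phi> =
    avg (\<lambda>a. avg (\<lambda>b. avg (\<lambda>c. avg (\<lambda>d. real_of_int (rtc K (A a) (A b) (E ?v a b) (E a c d) (E ?v c d))))))"
    by (rule avgs4[OF ix, where g = "\<lambda>v a b c d. real_of_int (rtc K (A a) (A b) (E v a b) (E a c d) (E v c d))"])
  also have "\<dots> \<ge> 0"
  proof (rule avg_nonneg, rule avg_nonneg)
    fix a b assume "a \<in> V" "b \<in> V"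
    have e: "real_of_int (rtc K (A a) (A b) (E ?v a b) (E a c d) (E ?v c d)) =
        real_of_int (rdeg1 K (A a) (A b) (E ?v a b)) * (if E a c d then 536 else - 464)
        + real_of_int (req K (A a) (A b) (E ?v a b)) * (1000 * (of_bool (E ?v c d) - of_bool (E a c d)))" for c d
      by (simp add: rtc_def)
    have "avg (\<lambda>c. avg (\<lambda>d. real_of_int (rtc K (A a) (A b) (E ?v a b) (E a c d) (E ?v c d)))) =
        real_of_int (rdeg1 K (A a) (A b) (E ?v a b)) * avg (\<lambda>c. avg (\<lambda>d. if E a c d then 536 else - 464))"
      unfolding e avg_add by (simp only: avg_cmult avg_diff eq \<open>a \<in> V\<close> v) simp
    also have "\<dots> \<ge> 0" using nn(1) deg[OF \<open>a \<in> V\<close>] by simp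
    finally show "0 \<le> avg (\<lambda>c. avg (\<lambda>d. real_of_int (rtc K (A a) (A b) (E ?v a b) (E a c d) (E ?v c d))))" .
  qed
  finally show ?thesis .
qed

lemma avg_rtd_nonneg:
  assumes ix: "sort [l, i, j, k] = [1, 2, 3, 4]"
    and nn: "\<And>c. 0 \<le> rtri K c"
    and tri: "0 \<le> avg (\<lambda>x. avg (\<lambda>y. avg (\<lambda>z. real_of_int (rq K (A x) (A y) (A z) (E x y z)))))"
  shows "0 \<le> avgs [1, 2, 3, 4] (\<lambda>\<phi>. real_of_int
    (rtd K (A (\<phi> l)) (A (\<phi> i)) (A (\<phi> j)) (A (\<phi> k)) (E (\<phi> i) (\<phi> j) (\<phi> k)))) \<phi>"
proof -
  have "avgs [1, 2, 3, 4] (\<lambda>\<phi>. real_of_int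
    (rtd K (A (\<phi> l)) (A (\<phi> i)) (A (\<phi> j)) (A (\<phi> k)) (E (\<phi> i) (\<phi> j) (\<phi> k)))) \<phi> =
    avg (\<lambda>a. avg (\<lambda>b. avg (\<lambda>c. avg (\<lambda>d. real_of_int (rtd K (A a) (A b) (A c) (A d) (E b c d))))))"
    by (rule avgs4[OF ix, where g = "\<lambda>v a b c d. real_of_int (rtd K (A a) (A b) (A c) (A d) (E b c d))"])
  also have "\<dots> = avg (\<lambda>a. real_of_int (rtri K (A a))) * avg (\<lambda>x. avg (\<lambda>y. avg (\<lambda>z. real_of_int (rq K (A x) (A y) (A z) (E x y z)))))"
    by (simp only: rtd_def of_int_mult avg_cmult avg_cmult_right)
  also have "\<dots> \<ge> 0" using nn by (intro mult_nonneg_nonneg tri avg_nonneg) auto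
  finally show ?thesis .
qed

text \<open>Averaged over four random vertices, the sum is a combination of squares and valid
  inequalities with nonnegative multipliers, hence nonnegative; the finite check makes it negative
  on every pattern that can occur.\<close>

theorem rooted_contradiction:
  assumes v: "v \<in> V"
    and nn: "\<And>p q e. 0 \<le> rdeg K p q e" "\<And>p q e. 0 \<le> rloc K p q e" "\<And>p q e. 0 \<le> rhi K p q e" "0 \<le> rlohi K"
      "\<And>p q e. 0 \<le> rdeg1 K p q e" "\<And>p q e. 0 \<le> req K p q e" "\<And>c. 0 \<le> rtri K c"
    and sym: "\<And>a b c e. rq K a b c e = rq K b a c e" "\<And>a b c e. rq K a b c e = rq K a c b e"
    and chk: "\<And>c1 c2 c3 c4 e012 e013 e023 e123 e014 e024 e124 e034 e134 e234. rcheck K c1 c2 c3 c4 e012 e013 e023 e123 e014 e024 e124 e034 e134 e234"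
    and deg: "\<And>u. u \<in> V \<Longrightarrow> 0 \<le> avg (\<lambda>x. avg (\<lambda>y. if E u x y then 536 else - 464))"
    and eq: "\<And>u. u \<in> V \<Longrightarrow> avg (\<lambda>x. avg (\<lambda>y. of_bool (E u x y))) = L"
    and loc: "xdens (\<not> rcol K) v \<le> xdens (rcol K) v"
    and lo: "rlo K \<le> xdens (rcol K) v" and up: "xdens (rcol K) v \<le> rup K"
    and tri: "0 \<le> avg (\<lambda>x. avg (\<lambda>y. avg (\<lambda>z. real_of_int (rq K (A x) (A y) (A z) (E x y z)))))"
  shows False
proof -
  let ?\<phi> = "\<lambda>_::nat. v"
  note t3 = avg_rt3_nonneg[where K = K and \<phi> = ?\<phi>]
  note tb = avg_rtb_aux_nonneg[where K = K and \<phi> = ?\<phi>, OF _ nn(1-4) deg[OF v] loc lo up]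
  note tc = avg_rtc_nonneg[where K = K and \<phi> = ?\<phi>, OF _ nn(5,6) deg eq v]
  note td = avg_rtd_nonneg[where K = K and \<phi> = ?\<phi>, OF _ nn(7) tri]
  have p0: "0 \<le> avgs [1, 2, 3, 4] (\<lambda>\<phi>. real_of_int (rt3 K (A (\<phi> 1)) (A (\<phi> 2)) (E (\<phi> 0) (\<phi> 1) (\<phi> 2)) (A (\<phi> 3)) (E (\<phi> 0) (\<phi> 1) (\<phi> 3)) (E (\<phi> 0) (\<phi> 2) (\<phi> 3)) (E (\<phi> 1) (\<phi> 2) (\<phi> 3)) (A (\<phi> 4)) (E (\<phi> 0) (\<phi> 1) (\<phi> 4)) (E (\<phi> 0) (\<phi> 2) (\<phi> 4)) (E (\<phi> 1) (\<phi> 2) (\<phi> 4)))) ?\<phi>"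
    using t3[of 1 2 3 4] by (simp add: E_ac del: avgs.simps)
  have p1: "0 \<le> avgs [1, 2, 3, 4] (\<lambda>\<phi>. real_of_int (rt3 K (A (\<phi> 1)) (A (\<phi> 3)) (E (\<phi> 0) (\<phi> 1) (\<phi> 3)) (A (\<phi> 2)) (E (\<phi> 0) (\<phi> 1) (\<phi> 2)) (E (\<phi> 0) (\<phi> 2) (\<phi> 3)) (E (\<phi> 1) (\<phi> 2) (\<phi> 3)) (A (\<phi> 4)) (E (\<phi> 0) (\<phi> 1) (\<phi> 4)) (E (\<phi> 0) (\<phi> 3) (\<phi> 4)) (E (\<phi> 1) (\<phi> 3) (\<phi> 4)))) ?\<phi>"
    using t3[of 1 3 2 4] by (simp add: E_ac del: avgs.simps)
  have p2: "0 \<le> avgs [1, 2, 3, 4] (\<lambda>\<phi>. real_of_int (rt3 K (A (\<phi> 1)) (A (\<phi> 4)) (E (\<phi> 0) (\<phi> 1) (\<phi> 4)) (A (\<phi> 2)) (E (\<phi> 0) (\<phi> 1) (\<phi> 2)) (E (\<phi> 0) (\<phi> 2) (\<phi> 4)) (E (\<phi> 1) (\<phi> 2) (\<phi> 4)) (A (\<phi> 3)) (E (\<phi> 0) (\<phi> 1) (\<phi> 3)) (E (\<phi> 0) (\<phi> 3) (\<phi> 4)) (E (\<phi> 1) (\<phi> 3) (\<phi> 4)))) ?\<phi>"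
    using t3[of 1 4 2 3] by (simp add: E_ac del: avgs.simps)
  have p3: "0 \<le> avgs [1, 2, 3, 4] (\<lambda>\<phi>. real_of_int (rt3 K (A (\<phi> 2)) (A (\<phi> 1)) (E (\<phi> 0) (\<phi> 1) (\<phi> 2)) (A (\<phi> 3)) (E (\<phi> 0) (\<phi> 2) (\<phi> 3)) (E (\<phi> 0) (\<phi> 1) (\<phi> 3)) (E (\<phi> 1) (\<phi> 2) (\<phi> 3)) (A (\<phi> 4)) (E (\<phi> 0) (\<phi> 2) (\<phi> 4)) (E (\<phi> 0) (\<phi> 1) (\<phi> 4)) (E (\<phi> 1) (\<phi> 2) (\<phi> 4)))) ?\<phi>"
    using t3[of 2 1 3 4] by (simp add: E_ac del: avgs.simps)
  have p4: "0 \<le> avgs [1, 2, 3, 4] (\<lambda>\<phi>. real_of_int (rt3 K (A (\<phi> 2)) (A (\<phi> 3)) (E (\<phi> 0) (\<phi> 2) (\<phi> 3)) (A (\<phi> 1)) (E (\<phi> 0) (\<phi> 1) (\<phi> 2)) (E (\<phi> 0) (\<phi> 1) (\<phi> 3)) (E (\<phi> 1) (\<phi> 2) (\<phi> 3)) (A (\<phi> 4)) (E (\<phi> 0) (\<phi> 2) (\<phi> 4)) (E (\<phi> 0) (\<phi> 3) (\<phi> 4)) (E (\<phi> 2) (\<phi> 3) (\<phi> 4)))) ?\<phi>"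
    using t3[of 2 3 1 4] by (simp add: E_ac del: avgs.simps)
  have p5: "0 \<le> avgs [1, 2, 3, 4] (\<lambda>\<phi>. real_of_int (rt3 K (A (\<phi> 2)) (A (\<phi> 4)) (E (\<phi> 0) (\<phi> 2) (\<phi> 4)) (A (\<phi> 1)) (E (\<phi> 0) (\<phi> 1) (\<phi> 2)) (E (\<phi> 0) (\<phi> 1) (\<phi> 4)) (E (\<phi> 1) (\<phi> 2) (\<phi> 4)) (A (\<phi> 3)) (E (\<phi> 0) (\<phi> 2) (\<phi> 3)) (E (\<phi> 0) (\<phi> 3) (\<phi> 4)) (E (\<phi> 2) (\<phi> 3) (\<phi> 4)))) ?\<phi>"
    using t3[of 2 4 1 3] by (simp add: E_ac del: avgs.simps)
  have p6: "0 \<le> avgs [1, 2, 3, 4] (\<lambda>\<phi>. real_of_int (rt3 K (A (\<phi> 3)) (A (\<phi> 1)) (E (\<phi> 0) (\<phi> 1) (\<phi> 3)) (A (\<phi> 2)) (E (\<phi> 0) (\<phi> 2) (\<phi> 3)) (E (\<phi> 0) (\<phi> 1) (\<phi> 2)) (E (\<phi> 1) (\<phi> 2) (\<phi> 3)) (A (\<phi> 4)) (E (\<phi> 0) (\<phi> 3) (\<phi> 4)) (E (\<phi> 0) (\<phi> 1) (\<phi> 4)) (E (\<phi> 1) (\<phi> 3) (\<phi> 4)))) ?\<phi>"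
    using t3[of 3 1 2 4] by (simp add: E_ac del: avgs.simps)
  have p7: "0 \<le> avgs [1, 2, 3, 4] (\<lambda>\<phi>. real_of_int (rt3 K (A (\<phi> 3)) (A (\<phi> 2)) (E (\<phi> 0) (\<phi> 2) (\<phi> 3)) (A (\<phi> 1)) (E (\<phi> 0) (\<phi> 1) (\<phi> 3)) (E (\<phi> 0) (\<phi> 1) (\<phi> 2)) (E (\<phi> 1) (\<phi> 2) (\<phi> 3)) (A (\<phi> 4)) (E (\<phi> 0) (\<phi> 3) (\<phi> 4)) (E (\<phi> 0) (\<phi> 2) (\<phi> 4)) (E (\<phi> 2) (\<phi> 3) (\<phi> 4)))) ?\<phi>"
    using t3[of 3 2 1 4] by (simp add: E_ac del: avgs.simps)
  have p8: "0 \<le> avgs [1, 2, 3, 4] (\<lambda>\<phi>. real_of_int (rt3 K (A (\<phi> 3)) (A (\<phi> 4)) (E (\<phi> 0) (\<phi> 3) (\<phi> 4)) (A (\<phi> 1)) (E (\<phi> 0) (\<phi> 1) (\<phi> 3)) (E (\<phi> 0) (\<phi> 1) (\<phi> 4)) (E (\<phi> 1) (\<phi> 3) (\<phi> 4)) (A (\<phi> 2)) (E (\<phi> 0) (\<phi> 2) (\<phi> 3)) (E (\<phi> 0) (\<phi> 2) (\<phi> 4)) (E (\<phi> 2) (\<phi> 3) (\<phi> 4)))) ?\<phi>"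
    using t3[of 3 4 1 2] by (simp add: E_ac del: avgs.simps)
  have p9: "0 \<le> avgs [1, 2, 3, 4] (\<lambda>\<phi>. real_of_int (rt3 K (A (\<phi> 4)) (A (\<phi> 1)) (E (\<phi> 0) (\<phi> 1) (\<phi> 4)) (A (\<phi> 2)) (E (\<phi> 0) (\<phi> 2) (\<phi> 4)) (E (\<phi> 0) (\<phi> 1) (\<phi> 2)) (E (\<phi> 1) (\<phi> 2) (\<phi> 4)) (A (\<phi> 3)) (E (\<phi> 0) (\<phi> 3) (\<phi> 4)) (E (\<phi> 0) (\<phi> 1) (\<phi> 3)) (E (\<phi> 1) (\<phi> 3) (\<phi> 4)))) ?\<phi>"
    using t3[of 4 1 2 3] by (simp add: E_ac del: avgs.simps)
  have p10: "0 \<le> avgs [1, 2, 3, 4] (\<lambda>\<phi>. real_of_int (rt3 K (A (\<phi> 4)) (A (\<phi> 2)) (E (\<phi> 0) (\<phi> 2) (\<phi> 4)) (A (\<phi> 1)) (E (\<phi> 0) (\<phi> 1) (\<phi> 4)) (E (\<phi> 0) (\<phi> 1) (\<phi> 2)) (E (\<phi> 1) (\<phi> 2) (\<phi> 4)) (A (\<phi> 3)) (E (\<phi> 0) (\<phi> 3) (\<phi> 4)) (E (\<phi> 0) (\<phi> 2) (\<phi> 3)) (E (\<phi> 2) (\<phi> 3) (\<phi> 4)))) ?\<phi>"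
    using t3[of 4 2 1 3] by (simp add: E_ac del: avgs.simps)
  have p11: "0 \<le> avgs [1, 2, 3, 4] (\<lambda>\<phi>. real_of_int (rt3 K (A (\<phi> 4)) (A (\<phi> 3)) (E (\<phi> 0) (\<phi> 3) (\<phi> 4)) (A (\<phi> 1)) (E (\<phi> 0) (\<phi> 1) (\<phi> 4)) (E (\<phi> 0) (\<phi> 1) (\<phi> 3)) (E (\<phi> 1) (\<phi> 3) (\<phi> 4)) (A (\<phi> 2)) (E (\<phi> 0) (\<phi> 2) (\<phi> 4)) (E (\<phi> 0) (\<phi> 2) (\<phi> 3)) (E (\<phi> 2) (\<phi> 3) (\<phi> 4)))) ?\<phi>"
    using t3[of 4 3 1 2] by (simp add: E_ac del: avgs.simps)
  have p12: "0 \<le> avgs [1, 2, 3, 4] (\<lambda>\<phi>. real_of_int (rtb_aux K (A (\<phi> 1) \<and> A (\<phi> 2)) (A (\<phi> 1) \<or> A (\<phi> 2)) (E (\<phi> 0) (\<phi> 1) (\<phi> 2)) (A (\<phi> 3) \<and> A (\<phi> 4)) (A (\<phi> 3) \<or> A (\<phi> 4)) (E (\<phi> 0) (\<phi> 3) (\<phi> 4)))) ?\<phi>"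
    using tb[of 1 2 3 4] by (simp add: E_ac del: avgs.simps)
  have p13: "0 \<le> avgs [1, 2, 3, 4] (\<lambda>\<phi>. real_of_int (rtb_aux K (A (\<phi> 1) \<and> A (\<phi> 3)) (A (\<phi> 1) \<or> A (\<phi> 3)) (E (\<phi> 0) (\<phi> 1) (\<phi> 3)) (A (\<phi> 2) \<and> A (\<phi> 4)) (A (\<phi> 2) \<or> A (\<phi> 4)) (E (\<phi> 0) (\<phi> 2) (\<phi> 4)))) ?\<phi>"
    using tb[of 1 3 2 4] by (simp add: E_ac del: avgs.simps)
  have p14: "0 \<le> avgs [1, 2, 3, 4] (\<lambda>\<phi>. real_of_int (rtb_aux K (A (\<phi> 1) \<and> A (\<phi> 4)) (A (\<phi> 1) \<or> A (\<phi> 4)) (E (\<phi> 0) (\<phi> 1) (\<phi> 4)) (A (\<phi> 2) \<and> A (\<phi> 3)) (A (\<phi> 2) \<or> A (\<phi> 3)) (E (\<phi> 0) (\<phi> 2) (\<phi> 3)))) ?\<phi>"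
    using tb[of 1 4 2 3] by (simp add: E_ac del: avgs.simps)
  have p15: "0 \<le> avgs [1, 2, 3, 4] (\<lambda>\<phi>. real_of_int (rtb_aux K (A (\<phi> 2) \<and> A (\<phi> 3)) (A (\<phi> 2) \<or> A (\<phi> 3)) (E (\<phi> 0) (\<phi> 2) (\<phi> 3)) (A (\<phi> 1) \<and> A (\<phi> 4)) (A (\<phi> 1) \<or> A (\<phi> 4)) (E (\<phi> 0) (\<phi> 1) (\<phi> 4)))) ?\<phi>"
    using tb[of 2 3 1 4] by (simp add: E_ac del: avgs.simps)
  have p16: "0 \<le> avgs [1, 2, 3, 4] (\<lambda>\<phi>. real_of_int (rtb_aux K (A (\<phi> 2) \<and> A (\<phi> 4)) (A (\<phi> 2) \<or> A (\<phi> 4)) (E (\<phi> 0) (\<phi> 2) (\<phi> 4)) (A (\<phi> 1) \<and> A (\<phi> 3)) (A (\<phi> 1) \<or> A (\<phi> 3)) (E (\<phi> 0) (\<phi> 1) (\<phi> 3)))) ?\<phi>"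
    using tb[of 2 4 1 3] by (simp add: E_ac del: avgs.simps)
  have p17: "0 \<le> avgs [1, 2, 3, 4] (\<lambda>\<phi>. real_of_int (rtb_aux K (A (\<phi> 3) \<and> A (\<phi> 4)) (A (\<phi> 3) \<or> A (\<phi> 4)) (E (\<phi> 0) (\<phi> 3) (\<phi> 4)) (A (\<phi> 1) \<and> A (\<phi> 2)) (A (\<phi> 1) \<or> A (\<phi> 2)) (E (\<phi> 0) (\<phi> 1) (\<phi> 2)))) ?\<phi>"
    using tb[of 3 4 1 2] by (simp add: E_ac del: avgs.simps)
  have p18: "0 \<le> avgs [1, 2, 3, 4] (\<lambda>\<phi>. real_of_int (rtc K (A (\<phi> 1)) (A (\<phi> 2)) (E (\<phi> 0) (\<phi> 1) (\<phi> 2)) (E (\<phi> 1) (\<phi> 3) (\<phi> 4)) (E (\<phi> 0) (\<phi> 3) (\<phi> 4)))) ?\<phi>"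
    using tc[of 1 2 3 4] by (simp add: E_ac del: avgs.simps)
  have p19: "0 \<le> avgs [1, 2, 3, 4] (\<lambda>\<phi>. real_of_int (rtc K (A (\<phi> 1)) (A (\<phi> 3)) (E (\<phi> 0) (\<phi> 1) (\<phi> 3)) (E (\<phi> 1) (\<phi> 2) (\<phi> 4)) (E (\<phi> 0) (\<phi> 2) (\<phi> 4)))) ?\<phi>"
    using tc[of 1 3 2 4] by (simp add: E_ac del: avgs.simps)
  have p20: "0 \<le> avgs [1, 2, 3, 4] (\<lambda>\<phi>. real_of_int (rtc K (A (\<phi> 1)) (A (\<phi> 4)) (E (\<phi> 0) (\<phi> 1) (\<phi> 4)) (E (\<phi> 1) (\<phi> 2) (\<phi> 3)) (E (\<phi> 0) (\<phi> 2) (\<phi> 3)))) ?\<phi>"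
    using tc[of 1 4 2 3] by (simp add: E_ac del: avgs.simps)
  have p21: "0 \<le> avgs [1, 2, 3, 4] (\<lambda>\<phi>. real_of_int (rtc K (A (\<phi> 2)) (A (\<phi> 1)) (E (\<phi> 0) (\<phi> 1) (\<phi> 2)) (E (\<phi> 2) (\<phi> 3) (\<phi> 4)) (E (\<phi> 0) (\<phi> 3) (\<phi> 4)))) ?\<phi>"
    using tc[of 2 1 3 4] by (simp add: E_ac del: avgs.simps)
  have p22: "0 \<le> avgs [1, 2, 3, 4] (\<lambda>\<phi>. real_of_int (rtc K (A (\<phi> 2)) (A (\<phi> 3)) (E (\<phi> 0) (\<phi> 2) (\<phi> 3)) (E (\<phi> 1) (\<phi> 2) (\<phi> 4)) (E (\<phi> 0) (\<phi> 1) (\<phi> 4)))) ?\<phi>"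
    using tc[of 2 3 1 4] by (simp add: E_ac del: avgs.simps)
  have p23: "0 \<le> avgs [1, 2, 3, 4] (\<lambda>\<phi>. real_of_int (rtc K (A (\<phi> 2)) (A (\<phi> 4)) (E (\<phi> 0) (\<phi> 2) (\<phi> 4)) (E (\<phi> 1) (\<phi> 2) (\<phi> 3)) (E (\<phi> 0) (\<phi> 1) (\<phi> 3)))) ?\<phi>"
    using tc[of 2 4 1 3] by (simp add: E_ac del: avgs.simps)
  have p24: "0 \<le> avgs [1, 2, 3, 4] (\<lambda>\<phi>. real_of_int (rtc K (A (\<phi> 3)) (A (\<phi> 1)) (E (\<phi> 0) (\<phi> 1) (\<phi> 3)) (E (\<phi> 2) (\<phi> 3) (\<phi> 4)) (E (\<phi> 0) (\<phi> 2) (\<phi> 4)))) ?\<phi>"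
    using tc[of 3 1 2 4] by (simp add: E_ac del: avgs.simps)
  have p25: "0 \<le> avgs [1, 2, 3, 4] (\<lambda>\<phi>. real_of_int (rtc K (A (\<phi> 3)) (A (\<phi> 2)) (E (\<phi> 0) (\<phi> 2) (\<phi> 3)) (E (\<phi> 1) (\<phi> 3) (\<phi> 4)) (E (\<phi> 0) (\<phi> 1) (\<phi> 4)))) ?\<phi>"
    using tc[of 3 2 1 4] by (simp add: E_ac del: avgs.simps)
  have p26: "0 \<le> avgs [1, 2, 3, 4] (\<lambda>\<phi>. real_of_int (rtc K (A (\<phi> 3)) (A (\<phi> 4)) (E (\<phi> 0) (\<phi> 3) (\<phi> 4)) (E (\<phi> 1) (\<phi> 2) (\<phi> 3)) (E (\<phi> 0) (\<phi> 1) (\<phi> 2)))) ?\<phi>"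
    using tc[of 3 4 1 2] by (simp add: E_ac del: avgs.simps)
  have p27: "0 \<le> avgs [1, 2, 3, 4] (\<lambda>\<phi>. real_of_int (rtc K (A (\<phi> 4)) (A (\<phi> 1)) (E (\<phi> 0) (\<phi> 1) (\<phi> 4)) (E (\<phi> 2) (\<phi> 3) (\<phi> 4)) (E (\<phi> 0) (\<phi> 2) (\<phi> 3)))) ?\<phi>"
    using tc[of 4 1 2 3] by (simp add: E_ac del: avgs.simps)
  have p28: "0 \<le> avgs [1, 2, 3, 4] (\<lambda>\<phi>. real_of_int (rtc K (A (\<phi> 4)) (A (\<phi> 2)) (E (\<phi> 0) (\<phi> 2) (\<phi> 4)) (E (\<phi> 1) (\<phi> 3) (\<phi> 4)) (E (\<phi> 0) (\<phi> 1) (\<phi> 3)))) ?\<phi>"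
    using tc[of 4 2 1 3] by (simp add: E_ac del: avgs.simps)
  have p29: "0 \<le> avgs [1, 2, 3, 4] (\<lambda>\<phi>. real_of_int (rtc K (A (\<phi> 4)) (A (\<phi> 3)) (E (\<phi> 0) (\<phi> 3) (\<phi> 4)) (E (\<phi> 1) (\<phi> 2) (\<phi> 4)) (E (\<phi> 0) (\<phi> 1) (\<phi> 2)))) ?\<phi>"
    using tc[of 4 3 1 2] by (simp add: E_ac del: avgs.simps)
  have p30: "0 \<le> avgs [1, 2, 3, 4] (\<lambda>\<phi>. real_of_int (rtd K (A (\<phi> 1)) (A (\<phi> 2)) (A (\<phi> 3)) (A (\<phi> 4)) (E (\<phi> 2) (\<phi> 3) (\<phi> 4)))) ?\<phi>"
    using td[of 1 2 3 4] by (simp add: E_ac del: avgs.simps)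
  have p31: "0 \<le> avgs [1, 2, 3, 4] (\<lambda>\<phi>. real_of_int (rtd K (A (\<phi> 2)) (A (\<phi> 1)) (A (\<phi> 3)) (A (\<phi> 4)) (E (\<phi> 1) (\<phi> 3) (\<phi> 4)))) ?\<phi>"
    using td[of 2 1 3 4] by (simp add: E_ac del: avgs.simps)
  have p32: "0 \<le> avgs [1, 2, 3, 4] (\<lambda>\<phi>. real_of_int (rtd K (A (\<phi> 3)) (A (\<phi> 1)) (A (\<phi> 2)) (A (\<phi> 4)) (E (\<phi> 1) (\<phi> 2) (\<phi> 4)))) ?\<phi>"
    using td[of 3 1 2 4] by (simp add: E_ac del: avgs.simps)
  have p33: "0 \<le> avgs [1, 2, 3, 4] (\<lambda>\<phi>. real_of_int (rtd K (A (\<phi> 4)) (A (\<phi> 1)) (A (\<phi> 2)) (A (\<phi> 3)) (E (\<phi> 1) (\<phi> 2) (\<phi> 3)))) ?\<phi>"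
    using td[of 4 1 2 3] by (simp add: E_ac del: avgs.simps)

  have "0 \<le> avgs [1, 2, 3, 4] (\<lambda>\<phi>. real_of_int (rsum K \<phi>)) ?\<phi>"
    unfolding rsum_def rS_def rtb_def of_int_add of_int_mult of_int_numeral avgs_add avgs_cmult
    by (intro add_nonneg_nonneg mult_nonneg_nonneg
      p0 p1 p2 p3 p4 p5 p6 p7 p8 p9 p10 p11 
      p12 p13 p14 p15 p16 p17 p18 p19 p20 p21 p22 p23 
      p24 p25 p26 p27 p28 p29 p30 p31 p32 p33) simp_all
  also have "\<dots> \<le> avgs [1, 2, 3, 4] (\<lambda>_. - 1) ?\<phi>"
  proof (rule avgs_mono)
    fix \<psi>
    have "rsum K \<psi> < 0" by (rule rsum_neg[OF sym chk])
    \<comment> \<open>Integrality provides the uniform gap -1, which survives averaging.\<close>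
    then have "rsum K \<psi> \<le> - 1" by linarith
    then show "real_of_int (rsum K \<psi>) \<le> - 1" by linarith
  qed
  finally show False by simp
qed

end

section \<open>Certificates averaged over all vertices\<close>

record ucert =
  uobj :: "bool \<Rightarrow> bool \<Rightarrow> bool \<Rightarrow> bool \<Rightarrow> int"
  uxA :: int
  uxB :: int
  uV3 :: "bool \<Rightarrow> bool \<Rightarrow> bool \<Rightarrow> bool \<Rightarrow> bool \<Rightarrow> bool \<Rightarrow> bool \<Rightarrow> bool \<Rightarrow> int list"
  uV1 :: "bool \<Rightarrow> bool \<Rightarrow> bool \<Rightarrow> bool \<Rightarrow> int list"
  udeg :: "bool \<Rightarrow> bool \<Rightarrow> bool \<Rightarrow> bool \<Rightarrow> int"
  uloc :: "bool \<Rightarrow> bool \<Rightarrow> bool \<Rightarrow> bool \<Rightarrow> int"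
  ux :: "bool \<Rightarrow> bool \<Rightarrow> bool \<Rightarrow> bool \<Rightarrow> int"
  ual :: "bool \<Rightarrow> bool \<Rightarrow> int"

definition ut3 where
  "ut3 K c0 c1 c2 e012 c3 e013 e023 e123 c4 e014 e024 e124 =
     dot (uV3 K c0 c1 c2 e012 c3 e013 e023 e123) (uV3 K c0 c1 c2 e012 c4 e014 e024 e124)"

text \<open>The root is now averaged as well, so the multipliers depend on its colour
  \<open>c\<close>. The bound 403 holds only for the mean over all roots of the AAB link density;
  therefore \<open>ual\<close> may depend on the second pair but not on the root.\<close>

definition utb_aux where
  "utb_aux K c p q e p' q' e' =
     dot (uV1 K c p q e) (uV1 K c p' q' e')
     + udeg K c p' q' e' * (if e then 536 else - 464)
     + uloc K c p' q' e' * (xind c p q e - xind (\<not> c) p q e)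
     + ux K c p' q' e' * (xind c p q e - (if c then uxA K else uxB K))
     + ual K p' q' * (xind c p q e - 403)"

definition utb where
  "utb K c c1 c2 e c3 c4 e' =
     utb_aux K c (c1 \<and> c2) (c1 \<or> c2) e (c3 \<and> c4) (c3 \<or> c4) e'
     + utb_aux K c (c3 \<and> c4) (c3 \<or> c4) e' (c1 \<and> c2) (c1 \<or> c2) e"

text \<open>Sum over all 120 orderings of five vertices, with multiplicities 2, 4 and 12.
  Nonpositivity says that on this pattern the certified part is at most 12 times the sum of the
  objective over the ten triples.\<close>

definition uS :: "ucert \<Rightarrow> bool \<Rightarrow> bool \<Rightarrow> bool \<Rightarrow> bool \<Rightarrow> bool \<Rightarrow> bool \<Rightarrow> bool \<Rightarrow> bool \<Rightarrow> bool \<Rightarrow> bool \<Rightarrow> bool \<Rightarrow> bool \<Rightarrow> bool \<Rightarrow> bool \<Rightarrow> bool \<Rightarrow> int" where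
  "uS K c0 c1 c2 c3 c4 e012 e013 e023 e123 e014 e024 e124 e034 e134 e234 =
    2 * (ut3 K c0 c1 c2 e012 c3 e013 e023 e123 c4 e014 e024 e124 + ut3 K c0 c1 c3 e013 c2 e012 e023 e123 c4 e014 e034 e134 + 
    ut3 K c0 c1 c4 e014 c2 e012 e024 e124 c3 e013 e034 e134 + ut3 K c0 c2 c1 e012 c3 e023 e013 e123 c4 e024 e014 e124 + 
    ut3 K c0 c2 c3 e023 c1 e012 e013 e123 c4 e024 e034 e234 + ut3 K c0 c2 c4 e024 c1 e012 e014 e124 c3 e023 e034 e234 + 
    ut3 K c0 c3 c1 e013 c2 e023 e012 e123 c4 e034 e014 e134 + ut3 K c0 c3 c2 e023 c1 e013 e012 e123 c4 e034 e024 e234 + 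
    ut3 K c0 c3 c4 e034 c1 e013 e014 e134 c2 e023 e024 e234 + ut3 K c0 c4 c1 e014 c2 e024 e012 e124 c3 e034 e013 e134 + 
    ut3 K c0 c4 c2 e024 c1 e014 e012 e124 c3 e034 e023 e234 + ut3 K c0 c4 c3 e034 c1 e014 e013 e134 c2 e024 e023 e234 + 
    ut3 K c1 c0 c2 e012 c3 e013 e123 e023 c4 e014 e124 e024 + ut3 K c1 c0 c3 e013 c2 e012 e123 e023 c4 e014 e134 e034 + 
    ut3 K c1 c0 c4 e014 c2 e012 e124 e024 c3 e013 e134 e034 + ut3 K c1 c2 c0 e012 c3 e123 e013 e023 c4 e124 e014 e024 + 
    ut3 K c1 c2 c3 e123 c0 e012 e013 e023 c4 e124 e134 e234 + ut3 K c1 c2 c4 e124 c0 e012 e014 e024 c3 e123 e134 e234 + 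
    ut3 K c1 c3 c0 e013 c2 e123 e012 e023 c4 e134 e014 e034 + ut3 K c1 c3 c2 e123 c0 e013 e012 e023 c4 e134 e124 e234 + 
    ut3 K c1 c3 c4 e134 c0 e013 e014 e034 c2 e123 e124 e234 + ut3 K c1 c4 c0 e014 c2 e124 e012 e024 c3 e134 e013 e034 + 
    ut3 K c1 c4 c2 e124 c0 e014 e012 e024 c3 e134 e123 e234 + ut3 K c1 c4 c3 e134 c0 e014 e013 e034 c2 e124 e123 e234 + 
    ut3 K c2 c0 c1 e012 c3 e023 e123 e013 c4 e024 e124 e014 + ut3 K c2 c0 c3 e023 c1 e012 e123 e013 c4 e024 e234 e034 + 
    ut3 K c2 c0 c4 e024 c1 e012 e124 e014 c3 e023 e234 e034 + ut3 K c2 c1 c0 e012 c3 e123 e023 e013 c4 e124 e024 e014 + 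
    ut3 K c2 c1 c3 e123 c0 e012 e023 e013 c4 e124 e234 e134 + ut3 K c2 c1 c4 e124 c0 e012 e024 e014 c3 e123 e234 e134 + 
    ut3 K c2 c3 c0 e023 c1 e123 e012 e013 c4 e234 e024 e034 + ut3 K c2 c3 c1 e123 c0 e023 e012 e013 c4 e234 e124 e134 + 
    ut3 K c2 c3 c4 e234 c0 e023 e024 e034 c1 e123 e124 e134 + ut3 K c2 c4 c0 e024 c1 e124 e012 e014 c3 e234 e023 e034 + 
    ut3 K c2 c4 c1 e124 c0 e024 e012 e014 c3 e234 e123 e134 + ut3 K c2 c4 c3 e234 c0 e024 e023 e034 c1 e124 e123 e134 + 
    ut3 K c3 c0 c1 e013 c2 e023 e123 e012 c4 e034 e134 e014 + ut3 K c3 c0 c2 e023 c1 e013 e123 e012 c4 e034 e234 e024 + 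
    ut3 K c3 c0 c4 e034 c1 e013 e134 e014 c2 e023 e234 e024 + ut3 K c3 c1 c0 e013 c2 e123 e023 e012 c4 e134 e034 e014 + 
    ut3 K c3 c1 c2 e123 c0 e013 e023 e012 c4 e134 e234 e124 + ut3 K c3 c1 c4 e134 c0 e013 e034 e014 c2 e123 e234 e124 + 
    ut3 K c3 c2 c0 e023 c1 e123 e013 e012 c4 e234 e034 e024 + ut3 K c3 c2 c1 e123 c0 e023 e013 e012 c4 e234 e134 e124 + 
    ut3 K c3 c2 c4 e234 c0 e023 e034 e024 c1 e123 e134 e124 + ut3 K c3 c4 c0 e034 c1 e134 e013 e014 c2 e234 e023 e024 + 
    ut3 K c3 c4 c1 e134 c0 e034 e013 e014 c2 e234 e123 e124 + ut3 K c3 c4 c2 e234 c0 e034 e023 e024 c1 e134 e123 e124 + 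
    ut3 K c4 c0 c1 e014 c2 e024 e124 e012 c3 e034 e134 e013 + ut3 K c4 c0 c2 e024 c1 e014 e124 e012 c3 e034 e234 e023 + 
    ut3 K c4 c0 c3 e034 c1 e014 e134 e013 c2 e024 e234 e023 + ut3 K c4 c1 c0 e014 c2 e124 e024 e012 c3 e134 e034 e013 + 
    ut3 K c4 c1 c2 e124 c0 e014 e024 e012 c3 e134 e234 e123 + ut3 K c4 c1 c3 e134 c0 e014 e034 e013 c2 e124 e234 e123 + 
    ut3 K c4 c2 c0 e024 c1 e124 e014 e012 c3 e234 e034 e023 + ut3 K c4 c2 c1 e124 c0 e024 e014 e012 c3 e234 e134 e123 + 
    ut3 K c4 c2 c3 e234 c0 e024 e034 e023 c1 e124 e134 e123 + ut3 K c4 c3 c0 e034 c1 e134 e014 e013 c2 e234 e024 e023 + 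
    ut3 K c4 c3 c1 e134 c0 e034 e014 e013 c2 e234 e124 e123 + ut3 K c4 c3 c2 e234 c0 e034 e024 e023 c1 e134 e124 e123) +
    4 * (utb K c0 c1 c2 e012 c3 c4 e034 + utb K c0 c1 c3 e013 c2 c4 e024 + 
    utb K c0 c1 c4 e014 c2 c3 e023 + utb K c1 c0 c2 e012 c3 c4 e134 + 
    utb K c1 c0 c3 e013 c2 c4 e124 + utb K c1 c0 c4 e014 c2 c3 e123 + 
    utb K c2 c0 c1 e012 c3 c4 e234 + utb K c2 c0 c3 e023 c1 c4 e124 + 
    utb K c2 c0 c4 e024 c1 c3 e123 + utb K c3 c0 c1 e013 c2 c4 e234 + 
    utb K c3 c0 c2 e023 c1 c4 e134 + utb K c3 c0 c4 e034 c1 c2 e123 + 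
    utb K c4 c0 c1 e014 c2 c3 e234 + utb K c4 c0 c2 e024 c1 c3 e134 + 
    utb K c4 c0 c3 e034 c1 c2 e124) -
    12 * (uobj K c0 c1 c2 e012 + uobj K c0 c1 c3 e013 + 
    uobj K c0 c1 c4 e014 + uobj K c0 c2 c3 e023 + 
    uobj K c0 c2 c4 e024 + uobj K c0 c3 c4 e034 + 
    uobj K c1 c2 c3 e123 + uobj K c1 c2 c4 e124 + 
    uobj K c1 c3 c4 e134 + uobj K c2 c3 c4 e234)"

definition ucheck where
  "ucheck K c0 c1 c2 c3 c4 e012 e013 e023 e123 e014 e024 e124 e034 e134 e234 =
    (if lexmin5 c0 c1 c2 c3 c4 e012 e013 e023 e123 e014 e024 e124 e034 e134 e234
     then if allowed5 e012 e013 e023 e123 e014 e024 e124 e034 e134 e234 then uS K c0 c1 c2 c3 c4 e012 e013 e023 e123 e014 e024 e124 e034 e134 e234 \<le> 0 else True else True)"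

context coloured
begin

lemma avgs5:
  assumes "sort [i, j, k, l, m] = [0, 1, 2, 3, 4]"
  shows "avgs [0, 1, 2, 3, 4] (\<lambda>\<phi>. g (\<phi> i) (\<phi> j) (\<phi> k) (\<phi> l) (\<phi> m)) \<phi> =
    avg (\<lambda>v. avg (\<lambda>a. avg (\<lambda>b. avg (\<lambda>c. avg (\<lambda>d. g v a b c d)))))"
proof -
  have ix: "set [i, j, k, l, m] = {0, 1, 2, 3, 4}" "distinct [i, j, k, l, m]"
    using arg_cong[OF assms, of set] arg_cong[OF assms, of distinct] unfolding set_sort distinct_sort by simp_all
  have "avgs [0, 1, 2, 3, 4] (\<lambda>\<phi>. g (\<phi> i) (\<phi> j) (\<phi> k) (\<phi> l) (\<phi> m)) \<phi> =
      avgs [i, j, k, l, m] (\<lambda>\<phi>. g (\<phi> i) (\<phi> j) (\<phi> k) (\<phi> l) (\<phi> m)) \<phi>"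
    using ix by (intro avgs_perm) simp_all
  then show ?thesis using ix(2) by simp
qed

definition usum :: "ucert \<Rightarrow> (nat \<Rightarrow> 'v) \<Rightarrow> int" where
  "usum K \<phi> = uS K (A (\<phi> 0)) (A (\<phi> 1)) (A (\<phi> 2)) (A (\<phi> 3)) (A (\<phi> 4))
       (E (\<phi> 0) (\<phi> 1) (\<phi> 2)) (E (\<phi> 0) (\<phi> 1) (\<phi> 3)) (E (\<phi> 0) (\<phi> 2) (\<phi> 3)) (E (\<phi> 1) (\<phi> 2) (\<phi> 3)) (E (\<phi> 0) (\<phi> 1) (\<phi> 4))
       (E (\<phi> 0) (\<phi> 2) (\<phi> 4)) (E (\<phi> 1) (\<phi> 2) (\<phi> 4)) (E (\<phi> 0) (\<phi> 3) (\<phi> 4)) (E (\<phi> 1) (\<phi> 3) (\<phi> 4)) (E (\<phi> 2) (\<phi> 3) (\<phi> 4))"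

definition ubits :: "(nat \<Rightarrow> 'v) \<Rightarrow> bool list" where
  "ubits \<phi> = [(A (\<phi> 0)), (A (\<phi> 1)), (A (\<phi> 2)), (A (\<phi> 3)), (A (\<phi> 4)),
       (E (\<phi> 0) (\<phi> 1) (\<phi> 2)), (E (\<phi> 0) (\<phi> 1) (\<phi> 3)), (E (\<phi> 0) (\<phi> 2) (\<phi> 3)), (E (\<phi> 1) (\<phi> 2) (\<phi> 3)), (E (\<phi> 0) (\<phi> 1) (\<phi> 4)),
       (E (\<phi> 0) (\<phi> 2) (\<phi> 4)), (E (\<phi> 1) (\<phi> 2) (\<phi> 4)), (E (\<phi> 0) (\<phi> 3) (\<phi> 4)), (E (\<phi> 1) (\<phi> 3) (\<phi> 4)), (E (\<phi> 2) (\<phi> 3) (\<phi> 4))]"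

lemma ut3_commute:
  "ut3 K c0 c1 c2 e012 c3 e013 e023 e123 c4 e014 e024 e124 = ut3 K c0 c1 c2 e012 c4 e014 e024 e124 c3 e013 e023 e123"
  by (simp add: ut3_def dot_commute)

lemma utb_commute:
  "utb K c c1 c2 e c3 c4 e' = utb K c c3 c4 e' c1 c2 e"
  "utb K c c1 c2 e c3 c4 e' = utb K c c2 c1 e c3 c4 e'"
  "utb K c c1 c2 e c3 c4 e' = utb K c c1 c2 e c4 c3 e'"
  by (simp_all add: utb_def conj_commute disj_commute)

lemma usum_swap_adjacent:
  assumes sym: "\<And>a b c e. uobj K a b c e = uobj K b a c e" "\<And>a b c e. uobj K a b c e = uobj K a c b e"
  shows "usum K (swap 0 1 \<phi>) = usum K \<phi>" "usum K (swap 1 2 \<phi>) = usum K \<phi>"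
    "usum K (swap 2 3 \<phi>) = usum K \<phi>" "usum K (swap 3 4 \<phi>) = usum K \<phi>"
  by (simp_all add: usum_def swap_def uS_def E_ac ut3_commute utb_commute sym add_ac)

lemma usum_swap:
  assumes sym: "\<And>a b c e. uobj K a b c e = uobj K b a c e" "\<And>a b c e. uobj K a b c e = uobj K a c b e"
  assumes "(i, j) \<in> {(0, 1), (0, 2), (0, 3), (0, 4), (1, 2), (1, 3), (1, 4), (2, 3), (2, 4), (3, 4)}"
  shows "usum K (swap i j \<phi>) = usum K \<phi>"
proof -
  note adj = usum_swap_adjacent[OF sym]
  have 02: "usum K (swap 0 2 \<phi>) = usum K \<phi>" for \<phi>
    by (subst swap_via[of 0 1 2]) (simp, simp, simp, simp only: adj)
  have 13: "usum K (swap 1 3 \<phi>) = usum K \<phi>" for \<phi>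
    by (subst swap_via[of 1 2 3]) (simp, simp, simp, simp only: adj)
  have 24: "usum K (swap 2 4 \<phi>) = usum K \<phi>" for \<phi>
    by (subst swap_via[of 2 3 4]) (simp, simp, simp, simp only: adj)
  have 03: "usum K (swap 0 3 \<phi>) = usum K \<phi>" for \<phi>
    by (subst swap_via[of 0 2 3]) (simp, simp, simp, simp only: adj 02)
  have 14: "usum K (swap 1 4 \<phi>) = usum K \<phi>" for \<phi>
    by (subst swap_via[of 1 3 4]) (simp, simp, simp, simp only: adj 13)
  have 04: "usum K (swap 0 4 \<phi>) = usum K \<phi>" for \<phi>
    by (subst swap_via[of 0 3 4]) (simp, simp, simp, simp only: adj 03)
  show ?thesis
    using assms(3) adj 02 13 24 03 14 04 by auto
qed

lemma usum_nonpos: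
  assumes "\<And>a b c e. uobj K a b c e = uobj K b a c e" "\<And>a b c e. uobj K a b c e = uobj K a c b e"
    and chk: "\<And>c0 c1 c2 c3 c4 e012 e013 e023 e123 e014 e024 e124 e034 e134 e234. ucheck K c0 c1 c2 c3 c4 e012 e013 e023 e123 e014 e024 e124 e034 e134 e234"
  shows "usum K \<phi> \<le> 0"
proof (rule minimal_code_induct[where code = "\<lambda>\<phi>. bcode (ubits \<phi>)" and p = \<phi>
      and T = "(\<lambda>(i, j). swap i j) ` {(0, 1), (0, 2), (0, 3), (0, 4), (1, 2), (1, 3), (1, 4), (2, 3), (2, 4), (3, 4)}"])
  fix \<phi> t
  assume "t \<in> (\<lambda>(i, j). swap i j) ` {(0, 1), (0, 2), (0, 3), (0, 4), (1, 2), (1, 3), (1, 4), (2, 3), (2, 4), (3, 4)}"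
    and "usum K (t \<phi>) \<le> 0"
  then show "usum K \<phi> \<le> 0" using usum_swap[OF assms(1,2)] by auto
next
  fix \<phi>
  assume min: "bcode (ubits \<phi>) \<le> bcode (ubits (t \<phi>))"
    if "t \<in> (\<lambda>(i, j). swap i j) ` {(0, 1), (0, 2), (0, 3), (0, 4), (1, 2), (1, 3), (1, 4), (2, 3), (2, 4), (3, 4)}" for t
  have le: "lexle (ubits \<phi>) (ubits (swap i j \<phi>))" if "(i, j) \<in> {(0, 1), (0, 2), (0, 3), (0, 4), (1, 2), (1, 3), (1, 4), (2, 3), (2, 4), (3, 4)}" for i j
    using that by (intro lexle_if_bcode_le min) (auto simp: ubits_def)
  have "lexmin5 (A (\<phi> 0)) (A (\<phi> 1)) (A (\<phi> 2)) (A (\<phi> 3)) (A (\<phi> 4))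
       (E (\<phi> 0) (\<phi> 1) (\<phi> 2)) (E (\<phi> 0) (\<phi> 1) (\<phi> 3)) (E (\<phi> 0) (\<phi> 2) (\<phi> 3)) (E (\<phi> 1) (\<phi> 2) (\<phi> 3)) (E (\<phi> 0) (\<phi> 1) (\<phi> 4))
       (E (\<phi> 0) (\<phi> 2) (\<phi> 4)) (E (\<phi> 1) (\<phi> 2) (\<phi> 4)) (E (\<phi> 0) (\<phi> 3) (\<phi> 4)) (E (\<phi> 1) (\<phi> 3) (\<phi> 4)) (E (\<phi> 2) (\<phi> 3) (\<phi> 4))"
    using le[of 0 1] le[of 0 2] le[of 0 3] le[of 0 4] le[of 1 2] le[of 1 3] le[of 1 4] le[of 2 3] le[of 2 4] le[of 3 4]
    unfolding lexmin5_def ubits_def swap_def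
    by (simp add: E_ac del: lexle.simps)
  then show "usum K \<phi> \<le> 0"
    using chk[of "A (\<phi> 0)"
      "A (\<phi> 1)"
      "A (\<phi> 2)"
      "A (\<phi> 3)"
      "A (\<phi> 4)"
      "E (\<phi> 0) (\<phi> 1) (\<phi> 2)"
      "E (\<phi> 0) (\<phi> 1) (\<phi> 3)"
      "E (\<phi> 0) (\<phi> 2) (\<phi> 3)"
      "E (\<phi> 1) (\<phi> 2) (\<phi> 3)"
      "E (\<phi> 0) (\<phi> 1) (\<phi> 4)"
      "E (\<phi> 0) (\<phi> 2) (\<phi> 4)"
      "E (\<phi> 1) (\<phi> 2) (\<phi> 4)"
      "E (\<phi> 0) (\<phi> 3) (\<phi> 4)"
      "E (\<phi> 1) (\<phi> 3) (\<phi> 4)"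
      "E (\<phi> 2) (\<phi> 3) (\<phi> 4)"]
    unfolding ucheck_def usum_def by (simp add: allowed5)
qed

lemma avg_ut3_nonneg:
  assumes "sort [i, j, k, l, m] = [0, 1, 2, 3, 4]"
  shows "0 \<le> avgs [0, 1, 2, 3, 4] (\<lambda>\<phi>. real_of_int
    (ut3 K (A (\<phi> i)) (A (\<phi> j)) (A (\<phi> k)) (E (\<phi> i) (\<phi> j) (\<phi> k))
       (A (\<phi> l)) (E (\<phi> i) (\<phi> j) (\<phi> l)) (E (\<phi> i) (\<phi> k) (\<phi> l)) (E (\<phi> j) (\<phi> k) (\<phi> l))
       (A (\<phi> m)) (E (\<phi> i) (\<phi> j) (\<phi> m)) (E (\<phi> i) (\<phi> k) (\<phi> m)) (E (\<phi> j) (\<phi> k) (\<phi> m)))) \<phi>"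
  unfolding ut3_def
  by (subst avgs5[OF assms, where g = "\<lambda>v a b c d. real_of_int (dot
        (uV3 K (A v) (A a) (A b) (E v a b) (A c) (E v a c) (E v b c) (E a b c))
        (uV3 K (A v) (A a) (A b) (E v a b) (A d) (E v a d) (E v b d) (E a b d)))"])
    (intro avg_nonneg avg_dot_nonneg)

lemma avg_utb_aux_nonneg:
  assumes ix: "sort [z, i, j, k, l] = [0, 1, 2, 3, 4]"
    and nn: "\<And>c p q e. 0 \<le> udeg K c p q e" "\<And>c p q e. 0 \<le> uloc K c p q e"
      "\<And>c p q e. 0 \<le> ux K c p q e" "\<And>p q. 0 \<le> ual K p q"
    and deg: "\<And>u. u \<in> V \<Longrightarrow> 0 \<le> avg (\<lambda>x. avg (\<lambda>y. if E u x y then 536 else - 464))"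
    and loc: "\<And>u. u \<in> V \<Longrightarrow> xdens (\<not> A u) u \<le> xdens (A u) u"
    and x: "\<And>u. u \<in> V \<Longrightarrow> (if A u then uxA K else uxB K) \<le> xdens (A u) u"
    and al: "403 \<le> avg (\<lambda>u. xdens (A u) u)"
  shows "0 \<le> avgs [0, 1, 2, 3, 4] (\<lambda>\<phi>. real_of_int
    (utb_aux K (A (\<phi> z)) (A (\<phi> i) \<and> A (\<phi> j)) (A (\<phi> i) \<or> A (\<phi> j)) (E (\<phi> z) (\<phi> i) (\<phi> j))
       (A (\<phi> k) \<and> A (\<phi> l)) (A (\<phi> k) \<or> A (\<phi> l)) (E (\<phi> z) (\<phi> k) (\<phi> l)))) \<phi>"
proof -
  let ?P = "\<lambda>a b. A a \<and> A b" and ?Q = "\<lambda>a b. A a \<or> A b"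
  let ?x = "\<lambda>v r a b. real_of_int (xind r (?P a b) (?Q a b) (E v a b))"
  let ?al = "avg (\<lambda>c. avg (\<lambda>d. real_of_int (ual K (?P c d) (?Q c d))))"
  have xd: "avg (\<lambda>a. avg (\<lambda>b. ?x v r a b)) = xdens r v" for v r
    by (simp add: xdens_def)
  have h: "0 \<le> avg (\<lambda>c. avg (\<lambda>d. real_of_int (f (A v) (?P c d) (?Q c d) (E v c d))))"
    if "\<And>c p q e. 0 \<le> f c p q e" for f v
    using that by (intro avg_nonneg) auto
  have eq: "real_of_int (utb_aux K (A v) (?P a b) (?Q a b) (E v a b) (?P c d) (?Q c d) (E v c d)) =
      real_of_int (dot (uV1 K (A v) (?P a b) (?Q a b) (E v a b)) (uV1 K (A v) (?P c d) (?Q c d) (E v c d)))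
      + real_of_int (udeg K (A v) (?P c d) (?Q c d) (E v c d)) * (if E v a b then 536 else - 464)
      + real_of_int (uloc K (A v) (?P c d) (?Q c d) (E v c d)) * (?x v (A v) a b - ?x v (\<not> A v) a b)
      + real_of_int (ux K (A v) (?P c d) (?Q c d) (E v c d)) * (?x v (A v) a b - (if A v then uxA K else uxB K))
      + real_of_int (ual K (?P c d) (?Q c d)) * (?x v (A v) a b - 403)" for v a b c d
    by (simp add: utb_aux_def)
  have "avgs [0, 1, 2, 3, 4] (\<lambda>\<phi>. real_of_int
    (utb_aux K (A (\<phi> z)) (A (\<phi> i) \<and> A (\<phi> j)) (A (\<phi> i) \<or> A (\<phi> j)) (E (\<phi> z) (\<phi> i) (\<phi> j))
       (A (\<phi> k) \<and> A (\<phi> l)) (A (\<phi> k) \<or> A (\<phi> l)) (E (\<phi> z) (\<phi> k) (\<phi> l)))) \<phi> =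
    avg (\<lambda>v. avg (\<lambda>a. avg (\<lambda>b. avg (\<lambda>c. avg (\<lambda>d. real_of_int
      (utb_aux K (A v) (?P a b) (?Q a b) (E v a b) (?P c d) (?Q c d) (E v c d)))))))"
    by (rule avgs5[OF ix, where g = "\<lambda>v a b c d. real_of_int
      (utb_aux K (A v) (?P a b) (?Q a b) (E v a b) (?P c d) (?Q c d) (E v c d))"])
  also have "\<dots> = avg (\<lambda>v.
      avg (\<lambda>a. avg (\<lambda>b. avg (\<lambda>c. avg (\<lambda>d. real_of_int (dot (uV1 K (A v) (?P a b) (?Q a b) (E v a b)) (uV1 K (A v) (?P c d) (?Q c d) (E v c d)))))))
      + avg (\<lambda>c. avg (\<lambda>d. real_of_int (udeg K (A v) (?P c d) (?Q c d) (E v c d)))) * avg (\<lambda>a. avg (\<lambda>b. if E v a b then 536 else - 464))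
      + avg (\<lambda>c. avg (\<lambda>d. real_of_int (uloc K (A v) (?P c d) (?Q c d) (E v c d)))) * (xdens (A v) v - xdens (\<not> A v) v)
      + avg (\<lambda>c. avg (\<lambda>d. real_of_int (ux K (A v) (?P c d) (?Q c d) (E v c d)))) * (xdens (A v) v - (if A v then uxA K else uxB K)))
      + avg (\<lambda>v. ?al * (xdens (A v) v - 403))"
    unfolding eq avg_add by (simp only: avg2_mult_avg2 avg_cmult avg_cmult_right avg_diff avg_const xd avg_add)
  also have "\<dots> \<ge> 0"
  \<comment> \<open>Only the \<open>ual\<close> part needs the average over v to have a definite
    sign; the other parts are nonnegative for every single v.\<close>
  proof (intro add_nonneg_nonneg)
    show "0 \<le> avg (\<lambda>v. ?al * (xdens (A v) v - 403))"
      unfolding avg_cmult avg_diff avg_const using nn(4) al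
      by (intro mult_nonneg_nonneg avg_nonneg) auto
  qed (intro avg_nonneg add_nonneg_nonneg mult_nonneg_nonneg h avg2_dot_nonneg nn deg; use loc x in force)
  finally show ?thesis .
qed

end

context coloured
begin

text \<open>The pointwise bound on \<open>uS\<close> is averaged over five independent vertices: the
  certified terms have nonnegative means, and all objective terms have the same mean.\<close>

theorem unrooted_inequality:
  assumes nn: "\<And>c p q e. 0 \<le> udeg K c p q e" "\<And>c p q e. 0 \<le> uloc K c p q e"
      "\<And>c p q e. 0 \<le> ux K c p q e" "\<And>p q. 0 \<le> ual K p q"
    and sym: "\<And>a b c e. uobj K a b c e = uobj K b a c e" "\<And>a b c e. uobj K a b c e = uobj K a c b e"
    and chk: "\<And>c0 c1 c2 c3 c4 e012 e013 e023 e123 e014 e024 e124 e034 e134 e234. ucheck K c0 c1 c2 c3 c4 e012 e013 e023 e123 e014 e024 e124 e034 e134 e234"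
    and deg: "\<And>u. u \<in> V \<Longrightarrow> 0 \<le> avg (\<lambda>x. avg (\<lambda>y. if E u x y then 536 else - 464))"
    and loc: "\<And>u. u \<in> V \<Longrightarrow> xdens (\<not> A u) u \<le> xdens (A u) u"
    and x: "\<And>u. u \<in> V \<Longrightarrow> (if A u then uxA K else uxB K) \<le> xdens (A u) u"
    and al: "403 \<le> avg (\<lambda>u. xdens (A u) u)"
  shows "0 \<le> avg (\<lambda>x. avg (\<lambda>y. avg (\<lambda>z. real_of_int (uobj K (A x) (A y) (A z) (E x y z)))))"
    (is "0 \<le> ?obj")
proof -
  let ?\<phi> = "\<lambda>_::nat. undefined :: 'v"
  define T3 :: "nat \<times> nat \<times> nat \<times> nat \<times> nat \<Rightarrow> (nat \<Rightarrow> 'v) \<Rightarrow> int" where "T3 = (\<lambda>(i, j, k, l, m) \<phi>. ut3 K (A (\<phi> i)) (A (\<phi> j)) (A (\<phi> k)) (E (\<phi> i) (\<phi> j) (\<phi> k))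
       (A (\<phi> l)) (E (\<phi> i) (\<phi> j) (\<phi> l)) (E (\<phi> i) (\<phi> k) (\<phi> l)) (E (\<phi> j) (\<phi> k) (\<phi> l))
       (A (\<phi> m)) (E (\<phi> i) (\<phi> j) (\<phi> m)) (E (\<phi> i) (\<phi> k) (\<phi> m)) (E (\<phi> j) (\<phi> k) (\<phi> m)))"
  define TB :: "nat \<times> nat \<times> nat \<times> nat \<times> nat \<Rightarrow> (nat \<Rightarrow> 'v) \<Rightarrow> int" where "TB = (\<lambda>(z, i, j, k, l) \<phi>.
    utb_aux K (A (\<phi> z)) (A (\<phi> i) \<and> A (\<phi> j)) (A (\<phi> i) \<or> A (\<phi> j)) (E (\<phi> z) (\<phi> i) (\<phi> j))
       (A (\<phi> k) \<and> A (\<phi> l)) (A (\<phi> k) \<or> A (\<phi> l)) (E (\<phi> z) (\<phi> k) (\<phi> l)))"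
  define TD :: "nat \<times> nat \<times> nat \<times> nat \<times> nat \<Rightarrow> (nat \<Rightarrow> 'v) \<Rightarrow> int" where "TD = (\<lambda>(i, j, k, l, m) \<phi>. uobj K (A (\<phi> i)) (A (\<phi> j)) (A (\<phi> k)) (E (\<phi> i) (\<phi> j) (\<phi> k)))"
  define L3 :: "(nat \<times> nat \<times> nat \<times> nat \<times> nat) list" where "L3 =
    [(0, 1, 2, 3, 4), (0, 1, 3, 2, 4), (0, 1, 4, 2, 3), (0, 2, 1, 3, 4), (0, 2, 3, 1, 4), (0, 2, 4, 1, 3), 
     (0, 3, 1, 2, 4), (0, 3, 2, 1, 4), (0, 3, 4, 1, 2), (0, 4, 1, 2, 3), (0, 4, 2, 1, 3), (0, 4, 3, 1, 2), 
     (1, 0, 2, 3, 4), (1, 0, 3, 2, 4), (1, 0, 4, 2, 3), (1, 2, 0, 3, 4), (1, 2, 3, 0, 4), (1, 2, 4, 0, 3), 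
     (1, 3, 0, 2, 4), (1, 3, 2, 0, 4), (1, 3, 4, 0, 2), (1, 4, 0, 2, 3), (1, 4, 2, 0, 3), (1, 4, 3, 0, 2), 
     (2, 0, 1, 3, 4), (2, 0, 3, 1, 4), (2, 0, 4, 1, 3), (2, 1, 0, 3, 4), (2, 1, 3, 0, 4), (2, 1, 4, 0, 3), 
     (2, 3, 0, 1, 4), (2, 3, 1, 0, 4), (2, 3, 4, 0, 1), (2, 4, 0, 1, 3), (2, 4, 1, 0, 3), (2, 4, 3, 0, 1), 
     (3, 0, 1, 2, 4), (3, 0, 2, 1, 4), (3, 0, 4, 1, 2), (3, 1, 0, 2, 4), (3, 1, 2, 0, 4), (3, 1, 4, 0, 2), 
     (3, 2, 0, 1, 4), (3, 2, 1, 0, 4), (3, 2, 4, 0, 1), (3, 4, 0, 1, 2), (3, 4, 1, 0, 2), (3, 4, 2, 0, 1), 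
     (4, 0, 1, 2, 3), (4, 0, 2, 1, 3), (4, 0, 3, 1, 2), (4, 1, 0, 2, 3), (4, 1, 2, 0, 3), (4, 1, 3, 0, 2), 
     (4, 2, 0, 1, 3), (4, 2, 1, 0, 3), (4, 2, 3, 0, 1), (4, 3, 0, 1, 2), (4, 3, 1, 0, 2), (4, 3, 2, 0, 1)]"
  define LB :: "(nat \<times> nat \<times> nat \<times> nat \<times> nat) list" where "LB =
    [(0, 1, 2, 3, 4), (0, 3, 4, 1, 2), (0, 1, 3, 2, 4), (0, 2, 4, 1, 3), (0, 1, 4, 2, 3), (0, 2, 3, 1, 4), 
     (1, 0, 2, 3, 4), (1, 3, 4, 0, 2), (1, 0, 3, 2, 4), (1, 2, 4, 0, 3), (1, 0, 4, 2, 3), (1, 2, 3, 0, 4), 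
     (2, 0, 1, 3, 4), (2, 3, 4, 0, 1), (2, 0, 3, 1, 4), (2, 1, 4, 0, 3), (2, 0, 4, 1, 3), (2, 1, 3, 0, 4), 
     (3, 0, 1, 2, 4), (3, 2, 4, 0, 1), (3, 0, 2, 1, 4), (3, 1, 4, 0, 2), (3, 0, 4, 1, 2), (3, 1, 2, 0, 4), 
     (4, 0, 1, 2, 3), (4, 2, 3, 0, 1), (4, 0, 2, 1, 3), (4, 1, 3, 0, 2), (4, 0, 3, 1, 2), (4, 1, 2, 0, 3)]"
  define LD :: "(nat \<times> nat \<times> nat \<times> nat \<times> nat) list" where "LD =
    [(0, 1, 2, 3, 4), (0, 1, 3, 2, 4), (0, 1, 4, 2, 3), (0, 2, 3, 1, 4), (0, 2, 4, 1, 3), (0, 3, 4, 1, 2), 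
     (1, 2, 3, 0, 4), (1, 2, 4, 0, 3), (1, 3, 4, 0, 2), (2, 3, 4, 0, 1)]"
  have srt: "\<forall>(i, j, k, l, m)\<in>set L3. sort [i, j, k, l, m] = [0, 1, 2, 3, 4]"
    "\<forall>(i, j, k, l, m)\<in>set LB. sort [i, j, k, l, m] = [0, 1, 2, 3, 4]"
    "\<forall>(i, j, k, l, m)\<in>set LD. sort [i, j, k, l, m] = [0, 1, 2, 3, 4]"
    unfolding L3_def LB_def LD_def by simp_all
  \<comment> \<open>The terms of \<open>uS\<close> sorted by index tuples: 60 with factor 2, 30 with
    factor 4, and 10 objective triples with factor 12. Each group amounts to 120 orderings.\<close>
  have eq: "usum K \<phi> + 12 * (\<Sum>x\<leftarrow>LD. TD x \<phi>) = 2 * (\<Sum>x\<leftarrow>L3. T3 x \<phi>) + 4 * (\<Sum>x\<leftarrow>LB. TB x \<phi>)" for \<phi>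
    unfolding usum_def uS_def utb_def L3_def LB_def LD_def T3_def TB_def TD_def
    by (simp add: E_ac add.assoc)
  have "0 \<le> avgs [0, 1, 2, 3, 4] (\<lambda>\<phi>. real_of_int (\<Sum>x\<leftarrow>L3. T3 x \<phi>)) ?\<phi>"
  proof (rule avgs_sum_list_nonneg)
    fix x assume x: "x \<in> set L3"
    obtain i j k l m where [simp]: "x = (i, j, k, l, m)" by (cases x)
    have "sort [i, j, k, l, m] = [0, 1, 2, 3, 4]" using bspec[OF srt(1) x] by simp
    from avg_ut3_nonneg[OF this, where K = K and \<phi> = ?\<phi>]
    show "0 \<le> avgs [0, 1, 2, 3, 4] (\<lambda>\<phi>. real_of_int (T3 x \<phi>)) ?\<phi>"
      by (simp add: T3_def del: avgs.simps)
  qed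
  moreover have "0 \<le> avgs [0, 1, 2, 3, 4] (\<lambda>\<phi>. real_of_int (\<Sum>x\<leftarrow>LB. TB x \<phi>)) ?\<phi>"
  proof (rule avgs_sum_list_nonneg)
    fix y assume y: "y \<in> set LB"
    obtain i j k l m where [simp]: "y = (i, j, k, l, m)" by (cases y)
    have "sort [i, j, k, l, m] = [0, 1, 2, 3, 4]" using bspec[OF srt(2) y] by simp
    from avg_utb_aux_nonneg[OF this, where K = K and \<phi> = ?\<phi>, OF nn deg loc x al]
    show "0 \<le> avgs [0, 1, 2, 3, 4] (\<lambda>\<phi>. real_of_int (TB y \<phi>)) ?\<phi>"
      by (simp add: TB_def del: avgs.simps)
  qed
  ultimately have "0 \<le> avgs [0, 1, 2, 3, 4] (\<lambda>\<phi>. real_of_int (usum K \<phi> + 12 * (\<Sum>x\<leftarrow>LD. TD x \<phi>))) ?\<phi>"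
    unfolding eq of_int_add of_int_mult of_int_numeral avgs_add avgs_cmult by simp
  also have "\<dots> \<le> avgs [0, 1, 2, 3, 4] (\<lambda>\<phi>. 12 * (\<Sum>x\<leftarrow>LD. real_of_int (TD x \<phi>))) ?\<phi>"
  proof (rule avgs_mono)
    fix \<psi>
    have "usum K \<psi> \<le> 0" by (rule usum_nonpos[OF sym chk])
    moreover have "real_of_int (\<Sum>x\<leftarrow>LD. TD x \<psi>) = (\<Sum>x\<leftarrow>LD. real_of_int (TD x \<psi>))"
      by (induction LD) simp_all
    ultimately show "real_of_int (usum K \<psi> + 12 * (\<Sum>x\<leftarrow>LD. TD x \<psi>)) \<le> 12 * (\<Sum>x\<leftarrow>LD. real_of_int (TD x \<psi>))"
      by simp
  qed
  also have "\<dots> = 12 * (\<Sum>x\<leftarrow>LD. ?obj)"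
  proof -
    have "avgs [0, 1, 2, 3, 4] (\<lambda>\<phi>. real_of_int (TD x \<phi>)) ?\<phi> = ?obj" if "x \<in> set LD" for x
    proof -
      obtain i j k l m where [simp]: "x = (i, j, k, l, m)" by (cases x)
      have "sort [i, j, k, l, m] = [0, 1, 2, 3, 4]" using bspec[OF srt(3) that] by simp
      from avgs5[OF this, where g = "\<lambda>a b c d e. real_of_int (uobj K (A a) (A b) (A c) (E a b c))"]
      show ?thesis by (simp add: TD_def del: avgs.simps)
    qed
    then show ?thesis unfolding avgs_cmult avgs_sum_list by (simp cong: map_cong)
  qed
  also have "\<dots> = 120 * ?obj" by (simp add: LD_def)
  finally show ?thesis by simp
qed

end

section \<open>Six vertices: vectors of the quadratic forms\<close>

definition N6_V0_ttt :: "bool \<Rightarrow> bool \<Rightarrow> bool \<Rightarrow> int list"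
    where "N6_V0_ttt f12 f13 f23 = (if f12 then (if f13 then (if f23 then [0, - 8, 0, 0, 0, 0,
    - 111] else [14, 200, 21, 51, - 13, 29, - 101]) else (if f23 then [33, 200, 31, - 28, - 52,
    - 49, - 101] else [59, - 37, 37, 24, - 50, - 48, 26])) else (if f13 then (if f23 then [39,
    200, - 34, 6, 65, 44, - 101] else [62, - 37, - 1, 44, 40, 38, 26]) else (if f23 then [74, -
    37, 5, - 2, 10, - 34, 26] else [50, 20, 10, 17, 0, - 1, 5])))"

definition N6_V0_ttf :: "bool \<Rightarrow> bool \<Rightarrow> bool \<Rightarrow> int list"
    where "N6_V0_ttf f12 f13 f23 = (if f12 then (if f13 then (if f23 then [- 39, 200, 34, - 6,
    65, - 44, - 101] else [- 36, - 37, 41, 54, 40, - 55, 26]) else (if f23 then [- 10, - 37,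
    54, - 52, 10, 64, 26] else [19, - 117, 200, 40, 0, 70, - 200])) else (if f13 then (if f23
    then [0, - 186, 0, 0, 34, 0, - 46] else [13, - 32, 21, 51, - 18, 0, 32]) else (if f23 then
    [33, - 32, 30, - 28, - 18, 0, 32] else [46, - 45, 105, 32, 68, 68, - 49])))"

definition N6_V0_tft :: "bool \<Rightarrow> bool \<Rightarrow> bool \<Rightarrow> int list"
    where "N6_V0_tft f12 f13 f23 = (if f12 then (if f13 then (if f23 then [- 33, 200, - 31, 28,
    - 52, 49, - 101] else [- 33, - 37, 3, 73, - 50, 30, 26]) else (if f23 then [0, - 186, 0, 0,
    - 27, 0, - 46] else [13, - 32, 21, 51, 14, 0, 32])) else (if f13 then (if f23 then [0, -
    37, - 69, 13, 10, 6, 26] else [44, - 117, - 103, 200, 0, - 132, - 200]) else (if f23 then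
    [38, - 32, - 33, 6, 15, 0, 32] else [59, - 45, - 42, 110, - 54, - 66, - 49])))"

definition N6_V0_tff :: "bool \<Rightarrow> bool \<Rightarrow> bool \<Rightarrow> int list"
    where "N6_V0_tff f12 f13 f23 = (if f12 then (if f13 then (if f23 then [- 63, - 37, 11, 40,
    10, - 37, 26] else [- 34, 20, 14, 43, 0, - 1, 5]) else (if f23 then [- 38, - 32, 33, - 6,
    15, 0, 32] else [- 16, - 45, 107, 52, - 54, 77, - 49])) else (if f13 then (if f23 then [-
    33, - 32, - 30, 28, - 18, 0, 32] else [- 4, - 45, - 39, 129, 68, - 57, - 49]) else (if f23
    then [0, - 16, 0, 0, 40, 0, 185] else [24, 9, 37, 92, 29, 116, 130])))"

definition N6_V0_ftt :: "bool \<Rightarrow> bool \<Rightarrow> bool \<Rightarrow> int list"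
    where "N6_V0_ftt f12 f13 f23 = (if f12 then (if f13 then (if f23 then [- 14, 200, - 21, -
    51, - 13, - 29, - 101] else [0, - 186, 0, 0, - 7, 0, - 46]) else (if f23 then [4, - 37, 22,
    - 78, - 50, 78, 26] else [33, - 32, 30, - 28, 2, 0, 32])) else (if f13 then (if f23 then
    [12, - 37, - 64, - 33, 40, - 65, 26] else [38, - 32, - 33, 6, 5, 0, 32]) else (if f23 then
    [136, - 117, - 56, - 172, 0, 36, - 200] else [103, - 45, - 19, - 71, - 13, 45, - 49])))"

definition N6_V0_ftf :: "bool \<Rightarrow> bool \<Rightarrow> bool \<Rightarrow> int list"
    where "N6_V0_ftf f12 f13 f23 = (if f12 then (if f13 then (if f23 then [- 37, - 37, 24, -
    65, 40, 83, 26] else [- 38, - 32, 33, - 6, 5, 0, 32]) else (if f23 then [- 11, 20, 26, -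
    50, 0, 4, 5] else [1, - 45, 116, - 17, - 13, - 63, - 49])) else (if f13 then (if f23 then
    [- 13, - 32, - 21, - 51, - 18, 0, 32] else [0, - 16, 0, 0, 160, 0, 185]) else (if f23 then
    [58, - 45, - 8, - 120, 68, - 86, - 49] else [60, 9, 55, - 50, 117, - 200, 130])))"

definition N6_V0_fft :: "bool \<Rightarrow> bool \<Rightarrow> bool \<Rightarrow> int list"
    where "N6_V0_fft f12 f13 f23 = (if f12 then (if f13 then (if f23 then [- 30, - 37, - 62, -
    20, - 50, - 61, 26] else [- 33, - 32, - 30, 28, 2, 0, 32]) else (if f23 then [- 13, - 32, -
    21, - 51, 14, 0, 32] else [0, - 16, 0, 0, - 200, 0, 185])) else (if f13 then (if f23 then
    [- 5, 20, - 50, - 10, 0, - 2, 5] else [18, - 45, - 87, 90, - 13, - 29, - 49]) else (if f23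
    then [63, - 45, - 64, - 91, - 54, 82, - 49] else [69, 9, - 61, 11, - 145, 180, 130])))"

definition N6_V0_fff :: "bool \<Rightarrow> bool \<Rightarrow> bool \<Rightarrow> int list"
    where "N6_V0_fff f12 f13 f23 = (if f12 then (if f13 then (if f23 then [- 200, - 117, - 42,
    - 69, 0, 26, - 200] else [- 122, - 45, - 10, - 2, - 13, 47, - 49]) else (if f23 then [-
    105, - 45, - 1, - 71, - 54, - 93, - 49] else [- 69, 9, 61, - 11, - 145, - 180, 130])) else
    (if f13 then (if f23 then [- 101, - 45, - 57, - 41, 68, 75, - 49] else [- 60, 9, - 55, 50,
    117, 200, 130]) else (if f23 then [- 24, 9, - 37, - 92, 29, - 116, 130] else [0, 5, 0, 0,
    0, 0, 64])))"

text \<open>Vectors for the type of four vertices 0, 1, 2, 3 without edges; \<open>fij\<close> tells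
  whether the fifth vertex forms an edge with i and j. \<open>N6_V1\<close>, \<open>N6_V2\<close>
  and \<open>N6_V3\<close> belong to the types with one, two and three edges; a type with four edges
  cannot occur.\<close>

definition N6_V0 :: "bool \<Rightarrow> bool \<Rightarrow> bool \<Rightarrow> bool
    \<Rightarrow> bool \<Rightarrow> bool \<Rightarrow> int list" where "N6_V0 f01 f02 f03 f12
    f13 f23 = (if f01 then (if f02 then (if f03 then N6_V0_ttt f12 f13 f23 else N6_V0_ttf f12
    f13 f23) else (if f03 then N6_V0_tft f12 f13 f23 else N6_V0_tff f12 f13 f23)) else (if f02
    then (if f03 then N6_V0_ftt f12 f13 f23 else N6_V0_ftf f12 f13 f23) else (if f03 then
    N6_V0_fft f12 f13 f23 else N6_V0_fff f12 f13 f23)))"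

definition N6_V1_ttt :: "bool \<Rightarrow> bool \<Rightarrow> bool \<Rightarrow> int list"
    where "N6_V1_ttt f12 f13 f23 = (if f12 then [0, 0, 0, 0, 0, 0] else (if f13 then (if f23
    then [- 200, 110, 41, - 5, - 135, - 27] else [- 108, 21, 29, - 93, 187, - 17]) else (if f23
    then [- 108, 21, - 31, 161, 187, - 17] else [- 19, - 165, 42, - 12, 85, 18])))"

definition N6_V1_ttf :: "bool \<Rightarrow> bool \<Rightarrow> bool \<Rightarrow> int list"
    where "N6_V1_ttf f12 f13 f23 = (if f12 then [0, 0, 0, 0, 0, 0] else (if f13 then (if f23
    then [28, - 64, 84, 60, - 200, 71] else [29, - 134, 41, 40, 15, 15]) else (if f23 then [29,
    - 134, 14, - 45, 15, 15] else [- 18, - 180, 125, - 9, - 8, - 5])))"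

definition N6_V1_tft :: "bool \<Rightarrow> bool \<Rightarrow> bool \<Rightarrow> int list"
    where "N6_V1_tft f12 f13 f23 = (if f12 then (if f13 then (if f23 then [- 200, 110, - 4, 15,
    - 135, - 27] else [- 108, 21, 72, - 143, 187, - 17]) else (if f23 then [28, - 64, - 8, -
    199, - 200, 71] else [29, - 134, 29, 19, 15, 15])) else (if f13 then (if f23 then [18, 172,
    112, 38, - 13, 29] else [53, 46, 110, 78, 63, 186]) else (if f23 then [21, 35, - 68, - 16,
    - 14, - 25] else [30, - 18, 40, 10, - 9, - 98])))"

definition N6_V1_tff :: "bool \<Rightarrow> bool \<Rightarrow> bool \<Rightarrow> int list"
    where "N6_V1_tff f12 f13 f23 = (if f12 then (if f13 then (if f23 then [- 108, 21, - 71, -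
    83, 187, - 17] else [- 19, - 165, - 4, 40, 85, 18]) else (if f23 then [29, - 134, - 35, -
    1, 15, 15] else [- 18, - 180, - 12, 29, - 8, - 5])) else (if f13 then (if f23 then [21, 35,
    - 25, 18, - 14, - 25] else [30, - 18, 8, 40, - 9, - 98]) else (if f23 then [133, 117, 83, -
    118, 64, - 42] else [83, 200, 180, 31, 45, - 3])))"

definition N6_V1_ftt :: "bool \<Rightarrow> bool \<Rightarrow> bool \<Rightarrow> int list"
    where "N6_V1_ftt f12 f13 f23 = (if f12 then (if f13 then (if f23 then [- 200, 110, - 37, -
    11, - 135, - 27] else [28, - 64, - 76, 139, - 200, 71]) else (if f23 then [- 108, 21, 42,
    176, 187, - 17] else [29, - 134, - 6, - 39, 15, 15])) else (if f13 then (if f23 then [18,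
    172, 12, - 55, - 13, 29] else [21, 35, - 42, 4, - 14, - 25]) else (if f23 then [53, 46, 12,
    - 111, 63, 186] else [30, - 18, 30, - 31, - 9, - 98])))"

definition N6_V1_ftf :: "bool \<Rightarrow> bool \<Rightarrow> bool \<Rightarrow> int list"
    where "N6_V1_ftf f12 f13 f23 = (if f12 then (if f13 then (if f23 then [- 108, 21, - 40, -
    18, 187, - 17] else [29, - 134, - 43, 26, 15, 15]) else (if f23 then [- 19, - 165, - 37, -
    28, 85, 18] else [- 18, - 180, - 113, - 20, - 8, - 5])) else (if f13 then (if f23 then [21,
    35, 32, - 6, - 14, - 25] else [133, 117, 9, 168, 64, - 42]) else (if f23 then [30, - 18, -
    25, - 40, - 9, - 98] else [83, 200, 20, - 44, 45, - 3])))"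

definition N6_V1_fft :: "bool \<Rightarrow> bool \<Rightarrow> bool \<Rightarrow> int list"
    where "N6_V1_fft f12 f13 f23 = (if f12 then (if f13 then (if f23 then [18, 172, - 125, 16,
    - 13, 29] else [21, 35, 36, 22, - 14, - 25]) else (if f23 then [21, 35, 67, - 21, - 14, -
    25] else [133, 117, - 92, - 50, 64, - 42])) else (if f13 then (if f23 then [- 13, 24, 0, 0,
    - 8, 2] else [58, - 81, 47, 140, 67, 70]) else (if f23 then [58, - 81, 5, - 200, 67, 70]
    else [67, - 51, - 6, - 52, 5, - 200])))"

definition N6_V1_fff :: "bool \<Rightarrow> bool \<Rightarrow> bool \<Rightarrow> int list"
    where "N6_V1_fff f12 f13 f23 = (if f12 then (if f13 then (if f23 then [53, 46, - 122, 33,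
    63, 186] else [30, - 18, - 15, 31, - 9, - 98]) else (if f23 then [30, - 18, - 38, - 9, - 9,
    - 98] else [83, 200, - 200, 13, 45, - 3])) else (if f13 then (if f23 then [58, - 81, - 52,
    60, 67, 70] else [67, - 51, 1, 174, 5, - 200]) else (if f23 then [67, - 51, 6, - 121, 5, -
    200] else [60, 0, 0, 0, 39, 6])))"

definition N6_V1 :: "bool \<Rightarrow> bool \<Rightarrow> bool \<Rightarrow> bool
    \<Rightarrow> bool \<Rightarrow> bool \<Rightarrow> int list" where "N6_V1 f01 f02 f03 f12
    f13 f23 = (if f01 then (if f02 then (if f03 then N6_V1_ttt f12 f13 f23 else N6_V1_ttf f12
    f13 f23) else (if f03 then N6_V1_tft f12 f13 f23 else N6_V1_tff f12 f13 f23)) else (if f02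
    then (if f03 then N6_V1_ftt f12 f13 f23 else N6_V1_ftf f12 f13 f23) else (if f03 then
    N6_V1_fft f12 f13 f23 else N6_V1_fff f12 f13 f23)))"

definition N6_V2_ttt :: "bool \<Rightarrow> bool \<Rightarrow> bool \<Rightarrow> int list"
    where "N6_V2_ttt f12 f13 f23 = (if f12 then [0, 0, 0, 0] else (if f13 then [0, 0, 0, 0]
    else (if f23 then [- 200, 115, 0, - 102] else [- 23, 104, 0, - 181])))"

definition N6_V2_ttf :: "bool \<Rightarrow> bool \<Rightarrow> bool \<Rightarrow> int list"
    where "N6_V2_ttf f12 f13 f23 = (if f12 then [0, 0, 0, 0] else (if f13 then (if f23 then [0,
    0, 0, 0] else [28, 0, - 13, - 184]) else (if f23 then [22, 78, - 53, - 44] else [93, 7, 48,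
    - 37])))"

definition N6_V2_tft :: "bool \<Rightarrow> bool \<Rightarrow> bool \<Rightarrow> int list"
    where "N6_V2_tft f12 f13 f23 = (if f12 then (if f13 then [0, 0, 0, 0] else (if f23 then [0,
    0, 0, 0] else [28, 0, 13, - 184])) else (if f13 then [0, 0, 0, 0] else (if f23 then [22,
    78, 53, - 44] else [93, 7, - 48, - 37])))"

definition N6_V2_tff :: "bool \<Rightarrow> bool \<Rightarrow> bool \<Rightarrow> int list"
    where "N6_V2_tff f12 f13 f23 = (if f12 then (if f13 then (if f23 then [- 200, - 115, 0, -
    102] else [- 23, - 104, 0, - 181]) else (if f23 then [22, - 78, 53, - 44] else [93, - 7, -
    48, - 37])) else (if f13 then (if f23 then [22, - 78, - 53, - 44] else [93, - 7, 48, - 37])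
    else (if f23 then [159, 0, 0, - 55] else [180, 0, 0, 4])))"

definition N6_V2_ftt :: "bool \<Rightarrow> bool \<Rightarrow> bool \<Rightarrow> int list"
    where "N6_V2_ftt f12 f13 f23 = (if f12 then (if f13 then (if f23 then [0, 0, 0, 0] else [-
    99, 0, 0, 14]) else (if f23 then [0, 0, 0, 0] else [- 22, 42, 45, - 7])) else (if f13 then
    (if f23 then [0, 0, 0, 0] else [- 22, 42, - 45, - 7]) else (if f23 then [- 33, 200, 0, 200]
    else [78, 138, 0, 157])))"

definition N6_V2_ftf :: "bool \<Rightarrow> bool \<Rightarrow> bool \<Rightarrow> int list"
    where "N6_V2_ftf f12 f13 f23 = (if f12 then (if f13 then (if f23 then [0, 0, 0, 0] else [-
    22, - 42, - 45, - 7]) else (if f23 then [- 63, 0, 0, 69] else [10, 0, 0, - 76])) else (if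
    f13 then (if f23 then [- 169, 0, 200, 81] else [49, 0, - 30, 19]) else (if f23 then [58,
    35, 5, 60] else [105, 4, 4, - 5])))"

definition N6_V2_fft :: "bool \<Rightarrow> bool \<Rightarrow> bool \<Rightarrow> int list"
    where "N6_V2_fft f12 f13 f23 = (if f12 then (if f13 then (if f23 then [0, 0, 0, 0] else [-
    22, - 42, 45, - 7]) else (if f23 then [- 169, 0, - 200, 81] else [49, 0, 30, 19])) else (if
    f13 then (if f23 then [- 63, 0, 0, 69] else [10, 0, 0, - 76]) else (if f23 then [58, 35, -
    5, 60] else [105, 4, - 4, - 5])))"

definition N6_V2_fff :: "bool \<Rightarrow> bool \<Rightarrow> bool \<Rightarrow> int list"
    where "N6_V2_fff f12 f13 f23 = (if f12 then (if f13 then (if f23 then [- 33, - 200, 0, 200]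
    else [78, - 138, 0, 157]) else (if f23 then [58, - 35, - 5, 60] else [105, - 4, - 4, - 5]))
    else (if f13 then (if f23 then [58, - 35, 5, 60] else [105, - 4, 4, - 5]) else (if f23 then
    [- 2, 0, 0, - 27] else [25, 0, 0, 5])))"

definition N6_V2 :: "bool \<Rightarrow> bool \<Rightarrow> bool \<Rightarrow> bool
    \<Rightarrow> bool \<Rightarrow> bool \<Rightarrow> int list" where "N6_V2 f01 f02 f03 f12
    f13 f23 = (if f01 then (if f02 then (if f03 then N6_V2_ttt f12 f13 f23 else N6_V2_ttf f12
    f13 f23) else (if f03 then N6_V2_tft f12 f13 f23 else N6_V2_tff f12 f13 f23)) else (if f02
    then (if f03 then N6_V2_ftt f12 f13 f23 else N6_V2_ftf f12 f13 f23) else (if f03 then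
    N6_V2_fft f12 f13 f23 else N6_V2_fff f12 f13 f23)))"

definition N6_V3_ttt :: "bool \<Rightarrow> bool \<Rightarrow> bool \<Rightarrow> int list"
    where "N6_V3_ttt f12 f13 f23 = (if f12 then [0, 0, 0] else (if f13 then [0, 0, 0] else (if
    f23 then [0, 0, 0] else [- 16, 0, 0])))"

definition N6_V3_ttf :: "bool \<Rightarrow> bool \<Rightarrow> bool \<Rightarrow> int list"
    where "N6_V3_ttf f12 f13 f23 = (if f12 then [0, 0, 0] else (if f13 then (if f23 then [0, 0,
    0] else [- 25, - 33, - 198]) else (if f23 then [- 25, 146, 200] else [200, - 131, 24])))"

definition N6_V3_tft :: "bool \<Rightarrow> bool \<Rightarrow> bool \<Rightarrow> int list"
    where "N6_V3_tft f12 f13 f23 = (if f12 then (if f13 then [0, 0, 0] else (if f23 then [0, 0,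
    0] else [- 25, - 80, - 158])) else (if f13 then [0, 0, 0] else (if f23 then [- 25, 140,
    161] else [200, - 69, 48])))"

definition N6_V3_tff :: "bool \<Rightarrow> bool \<Rightarrow> bool \<Rightarrow> int list"
    where "N6_V3_tff f12 f13 f23 = (if f12 then (if f13 then (if f23 then [0, 0, 0] else [-
    164, - 173, 36]) else (if f23 then [0, 0, 0] else [118, - 146, 110])) else (if f13 then (if
    f23 then [0, 0, 0] else [118, - 102, 144]) else (if f23 then [12, 120, 184] else [23, 32,
    77])))"

definition N6_V3_ftt :: "bool \<Rightarrow> bool \<Rightarrow> bool \<Rightarrow> int list"
    where "N6_V3_ftt f12 f13 f23 = (if f12 then (if f13 then [0, 0, 0] else (if f23 then [0, 0,
    0] else [- 25, - 107, 37])) else (if f13 then (if f23 then [0, 0, 0] else [- 25, - 67, -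
    42]) else (if f23 then [0, 0, 0] else [200, 200, - 72])))"

definition N6_V3_ftf :: "bool \<Rightarrow> bool \<Rightarrow> bool \<Rightarrow> int list"
    where "N6_V3_ftf f12 f13 f23 = (if f12 then (if f13 then [0, 0, 0] else (if f23 then [-
    164, 60, - 24] else [118, - 77, - 17])) else (if f13 then (if f23 then [0, 0, 0] else [12,
    - 42, - 123]) else (if f23 then [118, 163, - 152] else [23, - 11, - 51])))"

definition N6_V3_fft :: "bool \<Rightarrow> bool \<Rightarrow> bool \<Rightarrow> int list"
    where "N6_V3_fft f12 f13 f23 = (if f12 then (if f13 then [0, 0, 0] else (if f23 then [0, 0,
    0] else [12, - 78, - 62])) else (if f13 then (if f23 then [- 164, 113, - 12] else [118, -
    17, 42]) else (if f23 then [118, 179, - 127] else [23, - 21, - 26])))"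

definition N6_V3_fff :: "bool \<Rightarrow> bool \<Rightarrow> bool \<Rightarrow> int list"
    where "N6_V3_fff f12 f13 f23 = (if f12 then (if f13 then (if f23 then [27, 0, 0] else [38,
    - 54, - 181]) else (if f23 then [38, 19, 121] else [139, - 97, 19])) else (if f13 then (if
    f23 then [38, 35, 61] else [139, - 51, 38]) else (if f23 then [139, 148, - 57] else [16, 0,
    0])))"

definition N6_V3 :: "bool \<Rightarrow> bool \<Rightarrow> bool \<Rightarrow> bool
    \<Rightarrow> bool \<Rightarrow> bool \<Rightarrow> int list" where "N6_V3 f01 f02 f03 f12
    f13 f23 = (if f01 then (if f02 then (if f03 then N6_V3_ttt f12 f13 f23 else N6_V3_ttf f12
    f13 f23) else (if f03 then N6_V3_tft f12 f13 f23 else N6_V3_tff f12 f13 f23)) else (if f02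
    then (if f03 then N6_V3_ftt f12 f13 f23 else N6_V3_ftf f12 f13 f23) else (if f03 then
    N6_V3_fft f12 f13 f23 else N6_V3_fff f12 f13 f23)))"

lemmas N6_V_eval =
  N6_V0_ttt_def N6_V0_ttf_def N6_V0_tft_def N6_V0_tff_def N6_V0_ftt_def N6_V0_ftf_def 
  N6_V0_fft_def N6_V0_fff_def N6_V0_def N6_V1_ttt_def N6_V1_ttf_def N6_V1_tft_def 
  N6_V1_tff_def N6_V1_ftt_def N6_V1_ftf_def N6_V1_fft_def N6_V1_fff_def N6_V1_def 
  N6_V2_ttt_def N6_V2_ttf_def N6_V2_tft_def N6_V2_tff_def N6_V2_ftt_def N6_V2_ftf_def 
  N6_V2_fft_def N6_V2_fff_def N6_V2_def N6_V3_ttt_def N6_V3_ttf_def N6_V3_tft_def 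
  N6_V3_tff_def N6_V3_ftt_def N6_V3_ftf_def N6_V3_fft_def N6_V3_fff_def N6_V3_def

text \<open>Positive diagonal weights of the four forms, which allow the entries of the vectors to
  stay integers between -200 and 200.\<close>

definition N6_W0 :: "int list" where "N6_W0 = [4681, 1646, 14249, 7826, 2481, 175, 3417]"

definition N6_W1 :: "int list" where "N6_W1 = [22809, 2394, 20751, 4807, 1286, 669]"

definition N6_W2 :: "int list" where "N6_W2 = [17966, 8992, 19490, 4059]"

definition N6_W3 :: "int list" where "N6_W3 = [4156, 6618, 2121]"

definition N6_W where
  "N6_W t012 t013 t023 t123 =
    (if t123 then [] else if t012
     then if t013 then if t023 then N6_W3 else N6_W2
       else if t023 then [] else N6_W1
     else if t013 then [] else if t023 then [] else N6_W0)"

text \<open>Only one edge pattern for each type carries vectors; every other labelling gets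
  \<open>[]\<close> and contributes 0. The sum over all 24 orderings in \<open>N6_kernel\<close>
  brings each type into the chosen labelling.\<close>

definition N6_V where
  "N6_V t012 t013 t023 t123 f01 f02 f03 f12 f13 f23 =
    (if t123 then [] else if t012
     then if t013 then if t023 then N6_V3 f01 f02 f03 f12 f13 f23 else N6_V2 f01 f02 f03 f12 f13 f23
       else if t023 then [] else N6_V1 f01 f02 f03 f12 f13 f23
     else if t013 then [] else if t023 then [] else N6_V0 f01 f02 f03 f12 f13 f23)"

definition N6_kernel where
  "N6_kernel t012 t013 t023 t123 f01 f02 f03 f12 f13 f23 g01 g02 g03 g12 g13 g23 =
    wdot (N6_W t012 t013 t023 t123) (N6_V t012 t013 t023 t123 f01 f02 f03 f12 f13 f23) (N6_V t012 t013 t023 t123 g01 g02 g03 g12 g13 g23) +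
    wdot (N6_W t013 t012 t023 t123) (N6_V t013 t012 t023 t123 f01 f03 f02 f13 f12 f23) (N6_V t013 t012 t023 t123 g01 g03 g02 g13 g12 g23) +
    wdot (N6_W t012 t023 t013 t123) (N6_V t012 t023 t013 t123 f02 f01 f03 f12 f23 f13) (N6_V t012 t023 t013 t123 g02 g01 g03 g12 g23 g13) +
    wdot (N6_W t023 t012 t013 t123) (N6_V t023 t012 t013 t123 f02 f03 f01 f23 f12 f13) (N6_V t023 t012 t013 t123 g02 g03 g01 g23 g12 g13) +
    wdot (N6_W t013 t023 t012 t123) (N6_V t013 t023 t012 t123 f03 f01 f02 f13 f23 f12) (N6_V t013 t023 t012 t123 g03 g01 g02 g13 g23 g12) +
    wdot (N6_W t023 t013 t012 t123) (N6_V t023 t013 t012 t123 f03 f02 f01 f23 f13 f12) (N6_V t023 t013 t012 t123 g03 g02 g01 g23 g13 g12) +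
    wdot (N6_W t012 t013 t123 t023) (N6_V t012 t013 t123 t023 f01 f12 f13 f02 f03 f23) (N6_V t012 t013 t123 t023 g01 g12 g13 g02 g03 g23) +
    wdot (N6_W t013 t012 t123 t023) (N6_V t013 t012 t123 t023 f01 f13 f12 f03 f02 f23) (N6_V t013 t012 t123 t023 g01 g13 g12 g03 g02 g23) +
    wdot (N6_W t012 t123 t013 t023) (N6_V t012 t123 t013 t023 f12 f01 f13 f02 f23 f03) (N6_V t012 t123 t013 t023 g12 g01 g13 g02 g23 g03) +
    wdot (N6_W t123 t012 t013 t023) (N6_V t123 t012 t013 t023 f12 f13 f01 f23 f02 f03) (N6_V t123 t012 t013 t023 g12 g13 g01 g23 g02 g03) +
    wdot (N6_W t013 t123 t012 t023) (N6_V t013 t123 t012 t023 f13 f01 f12 f03 f23 f02) (N6_V t013 t123 t012 t023 g13 g01 g12 g03 g23 g02) +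
    wdot (N6_W t123 t013 t012 t023) (N6_V t123 t013 t012 t023 f13 f12 f01 f23 f03 f02) (N6_V t123 t013 t012 t023 g13 g12 g01 g23 g03 g02) +
    wdot (N6_W t012 t023 t123 t013) (N6_V t012 t023 t123 t013 f02 f12 f23 f01 f03 f13) (N6_V t012 t023 t123 t013 g02 g12 g23 g01 g03 g13) +
    wdot (N6_W t023 t012 t123 t013) (N6_V t023 t012 t123 t013 f02 f23 f12 f03 f01 f13) (N6_V t023 t012 t123 t013 g02 g23 g12 g03 g01 g13) +
    wdot (N6_W t012 t123 t023 t013) (N6_V t012 t123 t023 t013 f12 f02 f23 f01 f13 f03) (N6_V t012 t123 t023 t013 g12 g02 g23 g01 g13 g03) +
    wdot (N6_W t123 t012 t023 t013) (N6_V t123 t012 t023 t013 f12 f23 f02 f13 f01 f03) (N6_V t123 t012 t023 t013 g12 g23 g02 g13 g01 g03) +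
    wdot (N6_W t023 t123 t012 t013) (N6_V t023 t123 t012 t013 f23 f02 f12 f03 f13 f01) (N6_V t023 t123 t012 t013 g23 g02 g12 g03 g13 g01) +
    wdot (N6_W t123 t023 t012 t013) (N6_V t123 t023 t012 t013 f23 f12 f02 f13 f03 f01) (N6_V t123 t023 t012 t013 g23 g12 g02 g13 g03 g01) +
    wdot (N6_W t013 t023 t123 t012) (N6_V t013 t023 t123 t012 f03 f13 f23 f01 f02 f12) (N6_V t013 t023 t123 t012 g03 g13 g23 g01 g02 g12) +
    wdot (N6_W t023 t013 t123 t012) (N6_V t023 t013 t123 t012 f03 f23 f13 f02 f01 f12) (N6_V t023 t013 t123 t012 g03 g23 g13 g02 g01 g12) +
    wdot (N6_W t013 t123 t023 t012) (N6_V t013 t123 t023 t012 f13 f03 f23 f01 f12 f02) (N6_V t013 t123 t023 t012 g13 g03 g23 g01 g12 g02) +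
    wdot (N6_W t123 t013 t023 t012) (N6_V t123 t013 t023 t012 f13 f23 f03 f12 f01 f02) (N6_V t123 t013 t023 t012 g13 g23 g03 g12 g01 g02) +
    wdot (N6_W t023 t123 t013 t012) (N6_V t023 t123 t013 t012 f23 f03 f13 f02 f12 f01) (N6_V t023 t123 t013 t012 g23 g03 g13 g02 g12 g01) +
    wdot (N6_W t123 t023 t013 t012) (N6_V t123 t023 t013 t012 f23 f13 f03 f12 f02 f01) (N6_V t123 t023 t013 t012 g23 g13 g03 g12 g02 g01)"

text \<open>For a given edge pattern only the orderings that bring it into the chosen labelling
  survive. Their number is the order of the automorphism group of the type: 24, 6, 4, 6 for zero,
  one, two, three edges.\<close>

lemma N6_kernel_eval:
  "N6_kernel False False False False f01 f02 f03 f12 f13 f23 g01 g02 g03 g12 g13 g23 =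
    dot N6_W0 (add2 (mul2 (N6_V0 f01 f02 f03 f12 f13 f23) (N6_V0 g01 g02 g03 g12 g13 g23)) (
    add2 (mul2 (N6_V0 f01 f03 f02 f13 f12 f23) (N6_V0 g01 g03 g02 g13 g12 g23)) (
    add2 (mul2 (N6_V0 f02 f01 f03 f12 f23 f13) (N6_V0 g02 g01 g03 g12 g23 g13)) (
    add2 (mul2 (N6_V0 f02 f03 f01 f23 f12 f13) (N6_V0 g02 g03 g01 g23 g12 g13)) (
    add2 (mul2 (N6_V0 f03 f01 f02 f13 f23 f12) (N6_V0 g03 g01 g02 g13 g23 g12)) (
    add2 (mul2 (N6_V0 f03 f02 f01 f23 f13 f12) (N6_V0 g03 g02 g01 g23 g13 g12)) (
    add2 (mul2 (N6_V0 f01 f12 f13 f02 f03 f23) (N6_V0 g01 g12 g13 g02 g03 g23)) (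
    add2 (mul2 (N6_V0 f01 f13 f12 f03 f02 f23) (N6_V0 g01 g13 g12 g03 g02 g23)) (
    add2 (mul2 (N6_V0 f12 f01 f13 f02 f23 f03) (N6_V0 g12 g01 g13 g02 g23 g03)) (
    add2 (mul2 (N6_V0 f12 f13 f01 f23 f02 f03) (N6_V0 g12 g13 g01 g23 g02 g03)) (
    add2 (mul2 (N6_V0 f13 f01 f12 f03 f23 f02) (N6_V0 g13 g01 g12 g03 g23 g02)) (
    add2 (mul2 (N6_V0 f13 f12 f01 f23 f03 f02) (N6_V0 g13 g12 g01 g23 g03 g02)) (
    add2 (mul2 (N6_V0 f02 f12 f23 f01 f03 f13) (N6_V0 g02 g12 g23 g01 g03 g13)) (
    add2 (mul2 (N6_V0 f02 f23 f12 f03 f01 f13) (N6_V0 g02 g23 g12 g03 g01 g13)) (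
    add2 (mul2 (N6_V0 f12 f02 f23 f01 f13 f03) (N6_V0 g12 g02 g23 g01 g13 g03)) (
    add2 (mul2 (N6_V0 f12 f23 f02 f13 f01 f03) (N6_V0 g12 g23 g02 g13 g01 g03)) (
    add2 (mul2 (N6_V0 f23 f02 f12 f03 f13 f01) (N6_V0 g23 g02 g12 g03 g13 g01)) (
    add2 (mul2 (N6_V0 f23 f12 f02 f13 f03 f01) (N6_V0 g23 g12 g02 g13 g03 g01)) (
    add2 (mul2 (N6_V0 f03 f13 f23 f01 f02 f12) (N6_V0 g03 g13 g23 g01 g02 g12)) (
    add2 (mul2 (N6_V0 f03 f23 f13 f02 f01 f12) (N6_V0 g03 g23 g13 g02 g01 g12)) (
    add2 (mul2 (N6_V0 f13 f03 f23 f01 f12 f02) (N6_V0 g13 g03 g23 g01 g12 g02)) (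
    add2 (mul2 (N6_V0 f13 f23 f03 f12 f01 f02) (N6_V0 g13 g23 g03 g12 g01 g02)) (
    add2 (mul2 (N6_V0 f23 f03 f13 f02 f12 f01) (N6_V0 g23 g03 g13 g02 g12 g01)) (mul2 (N6_V0 f23 f13 f03 f12 f02 f01) (N6_V0 g23 g13 g03 g12 g02 g01)))))))))))))))))))))))))"
  "N6_kernel False False False True f01 f02 f03 f12 f13 f23 g01 g02 g03 g12 g13 g23 =
    dot N6_W1 (add2 (mul2 (N6_V1 f12 f13 f01 f23 f02 f03) (N6_V1 g12 g13 g01 g23 g02 g03)) (
    add2 (mul2 (N6_V1 f13 f12 f01 f23 f03 f02) (N6_V1 g13 g12 g01 g23 g03 g02)) (
    add2 (mul2 (N6_V1 f12 f23 f02 f13 f01 f03) (N6_V1 g12 g23 g02 g13 g01 g03)) (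
    add2 (mul2 (N6_V1 f23 f12 f02 f13 f03 f01) (N6_V1 g23 g12 g02 g13 g03 g01)) (
    add2 (mul2 (N6_V1 f13 f23 f03 f12 f01 f02) (N6_V1 g13 g23 g03 g12 g01 g02)) (mul2 (N6_V1 f23 f13 f03 f12 f02 f01) (N6_V1 g23 g13 g03 g12 g02 g01)))))))"
  "N6_kernel False False True False f01 f02 f03 f12 f13 f23 g01 g02 g03 g12 g13 g23 =
    dot N6_W1 (add2 (mul2 (N6_V1 f02 f03 f01 f23 f12 f13) (N6_V1 g02 g03 g01 g23 g12 g13)) (
    add2 (mul2 (N6_V1 f03 f02 f01 f23 f13 f12) (N6_V1 g03 g02 g01 g23 g13 g12)) (
    add2 (mul2 (N6_V1 f02 f23 f12 f03 f01 f13) (N6_V1 g02 g23 g12 g03 g01 g13)) (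
    add2 (mul2 (N6_V1 f23 f02 f12 f03 f13 f01) (N6_V1 g23 g02 g12 g03 g13 g01)) (
    add2 (mul2 (N6_V1 f03 f23 f13 f02 f01 f12) (N6_V1 g03 g23 g13 g02 g01 g12)) (mul2 (N6_V1 f23 f03 f13 f02 f12 f01) (N6_V1 g23 g03 g13 g02 g12 g01)))))))"
  "N6_kernel False False True True f01 f02 f03 f12 f13 f23 g01 g02 g03 g12 g13 g23 =
    dot N6_W2 (add2 (mul2 (N6_V2 f23 f02 f12 f03 f13 f01) (N6_V2 g23 g02 g12 g03 g13 g01)) (
    add2 (mul2 (N6_V2 f23 f12 f02 f13 f03 f01) (N6_V2 g23 g12 g02 g13 g03 g01)) (
    add2 (mul2 (N6_V2 f23 f03 f13 f02 f12 f01) (N6_V2 g23 g03 g13 g02 g12 g01)) (mul2 (N6_V2 f23 f13 f03 f12 f02 f01) (N6_V2 g23 g13 g03 g12 g02 g01)))))"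
  "N6_kernel False True False False f01 f02 f03 f12 f13 f23 g01 g02 g03 g12 g13 g23 =
    dot N6_W1 (add2 (mul2 (N6_V1 f01 f03 f02 f13 f12 f23) (N6_V1 g01 g03 g02 g13 g12 g23)) (
    add2 (mul2 (N6_V1 f03 f01 f02 f13 f23 f12) (N6_V1 g03 g01 g02 g13 g23 g12)) (
    add2 (mul2 (N6_V1 f01 f13 f12 f03 f02 f23) (N6_V1 g01 g13 g12 g03 g02 g23)) (
    add2 (mul2 (N6_V1 f13 f01 f12 f03 f23 f02) (N6_V1 g13 g01 g12 g03 g23 g02)) (
    add2 (mul2 (N6_V1 f03 f13 f23 f01 f02 f12) (N6_V1 g03 g13 g23 g01 g02 g12)) (mul2 (N6_V1 f13 f03 f23 f01 f12 f02) (N6_V1 g13 g03 g23 g01 g12 g02)))))))"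
  "N6_kernel False True False True f01 f02 f03 f12 f13 f23 g01 g02 g03 g12 g13 g23 =
    dot N6_W2 (add2 (mul2 (N6_V2 f13 f01 f12 f03 f23 f02) (N6_V2 g13 g01 g12 g03 g23 g02)) (
    add2 (mul2 (N6_V2 f13 f12 f01 f23 f03 f02) (N6_V2 g13 g12 g01 g23 g03 g02)) (
    add2 (mul2 (N6_V2 f13 f03 f23 f01 f12 f02) (N6_V2 g13 g03 g23 g01 g12 g02)) (mul2 (N6_V2 f13 f23 f03 f12 f01 f02) (N6_V2 g13 g23 g03 g12 g01 g02)))))"
  "N6_kernel False True True False f01 f02 f03 f12 f13 f23 g01 g02 g03 g12 g13 g23 =
    dot N6_W2 (add2 (mul2 (N6_V2 f03 f01 f02 f13 f23 f12) (N6_V2 g03 g01 g02 g13 g23 g12)) (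
    add2 (mul2 (N6_V2 f03 f02 f01 f23 f13 f12) (N6_V2 g03 g02 g01 g23 g13 g12)) (
    add2 (mul2 (N6_V2 f03 f13 f23 f01 f02 f12) (N6_V2 g03 g13 g23 g01 g02 g12)) (mul2 (N6_V2 f03 f23 f13 f02 f01 f12) (N6_V2 g03 g23 g13 g02 g01 g12)))))"
  "N6_kernel False True True True f01 f02 f03 f12 f13 f23 g01 g02 g03 g12 g13 g23 =
    dot N6_W3 (add2 (mul2 (N6_V3 f03 f13 f23 f01 f02 f12) (N6_V3 g03 g13 g23 g01 g02 g12)) (
    add2 (mul2 (N6_V3 f03 f23 f13 f02 f01 f12) (N6_V3 g03 g23 g13 g02 g01 g12)) (
    add2 (mul2 (N6_V3 f13 f03 f23 f01 f12 f02) (N6_V3 g13 g03 g23 g01 g12 g02)) (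
    add2 (mul2 (N6_V3 f13 f23 f03 f12 f01 f02) (N6_V3 g13 g23 g03 g12 g01 g02)) (
    add2 (mul2 (N6_V3 f23 f03 f13 f02 f12 f01) (N6_V3 g23 g03 g13 g02 g12 g01)) (mul2 (N6_V3 f23 f13 f03 f12 f02 f01) (N6_V3 g23 g13 g03 g12 g02 g01)))))))"
  "N6_kernel True False False False f01 f02 f03 f12 f13 f23 g01 g02 g03 g12 g13 g23 =
    dot N6_W1 (add2 (mul2 (N6_V1 f01 f02 f03 f12 f13 f23) (N6_V1 g01 g02 g03 g12 g13 g23)) (
    add2 (mul2 (N6_V1 f02 f01 f03 f12 f23 f13) (N6_V1 g02 g01 g03 g12 g23 g13)) (
    add2 (mul2 (N6_V1 f01 f12 f13 f02 f03 f23) (N6_V1 g01 g12 g13 g02 g03 g23)) (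
    add2 (mul2 (N6_V1 f12 f01 f13 f02 f23 f03) (N6_V1 g12 g01 g13 g02 g23 g03)) (
    add2 (mul2 (N6_V1 f02 f12 f23 f01 f03 f13) (N6_V1 g02 g12 g23 g01 g03 g13)) (mul2 (N6_V1 f12 f02 f23 f01 f13 f03) (N6_V1 g12 g02 g23 g01 g13 g03)))))))"
  "N6_kernel True False False True f01 f02 f03 f12 f13 f23 g01 g02 g03 g12 g13 g23 =
    dot N6_W2 (add2 (mul2 (N6_V2 f12 f01 f13 f02 f23 f03) (N6_V2 g12 g01 g13 g02 g23 g03)) (
    add2 (mul2 (N6_V2 f12 f13 f01 f23 f02 f03) (N6_V2 g12 g13 g01 g23 g02 g03)) (
    add2 (mul2 (N6_V2 f12 f02 f23 f01 f13 f03) (N6_V2 g12 g02 g23 g01 g13 g03)) (mul2 (N6_V2 f12 f23 f02 f13 f01 f03) (N6_V2 g12 g23 g02 g13 g01 g03)))))"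
  "N6_kernel True False True False f01 f02 f03 f12 f13 f23 g01 g02 g03 g12 g13 g23 =
    dot N6_W2 (add2 (mul2 (N6_V2 f02 f01 f03 f12 f23 f13) (N6_V2 g02 g01 g03 g12 g23 g13)) (
    add2 (mul2 (N6_V2 f02 f03 f01 f23 f12 f13) (N6_V2 g02 g03 g01 g23 g12 g13)) (
    add2 (mul2 (N6_V2 f02 f12 f23 f01 f03 f13) (N6_V2 g02 g12 g23 g01 g03 g13)) (mul2 (N6_V2 f02 f23 f12 f03 f01 f13) (N6_V2 g02 g23 g12 g03 g01 g13)))))"
  "N6_kernel True False True True f01 f02 f03 f12 f13 f23 g01 g02 g03 g12 g13 g23 =
    dot N6_W3 (add2 (mul2 (N6_V3 f02 f12 f23 f01 f03 f13) (N6_V3 g02 g12 g23 g01 g03 g13)) (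
    add2 (mul2 (N6_V3 f02 f23 f12 f03 f01 f13) (N6_V3 g02 g23 g12 g03 g01 g13)) (
    add2 (mul2 (N6_V3 f12 f02 f23 f01 f13 f03) (N6_V3 g12 g02 g23 g01 g13 g03)) (
    add2 (mul2 (N6_V3 f12 f23 f02 f13 f01 f03) (N6_V3 g12 g23 g02 g13 g01 g03)) (
    add2 (mul2 (N6_V3 f23 f02 f12 f03 f13 f01) (N6_V3 g23 g02 g12 g03 g13 g01)) (mul2 (N6_V3 f23 f12 f02 f13 f03 f01) (N6_V3 g23 g12 g02 g13 g03 g01)))))))"
  "N6_kernel True True False False f01 f02 f03 f12 f13 f23 g01 g02 g03 g12 g13 g23 =
    dot N6_W2 (add2 (mul2 (N6_V2 f01 f02 f03 f12 f13 f23) (N6_V2 g01 g02 g03 g12 g13 g23)) (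
    add2 (mul2 (N6_V2 f01 f03 f02 f13 f12 f23) (N6_V2 g01 g03 g02 g13 g12 g23)) (
    add2 (mul2 (N6_V2 f01 f12 f13 f02 f03 f23) (N6_V2 g01 g12 g13 g02 g03 g23)) (mul2 (N6_V2 f01 f13 f12 f03 f02 f23) (N6_V2 g01 g13 g12 g03 g02 g23)))))"
  "N6_kernel True True False True f01 f02 f03 f12 f13 f23 g01 g02 g03 g12 g13 g23 =
    dot N6_W3 (add2 (mul2 (N6_V3 f01 f12 f13 f02 f03 f23) (N6_V3 g01 g12 g13 g02 g03 g23)) (
    add2 (mul2 (N6_V3 f01 f13 f12 f03 f02 f23) (N6_V3 g01 g13 g12 g03 g02 g23)) (
    add2 (mul2 (N6_V3 f12 f01 f13 f02 f23 f03) (N6_V3 g12 g01 g13 g02 g23 g03)) (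
    add2 (mul2 (N6_V3 f12 f13 f01 f23 f02 f03) (N6_V3 g12 g13 g01 g23 g02 g03)) (
    add2 (mul2 (N6_V3 f13 f01 f12 f03 f23 f02) (N6_V3 g13 g01 g12 g03 g23 g02)) (mul2 (N6_V3 f13 f12 f01 f23 f03 f02) (N6_V3 g13 g12 g01 g23 g03 g02)))))))"
  "N6_kernel True True True False f01 f02 f03 f12 f13 f23 g01 g02 g03 g12 g13 g23 =
    dot N6_W3 (add2 (mul2 (N6_V3 f01 f02 f03 f12 f13 f23) (N6_V3 g01 g02 g03 g12 g13 g23)) (
    add2 (mul2 (N6_V3 f01 f03 f02 f13 f12 f23) (N6_V3 g01 g03 g02 g13 g12 g23)) (
    add2 (mul2 (N6_V3 f02 f01 f03 f12 f23 f13) (N6_V3 g02 g01 g03 g12 g23 g13)) (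
    add2 (mul2 (N6_V3 f02 f03 f01 f23 f12 f13) (N6_V3 g02 g03 g01 g23 g12 g13)) (
    add2 (mul2 (N6_V3 f03 f01 f02 f13 f23 f12) (N6_V3 g03 g01 g02 g13 g23 g12)) (mul2 (N6_V3 f03 f02 f01 f23 f13 f12) (N6_V3 g03 g02 g01 g23 g13 g12)))))))"
  by (simp_all only: N6_kernel_def N6_V_def N6_W_def if_True if_False wdot.simps dot_add2 dot_mul2 add_0_left add_0_right add_ac)

section \<open>Six vertices: degree terms and objective\<close>

definition N6_deg :: "bool \<Rightarrow> bool \<Rightarrow> bool \<Rightarrow> bool
    \<Rightarrow> int" where "N6_deg a b c d = (if a then (if b then (if c then 0 else (if d
    then 0 else 27017)) else (if c then (if d then 0 else 27017) else (if d then 15062 else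
    12059))) else (if b then (if c then (if d then 0 else 27017) else (if d then 15062 else
    12059)) else (if c then (if d then 15062 else 12059) else (if d then 28080 else 3025))))"

text \<open>The multiplier \<open>N6_deg\<close> looks at four vertices z, i, j, k: how many of the
  pairs among i, j, k are link edges of z, and whether ijk is an edge. The other factor has mean
  10000 times the link density of z, minus 4641.\<close>

definition N6_degree where
  "N6_degree a b c d e = N6_deg a b c d * (if e then 5359 else - 4641)"

definition pair_overlap :: "bool \<Rightarrow> bool \<Rightarrow> bool \<Rightarrow> bool \<Rightarrow> bool \<Rightarrow> bool \<Rightarrow> int" where
  "pair_overlap x1 x2 x3 y1 y2 y3 =
     (if x1 then (if y2 then 1 else 0) + (if y3 then 1 else 0) else 0) +
     (if x2 then (if y1 then 1 else 0) + (if y3 then 1 else 0) else 0) +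
     (if x3 then (if y1 then 1 else 0) + (if y2 then 1 else 0) else 0)"

lemma pair_overlap_commute:
  "pair_overlap x2 x1 x3 y2 y1 y3 = pair_overlap x1 x2 x3 y1 y2 y3"
  "pair_overlap x1 x3 x2 y1 y3 y2 = pair_overlap x1 x2 x3 y1 y2 y3"
  by (simp_all only: pair_overlap_def add_ac)

lemma pair_overlap_swap: "pair_overlap y1 y2 y3 x1 x2 x3 = pair_overlap x1 x2 x3 y1 y2 y3"
  unfolding pair_overlap_def by (cases x1; cases x2; cases x3; simp)

text \<open>For an edge abc let M1, M2, M3 be the pairwise intersections of the neighbourhoods of
  ab, ac and bc, with measures s1, s2, s3; \<open>xi\<close>, \<open>yi\<close>, \<open>zi\<close>
  record whether x, y, z lie in Mi. Averaging over x, y, z gives 360000 (D - 0.403), where D is the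
  sum of the three cut densities minus 3 (s1 s2 + s1 s3 + s2 s3), and 145080 is 0.403 times 360000.
  The subtracted products ensure that D is at most the best of the three cuts.\<close>

definition N6_obj_aux where
  "N6_obj_aux e012 e345 x1 x2 x3 y1 y2 y3 z1 z2 z3 =
     (if e012 then 10000 * (36 * (if e345
          then (if two x1 y1 z1 then 1 else 0) + (if two x2 y2 z2 then 1 else 0) + (if two x3 y3 z3 then 1 else 0)
          else 0)
        - 18 * (pair_overlap x1 x2 x3 y1 y2 y3 + pair_overlap x1 x2 x3 z1 z2 z3 + pair_overlap y1 y2 y3 z1 z2 z3))
        - 145080 else (0 :: int))"

lemma N6_obj_aux_commute1:
  "N6_obj_aux e e' x2 x1 x3 y2 y1 y3 z2 z1 z3 = N6_obj_aux e e' x1 x2 x3 y1 y2 y3 z1 z2 z3"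
  unfolding N6_obj_aux_def pair_overlap_commute(1)[of x2 x1 x3 y2 y1 y3] pair_overlap_commute(1)[of x2 x1 x3 z2 z1 z3] pair_overlap_commute(1)[of y2 y1 y3 z2 z1 z3]
  by (simp only: add_ac)

lemma N6_obj_aux_commute2:
  "N6_obj_aux e e' x1 x3 x2 y1 y3 y2 z1 z3 z2 = N6_obj_aux e e' x1 x2 x3 y1 y2 y3 z1 z2 z3"
  unfolding N6_obj_aux_def pair_overlap_commute(2)[of x1 x3 x2 y1 y3 y2] pair_overlap_commute(2)[of x1 x3 x2 z1 z3 z2] pair_overlap_commute(2)[of y1 y3 y2 z1 z3 z2]
  by (simp only: add_ac)

lemma N6_obj_aux_commute3:
  "N6_obj_aux e e' y1 y2 y3 x1 x2 x3 z1 z2 z3 = N6_obj_aux e e' x1 x2 x3 y1 y2 y3 z1 z2 z3"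
  unfolding N6_obj_aux_def pair_overlap_swap[of y1 y2 y3 x1 x2 x3] two_commute(1)[of y1 x1] two_commute(1)[of y2 x2] two_commute(1)[of y3 x3]
  by (simp only: add_ac)

lemma N6_obj_aux_commute4:
  "N6_obj_aux e e' x1 x2 x3 z1 z2 z3 y1 y2 y3 = N6_obj_aux e e' x1 x2 x3 y1 y2 y3 z1 z2 z3"
  unfolding N6_obj_aux_def pair_overlap_swap[of z1 z2 z3 y1 y2 y3] two_commute(2)[of x1 z1] two_commute(2)[of x2 z2] two_commute(2)[of x3 z3]
  by (simp only: add_ac)

lemmas N6_obj_aux_commute = N6_obj_aux_commute1 N6_obj_aux_commute2 N6_obj_aux_commute3 N6_obj_aux_commute4

definition N6_obj where
  "N6_obj e012 e013 e023 e123 e014 e024 e124 e015 e025 e125 e345 =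
     N6_obj_aux e012 e345 (e013 \<and> e023) (e013 \<and> e123) (e023 \<and> e123)
       (e014 \<and> e024) (e014 \<and> e124) (e024 \<and> e124) (e015 \<and> e025) (e015 \<and> e125) (e025 \<and> e125)"

text \<open>Fifteen kernels with factor 2, each a sum over 24 orderings of its type, and sixty
  degree terms with factor 12 both amount to the 720 orderings of six vertices. The factor 1256 of
  the twenty objective terms sets the scale of the objective.\<close>

definition N6_S :: "bool \<Rightarrow> bool \<Rightarrow> bool \<Rightarrow> bool \<Rightarrow> bool \<Rightarrow> bool \<Rightarrow> bool \<Rightarrow> bool \<Rightarrow> bool \<Rightarrow> bool \<Rightarrow> bool \<Rightarrow> bool \<Rightarrow> bool \<Rightarrow> bool \<Rightarrow> bool \<Rightarrow> bool \<Rightarrow> bool \<Rightarrow> bool \<Rightarrow> bool \<Rightarrow> bool \<Rightarrow> int" where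
  "N6_S e012 e013 e023 e123 e014 e024 e124 e034 e134 e234 e015 e025 e125 e035 e135 e235 e045 e145 e245 e345 =
    2 * (N6_kernel e012 e013 e023 e123 e014 e024 e034 e124 e134 e234 e015 e025 e035 e125 e135 e235 +
    N6_kernel e012 e014 e024 e124 e013 e023 e034 e123 e134 e234 e015 e025 e045 e125 e145 e245 +
    N6_kernel e012 e015 e025 e125 e013 e023 e035 e123 e135 e235 e014 e024 e045 e124 e145 e245 +
    N6_kernel e013 e014 e034 e134 e012 e023 e024 e123 e124 e234 e015 e035 e045 e135 e145 e345 +
    N6_kernel e013 e015 e035 e135 e012 e023 e025 e123 e125 e235 e014 e034 e045 e134 e145 e345 +
    N6_kernel e014 e015 e045 e145 e012 e024 e025 e124 e125 e245 e013 e034 e035 e134 e135 e345 +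
    N6_kernel e023 e024 e034 e234 e012 e013 e014 e123 e124 e134 e025 e035 e045 e235 e245 e345 +
    N6_kernel e023 e025 e035 e235 e012 e013 e015 e123 e125 e135 e024 e034 e045 e234 e245 e345 +
    N6_kernel e024 e025 e045 e245 e012 e014 e015 e124 e125 e145 e023 e034 e035 e234 e235 e345 +
    N6_kernel e034 e035 e045 e345 e013 e014 e015 e134 e135 e145 e023 e024 e025 e234 e235 e245 +
    N6_kernel e123 e124 e134 e234 e012 e013 e014 e023 e024 e034 e125 e135 e145 e235 e245 e345 +
    N6_kernel e123 e125 e135 e235 e012 e013 e015 e023 e025 e035 e124 e134 e145 e234 e245 e345 +
    N6_kernel e124 e125 e145 e245 e012 e014 e015 e024 e025 e045 e123 e134 e135 e234 e235 e345 +
    N6_kernel e134 e135 e145 e345 e013 e014 e015 e034 e035 e045 e123 e124 e125 e234 e235 e245 +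
    N6_kernel e234 e235 e245 e345 e023 e024 e025 e034 e035 e045 e123 e124 e125 e134 e135 e145) +
    12 * (N6_degree e034 e035 e045 e345 e012 + N6_degree e024 e025 e045 e245 e013 + 
    N6_degree e023 e025 e035 e235 e014 + N6_degree e023 e024 e034 e234 e015 + 
    N6_degree e014 e015 e045 e145 e023 + N6_degree e013 e015 e035 e135 e024 + 
    N6_degree e013 e014 e034 e134 e025 + N6_degree e012 e015 e025 e125 e034 + 
    N6_degree e012 e014 e024 e124 e035 + N6_degree e012 e013 e023 e123 e045 + 
    N6_degree e134 e135 e145 e345 e012 + N6_degree e124 e125 e145 e245 e013 + 
    N6_degree e123 e125 e135 e235 e014 + N6_degree e123 e124 e134 e234 e015 + 
    N6_degree e014 e015 e145 e045 e123 + N6_degree e013 e015 e135 e035 e124 + 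
    N6_degree e013 e014 e134 e034 e125 + N6_degree e012 e015 e125 e025 e134 + 
    N6_degree e012 e014 e124 e024 e135 + N6_degree e012 e013 e123 e023 e145 + 
    N6_degree e234 e235 e245 e345 e012 + N6_degree e124 e125 e245 e145 e023 + 
    N6_degree e123 e125 e235 e135 e024 + N6_degree e123 e124 e234 e134 e025 + 
    N6_degree e024 e025 e245 e045 e123 + N6_degree e023 e025 e235 e035 e124 + 
    N6_degree e023 e024 e234 e034 e125 + N6_degree e012 e025 e125 e015 e234 + 
    N6_degree e012 e024 e124 e014 e235 + N6_degree e012 e023 e123 e013 e245 + 
    N6_degree e234 e235 e345 e245 e013 + N6_degree e134 e135 e345 e145 e023 + 
    N6_degree e123 e135 e235 e125 e034 + N6_degree e123 e134 e234 e124 e035 + 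
    N6_degree e034 e035 e345 e045 e123 + N6_degree e023 e035 e235 e025 e134 + 
    N6_degree e023 e034 e234 e024 e135 + N6_degree e013 e035 e135 e015 e234 + 
    N6_degree e013 e034 e134 e014 e235 + N6_degree e013 e023 e123 e012 e345 + 
    N6_degree e234 e245 e345 e235 e014 + N6_degree e134 e145 e345 e135 e024 + 
    N6_degree e124 e145 e245 e125 e034 + N6_degree e124 e134 e234 e123 e045 + 
    N6_degree e034 e045 e345 e035 e124 + N6_degree e024 e045 e245 e025 e134 + 
    N6_degree e024 e034 e234 e023 e145 + N6_degree e014 e045 e145 e015 e234 + 
    N6_degree e014 e034 e134 e013 e245 + N6_degree e014 e024 e124 e012 e345 + 
    N6_degree e235 e245 e345 e234 e015 + N6_degree e135 e145 e345 e134 e025 + 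
    N6_degree e125 e145 e245 e124 e035 + N6_degree e125 e135 e235 e123 e045 + 
    N6_degree e035 e045 e345 e034 e125 + N6_degree e025 e045 e245 e024 e135 + 
    N6_degree e025 e035 e235 e023 e145 + N6_degree e015 e045 e145 e014 e235 + 
    N6_degree e015 e035 e135 e013 e245 + N6_degree e015 e025 e125 e012 e345) -
    1256 * (N6_obj e012 e013 e023 e123 e014 e024 e124 e015 e025 e125 e345 +
    N6_obj e013 e012 e023 e123 e014 e034 e134 e015 e035 e135 e245 +
    N6_obj e014 e012 e024 e124 e013 e034 e134 e015 e045 e145 e235 +
    N6_obj e015 e012 e025 e125 e013 e035 e135 e014 e045 e145 e234 +
    N6_obj e023 e012 e013 e123 e024 e034 e234 e025 e035 e235 e145 +
    N6_obj e024 e012 e014 e124 e023 e034 e234 e025 e045 e245 e135 +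
    N6_obj e025 e012 e015 e125 e023 e035 e235 e024 e045 e245 e134 +
    N6_obj e034 e013 e014 e134 e023 e024 e234 e035 e045 e345 e125 +
    N6_obj e035 e013 e015 e135 e023 e025 e235 e034 e045 e345 e124 +
    N6_obj e045 e014 e015 e145 e024 e025 e245 e034 e035 e345 e123 +
    N6_obj e123 e012 e013 e023 e124 e134 e234 e125 e135 e235 e045 +
    N6_obj e124 e012 e014 e024 e123 e134 e234 e125 e145 e245 e035 +
    N6_obj e125 e012 e015 e025 e123 e135 e235 e124 e145 e245 e034 +
    N6_obj e134 e013 e014 e034 e123 e124 e234 e135 e145 e345 e025 +
    N6_obj e135 e013 e015 e035 e123 e125 e235 e134 e145 e345 e024 +
    N6_obj e145 e014 e015 e045 e124 e125 e245 e134 e135 e345 e023 +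
    N6_obj e234 e023 e024 e034 e123 e124 e134 e235 e245 e345 e015 +
    N6_obj e235 e023 e025 e035 e123 e125 e135 e234 e245 e345 e014 +
    N6_obj e245 e024 e025 e045 e124 e125 e145 e234 e235 e345 e013 +
    N6_obj e345 e034 e035 e045 e134 e135 e145 e234 e235 e245 e012)"

section \<open>Six vertices: enumeration up to relabelling\<close>

definition prefix_lexmin :: "bool \<Rightarrow> bool \<Rightarrow> bool \<Rightarrow> bool \<Rightarrow> bool \<Rightarrow> bool \<Rightarrow> bool \<Rightarrow> bool \<Rightarrow> bool \<Rightarrow> bool \<Rightarrow> bool" where
  "prefix_lexmin e012 e013 e023 e123 e014 e024 e124 e034 e134 e234 \<longleftrightarrow>
    (if \<not> lexle [e012, e013, e023, e123, e014, e024, e124, e034, e134, e234] [e012, e013, e123, e023, e014, e124, e024, e134, e034, e234] then False else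
     if \<not> lexle [e012, e013, e023, e123, e014, e024, e124, e034, e134, e234] [e012, e123, e023, e013, e124, e024, e014, e234, e134, e034] then False else
     if \<not> lexle [e012, e013, e023, e123, e014, e024, e124, e034, e134, e234] [e123, e013, e023, e012, e134, e234, e124, e034, e014, e024] then False else
     if \<not> lexle [e012, e013, e023, e123, e014, e024, e124, e034, e134, e234] [e124, e134, e234, e123, e014, e024, e012, e034, e013, e023] then False else
     if \<not> lexle [e012, e013, e023, e123, e014, e024, e124, e034, e134, e234] [e012, e023, e013, e123, e024, e014, e124, e034, e234, e134] then False else
     if \<not> lexle [e012, e013, e023, e123, e014, e024, e124, e034, e134, e234] [e023, e013, e012, e123, e034, e024, e234, e014, e134, e124] then False else
     if \<not> lexle [e012, e013, e023, e123, e014, e024, e124, e034, e134, e234] [e024, e034, e023, e234, e014, e012, e124, e013, e134, e123] then False else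
     if \<not> lexle [e012, e013, e023, e123, e014, e024, e124, e034, e134, e234] [e013, e012, e023, e123, e014, e034, e134, e024, e124, e234] then False else
     if \<not> lexle [e012, e013, e023, e123, e014, e024, e124, e034, e134, e234] [e014, e013, e034, e134, e012, e024, e124, e023, e123, e234] then False else
     if \<not> lexle [e012, e013, e023, e123, e014, e024, e124, e034, e134, e234] [e012, e014, e024, e124, e013, e023, e123, e034, e134, e234] then False else True)"

text \<open>Comparison with the images under the 15 transpositions and ten further permutations, in
  the order of the list \<open>symmetries\<close>; the extra permutations remove more duplicates
  from the enumeration.\<close>

definition lexmin6 :: "bool \<Rightarrow> bool \<Rightarrow> bool \<Rightarrow> bool \<Rightarrow> bool \<Rightarrow> bool \<Rightarrow> bool \<Rightarrow> bool \<Rightarrow> bool \<Rightarrow> bool \<Rightarrow> bool \<Rightarrow> bool \<Rightarrow> bool \<Rightarrow> bool \<Rightarrow> bool \<Rightarrow> bool \<Rightarrow> bool \<Rightarrow> bool \<Rightarrow> bool \<Rightarrow> bool \<Rightarrow> bool" where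
  "lexmin6 e012 e013 e023 e123 e014 e024 e124 e034 e134 e234 e015 e025 e125 e035 e135 e235 e045 e145 e245 e345 \<longleftrightarrow>
    (if \<not> lexle [e012, e013, e023, e123, e014, e024, e124, e034, e134, e234, e015, e025, e125, e035, e135, e235, e045, e145, e245, e345] [e012, e013, e123, e023, e014, e124, e024, e134, e034, e234, e015, e125, e025, e135, e035, e235, e145, e045, e245, e345] then False else
     if \<not> lexle [e012, e013, e023, e123, e014, e024, e124, e034, e134, e234, e015, e025, e125, e035, e135, e235, e045, e145, e245, e345] [e012, e123, e023, e013, e124, e024, e014, e234, e134, e034, e125, e025, e015, e235, e135, e035, e245, e145, e045, e345] then False else
     if \<not> lexle [e012, e013, e023, e123, e014, e024, e124, e034, e134, e234, e015, e025, e125, e035, e135, e235, e045, e145, e245, e345] [e123, e013, e023, e012, e134, e234, e124, e034, e014, e024, e135, e235, e125, e035, e015, e025, e345, e145, e245, e045] then False else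
     if \<not> lexle [e012, e013, e023, e123, e014, e024, e124, e034, e134, e234, e015, e025, e125, e035, e135, e235, e045, e145, e245, e345] [e124, e134, e234, e123, e014, e024, e012, e034, e013, e023, e145, e245, e125, e345, e135, e235, e045, e015, e025, e035] then False else
     if \<not> lexle [e012, e013, e023, e123, e014, e024, e124, e034, e134, e234, e015, e025, e125, e035, e135, e235, e045, e145, e245, e345] [e125, e135, e235, e123, e145, e245, e124, e345, e134, e234, e015, e025, e012, e035, e013, e023, e045, e014, e024, e034] then False else
     if \<not> lexle [e012, e013, e023, e123, e014, e024, e124, e034, e134, e234, e015, e025, e125, e035, e135, e235, e045, e145, e245, e345] [e012, e023, e013, e123, e024, e014, e124, e034, e234, e134, e025, e015, e125, e035, e235, e135, e045, e245, e145, e345] then False else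
     if \<not> lexle [e012, e013, e023, e123, e014, e024, e124, e034, e134, e234, e015, e025, e125, e035, e135, e235, e045, e145, e245, e345] [e023, e013, e012, e123, e034, e024, e234, e014, e134, e124, e035, e025, e235, e015, e135, e125, e045, e345, e245, e145] then False else
     if \<not> lexle [e012, e013, e023, e123, e014, e024, e124, e034, e134, e234, e015, e025, e125, e035, e135, e235, e045, e145, e245, e345] [e024, e034, e023, e234, e014, e012, e124, e013, e134, e123, e045, e025, e245, e035, e345, e235, e015, e145, e125, e135] then False else
     if \<not> lexle [e012, e013, e023, e123, e014, e024, e124, e034, e134, e234, e015, e025, e125, e035, e135, e235, e045, e145, e245, e345] [e025, e035, e023, e235, e045, e024, e245, e034, e345, e234, e015, e012, e125, e013, e135, e123, e014, e145, e124, e134] then False else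
     if \<not> lexle [e012, e013, e023, e123, e014, e024, e124, e034, e134, e234, e015, e025, e125, e035, e135, e235, e045, e145, e245, e345] [e013, e012, e023, e123, e014, e034, e134, e024, e124, e234, e015, e035, e135, e025, e125, e235, e045, e145, e345, e245] then False else
     if \<not> lexle [e012, e013, e023, e123, e014, e024, e124, e034, e134, e234, e015, e025, e125, e035, e135, e235, e045, e145, e245, e345] [e014, e013, e034, e134, e012, e024, e124, e023, e123, e234, e015, e045, e145, e035, e135, e345, e025, e125, e245, e235] then False else
     if \<not> lexle [e012, e013, e023, e123, e014, e024, e124, e034, e134, e234, e015, e025, e125, e035, e135, e235, e045, e145, e245, e345] [e015, e013, e035, e135, e014, e045, e145, e034, e134, e345, e012, e025, e125, e023, e123, e235, e024, e124, e245, e234] then False else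
     if \<not> lexle [e012, e013, e023, e123, e014, e024, e124, e034, e134, e234, e015, e025, e125, e035, e135, e235, e045, e145, e245, e345] [e012, e014, e024, e124, e013, e023, e123, e034, e134, e234, e015, e025, e125, e045, e145, e245, e035, e135, e235, e345] then False else
     if \<not> lexle [e012, e013, e023, e123, e014, e024, e124, e034, e134, e234, e015, e025, e125, e035, e135, e235, e045, e145, e245, e345] [e012, e015, e025, e125, e014, e024, e124, e045, e145, e245, e013, e023, e123, e035, e135, e235, e034, e134, e234, e345] then False else
     if \<not> lexle [e012, e013, e023, e123, e014, e024, e124, e034, e134, e234, e015, e025, e125, e035, e135, e235, e045, e145, e245, e345] [e012, e013, e023, e123, e015, e025, e125, e035, e135, e235, e014, e024, e124, e034, e134, e234, e045, e145, e245, e345] then False else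
     if \<not> lexle [e012, e013, e023, e123, e014, e024, e124, e034, e134, e234, e015, e025, e125, e035, e135, e235, e045, e145, e245, e345] [e012, e014, e124, e024, e013, e123, e023, e134, e034, e234, e015, e125, e025, e145, e045, e245, e135, e035, e235, e345] then False else
     if \<not> lexle [e012, e013, e023, e123, e014, e024, e124, e034, e134, e234, e015, e025, e125, e035, e135, e235, e045, e145, e245, e345] [e013, e012, e123, e023, e014, e134, e034, e124, e024, e234, e015, e135, e035, e125, e025, e235, e145, e045, e345, e245] then False else
     if \<not> lexle [e012, e013, e023, e123, e014, e024, e124, e034, e134, e234, e015, e025, e125, e035, e135, e235, e045, e145, e245, e345] [e023, e012, e013, e123, e025, e035, e235, e015, e125, e135, e024, e034, e234, e014, e124, e134, e045, e245, e345, e145] then False else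
     if \<not> lexle [e012, e013, e023, e123, e014, e024, e124, e034, e134, e234, e015, e025, e125, e035, e135, e235, e045, e145, e245, e345] [e123, e023, e012, e013, e235, e125, e135, e025, e035, e015, e234, e124, e134, e024, e034, e014, e245, e345, e145, e045] then False else
     if \<not> lexle [e012, e013, e023, e123, e014, e024, e124, e034, e134, e234, e015, e025, e125, e035, e135, e235, e045, e145, e245, e345] [e013, e035, e135, e015, e023, e123, e012, e235, e025, e125, e034, e134, e014, e345, e045, e145, e234, e024, e124, e245] then False else
     if \<not> lexle [e012, e013, e023, e123, e014, e024, e124, e034, e134, e234, e015, e025, e125, e035, e135, e235, e045, e145, e245, e345] [e045, e145, e014, e015, e245, e024, e025, e124, e125, e012, e345, e034, e035, e134, e135, e013, e234, e235, e023, e123] then False else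
     if \<not> lexle [e012, e013, e023, e123, e014, e024, e124, e034, e134, e234, e015, e025, e125, e035, e135, e235, e045, e145, e245, e345] [e135, e134, e345, e145, e013, e035, e015, e034, e014, e045, e123, e235, e125, e234, e124, e245, e023, e012, e025, e024] then False else
     if \<not> lexle [e012, e013, e023, e123, e014, e024, e124, e034, e134, e234, e015, e025, e125, e035, e135, e235, e045, e145, e245, e345] [e345, e235, e245, e234, e035, e045, e034, e025, e023, e024, e135, e145, e134, e125, e123, e124, e015, e013, e014, e012] then False else
     if \<not> lexle [e012, e013, e023, e123, e014, e024, e124, e034, e134, e234, e015, e025, e125, e035, e135, e235, e045, e145, e245, e345] [e013, e012, e023, e123, e015, e035, e135, e025, e125, e235, e014, e034, e134, e024, e124, e234, e045, e145, e345, e245] then False else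
     if \<not> lexle [e012, e013, e023, e123, e014, e024, e124, e034, e134, e234, e015, e025, e125, e035, e135, e235, e045, e145, e245, e345] [e013, e023, e123, e012, e035, e135, e015, e235, e025, e125, e034, e134, e014, e234, e024, e124, e345, e045, e145, e245] then False else True)"

text \<open>Eight labelled copies of \<open>F2\<close> on six distinct vertices; excluding just
  these suffices for the check on minimal patterns.\<close>

definition some_F2 :: "bool \<Rightarrow> bool \<Rightarrow> bool \<Rightarrow> bool \<Rightarrow> bool \<Rightarrow> bool \<Rightarrow> bool \<Rightarrow> bool \<Rightarrow> bool \<Rightarrow> bool \<Rightarrow> bool \<Rightarrow> bool \<Rightarrow> bool \<Rightarrow> bool \<Rightarrow> bool \<Rightarrow> bool \<Rightarrow> bool \<Rightarrow> bool \<Rightarrow> bool \<Rightarrow> bool \<Rightarrow> bool" where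
  "some_F2 e012 e013 e023 e123 e014 e024 e124 e034 e134 e234 e015 e025 e125 e035 e135 e235 e045 e145 e245 e345 \<longleftrightarrow>
    e123 \<and> e014 \<and> e134 \<and> e234 \<and> e015 \<and> e125 \<or>
    e123 \<and> e024 \<and> e124 \<and> e025 \<and> e035 \<and> e235 \<or>
    e123 \<and> e034 \<and> e134 \<and> e125 \<and> e035 \<and> e235 \<or>
    e124 \<and> e034 \<and> e234 \<and> e015 \<and> e045 \<and> e145 \<or>
    e024 \<and> e034 \<and> e134 \<and> e125 \<and> e145 \<and> e245 \<or>
    e034 \<and> e015 \<and> e125 \<and> e035 \<and> e245 \<and> e345 \<or>
    e124 \<and> e025 \<and> e035 \<and> e135 \<and> e145 \<and> e245 \<or>
    e034 \<and> e125 \<and> e035 \<and> e235 \<and> e045 \<and> e145"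

text \<open>As on five vertices, a pattern is excluded only if it contains a five-cycle and also an
  image of \<open>F2\<close>, here on five or six vertices. Complete 4-sets are tested separately,
  as soon as their edges are known.\<close>

definition allowed6 :: "bool \<Rightarrow> bool \<Rightarrow> bool \<Rightarrow> bool \<Rightarrow> bool \<Rightarrow> bool \<Rightarrow> bool \<Rightarrow> bool \<Rightarrow> bool \<Rightarrow> bool \<Rightarrow> bool \<Rightarrow> bool \<Rightarrow> bool \<Rightarrow> bool \<Rightarrow> bool \<Rightarrow> bool \<Rightarrow> bool \<Rightarrow> bool \<Rightarrow> bool \<Rightarrow> bool \<Rightarrow> bool" where
  "allowed6 e012 e013 e023 e123 e014 e024 e124 e034 e134 e234 e015 e025 e125 e035 e135 e235 e045 e145 e245 e345 \<longleftrightarrow>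
    (if (if has_C5 e012 e013 e023 e123 e014 e024 e124 e034 e134 e234 then True
      else if has_C5 e012 e013 e023 e123 e015 e025 e125 e035 e135 e235 then True
      else if has_C5 e012 e014 e024 e124 e015 e025 e125 e045 e145 e245 then True
      else if has_C5 e013 e014 e034 e134 e015 e035 e135 e045 e145 e345 then True
      else if has_C5 e023 e024 e034 e234 e025 e035 e235 e045 e245 e345 then True
      else if has_C5 e123 e124 e134 e234 e125 e135 e235 e145 e245 e345 then True else False)
     then (if (if has_F1 e012 e013 e023 e123 e014 e024 e124 e034 e134 e234 then True
      else if has_F1 e012 e013 e023 e123 e015 e025 e125 e035 e135 e235 then True
      else if has_F1 e012 e014 e024 e124 e015 e025 e125 e045 e145 e245 then True
      else if has_F1 e013 e014 e034 e134 e015 e035 e135 e045 e145 e345 then True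
      else if has_F1 e023 e024 e034 e234 e025 e035 e235 e045 e245 e345 then True
      else if has_F1 e123 e124 e134 e234 e125 e135 e235 e145 e245 e345 then True else False) then False else \<not> some_F2 e012 e013 e023 e123 e014 e024 e124 e034 e134 e234 e015 e025 e125 e035 e135 e235 e045 e145 e245 e345) else True)"

definition N6_leaf :: "bool \<Rightarrow> bool \<Rightarrow> bool \<Rightarrow> bool \<Rightarrow> bool \<Rightarrow> bool \<Rightarrow> bool \<Rightarrow> bool \<Rightarrow> bool \<Rightarrow> bool \<Rightarrow> bool \<Rightarrow> bool \<Rightarrow> bool \<Rightarrow> bool \<Rightarrow> bool \<Rightarrow> bool \<Rightarrow> bool \<Rightarrow> bool \<Rightarrow> bool \<Rightarrow> bool \<Rightarrow> bool" where
  "N6_leaf e012 e013 e023 e123 e014 e024 e124 e034 e134 e234 e015 e025 e125 e035 e135 e235 e045 e145 e245 e345 =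
    (if e014 \<and> e015 \<and> e045 \<and> e145 \<or> e024 \<and> e025 \<and> e045 \<and> e245 \<or> e034 \<and> e035 \<and> e045 \<and> e345 \<or> e124 \<and> e125 \<and> e145 \<and> e245 \<or> e134 \<and> e135 \<and> e145 \<and> e345 \<or> e234 \<and> e235 \<and> e245 \<and> e345 then True
     else if lexmin6 e012 e013 e023 e123 e014 e024 e124 e034 e134 e234 e015 e025 e125 e035 e135 e235 e045 e145 e245 e345
     then if allowed6 e012 e013 e023 e123 e014 e024 e124 e034 e134 e234 e015 e025 e125 e035 e135 e235 e045 e145 e245 e345 then N6_S e012 e013 e023 e123 e014 e024 e124 e034 e134 e234 e015 e025 e125 e035 e135 e235 e045 e145 e245 e345 \<le> 0 else True else True)"

definition N6_mid :: "bool \<Rightarrow> bool \<Rightarrow> bool \<Rightarrow> bool \<Rightarrow> bool \<Rightarrow> bool \<Rightarrow> bool \<Rightarrow> bool \<Rightarrow> bool \<Rightarrow> bool \<Rightarrow> bool \<Rightarrow> bool \<Rightarrow> bool \<Rightarrow> bool \<Rightarrow> bool \<Rightarrow> bool \<Rightarrow> bool" where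
  "N6_mid e012 e013 e023 e123 e014 e024 e124 e034 e134 e234 e015 e025 e125 e035 e135 e235 = (if e012 \<and> e015 \<and> e025 \<and> e125 \<or> e013 \<and> e015 \<and> e035 \<and> e135 \<or> e023 \<and> e025 \<and> e035 \<and> e235 \<or> e123 \<and> e125 \<and> e135 \<and> e235 then True else all4 (N6_leaf e012 e013 e023 e123 e014 e024 e124 e034 e134 e234 e015 e025 e125 e035 e135 e235))"

text \<open>The ten triples on the vertices 0 to 4 are tested for minimality and complete 4-sets
  before the ten triples through vertex 5 are enumerated.\<close>

definition N6_prefix :: "bool \<Rightarrow> bool \<Rightarrow> bool \<Rightarrow> bool \<Rightarrow> bool \<Rightarrow> bool \<Rightarrow> bool \<Rightarrow> bool \<Rightarrow> bool \<Rightarrow> bool \<Rightarrow> bool" where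
  "N6_prefix e012 e013 e023 e123 e014 e024 e124 e034 e134 e234 = (if prefix_lexmin e012 e013 e023 e123 e014 e024 e124 e034 e134 e234 then if has_K4 e012 e013 e023 e123 e014 e024 e124 e034 e134 e234 then True else all6 (N6_mid e012 e013 e023 e123 e014 e024 e124 e034 e134 e234) else True)"

lemma swap_apply: "swap a b \<phi> i = \<phi> (if i = a then b else if i = b then a else i)"
  by (simp add: swap_def)

text \<open>Triples through vertex 5 come last in the code, so minimality of a six-vertex pattern
  under permutations fixing 5 passes to its five-vertex prefix.\<close>

lemma lexle_append: "length xs = length ys \<Longrightarrow> lexle (xs @ us) (ys @ vs) \<Longrightarrow> lexle xs ys"
  by (induction xs ys rule: list_induct2) (auto split: if_splits)

lemma N6_kernel_commute:
  "N6_kernel t012 t013 t123 t023 f01 f12 f13 f02 f03 f23 g01 g12 g13 g02 g03 g23 =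
    N6_kernel t012 t013 t023 t123 f01 f02 f03 f12 f13 f23 g01 g02 g03 g12 g13 g23"
  "N6_kernel t012 t023 t013 t123 f02 f01 f03 f12 f23 f13 g02 g01 g03 g12 g23 g13 =
    N6_kernel t012 t013 t023 t123 f01 f02 f03 f12 f13 f23 g01 g02 g03 g12 g13 g23"
  "N6_kernel t013 t012 t023 t123 f01 f03 f02 f13 f12 f23 g01 g03 g02 g13 g12 g23 =
    N6_kernel t012 t013 t023 t123 f01 f02 f03 f12 f13 f23 g01 g02 g03 g12 g13 g23"
  "N6_kernel t012 t013 t023 t123 g01 g02 g03 g12 g13 g23 f01 f02 f03 f12 f13 f23 =
    N6_kernel t012 t013 t023 t123 f01 f02 f03 f12 f13 f23 g01 g02 g03 g12 g13 g23"
  by (simp_all only: N6_kernel_def add_ac wdot_commute)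

lemma N6_degree_commute:
  "N6_degree a c b d e = N6_degree a b c d e" "N6_degree b a c d e = N6_degree a b c d e"
  unfolding N6_degree_def N6_deg_def by (cases a; cases b; cases c; simp)+

section \<open>Six vertices: invariance and averaging\<close>

context trigraph
begin

definition kernel6 :: "(nat \<Rightarrow> 'v) \<Rightarrow> nat \<Rightarrow> nat \<Rightarrow> nat \<Rightarrow> nat \<Rightarrow> nat \<Rightarrow> nat \<Rightarrow> int" where
  "kernel6 \<phi> i j k l m n = N6_kernel (E (\<phi> i) (\<phi> j) (\<phi> k)) (E (\<phi> i) (\<phi> j) (\<phi> l)) (E (\<phi> i) (\<phi> k) (\<phi> l)) (E (\<phi> j) (\<phi> k) (\<phi> l)) (E (\<phi> i) (\<phi> j) (\<phi> m)) (E (\<phi> i) (\<phi> k) (\<phi> m)) (E (\<phi> i) (\<phi> l) (\<phi> m)) (E (\<phi> j) (\<phi> k) (\<phi> m)) (E (\<phi> j) (\<phi> l) (\<phi> m)) (E (\<phi> k) (\<phi> l) (\<phi> m)) (E (\<phi> i) (\<phi> j) (\<phi> n)) (E (\<phi> i) (\<phi> k) (\<phi> n)) (E (\<phi> i) (\<phi> l) (\<phi> n)) (E (\<phi> j) (\<phi> k) (\<phi> n)) (E (\<phi> j) (\<phi> l) (\<phi> n)) (E (\<phi> k) (\<phi> l) (\<phi> n))"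

definition degree6 :: "(nat \<Rightarrow> 'v) \<Rightarrow> nat \<Rightarrow> nat \<Rightarrow> nat \<Rightarrow> nat \<Rightarrow> nat \<Rightarrow> nat \<Rightarrow> int" where
  "degree6 \<phi> z x y i j k = N6_degree (E (\<phi> z) (\<phi> i) (\<phi> j)) (E (\<phi> z) (\<phi> i) (\<phi> k)) (E (\<phi> z) (\<phi> j) (\<phi> k)) (E (\<phi> i) (\<phi> j) (\<phi> k)) (E (\<phi> z) (\<phi> x) (\<phi> y))"

definition obj6 :: "(nat \<Rightarrow> 'v) \<Rightarrow> nat \<Rightarrow> nat \<Rightarrow> nat \<Rightarrow> nat \<Rightarrow> nat \<Rightarrow> nat \<Rightarrow> int" where
  "obj6 \<phi> i j k l m n = N6_obj (E (\<phi> i) (\<phi> j) (\<phi> k)) (E (\<phi> i) (\<phi> j) (\<phi> l)) (E (\<phi> i) (\<phi> k) (\<phi> l)) (E (\<phi> j) (\<phi> k) (\<phi> l)) (E (\<phi> i) (\<phi> j) (\<phi> m)) (E (\<phi> i) (\<phi> k) (\<phi> m)) (E (\<phi> j) (\<phi> k) (\<phi> m)) (E (\<phi> i) (\<phi> j) (\<phi> n)) (E (\<phi> i) (\<phi> k) (\<phi> n)) (E (\<phi> j) (\<phi> k) (\<phi> n)) (E (\<phi> l) (\<phi> m) (\<phi> n))"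

definition nsum :: "(nat \<Rightarrow> 'v) \<Rightarrow> int" where
  "nsum \<phi> = N6_S (E (\<phi> 0) (\<phi> 1) (\<phi> 2)) (E (\<phi> 0) (\<phi> 1) (\<phi> 3)) (E (\<phi> 0) (\<phi> 2) (\<phi> 3)) (E (\<phi> 1) (\<phi> 2) (\<phi> 3)) (E (\<phi> 0) (\<phi> 1) (\<phi> 4))
       (E (\<phi> 0) (\<phi> 2) (\<phi> 4)) (E (\<phi> 1) (\<phi> 2) (\<phi> 4)) (E (\<phi> 0) (\<phi> 3) (\<phi> 4)) (E (\<phi> 1) (\<phi> 3) (\<phi> 4)) (E (\<phi> 2) (\<phi> 3) (\<phi> 4))
       (E (\<phi> 0) (\<phi> 1) (\<phi> 5)) (E (\<phi> 0) (\<phi> 2) (\<phi> 5)) (E (\<phi> 1) (\<phi> 2) (\<phi> 5)) (E (\<phi> 0) (\<phi> 3) (\<phi> 5)) (E (\<phi> 1) (\<phi> 3) (\<phi> 5))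
       (E (\<phi> 2) (\<phi> 3) (\<phi> 5)) (E (\<phi> 0) (\<phi> 4) (\<phi> 5)) (E (\<phi> 1) (\<phi> 4) (\<phi> 5)) (E (\<phi> 2) (\<phi> 4) (\<phi> 5)) (E (\<phi> 3) (\<phi> 4) (\<phi> 5))"

definition nbits :: "(nat \<Rightarrow> 'v) \<Rightarrow> bool list" where
  "nbits \<phi> = [(E (\<phi> 0) (\<phi> 1) (\<phi> 2)), (E (\<phi> 0) (\<phi> 1) (\<phi> 3)), (E (\<phi> 0) (\<phi> 2) (\<phi> 3)), (E (\<phi> 1) (\<phi> 2) (\<phi> 3)), (E (\<phi> 0) (\<phi> 1) (\<phi> 4)),
       (E (\<phi> 0) (\<phi> 2) (\<phi> 4)), (E (\<phi> 1) (\<phi> 2) (\<phi> 4)), (E (\<phi> 0) (\<phi> 3) (\<phi> 4)), (E (\<phi> 1) (\<phi> 3) (\<phi> 4)), (E (\<phi> 2) (\<phi> 3) (\<phi> 4)),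
       (E (\<phi> 0) (\<phi> 1) (\<phi> 5)), (E (\<phi> 0) (\<phi> 2) (\<phi> 5)), (E (\<phi> 1) (\<phi> 2) (\<phi> 5)), (E (\<phi> 0) (\<phi> 3) (\<phi> 5)), (E (\<phi> 1) (\<phi> 3) (\<phi> 5)),
       (E (\<phi> 2) (\<phi> 3) (\<phi> 5)), (E (\<phi> 0) (\<phi> 4) (\<phi> 5)), (E (\<phi> 1) (\<phi> 4) (\<phi> 5)), (E (\<phi> 2) (\<phi> 4) (\<phi> 5)), (E (\<phi> 3) (\<phi> 4) (\<phi> 5))]"

lemma kernel6_commute:
  "kernel6 \<phi> j i k l m n = kernel6 \<phi> i j k l m n" "kernel6 \<phi> i k j l m n = kernel6 \<phi> i j k l m n"
  "kernel6 \<phi> i j l k m n = kernel6 \<phi> i j k l m n" "kernel6 \<phi> i j k l n m = kernel6 \<phi> i j k l m n"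
  unfolding kernel6_def
  by (subst N6_kernel_commute(1)[symmetric], simp only: E_ac)
    (subst N6_kernel_commute(2)[symmetric], simp only: E_ac,
     subst N6_kernel_commute(3)[symmetric], simp only: E_ac,
     subst N6_kernel_commute(4)[symmetric], simp only: E_ac)

lemma degree6_commute:
  "degree6 \<phi> z y x i j k = degree6 \<phi> z x y i j k" "degree6 \<phi> z x y j i k = degree6 \<phi> z x y i j k"
  "degree6 \<phi> z x y i k j = degree6 \<phi> z x y i j k"
  unfolding degree6_def by (simp_all add: E_ac N6_degree_commute)

lemma obj6_commute:
  "obj6 \<phi> j i k l m n = obj6 \<phi> i j k l m n" "obj6 \<phi> i k j l m n = obj6 \<phi> i j k l m n"
  "obj6 \<phi> i j k m l n = obj6 \<phi> i j k l m n" "obj6 \<phi> i j k l n m = obj6 \<phi> i j k l m n"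
  unfolding obj6_def N6_obj_def
  by (subst N6_obj_aux_commute(1)[symmetric], simp only: E_ac conj_commute)
    (subst N6_obj_aux_commute(2)[symmetric], simp only: E_ac conj_commute,
     subst N6_obj_aux_commute(3)[symmetric], simp only: E_ac conj_commute,
     subst N6_obj_aux_commute(4)[symmetric], simp only: E_ac conj_commute)

lemma kernel6_swap: "kernel6 (swap a b \<phi>) i j k l m n = kernel6 \<phi> (tr a b i) (tr a b j) (tr a b k) (tr a b l) (tr a b m) (tr a b n)"
  and degree6_swap: "degree6 (swap a b \<phi>) i j k l m n = degree6 \<phi> (tr a b i) (tr a b j) (tr a b k) (tr a b l) (tr a b m) (tr a b n)"
  and obj6_swap: "obj6 (swap a b \<phi>) i j k l m n = obj6 \<phi> (tr a b i) (tr a b j) (tr a b k) (tr a b l) (tr a b m) (tr a b n)"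
  if "tr = (\<lambda>a b i. if i = a then b else if i = b then a else i)" for tr
  unfolding kernel6_def degree6_def obj6_def swap_apply that by (rule refl)+

definition ksum :: "(nat \<Rightarrow> 'v) \<Rightarrow> int" where
  "ksum \<phi> = kernel6 \<phi> 0 1 2 3 4 5 + kernel6 \<phi> 0 1 2 4 3 5 + kernel6 \<phi> 0 1 2 5 3 4 + kernel6 \<phi> 0 1 3 4 2 5 + 
    kernel6 \<phi> 0 1 3 5 2 4 + kernel6 \<phi> 0 1 4 5 2 3 + kernel6 \<phi> 0 2 3 4 1 5 + kernel6 \<phi> 0 2 3 5 1 4 + 
    kernel6 \<phi> 0 2 4 5 1 3 + kernel6 \<phi> 0 3 4 5 1 2 + kernel6 \<phi> 1 2 3 4 0 5 + kernel6 \<phi> 1 2 3 5 0 4 + 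
    kernel6 \<phi> 1 2 4 5 0 3 + kernel6 \<phi> 1 3 4 5 0 2 + kernel6 \<phi> 2 3 4 5 0 1"

definition dsum :: "(nat \<Rightarrow> 'v) \<Rightarrow> int" where
  "dsum \<phi> = degree6 \<phi> 0 1 2 3 4 5 + degree6 \<phi> 0 1 3 2 4 5 + degree6 \<phi> 0 1 4 2 3 5 + degree6 \<phi> 0 1 5 2 3 4 + 
    degree6 \<phi> 0 2 3 1 4 5 + degree6 \<phi> 0 2 4 1 3 5 + degree6 \<phi> 0 2 5 1 3 4 + degree6 \<phi> 0 3 4 1 2 5 + 
    degree6 \<phi> 0 3 5 1 2 4 + degree6 \<phi> 0 4 5 1 2 3 + degree6 \<phi> 1 0 2 3 4 5 + degree6 \<phi> 1 0 3 2 4 5 + 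
    degree6 \<phi> 1 0 4 2 3 5 + degree6 \<phi> 1 0 5 2 3 4 + degree6 \<phi> 1 2 3 0 4 5 + degree6 \<phi> 1 2 4 0 3 5 + 
    degree6 \<phi> 1 2 5 0 3 4 + degree6 \<phi> 1 3 4 0 2 5 + degree6 \<phi> 1 3 5 0 2 4 + degree6 \<phi> 1 4 5 0 2 3 + 
    degree6 \<phi> 2 0 1 3 4 5 + degree6 \<phi> 2 0 3 1 4 5 + degree6 \<phi> 2 0 4 1 3 5 + degree6 \<phi> 2 0 5 1 3 4 + 
    degree6 \<phi> 2 1 3 0 4 5 + degree6 \<phi> 2 1 4 0 3 5 + degree6 \<phi> 2 1 5 0 3 4 + degree6 \<phi> 2 3 4 0 1 5 + 
    degree6 \<phi> 2 3 5 0 1 4 + degree6 \<phi> 2 4 5 0 1 3 + degree6 \<phi> 3 0 1 2 4 5 + degree6 \<phi> 3 0 2 1 4 5 + 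
    degree6 \<phi> 3 0 4 1 2 5 + degree6 \<phi> 3 0 5 1 2 4 + degree6 \<phi> 3 1 2 0 4 5 + degree6 \<phi> 3 1 4 0 2 5 + 
    degree6 \<phi> 3 1 5 0 2 4 + degree6 \<phi> 3 2 4 0 1 5 + degree6 \<phi> 3 2 5 0 1 4 + degree6 \<phi> 3 4 5 0 1 2 + 
    degree6 \<phi> 4 0 1 2 3 5 + degree6 \<phi> 4 0 2 1 3 5 + degree6 \<phi> 4 0 3 1 2 5 + degree6 \<phi> 4 0 5 1 2 3 + 
    degree6 \<phi> 4 1 2 0 3 5 + degree6 \<phi> 4 1 3 0 2 5 + degree6 \<phi> 4 1 5 0 2 3 + degree6 \<phi> 4 2 3 0 1 5 + 
    degree6 \<phi> 4 2 5 0 1 3 + degree6 \<phi> 4 3 5 0 1 2 + degree6 \<phi> 5 0 1 2 3 4 + degree6 \<phi> 5 0 2 1 3 4 + 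
    degree6 \<phi> 5 0 3 1 2 4 + degree6 \<phi> 5 0 4 1 2 3 + degree6 \<phi> 5 1 2 0 3 4 + degree6 \<phi> 5 1 3 0 2 4 + 
    degree6 \<phi> 5 1 4 0 2 3 + degree6 \<phi> 5 2 3 0 1 4 + degree6 \<phi> 5 2 4 0 1 3 + degree6 \<phi> 5 3 4 0 1 2"

definition gsum :: "(nat \<Rightarrow> 'v) \<Rightarrow> int" where
  "gsum \<phi> = obj6 \<phi> 0 1 2 3 4 5 + obj6 \<phi> 0 1 3 2 4 5 + obj6 \<phi> 0 1 4 2 3 5 + obj6 \<phi> 0 1 5 2 3 4 + 
    obj6 \<phi> 0 2 3 1 4 5 + obj6 \<phi> 0 2 4 1 3 5 + obj6 \<phi> 0 2 5 1 3 4 + obj6 \<phi> 0 3 4 1 2 5 + 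
    obj6 \<phi> 0 3 5 1 2 4 + obj6 \<phi> 0 4 5 1 2 3 + obj6 \<phi> 1 2 3 0 4 5 + obj6 \<phi> 1 2 4 0 3 5 + 
    obj6 \<phi> 1 2 5 0 3 4 + obj6 \<phi> 1 3 4 0 2 5 + obj6 \<phi> 1 3 5 0 2 4 + obj6 \<phi> 1 4 5 0 2 3 + 
    obj6 \<phi> 2 3 4 0 1 5 + obj6 \<phi> 2 3 5 0 1 4 + obj6 \<phi> 2 4 5 0 1 3 + obj6 \<phi> 3 4 5 0 1 2"

lemma nsum_eq: "nsum \<phi> = 2 * ksum \<phi> + 12 * dsum \<phi> - 1256 * gsum \<phi>"
  unfolding nsum_def N6_S_def ksum_def dsum_def gsum_def kernel6_def degree6_def obj6_def by (simp only: E_ac)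

lemma ksum_swap_adjacent:
  "ksum (swap 0 1 \<phi>) = ksum \<phi>" "ksum (swap 1 2 \<phi>) = ksum \<phi>"
  "ksum (swap 2 3 \<phi>) = ksum \<phi>" "ksum (swap 3 4 \<phi>) = ksum \<phi>"
  "ksum (swap 4 5 \<phi>) = ksum \<phi>"
  unfolding ksum_def kernel6_swap[OF refl]
  by (simp_all add: kernel6_commute add_ac)

lemma dsum_swap_adjacent:
  "dsum (swap 0 1 \<phi>) = dsum \<phi>" "dsum (swap 1 2 \<phi>) = dsum \<phi>"
  "dsum (swap 2 3 \<phi>) = dsum \<phi>" "dsum (swap 3 4 \<phi>) = dsum \<phi>"
  "dsum (swap 4 5 \<phi>) = dsum \<phi>"
  unfolding dsum_def degree6_swap[OF refl]
  by (simp_all add: degree6_commute add_ac)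

lemma gsum_swap_adjacent:
  "gsum (swap 0 1 \<phi>) = gsum \<phi>" "gsum (swap 1 2 \<phi>) = gsum \<phi>"
  "gsum (swap 2 3 \<phi>) = gsum \<phi>" "gsum (swap 3 4 \<phi>) = gsum \<phi>"
  "gsum (swap 4 5 \<phi>) = gsum \<phi>"
  unfolding gsum_def obj6_swap[OF refl]
  by (simp_all add: obj6_commute add_ac)

lemma nsum_swap_adjacent:
  "nsum (swap 0 1 \<phi>) = nsum \<phi>" "nsum (swap 1 2 \<phi>) = nsum \<phi>"
  "nsum (swap 2 3 \<phi>) = nsum \<phi>" "nsum (swap 3 4 \<phi>) = nsum \<phi>"
  "nsum (swap 4 5 \<phi>) = nsum \<phi>"
  by (simp_all only: nsum_eq ksum_swap_adjacent dsum_swap_adjacent gsum_swap_adjacent)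

end

context trigraph
begin

lemma nsum_swap: "i < j \<Longrightarrow> j < 6 \<Longrightarrow> nsum (swap i j \<phi>) = nsum \<phi>"
proof (induction j arbitrary: \<phi>)
  case (Suc j)
  show ?case
  proof (cases "i = j")
    case True
    then have "j \<in> {0, 1, 2, 3, 4}" using Suc.prems by auto
    then show ?thesis using nsum_swap_adjacent True by (auto simp: numeral_eq_Suc)
  next
    case False
    then have IH: "nsum (swap i j \<phi>) = nsum \<phi>" for \<phi> using Suc by simp
    have "j \<in> {0, 1, 2, 3, 4}" using Suc.prems by auto
    then have adj: "nsum (swap j (Suc j) \<phi>) = nsum \<phi>" for \<phi>
      using nsum_swap_adjacent by (auto simp: numeral_eq_Suc)
    show ?thesis
      using Suc.prems False by (subst swap_via[of i j]) (auto simp: IH adj)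
  qed
qed simp

text \<open>Each permutation is written as a product of transpositions, so invariance of
  \<open>nsum\<close> under transpositions covers the whole list.\<close>

definition symmetries :: "((nat \<Rightarrow> 'v) \<Rightarrow> nat \<Rightarrow> 'v) list" where
  "symmetries = [\<lambda>\<phi>. swap 0 1 \<phi>,
     \<lambda>\<phi>. swap 0 2 \<phi>,
     \<lambda>\<phi>. swap 0 3 \<phi>,
     \<lambda>\<phi>. swap 0 4 \<phi>,
     \<lambda>\<phi>. swap 0 5 \<phi>,
     \<lambda>\<phi>. swap 1 2 \<phi>,
     \<lambda>\<phi>. swap 1 3 \<phi>,
     \<lambda>\<phi>. swap 1 4 \<phi>,
     \<lambda>\<phi>. swap 1 5 \<phi>,
     \<lambda>\<phi>. swap 2 3 \<phi>,
     \<lambda>\<phi>. swap 2 4 \<phi>,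
     \<lambda>\<phi>. swap 2 5 \<phi>,
     \<lambda>\<phi>. swap 3 4 \<phi>,
     \<lambda>\<phi>. swap 3 5 \<phi>,
     \<lambda>\<phi>. swap 4 5 \<phi>,
     \<lambda>\<phi>. swap 0 1 (swap 3 4 \<phi>),
     \<lambda>\<phi>. swap 0 1 (swap 2 3 \<phi>),
     \<lambda>\<phi>. swap 1 3 (swap 2 3 (swap 4 5 \<phi>)),
     \<lambda>\<phi>. swap 0 3 (swap 1 2 (swap 2 3 (swap 4 5 \<phi>))),
     \<lambda>\<phi>. swap 0 1 (swap 1 2 (swap 2 4 (swap 3 4 (swap 4 5 \<phi>)))),
     \<lambda>\<phi>. swap 0 2 (swap 1 3 (swap 2 4 (swap 3 5 \<phi>))),
     \<lambda>\<phi>. swap 0 4 (swap 2 5 (swap 3 4 \<phi>)),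
     \<lambda>\<phi>. swap 0 4 (swap 1 5 (swap 2 3 (swap 3 5 (swap 4 5 \<phi>)))),
     \<lambda>\<phi>. swap 2 3 (swap 4 5 \<phi>),
     \<lambda>\<phi>. swap 0 1 (swap 1 2 (swap 2 3 (swap 4 5 \<phi>)))]"

definition pbits :: "(nat \<Rightarrow> 'v) \<Rightarrow> bool list" where
  "pbits \<phi> = [(E (\<phi> 0) (\<phi> 1) (\<phi> 2)), (E (\<phi> 0) (\<phi> 1) (\<phi> 3)), (E (\<phi> 0) (\<phi> 2) (\<phi> 3)), (E (\<phi> 1) (\<phi> 2) (\<phi> 3)), (E (\<phi> 0) (\<phi> 1) (\<phi> 4)),
       (E (\<phi> 0) (\<phi> 2) (\<phi> 4)), (E (\<phi> 1) (\<phi> 2) (\<phi> 4)), (E (\<phi> 0) (\<phi> 3) (\<phi> 4)), (E (\<phi> 1) (\<phi> 3) (\<phi> 4)), (E (\<phi> 2) (\<phi> 3) (\<phi> 4))]"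

definition qbits :: "(nat \<Rightarrow> 'v) \<Rightarrow> bool list" where
  "qbits \<phi> = [(E (\<phi> 0) (\<phi> 1) (\<phi> 5)), (E (\<phi> 0) (\<phi> 2) (\<phi> 5)), (E (\<phi> 1) (\<phi> 2) (\<phi> 5)), (E (\<phi> 0) (\<phi> 3) (\<phi> 5)), (E (\<phi> 1) (\<phi> 3) (\<phi> 5)),
       (E (\<phi> 2) (\<phi> 3) (\<phi> 5)), (E (\<phi> 0) (\<phi> 4) (\<phi> 5)), (E (\<phi> 1) (\<phi> 4) (\<phi> 5)), (E (\<phi> 2) (\<phi> 4) (\<phi> 5)), (E (\<phi> 3) (\<phi> 4) (\<phi> 5))]"

lemma nbits_append: "nbits \<phi> = pbits \<phi> @ qbits \<phi>"
  by (simp add: nbits_def pbits_def qbits_def)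

lemma allowed6: "allowed6 (E a b c) (E a b d) (E a c d) (E b c d) (E a b e)
     (E a c e) (E b c e) (E a d e) (E b d e) (E c d e)
     (E a b f) (E a c f) (E b c f) (E a d f) (E b d f)
     (E c d f) (E a e f) (E b e f) (E c e f) (E d e f)"
  using no_C5_or_no_F2
proof
  assume *: "\<forall>a b c d e. \<not> (E a b c \<and> E b c d \<and> E c d e \<and> E d e a \<and> E e a b)"
  show ?thesis
    unfolding allowed6_def by (simp only: not_has_C5[OF *] if_False)
next
  assume *: "\<forall>a b c d e f. \<not> (E a b c \<and> E a c d \<and> E a d e \<and> E a e f \<and> E a f b \<and> E b c d)"
  have "\<not> (E b c d \<and> E a b e \<and> E b d e \<and> E c d e \<and> E a b f \<and> E b c f)"
    using *[rule_format, of b c d e a f] by (auto simp: E_ac)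
  moreover have "\<not> (E b c d \<and> E a c e \<and> E b c e \<and> E a c f \<and> E a d f \<and> E c d f)"
    using *[rule_format, of c a f d b e] by (auto simp: E_ac)
  moreover have "\<not> (E b c d \<and> E a d e \<and> E b d e \<and> E b c f \<and> E a d f \<and> E c d f)"
    using *[rule_format, of d b c f a e] by (auto simp: E_ac)
  moreover have "\<not> (E b c e \<and> E a d e \<and> E c d e \<and> E a b f \<and> E a e f \<and> E b e f)"
    using *[rule_format, of e a f b c d] by (auto simp: E_ac)
  moreover have "\<not> (E a c e \<and> E a d e \<and> E b d e \<and> E b c f \<and> E b e f \<and> E c e f)"
    using *[rule_format, of e b f c a d] by (auto simp: E_ac)
  moreover have "\<not> (E a d e \<and> E a b f \<and> E b c f \<and> E a d f \<and> E c e f \<and> E d e f)"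
    using *[rule_format, of f a d e c b] by (auto simp: E_ac)
  moreover have "\<not> (E b c e \<and> E a c f \<and> E a d f \<and> E b d f \<and> E b e f \<and> E c e f)"
    using *[rule_format, of f b e c a d] by (auto simp: E_ac)
  moreover have "\<not> (E a d e \<and> E b c f \<and> E a d f \<and> E c d f \<and> E a e f \<and> E b e f)"
    using *[rule_format, of f d a e b c] by (auto simp: E_ac)
  ultimately have "\<not> some_F2 (E a b c) (E a b d) (E a c d) (E b c d) (E a b e)
     (E a c e) (E b c e) (E a d e) (E b d e) (E c d e)
     (E a b f) (E a c f) (E b c f) (E a d f) (E b d f)
     (E c d f) (E a e f) (E b e f) (E c e f) (E d e f)"
    unfolding some_F2_def de_Morgan_disj by (intro conjI)
  then show ?thesis
    unfolding allowed6_def by (simp only: not_has_F1[OF *] if_False simp_thms if_cancel)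
qed

text \<open>At an assignment that none of the \<open>symmetries\<close> lowers, both minimality
  tests succeed and the hypotheses rule out every other exit of the enumeration, so the inequality
  of the leaf applies.\<close>

lemma nsum_nonpos:
  assumes chk: "all10 N6_prefix"
  shows "nsum \<phi> \<le> 0"
proof (rule minimal_code_induct[where code = "\<lambda>\<phi>. bcode (nbits \<phi>)" and p = \<phi> and T = "set symmetries"])
  fix \<phi> t
  assume "t \<in> set symmetries" "nsum (t \<phi>) \<le> 0"
  then show "nsum \<phi> \<le> 0" unfolding symmetries_def by (auto simp: nsum_swap)
next
  fix \<phi>
  assume "\<And>t. t \<in> set symmetries \<Longrightarrow> bcode (nbits \<phi>) \<le> bcode (nbits (t \<phi>))"
  then have le: "lexle (nbits \<phi>) (nbits (t \<phi>))" if "t \<in> set symmetries" for t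
    using that by (intro lexle_if_bcode_le) (auto simp: nbits_def)
  have le': "lexle (pbits \<phi>) (pbits (t \<phi>))" if "t \<in> set symmetries" for t
    using le[OF that] unfolding nbits_append by (rule lexle_append[rotated]) (simp add: pbits_def)
  have "\<forall>t\<in>set symmetries. lexle (nbits \<phi>) (nbits (t \<phi>))" using le by blast
  then have lm: "lexmin6 (E (\<phi> 0) (\<phi> 1) (\<phi> 2)) (E (\<phi> 0) (\<phi> 1) (\<phi> 3)) (E (\<phi> 0) (\<phi> 2) (\<phi> 3)) (E (\<phi> 1) (\<phi> 2) (\<phi> 3)) (E (\<phi> 0) (\<phi> 1) (\<phi> 4))
       (E (\<phi> 0) (\<phi> 2) (\<phi> 4)) (E (\<phi> 1) (\<phi> 2) (\<phi> 4)) (E (\<phi> 0) (\<phi> 3) (\<phi> 4)) (E (\<phi> 1) (\<phi> 3) (\<phi> 4)) (E (\<phi> 2) (\<phi> 3) (\<phi> 4))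
       (E (\<phi> 0) (\<phi> 1) (\<phi> 5)) (E (\<phi> 0) (\<phi> 2) (\<phi> 5)) (E (\<phi> 1) (\<phi> 2) (\<phi> 5)) (E (\<phi> 0) (\<phi> 3) (\<phi> 5)) (E (\<phi> 1) (\<phi> 3) (\<phi> 5))
       (E (\<phi> 2) (\<phi> 3) (\<phi> 5)) (E (\<phi> 0) (\<phi> 4) (\<phi> 5)) (E (\<phi> 1) (\<phi> 4) (\<phi> 5)) (E (\<phi> 2) (\<phi> 4) (\<phi> 5)) (E (\<phi> 3) (\<phi> 4) (\<phi> 5))"
    unfolding lexmin6_def symmetries_def nbits_def swap_def by (simp add: E_ac del: lexle.simps)
  have "\<forall>t\<in>set symmetries. lexle (pbits \<phi>) (pbits (t \<phi>))" using le' by blast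
  then have pm: "prefix_lexmin (E (\<phi> 0) (\<phi> 1) (\<phi> 2)) (E (\<phi> 0) (\<phi> 1) (\<phi> 3)) (E (\<phi> 0) (\<phi> 2) (\<phi> 3)) (E (\<phi> 1) (\<phi> 2) (\<phi> 3)) (E (\<phi> 0) (\<phi> 1) (\<phi> 4))
       (E (\<phi> 0) (\<phi> 2) (\<phi> 4)) (E (\<phi> 1) (\<phi> 2) (\<phi> 4)) (E (\<phi> 0) (\<phi> 3) (\<phi> 4)) (E (\<phi> 1) (\<phi> 3) (\<phi> 4)) (E (\<phi> 2) (\<phi> 3) (\<phi> 4))"
    unfolding prefix_lexmin_def symmetries_def pbits_def swap_def by (simp add: E_ac del: lexle.simps)
  have k4: "\<not> has_K4 (E (\<phi> 0) (\<phi> 1) (\<phi> 2)) (E (\<phi> 0) (\<phi> 1) (\<phi> 3)) (E (\<phi> 0) (\<phi> 2) (\<phi> 3)) (E (\<phi> 1) (\<phi> 2) (\<phi> 3)) (E (\<phi> 0) (\<phi> 1) (\<phi> 4))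
       (E (\<phi> 0) (\<phi> 2) (\<phi> 4)) (E (\<phi> 1) (\<phi> 2) (\<phi> 4)) (E (\<phi> 0) (\<phi> 3) (\<phi> 4)) (E (\<phi> 1) (\<phi> 3) (\<phi> 4)) (E (\<phi> 2) (\<phi> 3) (\<phi> 4))"
    using allowed5 unfolding allowed5_def by (metis (full_types))
  have "N6_prefix (E (\<phi> 0) (\<phi> 1) (\<phi> 2)) (E (\<phi> 0) (\<phi> 1) (\<phi> 3)) (E (\<phi> 0) (\<phi> 2) (\<phi> 3)) (E (\<phi> 1) (\<phi> 2) (\<phi> 3)) (E (\<phi> 0) (\<phi> 1) (\<phi> 4))
       (E (\<phi> 0) (\<phi> 2) (\<phi> 4)) (E (\<phi> 1) (\<phi> 2) (\<phi> 4)) (E (\<phi> 0) (\<phi> 3) (\<phi> 4)) (E (\<phi> 1) (\<phi> 3) (\<phi> 4)) (E (\<phi> 2) (\<phi> 3) (\<phi> 4))"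
    using chk unfolding all_iff by blast
  then have "all6 (N6_mid (E (\<phi> 0) (\<phi> 1) (\<phi> 2)) (E (\<phi> 0) (\<phi> 1) (\<phi> 3)) (E (\<phi> 0) (\<phi> 2) (\<phi> 3)) (E (\<phi> 1) (\<phi> 2) (\<phi> 3)) (E (\<phi> 0) (\<phi> 1) (\<phi> 4))
       (E (\<phi> 0) (\<phi> 2) (\<phi> 4)) (E (\<phi> 1) (\<phi> 2) (\<phi> 4)) (E (\<phi> 0) (\<phi> 3) (\<phi> 4)) (E (\<phi> 1) (\<phi> 3) (\<phi> 4)) (E (\<phi> 2) (\<phi> 3) (\<phi> 4)))"
    unfolding N6_prefix_def by (simp only: pm k4 if_True if_False)
  then have "N6_mid (E (\<phi> 0) (\<phi> 1) (\<phi> 2)) (E (\<phi> 0) (\<phi> 1) (\<phi> 3)) (E (\<phi> 0) (\<phi> 2) (\<phi> 3)) (E (\<phi> 1) (\<phi> 2) (\<phi> 3)) (E (\<phi> 0) (\<phi> 1) (\<phi> 4))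
       (E (\<phi> 0) (\<phi> 2) (\<phi> 4)) (E (\<phi> 1) (\<phi> 2) (\<phi> 4)) (E (\<phi> 0) (\<phi> 3) (\<phi> 4)) (E (\<phi> 1) (\<phi> 3) (\<phi> 4)) (E (\<phi> 2) (\<phi> 3) (\<phi> 4)) (E (\<phi> 0) (\<phi> 1) (\<phi> 5)) (E (\<phi> 0) (\<phi> 2) (\<phi> 5)) (E (\<phi> 1) (\<phi> 2) (\<phi> 5)) (E (\<phi> 0) (\<phi> 3) (\<phi> 5)) (E (\<phi> 1) (\<phi> 3) (\<phi> 5))
       (E (\<phi> 2) (\<phi> 3) (\<phi> 5))"
    unfolding all_iff by blast
  then have "all4 (N6_leaf (E (\<phi> 0) (\<phi> 1) (\<phi> 2)) (E (\<phi> 0) (\<phi> 1) (\<phi> 3)) (E (\<phi> 0) (\<phi> 2) (\<phi> 3)) (E (\<phi> 1) (\<phi> 2) (\<phi> 3)) (E (\<phi> 0) (\<phi> 1) (\<phi> 4))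
       (E (\<phi> 0) (\<phi> 2) (\<phi> 4)) (E (\<phi> 1) (\<phi> 2) (\<phi> 4)) (E (\<phi> 0) (\<phi> 3) (\<phi> 4)) (E (\<phi> 1) (\<phi> 3) (\<phi> 4)) (E (\<phi> 2) (\<phi> 3) (\<phi> 4)) (E (\<phi> 0) (\<phi> 1) (\<phi> 5)) (E (\<phi> 0) (\<phi> 2) (\<phi> 5)) (E (\<phi> 1) (\<phi> 2) (\<phi> 5)) (E (\<phi> 0) (\<phi> 3) (\<phi> 5)) (E (\<phi> 1) (\<phi> 3) (\<phi> 5))
       (E (\<phi> 2) (\<phi> 3) (\<phi> 5)))"
    unfolding N6_mid_def by (simp only: no_K4 simp_thms if_False)
  then have "N6_leaf (E (\<phi> 0) (\<phi> 1) (\<phi> 2)) (E (\<phi> 0) (\<phi> 1) (\<phi> 3)) (E (\<phi> 0) (\<phi> 2) (\<phi> 3)) (E (\<phi> 1) (\<phi> 2) (\<phi> 3)) (E (\<phi> 0) (\<phi> 1) (\<phi> 4))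
       (E (\<phi> 0) (\<phi> 2) (\<phi> 4)) (E (\<phi> 1) (\<phi> 2) (\<phi> 4)) (E (\<phi> 0) (\<phi> 3) (\<phi> 4)) (E (\<phi> 1) (\<phi> 3) (\<phi> 4)) (E (\<phi> 2) (\<phi> 3) (\<phi> 4))
       (E (\<phi> 0) (\<phi> 1) (\<phi> 5)) (E (\<phi> 0) (\<phi> 2) (\<phi> 5)) (E (\<phi> 1) (\<phi> 2) (\<phi> 5)) (E (\<phi> 0) (\<phi> 3) (\<phi> 5)) (E (\<phi> 1) (\<phi> 3) (\<phi> 5))
       (E (\<phi> 2) (\<phi> 3) (\<phi> 5)) (E (\<phi> 0) (\<phi> 4) (\<phi> 5)) (E (\<phi> 1) (\<phi> 4) (\<phi> 5)) (E (\<phi> 2) (\<phi> 4) (\<phi> 5)) (E (\<phi> 3) (\<phi> 4) (\<phi> 5))"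
    unfolding all_iff by blast
  then show "nsum \<phi> \<le> 0"
    unfolding N6_leaf_def nsum_def by (simp only: no_K4 lm allowed6 simp_thms if_False if_True)
qed

end

lemma real_pair_overlap:
  "real_of_int (pair_overlap x1 x2 x3 y1 y2 y3) =
     of_bool x1 * of_bool y2 + of_bool x1 * of_bool y3 + of_bool x2 * of_bool y1 +
     of_bool x2 * of_bool y3 + of_bool x3 * of_bool y1 + of_bool x3 * of_bool y2"
  unfolding pair_overlap_def by (cases x1; cases x2; cases x3; simp)

lemma real_N6_obj_aux:
  "real_of_int (N6_obj_aux True e x1 x2 x3 y1 y2 y3 z1 z2 z3) =
     360000 * (of_bool (e \<and> two x1 y1 z1) + of_bool (e \<and> two x2 y2 z2) + of_bool (e \<and> two x3 y3 z3))
     - 180000 * (real_of_int (pair_overlap x1 x2 x3 y1 y2 y3) + real_of_int (pair_overlap x1 x2 x3 z1 z2 z3)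
         + real_of_int (pair_overlap y1 y2 y3 z1 z2 z3)) - 145080"
  by (cases e; cases "two x1 y1 z1"; cases "two x2 y2 z2"; cases "two x3 y3 z3")
    (simp_all only: N6_obj_aux_def of_int_diff of_int_mult of_int_add of_int_numeral if_True if_False simp_thms
      of_bool_eq of_int_0 of_int_1, simp_all)

lemma N6_deg_nonneg: "0 \<le> N6_deg a b c d"
  by (simp add: N6_deg_def)

lemma N6_W_nonneg: "\<forall>d\<in>set (N6_W t1 t2 t3 t4). 0 \<le> d"
  by (simp add: N6_W_def N6_W0_def N6_W1_def N6_W2_def N6_W3_def)

context trigraph
begin

definition points6 :: "nat list" where
  "points6 = [0, 1, 2, 3, 4, 5]"

lemma avgs6:
  assumes "sort [i, j, k, l, m, n] = points6"
  shows "avgs points6 (\<lambda>\<phi>. g (\<phi> i) (\<phi> j) (\<phi> k) (\<phi> l) (\<phi> m) (\<phi> n)) \<phi> =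
    avg (\<lambda>a. avg (\<lambda>b. avg (\<lambda>c. avg (\<lambda>d. avg (\<lambda>x. avg (\<lambda>y. g a b c d x y))))))"
proof -
  have ix: "set [i, j, k, l, m, n] = set points6" "distinct [i, j, k, l, m, n]"
    using arg_cong[OF assms, of set] arg_cong[OF assms, of distinct] unfolding set_sort distinct_sort
    by (simp_all add: points6_def)
  have "avgs points6 (\<lambda>\<phi>. g (\<phi> i) (\<phi> j) (\<phi> k) (\<phi> l) (\<phi> m) (\<phi> n)) \<phi> =
      avgs [i, j, k, l, m, n] (\<lambda>\<phi>. g (\<phi> i) (\<phi> j) (\<phi> k) (\<phi> l) (\<phi> m) (\<phi> n)) \<phi>"
    using ix by (intro avgs_perm) (simp_all add: points6_def)
  then show ?thesis using ix(2) by simp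
qed

text \<open>With the four vertices of the type fixed, each of the 24 summands is a weighted Gram
  form in two independent vertices.\<close>

lemma avg_kernel6_nonneg:
  assumes "sort [i, j, k, l, m, n] = points6"
  shows "0 \<le> avgs points6 (\<lambda>\<phi>. real_of_int (kernel6 \<phi> i j k l m n)) \<phi>"
  unfolding kernel6_def
  by (subst avgs6[OF assms, where g = "\<lambda>a b c d x y. real_of_int (N6_kernel
      (E a b c) (E a b d) (E a c d) (E b c d)
      (E a b x) (E a c x) (E a d x) (E b c x) (E b d x) (E c d x)
      (E a b y) (E a c y) (E a d y) (E b c y) (E b d y) (E c d y))"], rule avg_nonneg, rule avg_nonneg,
      rule avg_nonneg, rule avg_nonneg, unfold N6_kernel_def of_int_add avg_add)
    (intro add_nonneg_nonneg avg_wdot_nonneg N6_W_nonneg)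

lemma avg_degree6_nonneg:
  assumes "sort [z, i, j, k, x, y] = points6"
    and deg: "\<And>u. u \<in> V \<Longrightarrow> 0 \<le> avg (\<lambda>x. avg (\<lambda>y. if E u x y then 5359 else - 4641))"
  shows "0 \<le> avgs points6 (\<lambda>\<phi>. real_of_int (degree6 \<phi> z x y i j k)) \<phi>"
proof -
  have "real_of_int (N6_degree p q r s e) = real_of_int (N6_deg p q r s) * (if e then 5359 else - 4641)"
    for p q r s e by (simp add: N6_degree_def)
  then show ?thesis
    unfolding degree6_def
    by (subst avgs6[OF assms(1), where g = "\<lambda>a b c d x y. real_of_int (N6_degree
        (E a b c) (E a b d) (E a c d) (E b c d) (E a x y))"])
      (auto intro!: avg_nonneg mult_nonneg_nonneg deg simp: avg_cmult N6_deg_nonneg)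
qed

definition mean_obj :: real where
  "mean_obj = avg (\<lambda>a. avg (\<lambda>b. avg (\<lambda>c. avg (\<lambda>x. avg (\<lambda>y. avg (\<lambda>z. real_of_int (N6_obj (E a b c)
     (E a b x) (E a c x) (E b c x) (E a b y) (E a c y) (E b c y) (E a b z) (E a c z) (E b c z) (E x y z))))))))"

lemma avg_obj6:
  assumes "sort [i, j, k, l, m, n] = points6"
  shows "avgs points6 (\<lambda>\<phi>. real_of_int (obj6 \<phi> i j k l m n)) \<phi> = mean_obj"
  unfolding obj6_def mean_obj_def
  by (rule avgs6[OF assms, where g = "\<lambda>a b c x y z. real_of_int (N6_obj (E a b c)
     (E a b x) (E a c x) (E b c x) (E a b y) (E a c y) (E b c y) (E a b z) (E a c z) (E b c z) (E x y z))"])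

lemma mean_obj_nonneg:
  assumes nsum: "\<And>\<phi>. nsum \<phi> \<le> 0"
    and deg: "\<And>u. u \<in> V \<Longrightarrow> 0 \<le> avg (\<lambda>x. avg (\<lambda>y. if E u x y then 5359 else - 4641))"
  shows "0 \<le> mean_obj"
proof -
  let ?\<phi> = "\<lambda>_. undefined"
  have p6: "[0, Suc 0, 2, 3, 4, 5] = points6"
    "sort points6 = points6"
    by (simp_all add: points6_def)
  have k: "0 \<le> avgs points6 (\<lambda>\<phi>. real_of_int (ksum \<phi>)) ?\<phi>"
    unfolding ksum_def of_int_add avgs_add
    by (intro add_nonneg_nonneg avg_kernel6_nonneg; simp add: p6)
  have d: "0 \<le> avgs points6 (\<lambda>\<phi>. real_of_int (dsum \<phi>)) ?\<phi>"
    unfolding dsum_def of_int_add avgs_add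
    by (intro add_nonneg_nonneg avg_degree6_nonneg deg; simp add: p6)
  have g: "avgs points6 (\<lambda>\<phi>. real_of_int (gsum \<phi>)) ?\<phi> = 20 * mean_obj"
    unfolding gsum_def of_int_add avgs_add
    by (simp add: avg_obj6 p6)
  have "avgs points6 (\<lambda>\<phi>. 2 * real_of_int (ksum \<phi>) + 12 * real_of_int (dsum \<phi>)) ?\<phi> \<le>
      avgs points6 (\<lambda>\<phi>. 1256 * real_of_int (gsum \<phi>)) ?\<phi>"
  proof (rule avgs_mono)
    fix \<psi> :: "nat \<Rightarrow> 'v"
    have "2 * ksum \<psi> + 12 * dsum \<psi> \<le> 1256 * gsum \<psi>"
      using nsum[of \<psi>] unfolding nsum_eq by linarith
    then have "real_of_int (2 * ksum \<psi> + 12 * dsum \<psi>) \<le> real_of_int (1256 * gsum \<psi>)"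
      by (simp only: of_int_le_iff)
    then show "2 * real_of_int (ksum \<psi>) + 12 * real_of_int (dsum \<psi>) \<le> 1256 * real_of_int (gsum \<psi>)"
      by simp
  qed
  then show ?thesis
    unfolding avgs_add avgs_cmult g using k d by linarith
qed

section \<open>A cut of density at least 0.403\<close>

definition cut_density :: "('v \<Rightarrow> bool) \<Rightarrow> real" where
  "cut_density A = avg (\<lambda>x. avg (\<lambda>y. avg (\<lambda>z. of_bool (E x y z \<and> two (A x) (A y) (A z)))))"

text \<open>An AAB triple has two coordinates in A; the bound is the union bound over the three
  choices of these coordinates.\<close>

lemma cut_density_le: "cut_density A \<le> 3 * (avg (\<lambda>x. of_bool (A x)))\<^sup>2"
proof -
  let ?a = "\<lambda>x. of_bool (A x) :: real"
  have "cut_density A \<le> avg (\<lambda>x. avg (\<lambda>y. avg (\<lambda>z. ?a x * ?a y + ?a x * ?a z + ?a y * ?a z)))"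
    unfolding cut_density_def by (intro avg_mono) (auto simp: two_def)
  also have "\<dots> = 3 * (avg ?a)\<^sup>2"
    by (simp add: avg_add avg_cmult avg_cmult_right power2_eq_square)
  finally show ?thesis .
qed

text \<open>If s is the largest of s, t, u, then y + z is at most 3 t t + 3 u u, hence at most 3 (s
  t + s u), and the overlap leaves at most x. In this way an expression linear in the three cut
  densities stays below their maximum, which itself could not enter a linear certificate.\<close>

lemma sum_minus_overlap_le:
  fixes x y z s t u c :: real
  assumes "x \<le> 3 * s\<^sup>2" "y \<le> 3 * t\<^sup>2" "z \<le> 3 * u\<^sup>2" "x \<le> c" "y \<le> c" "z \<le> c" "0 \<le> s" "0 \<le> t" "0 \<le> u"
  shows "x + y + z - 3 * (s * t + s * u + t * u) \<le> c"
proof -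
  have *: "a\<^sup>2 \<le> a * b" if "0 \<le> a" "a \<le> b" for a b :: real
    using that by (simp add: power2_eq_square mult_left_mono)
  have tu: "0 \<le> t * u" "0 \<le> s * u" "0 \<le> s * t" using assms by auto
  consider "t \<le> s" "u \<le> s" | "s \<le> t" "u \<le> t" | "s \<le> u" "t \<le> u" by linarith
  then show ?thesis
  proof cases
    case 1
    then have "t\<^sup>2 \<le> s * t" "u\<^sup>2 \<le> s * u"
      using *[of t s] *[of u s] assms by (simp_all only: mult.commute)
    then show ?thesis using assms tu unfolding distrib_left by linarith
  next
    case 2
    then have "s\<^sup>2 \<le> s * t" "u\<^sup>2 \<le> t * u"
      using *[of s t] *[of u t] assms by (simp_all only: mult.commute)
    then show ?thesis using assms tu unfolding distrib_left by linarith
  next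
    case 3
    then have "s\<^sup>2 \<le> s * u" "t\<^sup>2 \<le> t * u"
      using *[of s u] *[of t u] assms by (simp_all only: mult.commute)
    then show ?thesis using assms tu unfolding distrib_left by linarith
  qed
qed

text \<open>If every cut were small, the objective would have negative mean over x, y, z for each
  edge abc, against the six-vertex certificate. In the iterated construction the top-level AAB edges
  yield the cut A and outweigh the edges inside B, whose sets are poor; 0.403 leaves room for this
  loss.\<close>

theorem exists_large_cut:
  assumes nsum: "\<And>\<phi>. nsum \<phi> \<le> 0"
    and deg: "\<And>u. u \<in> V \<Longrightarrow> 0 \<le> avg (\<lambda>x. avg (\<lambda>y. if E u x y then 5359 else - 4641))"
    and pos: "0 < avg (\<lambda>x. avg (\<lambda>y. avg (\<lambda>z. of_bool (E x y z))))"
  shows "\<exists>A. 403 / 1000 \<le> cut_density A"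
proof (rule ccontr)
  assume "\<not> ?thesis"
  then have small: "cut_density A < 403 / 1000" for A by (simp add: not_le)
  define inner where "inner a b c = avg (\<lambda>x. avg (\<lambda>y. avg (\<lambda>z. real_of_int (N6_obj (E a b c)
     (E a b x) (E a c x) (E b c x) (E a b y) (E a c y) (E b c y) (E a b z) (E a c z) (E b c z) (E x y z)))))" for a b c
  have inner: "inner a b c < 0" if abc: "E a b c" for a b c
  proof -
    define M1 M2 M3 where "M1 x \<longleftrightarrow> E a b x \<and> E a c x" and "M2 x \<longleftrightarrow> E a b x \<and> E b c x"
      and "M3 x \<longleftrightarrow> E a c x \<and> E b c x" for x
    define s1 s2 s3 where "s1 = avg (\<lambda>x. of_bool (M1 x))" and "s2 = avg (\<lambda>x. of_bool (M2 x))"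
      and "s3 = avg (\<lambda>x. of_bool (M3 x))"
    let ?o = "\<lambda>x y. real_of_int (pair_overlap (M1 x) (M2 x) (M3 x) (M1 y) (M2 y) (M3 y))"
    have po: "avg (\<lambda>x. avg (\<lambda>y. ?o x y)) = 2 * (s1 * s2 + s1 * s3 + s2 * s3)"
      unfolding real_pair_overlap avg_add avg_cmult avg_cmult_right s1_def s2_def s3_def by simp
    have e: "real_of_int (N6_obj (E a b c)
        (E a b x) (E a c x) (E b c x) (E a b y) (E a c y) (E b c y) (E a b z) (E a c z) (E b c z) (E x y z)) =
      360000 * (of_bool (E x y z \<and> two (M1 x) (M1 y) (M1 z)) + of_bool (E x y z \<and> two (M2 x) (M2 y) (M2 z))
        + of_bool (E x y z \<and> two (M3 x) (M3 y) (M3 z)))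
      - 180000 * (?o x y + ?o x z + ?o y z) - 145080" for x y z
      unfolding N6_obj_def M1_def M2_def M3_def using abc by (simp only: real_N6_obj_aux)
    have o: "avg (\<lambda>x. avg (\<lambda>y. avg (\<lambda>z. ?o x y + ?o x z + ?o y z))) = 3 * (2 * (s1 * s2 + s1 * s3 + s2 * s3))"
      by (simp only: avg_add avg_const po)
    define D where "D = cut_density M1 + cut_density M2 + cut_density M3 - 3 * (s1 * s2 + s1 * s3 + s2 * s3)"
    have "inner a b c = 360000 * D - 145080"
      unfolding inner_def e by (simp only: avg_diff avg_cmult avg_const o D_def) (simp add: avg_add cut_density_def)
    moreover have "D \<le> max (cut_density M1) (max (cut_density M2) (cut_density M3))"
      unfolding D_def by (rule sum_minus_overlap_le)
        (auto simp: s1_def s2_def s3_def cut_density_le intro!: avg_nonneg)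
    moreover have "max (cut_density M1) (max (cut_density M2) (cut_density M3)) < 403 / 1000"
      by (simp only: max_less_iff_conj small simp_thms)
    ultimately show ?thesis by linarith
  qed
  have zero: "inner a b c = 0" if "\<not> E a b c" for a b c
    unfolding inner_def N6_obj_def N6_obj_aux_def using that by (simp only: if_False of_int_0 avg_const)
  \<comment> \<open>There are finitely many edges, so the values of \<open>inner\<close> on them
    have a common negative upper bound m.\<close>
  define S where "S = {(a, b, c) \<in> V \<times> V \<times> V. E a b c}"
  have fin: "finite ((\<lambda>(a, b, c). inner a b c) ` S)"
    unfolding S_def
    by (rule finite_imageI, rule finite_subset[of _ "V \<times> V \<times> V"]) (auto simp: finite_V)
  have "S \<noteq> {}"
  proof
    assume "S = {}"
    then have "\<not> E x y z" if "x \<in> V" "y \<in> V" "z \<in> V" for x y z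
      using that unfolding S_def by blast
    then have "avg (\<lambda>x. avg (\<lambda>y. avg (\<lambda>z. of_bool (E x y z)))) \<le> avg (\<lambda>x. avg (\<lambda>y. avg (\<lambda>z. 0)))"
      by (intro avg_mono) simp
    then show False using pos by (simp only: avg_const)
  qed
  define m where "m = Max ((\<lambda>(a, b, c). inner a b c) ` S)"
  have "m < 0"
  proof -
    have "m \<in> (\<lambda>(a, b, c). inner a b c) ` S"
      unfolding m_def using fin \<open>S \<noteq> {}\<close> by (intro Max_in) simp_all
    then obtain a b c where "E a b c" "m = inner a b c" unfolding S_def by auto
    then show ?thesis using inner by simp
  qed
  have "mean_obj = avg (\<lambda>a. avg (\<lambda>b. avg (\<lambda>c. inner a b c)))"
    unfolding mean_obj_def inner_def ..
  also have "\<dots> \<le> avg (\<lambda>a. avg (\<lambda>b. avg (\<lambda>c. m * of_bool (E a b c))))"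
  proof (intro avg_mono)
    fix a b c assume "a \<in> V" "b \<in> V" "c \<in> V"
    show "inner a b c \<le> m * of_bool (E a b c)"
    proof (cases "E a b c")
      case True
      then have "inner a b c \<in> (\<lambda>(a, b, c). inner a b c) ` S"
        unfolding S_def using \<open>a \<in> V\<close> \<open>b \<in> V\<close> \<open>c \<in> V\<close> by (intro image_eqI[of _ _ "(a, b, c)"]) simp_all
      then have "inner a b c \<le> m" unfolding m_def by (rule Max_ge[OF fin])
      then show ?thesis using True by simp
    qed (simp add: zero)
  qed
  also have "\<dots> = m * avg (\<lambda>a. avg (\<lambda>b. avg (\<lambda>c. of_bool (E a b c))))"
    by (simp only: avg_cmult)
  also have "\<dots> < 0" using \<open>m < 0\<close> pos by (rule mult_neg_pos)
  finally have "mean_obj < 0" .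
  moreover have "0 \<le> mean_obj" by (rule mean_obj_nonneg[OF nsum deg])
  ultimately show False by linarith
qed

end

section \<open>Evaluation rules for the certificates\<close>

lemma rcert_sel:
  assumes "K = \<lparr> rcol = a, rlo = b, rup = c, rq = d, rV3 = f, rV1 = g, rdeg = h, rloc = i, rhi = j, rlohi = k,
     rdeg1 = l, req = m, rtri = n \<rparr>"
  shows "rcol K = a" "rlo K = b" "rup K = c" "rq K = d" "rV3 K = f" "rV1 K = g" "rdeg K = h" "rloc K = i"
    "rhi K = j" "rlohi K = k" "rdeg1 K = l" "req K = m" "rtri K = n"
  using assms by simp_all

lemma ucert_sel:
  assumes "K = \<lparr> uobj = a, uxA = b, uxB = c, uV3 = d, uV1 = f, udeg = g, uloc = h, ux = i, ual = j \<rparr>"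
  shows "uobj K = a" "uxA K = b" "uxB K = c" "uV3 K = d" "uV1 K = f" "udeg K = g" "uloc K = h" "ux K = i" "ual K = j"
  using assms by simp_all

text \<open>Rewriting with these rules and weak congruence for conditionals settles the tests of a
  pattern before its sum is expanded, so arithmetic is done only for minimal allowed
  patterns.\<close>

lemmas bool_eval = if_True if_False simp_thms not_True_eq_False not_False_eq_True
lemmas int_eval = arith_simps rel_simps mult_1_left mult_1_right mult_minus1 mult_minus1_right
  mult_zero_left mult_zero_right add_0_left add_0_right minus_zero minus_minus diff_zero
  add_neg_numeral_special diff_numeral_special one_add_one one_plus_numeral numeral_plus_one Num.inc.simps
lemmas pattern_eval = lexmin4_def lexmin5_def lexle.simps allowed5_def has_K4_def has_C5_def has_F1_def
  two_def cut_weight_def defect_def defect_weight_def xind_def dot.simps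
lemmas rooted_eval = rcheck_def rS_def rt3_def rtb_def rtb_aux_def rtc_def rtd_def
lemmas unrooted_eval = ucheck_def uS_def ut3_def utb_def utb_aux_def

text \<open>Colours head the code, so minimality under adjacent transpositions sorts them, with
  \<open>False\<close> before \<open>True\<close>. One check remains for each number of
  A-vertices.\<close>

lemma rcheck_sortedI:
  assumes "all10 (rcheck K False False False False)"
    "all10 (rcheck K False False False True)"
    "all10 (rcheck K False False True True)"
    "all10 (rcheck K False True True True)"
    "all10 (rcheck K True True True True)"
  shows "rcheck K c1 c2 c3 c4 e012 e013 e023 e123 e014 e024 e124 e034 e134 e234"
proof (cases "lexmin4 c1 c2 c3 c4 e012 e013 e023 e123 e014 e024 e124 e034 e134 e234")
  case True
  then have "lexle [c1, c2, c3, c4, e012, e013, e023, e123, e014, e024, e124, e034, e134, e234] [c2, c1, c3, c4, e012, e023, e013, e123, e024, e014, e124, e034, e234, e134]"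
      "lexle [c1, c2, c3, c4, e012, e013, e023, e123, e014, e024, e124, e034, e134, e234] [c1, c3, c2, c4, e013, e012, e023, e123, e014, e034, e134, e024, e124, e234]"
      "lexle [c1, c2, c3, c4, e012, e013, e023, e123, e014, e024, e124, e034, e134, e234] [c1, c2, c4, c3, e012, e014, e024, e124, e013, e023, e123, e034, e134, e234]"
    unfolding lexmin4_def by (simp_all split: if_splits del: lexle.simps)
  then have "(c1 \<longrightarrow> c2) \<and> (c2 \<longrightarrow> c3) \<and> (c3 \<longrightarrow> c4)"
    by (auto split: if_splits)
  then show ?thesis
    using assms unfolding all_iff by (cases c1; cases c2; cases c3; cases c4; simp only: simp_thms)
qed (simp only: rcheck_def if_False)

lemma ucheck_sortedI:
  assumes "all10 (ucheck K False False False False False)"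
    "all10 (ucheck K False False False False True)"
    "all10 (ucheck K False False False True True)"
    "all10 (ucheck K False False True True True)"
    "all10 (ucheck K False True True True True)"
    "all10 (ucheck K True True True True True)"
  shows "ucheck K c0 c1 c2 c3 c4 e012 e013 e023 e123 e014 e024 e124 e034 e134 e234"
proof (cases "lexmin5 c0 c1 c2 c3 c4 e012 e013 e023 e123 e014 e024 e124 e034 e134 e234")
  case True
  then have "lexle [c0, c1, c2, c3, c4, e012, e013, e023, e123, e014, e024, e124, e034, e134, e234] [c1, c0, c2, c3, c4, e012, e013, e123, e023, e014, e124, e024, e134, e034, e234]"
      "lexle [c0, c1, c2, c3, c4, e012, e013, e023, e123, e014, e024, e124, e034, e134, e234] [c0, c2, c1, c3, c4, e012, e023, e013, e123, e024, e014, e124, e034, e234, e134]"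
      "lexle [c0, c1, c2, c3, c4, e012, e013, e023, e123, e014, e024, e124, e034, e134, e234] [c0, c1, c3, c2, c4, e013, e012, e023, e123, e014, e034, e134, e024, e124, e234]"
      "lexle [c0, c1, c2, c3, c4, e012, e013, e023, e123, e014, e024, e124, e034, e134, e234] [c0, c1, c2, c4, c3, e012, e014, e024, e124, e013, e023, e123, e034, e134, e234]"
    unfolding lexmin5_def by (simp_all split: if_splits del: lexle.simps)
  then have "(c0 \<longrightarrow> c1) \<and> (c1 \<longrightarrow> c2) \<and> (c2 \<longrightarrow> c3) \<and> (c3 \<longrightarrow> c4)"
    by (auto split: if_splits)
  then show ?thesis
    using assms unfolding all_iff by (cases c0; cases c1; cases c2; cases c3; cases c4; simp only: simp_thms)
qed (simp only: ucheck_def if_False)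

section \<open>Certificate data: AAB link density at least 0.370 in A\<close>

definition A1_V3_ttt :: "bool \<Rightarrow> bool \<Rightarrow> bool \<Rightarrow> bool
    \<Rightarrow> int list" where "A1_V3_ttt c3 e013 e023 e123 = (if c3 then (if e013 then (if
    e023 then (if e123 then [0, 0, 0] else [926, - 1956, 1311]) else (if e123 then [485, - 121,
    56] else [595, 1014, 375])) else (if e023 then (if e123 then [485, - 121, 56] else [595,
    1014, 375]) else (if e123 then [- 1124, 2173, 1424] else [1543, 1304, - 1162]))) else (if
    e013 then (if e023 then (if e123 then [0, 0, 0] else [- 154, - 2390, - 1855]) else (if e123
    then [- 1499, - 1835, 318] else [- 154, 604, - 768])) else (if e023 then (if e123 then [-
    1499, - 1835, 318] else [- 154, 604, - 768]) else (if e123 then [- 2182, 2101, - 955] else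
    [309, 72, 56]))))"

definition A1_V3_ttf :: "bool \<Rightarrow> bool \<Rightarrow> bool \<Rightarrow> bool
    \<Rightarrow> int list" where "A1_V3_ttf c3 e013 e023 e123 = (if c3 then (if e013 then (if
    e023 then (if e123 then [1453, - 30, - 618] else [3047, 1475, - 603]) else (if e123 then
    [469, - 417, - 1531] else [- 141, - 298, - 788])) else (if e023 then (if e123 then [469, -
    417, - 1531] else [- 141, - 298, - 788]) else (if e123 then [- 47, - 1192, 1237] else [-
    1266, 477, 479]))) else (if e013 then (if e023 then (if e123 then [4641, - 730, - 464] else
    [- 4501, 700, - 1345]) else (if e123 then [656, 432, 680] else [- 1782, 179, 201])) else
    (if e023 then (if e123 then [656, 432, 680] else [- 1782, 179, 201]) else (if e123 then [-
    2110, - 1207, - 155] else [891, 581, 216]))))"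

definition A1_V3_tft :: "bool \<Rightarrow> bool \<Rightarrow> bool \<Rightarrow> bool
    \<Rightarrow> int list" where "A1_V3_tft c3 e013 e023 e123 = (if c3 then (if e013 then (if
    e023 then (if e123 then [0, 0, 0, 0] else [90, - 667, - 1247, 127]) else (if e123 then [-
    3900, 706, - 1515, - 183] else [- 762, 903, - 1604, 56])) else (if e023 then (if e123 then
    [- 1883, - 1609, 1812, - 211] else [3631, - 3885, - 297, - 141]) else (if e123 then [- 628,
    - 903, - 2049, - 577] else [1165, - 1177, - 267, - 211]))) else (if e013 then (if e023 then
    (if e123 then [0, 0, 0, 0] else [269, 2433, 2732, 901]) else (if e123 then [2331, 3846,
    178, - 1393] else [4437, 2394, - 2406, 295])) else (if e023 then (if e123 then [- 2779,
    2472, - 1515, - 169] else [448, 1766, 653, 802]) else (if e123 then [- 45, 118, 2940, -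
    1112] else [1031, 1217, 1693, 84]))))"

definition A1_V3_tff :: "bool \<Rightarrow> bool \<Rightarrow> bool \<Rightarrow> bool
    \<Rightarrow> int list" where "A1_V3_tff c3 e013 e023 e123 = (if c3 then (if e013 then (if
    e023 then (if e123 then [- 5076, 3705, - 116, 498] else [308, - 2111, 1273, - 237]) else
    (if e123 then [- 3179, 732, - 1388, 759] else [- 308, - 4265, 231, 2183])) else (if e023
    then (if e123 then [- 103, - 3877, 2121, - 1044] else [51, - 732, - 501, - 237]) else (if
    e123 then [- 1589, - 1852, - 1118, - 617] else [- 2000, - 1422, 270, 949]))) else (if e013
    then (if e023 then (if e123 then [1692, 1336, 1967, 142] else [2769, 3403, 1542, 2349])
    else (if e123 then [4461, - 388, 1195, - 119] else [4922, - 1508, - 1195, 1708])) else (if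
    e023 then (if e123 then [3692, 1852, - 39, - 1542] else [4102, 1163, 887, - 380]) else (if
    e123 then [4615, - 302, - 3818, - 166] else [4051, 388, 231, 47]))))"

definition A1_V3_fft :: "bool \<Rightarrow> bool \<Rightarrow> bool \<Rightarrow> bool
    \<Rightarrow> int list" where "A1_V3_fft c3 e013 e023 e123 = (if c3 then (if e013 then (if
    e023 then (if e123 then [0, 0, 0, 0] else [0, - 249, 2509, - 5407]) else (if e123 then [-
    1253, - 383, 2230, - 928] else [1894, 306, - 383, 109])) else (if e023 then (if e123 then
    [1253, - 383, 2230, - 928] else [- 1894, 306, - 383, 109]) else (if e123 then [0, - 823,
    3449, 5025] else [0, 746, - 662, 1748]))) else (if e013 then (if e023 then (if e123 then
    [0, 0, 0, 0] else [0, - 650, - 1533, - 164]) else (if e123 then [2885, - 172, 662, 328]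
    else [1515, 115, - 35, 55])) else (if e023 then (if e123 then [- 2885, - 172, 662, 328]
    else [- 1515, 115, - 35, 55]) else (if e123 then [0, 1894, 2683, 382] else [0, 57, 976,
    55]))))"

definition A1_V3_fff :: "bool \<Rightarrow> bool \<Rightarrow> bool \<Rightarrow> bool
    \<Rightarrow> int list" where "A1_V3_fff c3 e013 e023 e123 = (if c3 then (if e013 then (if
    e023 then (if e123 then [2664, 613, 594, 1424] else [- 1274, 805, 250, 578]) else (if e123
    then [193, - 192, 0, 62] else [- 1081, 268, - 266, - 516])) else (if e023 then (if e123
    then [193, - 192, 0, 62] else [- 1081, 268, - 266, - 516]) else (if e123 then [2124, -
    2108, 1250, - 2043] else [- 309, - 1188, - 391, - 433]))) else (if e013 then (if e023 then
    (if e123 then [- 2317, - 3794, - 109, 991] else [- 1815, 1571, 125, - 1404]) else (if e123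
    then [1004, - 192, 125, 495] else [425, 767, - 16, - 124])) else (if e023 then (if e123
    then [1004, - 192, 125, 495] else [425, 767, - 16, - 124]) else (if e123 then [3823, - 652,
    - 1546, - 537] else [1467, 230, 719, 619]))))"

text \<open>For two vertices of different colours only the ordering with the A-vertex first has
  vectors. The mirrored ordering gets \<open>[]\<close>, since the symmetrised sum runs over
  both.\<close>

definition A1_V3 :: "bool \<Rightarrow> bool \<Rightarrow> bool \<Rightarrow> bool
    \<Rightarrow> bool \<Rightarrow> bool \<Rightarrow> bool \<Rightarrow> int list" where
    "A1_V3 c1 c2 e012 c3 e013 e023 e123 = (if c1 then (if c2 then (if e012 then A1_V3_ttt c3
    e013 e023 e123 else A1_V3_ttf c3 e013 e023 e123) else (if e012 then A1_V3_tft c3 e013 e023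
    e123 else A1_V3_tff c3 e013 e023 e123)) else (if c2 then [] else (if e012 then A1_V3_fft c3
    e013 e023 e123 else A1_V3_fff c3 e013 e023 e123)))"

lemmas A1_V3_eval = A1_V3_ttt_def A1_V3_ttf_def A1_V3_tft_def A1_V3_tff_def A1_V3_fft_def A1_V3_fff_def A1_V3_def

definition A1_V1 :: "bool \<Rightarrow> bool \<Rightarrow> bool \<Rightarrow> int list" where
    "A1_V1 p q e = (if p then (if e then [- 1731, 1350] else [- 2520, - 777]) else (if q then
    (if e then [1731, 505] else [1502, - 477]) else (if e then [1196, - 368] else [967,
    682])))"

text \<open>The range from 0 to 370 is split at 190 and 300 among \<open>A1\<close>,
  \<open>A2\<close> and \<open>A3\<close>: the inequality (up - x)(x - lo) \<ge> 0 is the stronger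
  the shorter the interval.\<close>

definition A1 :: rcert where "A1 = \<lparr> rcol = True, rlo = 0, rup = 190, rq = cut_weight,
    rV3 = A1_V3, rV1 = A1_V1, rdeg = (\<lambda>p q e. (if p then (if e then 2093 else 9641)
    else (if q then (if e then 4239 else 138) else (if e then 9252 else 6511)))), rloc =
    (\<lambda>p q e. (if p then (if e then 9709 else 138) else (if q then 0 else (if e then
    3009 else 243)))), rhi = (\<lambda>p q e. (if p then (if e then 0 else 77) else (if q then
    (if e then 934 else 0) else (if e then 0 else 20431)))), rlohi = 1, rdeg1 = (\<lambda>c d
    e. (if c then (if d then (if e then 1 else 708) else (if e then 9702 else 0)) else (if d
    then (if e then 9909 else 0) else (if e then 8606 else 1)))), req = (\<lambda>c d e. (if c
    then (if d then (if e then 1584 else 1) else (if e then 0 else 5957)) else (if d then (if e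
    then 0 else 3303) else (if e then 1 else 10592)))), rtri = (\<lambda>c. (if c then 10547
    else 13380)) \<rparr>"

lemmas A1_sel = rcert_sel[OF A1_def]

lemma A1_check0: "all10 (rcheck A1 False False False False)"
  by (simp only: all_defs A1_sel A1_V1_def A1_V3_eval bool_eval int_eval pattern_eval rooted_eval cong: if_weak_cong)

lemma A1_check1: "all10 (rcheck A1 False False False True)"
  by (simp only: all_defs A1_sel A1_V1_def A1_V3_eval bool_eval int_eval pattern_eval rooted_eval cong: if_weak_cong)

lemma A1_check2: "all10 (rcheck A1 False False True True)"
  by (simp only: all_defs A1_sel A1_V1_def A1_V3_eval bool_eval int_eval pattern_eval rooted_eval cong: if_weak_cong)

lemma A1_check3: "all10 (rcheck A1 False True True True)"
  by (simp only: all_defs A1_sel A1_V1_def A1_V3_eval bool_eval int_eval pattern_eval rooted_eval cong: if_weak_cong)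

lemma A1_check4: "all10 (rcheck A1 True True True True)"
  by (simp only: all_defs A1_sel A1_V1_def A1_V3_eval bool_eval int_eval pattern_eval rooted_eval cong: if_weak_cong)

lemmas A1_check = rcheck_sortedI[OF A1_check0 A1_check1 A1_check2 A1_check3 A1_check4]

lemma A1_nonneg:
  "0 \<le> rdeg A1 p q e" "0 \<le> rloc A1 p q e" "0 \<le> rhi A1 p q e" "0 \<le> rlohi A1"
  "0 \<le> rdeg1 A1 p q e" "0 \<le> req A1 p q e" "0 \<le> rtri A1 p"
  by (simp_all add: A1_sel)

definition A2_V3_ttt :: "bool \<Rightarrow> bool \<Rightarrow> bool \<Rightarrow> bool
    \<Rightarrow> int list" where "A2_V3_ttt c3 e013 e023 e123 = (if c3 then (if e013 then (if
    e023 then (if e123 then [0, 0, 0, 0] else [30, - 788, 5, 0]) else (if e123 then [- 362, -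
    263, 169, 38] else [- 559, 91, 138, 198])) else (if e023 then (if e123 then [- 362, - 263,
    169, - 38] else [- 559, 91, 138, - 198]) else (if e123 then [- 1057, 101, - 524, 0] else [-
    287, 212, 524, 0]))) else (if e013 then (if e023 then (if e123 then [0, 0, 0, 0] else
    [1495, 192, 222, 0]) else (if e123 then [770, - 303, - 423, 28] else [423, 303, 58, 88]))
    else (if e023 then (if e123 then [770, - 303, - 423, - 28] else [423, 303, 58, - 88]) else
    (if e123 then [- 15, 1000, - 349, 0] else [408, 71, 333, 0]))))"

definition A2_V3_ttf :: "bool \<Rightarrow> bool \<Rightarrow> bool \<Rightarrow> bool
    \<Rightarrow> int list" where "A2_V3_ttf c3 e013 e023 e123 = (if c3 then (if e013 then (if
    e023 then (if e123 then [- 190, - 16, - 283] else [832, 386, - 85]) else (if e123 then [-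
    219, - 236, - 383] else [- 321, - 181, - 236])) else (if e023 then (if e123 then [- 219, -
    236, - 383] else [- 321, - 181, - 236]) else (if e123 then [- 29, - 780, 345] else [- 423,
    24, 225]))) else (if e013 then (if e023 then (if e123 then [1445, - 79, - 372] else [-
    1401, 646, - 279]) else (if e123 then [540, 354, 182] else [- 496, 39, 298])) else (if e023
    then (if e123 then [540, 354, 182] else [- 496, 39, 298]) else (if e123 then [- 730, - 142,
    - 50] else [146, 110, 139]))))"

definition A2_V3_tft :: "bool \<Rightarrow> bool \<Rightarrow> bool \<Rightarrow> bool
    \<Rightarrow> int list" where "A2_V3_tft c3 e013 e023 e123 = (if c3 then (if e013 then (if
    e023 then (if e123 then [0, 0, 0, 0] else [268, - 371, - 68, - 84]) else (if e123 then [-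
    1278, - 685, - 135, 120] else [142, - 516, - 21, 64])) else (if e023 then (if e123 then [-
    394, 621, 73, - 44] else [1562, 56, 514, - 104]) else (if e123 then [32, - 637, 218, 84]
    else [805, 16, 244, - 24]))) else (if e013 then (if e023 then (if e123 then [0, 0, 0, 0]
    else [- 363, 798, - 426, - 92]) else (if e123 then [552, 32, - 452, 204] else [1120, - 685,
    - 307, 72])) else (if e023 then (if e123 then [- 1215, - 347, 395, - 64] else [- 552, -
    177, 338, - 92]) else (if e123 then [- 63, 564, 468, 396] else [32, 282, 21, 100]))))"

definition A2_V3_tff :: "bool \<Rightarrow> bool \<Rightarrow> bool \<Rightarrow> bool
    \<Rightarrow> int list" where "A2_V3_tff c3 e013 e023 e123 = (if c3 then (if e013 then (if
    e023 then (if e123 then [- 1377, 1467, 98, 131] else [168, - 677, 233, - 162]) else (if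
    e123 then [- 857, 403, - 206, 353] else [- 61, - 1596, 599, 1000])) else (if e023 then (if
    e123 then [- 444, - 1435, 304, - 747] else [229, - 435, - 116, - 121]) else (if e123 then
    [- 566, - 726, - 519, 30] else [- 887, - 516, 80, 111]))) else (if e013 then (if e023 then
    (if e123 then [505, 548, 537, - 151] else [688, 1096, 885, 151]) else (if e123 then [1117,
    - 548, 295, - 434] else [1178, - 371, 27, 333])) else (if e023 then (if e123 then [1423,
    419, - 331, - 131] else [1377, 339, 188, - 40]) else (if e123 then [1514, - 97, - 850, 303]
    else [1499, 32, 80, 172]))))"

definition A2_V3_fft :: "bool \<Rightarrow> bool \<Rightarrow> bool \<Rightarrow> bool
    \<Rightarrow> int list" where "A2_V3_fft c3 e013 e023 e123 = (if c3 then (if e013 then (if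
    e023 then (if e123 then [0, 0, 0, 0] else [0, 63, - 1863, 450]) else (if e123 then [- 463,
    - 179, - 640, 267] else [593, 76, 19, 127])) else (if e023 then (if e123 then [463, - 179,
    - 640, 267] else [- 593, 76, 19, 127]) else (if e123 then [0, - 116, 1054, 1393] else [0,
    210, 489, - 155]))) else (if e013 then (if e023 then (if e123 then [0, 0, 0, 0] else [0, -
    286, 357, - 450]) else (if e123 then [804, - 72, 132, - 169] else [374, 58, 169, - 70]))
    else (if e023 then (if e123 then [- 804, - 72, 132, - 169] else [- 374, 58, 169, - 70])
    else (if e123 then [0, 443, 38, 141] else [0, 268, 0, 127]))))"

definition A2_V3_fff :: "bool \<Rightarrow> bool \<Rightarrow> bool \<Rightarrow> bool
    \<Rightarrow> int list" where "A2_V3_fff c3 e013 e023 e123 = (if c3 then (if e013 then (if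
    e023 then (if e123 then [885, - 194, - 335, 35] else [- 206, - 438, - 201, 65]) else (if
    e123 then [0, - 67, 40, - 60] else [- 268, 34, 228, - 150])) else (if e023 then (if e123
    then [0, - 67, 40, - 60] else [- 268, 34, 228, - 150]) else (if e123 then [322, 758, 215,
    495] else [- 224, 93, - 20, - 115]))) else (if e013 then (if e023 then (if e123 then [-
    644, 834, - 664, - 185] else [- 751, 110, 409, 255]) else (if e123 then [286, 59, - 201,
    155] else [- 63, - 34, 80, 20])) else (if e023 then (if e123 then [286, 59, - 201, 155]
    else [- 63, - 34, 80, 20]) else (if e123 then [769, 531, 402, - 425] else [456, 118, 0,
    70]))))"

definition A2_V3 :: "bool \<Rightarrow> bool \<Rightarrow> bool \<Rightarrow> bool
    \<Rightarrow> bool \<Rightarrow> bool \<Rightarrow> bool \<Rightarrow> int list" where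
    "A2_V3 c1 c2 e012 c3 e013 e023 e123 = (if c1 then (if c2 then (if e012 then A2_V3_ttt c3
    e013 e023 e123 else A2_V3_ttf c3 e013 e023 e123) else (if e012 then A2_V3_tft c3 e013 e023
    e123 else A2_V3_tff c3 e013 e023 e123)) else (if c2 then [] else (if e012 then A2_V3_fft c3
    e013 e023 e123 else A2_V3_fff c3 e013 e023 e123)))"

lemmas A2_V3_eval = A2_V3_ttt_def A2_V3_ttf_def A2_V3_tft_def A2_V3_tff_def A2_V3_fft_def A2_V3_fff_def A2_V3_def

definition A2_V1 :: "bool \<Rightarrow> bool \<Rightarrow> bool \<Rightarrow> int list" where
    "A2_V1 p q e = (if p then (if e then [110, 80, - 400] else [850, - 10, - 575]) else (if q
    then (if e then [- 1093, 140, - 36] else [- 33, 20, 677]) else (if e then [- 177, - 495,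
    95] else [740, 90, 721])))"

definition A2 :: rcert where "A2 = \<lparr> rcol = True, rlo = 190, rup = 300, rq = cut_weight,
    rV3 = A2_V3, rV1 = A2_V1, rdeg = (\<lambda>p q e. (if p then (if e then 0 else 1139) else
    (if q then (if e then 1041 else 29) else (if e then 13 else 1585)))), rloc = (\<lambda>p q
    e. (if p then (if e then 50 else 0) else (if q then 0 else (if e then 2 else 0)))), rhi =
    (\<lambda>p q e. 0), rlohi = 3, rdeg1 = (\<lambda>c d e. (if c then (if d then 0 else (if e
    then 1405 else 0)) else (if d then (if e then 716 else 0) else (if e then 279 else 0)))),
    req = (\<lambda>c d e. (if c then (if d then (if e then 4 else 233) else (if e then 0 else
    34)) else (if d then (if e then 0 else 32) else (if e then 0 else 772)))), rtri =
    (\<lambda>c. (if c then 1469 else 1022)) \<rparr>"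

lemmas A2_sel = rcert_sel[OF A2_def]

lemma A2_check0: "all10 (rcheck A2 False False False False)"
  by (simp only: all_defs A2_sel A2_V1_def A2_V3_eval bool_eval int_eval pattern_eval rooted_eval cong: if_weak_cong)

lemma A2_check1: "all10 (rcheck A2 False False False True)"
  by (simp only: all_defs A2_sel A2_V1_def A2_V3_eval bool_eval int_eval pattern_eval rooted_eval cong: if_weak_cong)

lemma A2_check2: "all10 (rcheck A2 False False True True)"
  by (simp only: all_defs A2_sel A2_V1_def A2_V3_eval bool_eval int_eval pattern_eval rooted_eval cong: if_weak_cong)

lemma A2_check3: "all10 (rcheck A2 False True True True)"
  by (simp only: all_defs A2_sel A2_V1_def A2_V3_eval bool_eval int_eval pattern_eval rooted_eval cong: if_weak_cong)

lemma A2_check4: "all10 (rcheck A2 True True True True)"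
  by (simp only: all_defs A2_sel A2_V1_def A2_V3_eval bool_eval int_eval pattern_eval rooted_eval cong: if_weak_cong)

lemmas A2_check = rcheck_sortedI[OF A2_check0 A2_check1 A2_check2 A2_check3 A2_check4]

lemma A2_nonneg:
  "0 \<le> rdeg A2 p q e" "0 \<le> rloc A2 p q e" "0 \<le> rhi A2 p q e" "0 \<le> rlohi A2"
  "0 \<le> rdeg1 A2 p q e" "0 \<le> req A2 p q e" "0 \<le> rtri A2 p"
  by (simp_all add: A2_sel)

definition A3_V3_ttt :: "bool \<Rightarrow> bool \<Rightarrow> bool \<Rightarrow> bool
    \<Rightarrow> int list" where "A3_V3_ttt c3 e013 e023 e123 = (if c3 then (if e013 then (if
    e023 then (if e123 then [0, 0, 0, 0, 0] else [71, - 131, - 3026, 0, - 61]) else (if e123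
    then [- 47, - 1877, - 539, 1066, 327] else [567, - 1572, 83, 1193, - 82])) else (if e023
    then (if e123 then [- 47, - 1877, - 539, - 1066, 327] else [567, - 1572, 83, - 1193, - 82])
    else (if e123 then [- 1170, - 4322, 1368, 0, - 281] else [130, - 1615, 83, 0, - 113])))
    else (if e013 then (if e023 then (if e123 then [0, 0, 0, 0, 0] else [12, 3973, - 705, 0,
    199]) else (if e123 then [- 1123, 1703, - 124, 650, 159] else [- 12, 2270, 663, 1789, -
    506])) else (if e023 then (if e123 then [- 1123, 1703, - 124, - 650, 159] else [- 12, 2270,
    663, - 1789, - 506]) else (if e123 then [142, 349, 4104, 0, 123] else [366, 1222, 2239, 0,
    404]))))"

definition A3_V3_ttf :: "bool \<Rightarrow> bool \<Rightarrow> bool \<Rightarrow> bool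
    \<Rightarrow> int list" where "A3_V3_ttf c3 e013 e023 e123 = (if c3 then (if e013 then (if
    e023 then (if e123 then [39, 1000, - 1084, 0] else [3878, 566, - 913, 0]) else (if e123
    then [- 588, 133, - 266, - 308] else [- 783, 333, - 723, 118])) else (if e023 then (if e123
    then [- 588, 133, - 266, 308] else [- 783, 333, - 723, - 118]) else (if e123 then [- 1136,
    - 2965, 875, 0] else [- 627, - 100, 456, 0]))) else (if e013 then (if e023 then (if e123
    then [1606, 366, - 247, 0] else [- 3251, 3298, 323, 0]) else (if e123 then [1097, 300, 190,
    206] else [- 588, - 267, 57, 81])) else (if e023 then (if e123 then [1097, 300, 190, - 206]
    else [- 588, - 267, 57, - 81]) else (if e123 then [- 2272, - 1799, - 1883, 0] else [392,
    500, 647, 0]))))"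

definition A3_V3_tft :: "bool \<Rightarrow> bool \<Rightarrow> bool \<Rightarrow> bool
    \<Rightarrow> int list" where "A3_V3_tft c3 e013 e023 e123 = (if c3 then (if e013 then (if
    e023 then (if e123 then [0, 0, 0, 0] else [1044, 1118, - 855, - 169]) else (if e123 then [-
    3986, 2531, 393, 488] else [949, 2663, 647, - 645])) else (if e023 then (if e123 then [-
    902, - 1644, 901, - 254] else [3417, - 1578, - 832, - 469]) else (if e123 then [- 664, -
    197, - 1548, 274] else [2515, - 99, 601, 163]))) else (if e013 then (if e023 then (if e123
    then [0, 0, 0, 0] else [380, 559, 2287, - 7]) else (if e123 then [- 1424, - 1381, 739, 423]
    else [2183, 2367, - 1571, 515])) else (if e023 then (if e123 then [- 4698, - 329, - 1871, -
    469] else [- 2657, 2005, 739, - 462]) else (if e123 then [- 2135, - 3255, 185, 104] else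
    [427, 164, 416, 404]))))"

definition A3_V3_tff :: "bool \<Rightarrow> bool \<Rightarrow> bool \<Rightarrow> bool
    \<Rightarrow> int list" where "A3_V3_tff c3 e013 e023 e123 = (if c3 then (if e013 then (if
    e023 then (if e123 then [- 2641, 668, - 1371, - 222, - 5777] else [- 731, 789, 1931, 263,
    525]) else (if e123 then [- 2235, - 91, 312, - 624, - 3501] else [- 41, - 2429, 6168, -
    818, - 233])) else (if e023 then (if e123 then [- 2154, 30, 374, 846, 3851] else [- 813, -
    61, - 561, - 582, 1167]) else (if e123 then [- 1910, 182, - 1059, - 652, 1926] else [-
    1544, 213, 748, - 139, 584]))) else (if e013 then (if e023 then (if e123 then [2194, 91,
    1184, 1276, - 1167] else [2845, - 152, 1994, 943, - 3034]) else (if e123 then [2804, 182,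
    62, 125, 1867] else [3860, 3006, 2492, - 1373, 117])) else (if e023 then (if e123 then
    [3373, - 668, - 3177, - 416, - 1050] else [4023, - 1184, - 312, 263, - 1342]) else (if e123
    then [3698, - 1913, - 2243, - 846, 1167] else [2804, 1700, 187, 347, 467]))))"

definition A3_V3_fft :: "bool \<Rightarrow> bool \<Rightarrow> bool \<Rightarrow> bool
    \<Rightarrow> int list" where "A3_V3_fft c3 e013 e023 e123 = (if c3 then (if e013 then (if
    e023 then (if e123 then [0, 0, 0, 0, 0] else [- 1638, 0, 774, 286, 498]) else (if e123 then
    [351, - 638, - 1987, 257, 1146] else [- 429, 1413, 697, 572, 231])) else (if e023 then (if
    e123 then [351, 638, - 1987, 257, 1146] else [- 429, - 1413, 697, 572, 231]) else (if e123
    then [2536, 0, - 1058, 2832, - 1076] else [- 195, 0, 671, 543, 717]))) else (if e013 then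
    (if e023 then (if e123 then [0, 0, 0, 0, 0] else [429, 0, - 1007, - 1373, - 1123]) else (if
    e123 then [1365, 2256, - 1884, - 1030, - 12] else [- 156, 1572, 774, - 315, - 799])) else
    (if e023 then (if e123 then [1365, - 2256, - 1884, - 1030, - 12] else [- 156, - 1572, 774,
    - 315, - 799]) else (if e123 then [3862, 0, 2555, - 915, 648] else [1599, 0, 1290, 257,
    509]))))"

definition A3_V3_fff :: "bool \<Rightarrow> bool \<Rightarrow> bool \<Rightarrow> bool
    \<Rightarrow> int list" where "A3_V3_fff c3 e013 e023 e123 = (if c3 then (if e013 then (if
    e023 then (if e123 then [- 2591, 1102, 246, - 452, 350] else [680, 1102, - 246, 113, - 6])
    else (if e123 then [- 366, 282, 61, - 90, 271] else [1884, - 1051, 184, 248, 283])) else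
    (if e023 then (if e123 then [- 366, 282, 61, - 90, 271] else [1884, - 1051, 184, 248, 283])
    else (if e123 then [- 340, - 2511, 246, - 113, - 139] else [1596, - 487, - 552, 655, -
    386]))) else (if e013 then (if e023 then (if e123 then [- 864, - 538, - 6077, 565, 0] else
    [2041, 231, - 1105, - 2236, - 66]) else (if e123 then [- 994, 103, - 123, - 90, - 422] else
    [131, 333, 552, 0, - 597])) else (if e023 then (if e123 then [- 994, 103, - 123, - 90, -
    422] else [131, 333, 552, 0, - 597]) else (if e123 then [- 2120, - 2537, 1043, - 700, - 18]
    else [52, 0, 1596, 1265, 66]))))"

definition A3_V3 :: "bool \<Rightarrow> bool \<Rightarrow> bool \<Rightarrow> bool
    \<Rightarrow> bool \<Rightarrow> bool \<Rightarrow> bool \<Rightarrow> int list" where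
    "A3_V3 c1 c2 e012 c3 e013 e023 e123 = (if c1 then (if c2 then (if e012 then A3_V3_ttt c3
    e013 e023 e123 else A3_V3_ttf c3 e013 e023 e123) else (if e012 then A3_V3_tft c3 e013 e023
    e123 else A3_V3_tff c3 e013 e023 e123)) else (if c2 then [] else (if e012 then A3_V3_fft c3
    e013 e023 e123 else A3_V3_fff c3 e013 e023 e123)))"

lemmas A3_V3_eval = A3_V3_ttt_def A3_V3_ttf_def A3_V3_tft_def A3_V3_tff_def A3_V3_fft_def A3_V3_fff_def A3_V3_def

definition A3_V1 :: "bool \<Rightarrow> bool \<Rightarrow> bool \<Rightarrow> int list" where
    "A3_V1 p q e = (if p then (if e then [261, 371, - 1024] else [83, 2965, - 1024]) else (if q
    then (if e then [21, - 4077, 395] else [- 94, 1935, 1779]) else (if e then [- 1032, 618, -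
    359] else [209, 2718, 683])))"

definition A3 :: rcert where "A3 = \<lparr> rcol = True, rlo = 300, rup = 370, rq = cut_weight,
    rV3 = A3_V3, rV1 = A3_V1, rdeg = (\<lambda>p q e. (if p then (if e then 0 else 7877) else
    (if q then (if e then 63 else 0) else (if e then 114 else 13226)))), rloc = (\<lambda>p q
    e. (if p then 0 else (if q then (if e then 7 else 2) else (if e then 0 else 115)))), rhi =
    (\<lambda>p q e. 0), rlohi = 34, rdeg1 = (\<lambda>c d e. (if c then (if d then (if e then
    7839 else 1) else (if e then 14969 else 0)) else (if d then (if e then 8835 else 0) else
    1))), req = (\<lambda>c d e. (if c then (if d then (if e then 0 else 7356) else (if e then
    0 else 7133)) else (if d then (if e then 0 else 283) else (if e then 38 else 3220)))), rtri
    = (\<lambda>c. (if c then 7528 else 5583)) \<rparr>"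

lemmas A3_sel = rcert_sel[OF A3_def]

lemma A3_check0: "all10 (rcheck A3 False False False False)"
  by (simp only: all_defs A3_sel A3_V1_def A3_V3_eval bool_eval int_eval pattern_eval rooted_eval cong: if_weak_cong)

lemma A3_check1: "all10 (rcheck A3 False False False True)"
  by (simp only: all_defs A3_sel A3_V1_def A3_V3_eval bool_eval int_eval pattern_eval rooted_eval cong: if_weak_cong)

lemma A3_check2: "all10 (rcheck A3 False False True True)"
  by (simp only: all_defs A3_sel A3_V1_def A3_V3_eval bool_eval int_eval pattern_eval rooted_eval cong: if_weak_cong)

lemma A3_check3: "all10 (rcheck A3 False True True True)"
  by (simp only: all_defs A3_sel A3_V1_def A3_V3_eval bool_eval int_eval pattern_eval rooted_eval cong: if_weak_cong)

lemma A3_check4: "all10 (rcheck A3 True True True True)"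
  by (simp only: all_defs A3_sel A3_V1_def A3_V3_eval bool_eval int_eval pattern_eval rooted_eval cong: if_weak_cong)

lemmas A3_check = rcheck_sortedI[OF A3_check0 A3_check1 A3_check2 A3_check3 A3_check4]

lemma A3_nonneg:
  "0 \<le> rdeg A3 p q e" "0 \<le> rloc A3 p q e" "0 \<le> rhi A3 p q e" "0 \<le> rlohi A3"
  "0 \<le> rdeg1 A3 p q e" "0 \<le> req A3 p q e" "0 \<le> rtri A3 p"
  by (simp_all add: A3_sel)

section \<open>Certificate data: AAB link density at least 0.255 in B\<close>

definition B1_V3_ttt :: "bool \<Rightarrow> bool \<Rightarrow> bool \<Rightarrow> bool
    \<Rightarrow> int list" where "B1_V3_ttt c3 e013 e023 e123 = (if c3 then (if e013 then (if
    e023 then (if e123 then [0, 0, 0] else [- 1070, - 159, 0]) else (if e123 then [- 16, - 106,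
    - 15] else [315, 556, 502])) else (if e023 then (if e123 then [- 16, - 106, 15] else [315,
    556, - 502]) else (if e123 then [1463, - 199, 0] else [236, 1310, 0]))) else (if e013 then
    (if e023 then (if e123 then [0, 0, 0] else [- 1557, 238, 0]) else (if e123 then [- 220, -
    1138, 96] else [- 126, 543, 41])) else (if e023 then (if e123 then [- 220, - 1138, - 96]
    else [- 126, 543, - 41]) else (if e123 then [1416, - 424, 0] else [409, 172, 0]))))"

definition B1_V3_ttf :: "bool \<Rightarrow> bool \<Rightarrow> bool \<Rightarrow> bool
    \<Rightarrow> int list" where "B1_V3_ttf c3 e013 e023 e123 = (if c3 then (if e013 then (if
    e023 then (if e123 then [- 129, 133, 0, - 908] else [- 1213, 1314, 0, 170]) else (if e123
    then [490, - 133, - 126, - 100] else [723, - 106, 193, - 150])) else (if e023 then (if e123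
    then [490, - 133, 126, - 100] else [723, - 106, - 193, - 150]) else (if e123 then [- 232, -
    1234, 0, 838] else [852, 305, 0, 619]))) else (if e013 then (if e023 then (if e123 then [-
    2426, - 531, 0, - 988] else [2555, 557, 0, - 768]) else (if e123 then [- 1110, 173, 265, -
    20] else [103, 13, 0, 90])) else (if e023 then (if e123 then [- 1110, 173, - 265, - 20]
    else [103, 13, 0, 90]) else (if e123 then [800, - 1221, 0, - 499] else [0, 0, 0, 0]))))"

definition B1_V3_tft :: "bool \<Rightarrow> bool \<Rightarrow> bool \<Rightarrow> bool
    \<Rightarrow> int list" where "B1_V3_tft c3 e013 e023 e123 = (if c3 then (if e013 then (if
    e023 then (if e123 then [0, 0, 0, 0] else [- 573, - 377, - 576, - 459]) else (if e123 then
    [- 1421, 258, - 900, 2753] else [- 948, - 178, - 15, 131])) else (if e023 then (if e123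
    then [- 1471, - 198, 1137, 197] else [- 773, 198, 59, - 3245]) else (if e123 then [- 972,
    516, - 871, - 164] else [0, 20, - 15, - 164]))) else (if e013 then (if e023 then (if e123
    then [0, 0, 0, 0] else [1521, - 853, 1461, 951]) else (if e123 then [2319, 119, 74, 262]
    else [2469, 139, - 1181, - 524])) else (if e023 then (if e123 then [923, - 119, - 738, 557]
    else [1396, - 317, - 192, - 197]) else (if e123 then [449, 1963, 930, 328] else [1446, 456,
    192, 229]))))"

definition B1_V3_tff :: "bool \<Rightarrow> bool \<Rightarrow> bool \<Rightarrow> bool
    \<Rightarrow> int list" where "B1_V3_tff c3 e013 e023 e123 = (if c3 then (if e013 then (if
    e023 then (if e123 then [- 1684, - 3045, - 22, 205] else [- 978, 769, - 844, 0]) else (if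
    e123 then [- 1575, - 1076, 476, 256] else [- 1304, 1507, - 325, 17])) else (if e023 then
    (if e123 then [- 1114, 2676, - 844, - 427] else [27, 92, 0, 0]) else (if e123 then [- 1657,
    1353, 671, 205] else [0, 0, 0, 0]))) else (if e013 then (if e023 then (if e123 then [951, -
    984, - 455, - 119] else [2689, - 1538, - 888, - 205]) else (if e123 then [2227, 953, - 152,
    - 222] else [2227, 953, - 346, 1689])) else (if e023 then (if e123 then [1983, - 215, - 87,
    - 495] else [2689, 62, - 303, - 273]) else (if e123 then [2119, 738, 2143, - 205] else
    [2173, 308, 22, 85]))))"

definition B1_V3_fft :: "bool \<Rightarrow> bool \<Rightarrow> bool \<Rightarrow> bool
    \<Rightarrow> int list" where "B1_V3_fft c3 e013 e023 e123 = (if c3 then (if e013 then (if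
    e023 then (if e123 then [0, 0, 0, 0] else [2434, - 1081, 0, - 2073]) else (if e123 then [-
    150, - 147, 253, 0] else [481, 770, - 789, 126])) else (if e023 then (if e123 then [- 150,
    - 147, - 253, 0] else [481, 770, 789, 126]) else (if e123 then [- 2224, 999, 0, 126] else
    [- 841, 1048, 0, 524]))) else (if e013 then (if e023 then (if e123 then [0, 0, 0, 0] else
    [781, - 1163, 0, 817]) else (if e123 then [- 1472, - 1622, - 964, 293] else [1142, 1442,
    331, 42])) else (if e023 then (if e123 then [- 1472, - 1622, 964, 293] else [1142, 1442, -
    331, 42]) else (if e123 then [- 2975, 950, 0, - 1592] else [1833, 328, 0, 544]))))"

definition B1_V3_fff :: "bool \<Rightarrow> bool \<Rightarrow> bool \<Rightarrow> bool
    \<Rightarrow> int list" where "B1_V3_fff c3 e013 e023 e123 = (if c3 then (if e013 then (if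
    e023 then (if e123 then [- 189, 562, 891, 0] else [1381, - 225, 81, 0]) else (if e123 then
    [0, 600, 9, - 15] else [108, 525, - 324, 126])) else (if e023 then (if e123 then [0, 600,
    9, 15] else [108, 525, - 324, - 126]) else (if e123 then [- 1678, 1836, 198, 0] else [-
    352, 1087, - 252, 0]))) else (if e013 then (if e023 then (if e123 then [- 487, - 3710, -
    126, 0] else [1245, - 187, - 198, 0]) else (if e123 then [- 325, - 974, 279, 175] else
    [596, 1424, - 261, 480])) else (if e023 then (if e123 then [- 325, - 974, 279, - 175] else
    [596, 1424, - 261, - 480]) else (if e123 then [- 2680, 450, - 243, 0] else [812, 1349, 477,
    0]))))"

definition B1_V3 :: "bool \<Rightarrow> bool \<Rightarrow> bool \<Rightarrow> bool
    \<Rightarrow> bool \<Rightarrow> bool \<Rightarrow> bool \<Rightarrow> int list" where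
    "B1_V3 c1 c2 e012 c3 e013 e023 e123 = (if c1 then (if c2 then (if e012 then B1_V3_ttt c3
    e013 e023 e123 else B1_V3_ttf c3 e013 e023 e123) else (if e012 then B1_V3_tft c3 e013 e023
    e123 else B1_V3_tff c3 e013 e023 e123)) else (if c2 then [] else (if e012 then B1_V3_fft c3
    e013 e023 e123 else B1_V3_fff c3 e013 e023 e123)))"

lemmas B1_V3_eval = B1_V3_ttt_def B1_V3_ttf_def B1_V3_tft_def B1_V3_tff_def B1_V3_fft_def B1_V3_fff_def B1_V3_def

definition B1_V1 :: "bool \<Rightarrow> bool \<Rightarrow> bool \<Rightarrow> int list" where
    "B1_V1 p q e = (if p then (if e then [- 2292, 436] else [- 2223, - 457]) else (if q then
    (if e then [1436, 247] else [1852, - 48]) else (if e then [857, - 532] else [347, 463])))"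

text \<open>The triple inequality is now the one for \<open>defect_weight\<close>, which
  \<open>GF\<close> supplies. \<open>B1\<close> and \<open>B2\<close> together exclude the range
  from 0 to 255 for a vertex outside A.\<close>

definition B1 :: rcert where "B1 = \<lparr> rcol = False, rlo = 0, rup = 210, rq =
    defect_weight, rV3 = B1_V3, rV1 = B1_V1, rdeg = (\<lambda>p q e. (if p then (if e then 1381
    else 2393) else (if q then (if e then 4262 else 4327) else (if e then 1904 else 4438)))),
    rloc = (\<lambda>p q e. (if p then (if e then 0 else 127) else (if q then (if e then 1474
    else 0) else 0))), rhi = (\<lambda>p q e. (if p then (if e then 963 else 28) else (if q
    then (if e then 40 else 3512) else (if e then 141 else 0)))), rlohi = 1, rdeg1 =
    (\<lambda>c d e. (if c then (if d then (if e then 8311 else 7048) else (if e then 6844 else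
    2286)) else (if d then (if e then 9356 else 3718) else (if e then 7772 else 0)))), req =
    (\<lambda>c d e. (if c then 0 else (if d then 0 else (if e then 0 else 57)))), rtri =
    (\<lambda>c. (if c then 6968 else 4027)) \<rparr>"

lemmas B1_sel = rcert_sel[OF B1_def]

lemma B1_check0: "all10 (rcheck B1 False False False False)"
  by (simp only: all_defs B1_sel B1_V1_def B1_V3_eval bool_eval int_eval pattern_eval rooted_eval cong: if_weak_cong)

lemma B1_check1: "all10 (rcheck B1 False False False True)"
  by (simp only: all_defs B1_sel B1_V1_def B1_V3_eval bool_eval int_eval pattern_eval rooted_eval cong: if_weak_cong)

lemma B1_check2: "all10 (rcheck B1 False False True True)"
  by (simp only: all_defs B1_sel B1_V1_def B1_V3_eval bool_eval int_eval pattern_eval rooted_eval cong: if_weak_cong)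

lemma B1_check3: "all10 (rcheck B1 False True True True)"
  by (simp only: all_defs B1_sel B1_V1_def B1_V3_eval bool_eval int_eval pattern_eval rooted_eval cong: if_weak_cong)

lemma B1_check4: "all10 (rcheck B1 True True True True)"
  by (simp only: all_defs B1_sel B1_V1_def B1_V3_eval bool_eval int_eval pattern_eval rooted_eval cong: if_weak_cong)

lemmas B1_check = rcheck_sortedI[OF B1_check0 B1_check1 B1_check2 B1_check3 B1_check4]

lemma B1_nonneg:
  "0 \<le> rdeg B1 p q e" "0 \<le> rloc B1 p q e" "0 \<le> rhi B1 p q e" "0 \<le> rlohi B1"
  "0 \<le> rdeg1 B1 p q e" "0 \<le> req B1 p q e" "0 \<le> rtri B1 p"
  by (simp_all add: B1_sel)

definition B2_V3_ttt :: "bool \<Rightarrow> bool \<Rightarrow> bool \<Rightarrow> bool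
    \<Rightarrow> int list" where "B2_V3_ttt c3 e013 e023 e123 = (if c3 then (if e013 then (if
    e023 then (if e123 then [0, 0] else [294, 1378]) else (if e123 then [252, - 161] else [399,
    - 286])) else (if e023 then (if e123 then [252, - 161] else [399, - 286]) else (if e123
    then [- 1407, - 340] else [1890, - 644]))) else (if e013 then (if e023 then (if e123 then
    [0, 0] else [2079, 250]) else (if e123 then [- 1050, 662] else [- 651, 644])) else (if e023
    then (if e123 then [- 1050, 662] else [- 651, 644]) else (if e123 then [- 1281, - 1771]
    else [105, 1002]))))"

definition B2_V3_ttf :: "bool \<Rightarrow> bool \<Rightarrow> bool \<Rightarrow> bool
    \<Rightarrow> int list" where "B2_V3_ttf c3 e013 e023 e123 = (if c3 then (if e013 then (if
    e023 then (if e123 then [- 1216, - 1399, 690, 0] else [1521, 1569, 690, 0]) else (if e123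
    then [- 253, - 254, - 714, - 280] else [- 811, - 191, - 387, 309])) else (if e023 then (if
    e123 then [- 253, - 254, - 714, 280] else [- 811, - 191, - 387, - 309]) else (if e123 then
    [1064, - 339, - 1198, 0] else [- 760, 1060, - 242, 0]))) else (if e013 then (if e023 then
    (if e123 then [4105, - 1887, 412, 0] else [- 5018, - 572, 775, 0]) else (if e123 then
    [1267, 127, 738, 486] else [- 203, 615, - 242, 0])) else (if e023 then (if e123 then [1267,
    127, 738, - 486] else [- 203, 615, - 242, 0]) else (if e123 then [- 558, - 2099, - 218, 0]
    else [253, 912, 97, 0]))))"

definition B2_V3_tft :: "bool \<Rightarrow> bool \<Rightarrow> bool \<Rightarrow> bool
    \<Rightarrow> int list" where "B2_V3_tft c3 e013 e023 e123 = (if c3 then (if e013 then (if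
    e023 then (if e123 then [0, 0, 0, 0, 0] else [- 4019, - 894, - 1319, - 742, 44]) else (if
    e123 then [- 2923, 5028, 715, - 1661, - 678] else [- 5407, 1117, 440, - 1602, 568])) else
    (if e023 then (if e123 then [- 3215, 950, 797, 1750, 153] else [- 2777, - 5531, - 110,
    2521, - 87]) else (if e123 then [- 2119, - 279, 302, 356, - 667] else [- 658, - 1676, 302,
    415, 240]))) else (if e013 then (if e023 then (if e123 then [0, 0, 0, 0, 0] else [3873,
    1509, - 165, - 682, 1082]) else (if e123 then [6211, 2123, - 2721, 2047, - 546] else [5334,
    - 1341, - 1209, - 1750, 393])) else (if e023 then (if e123 then [4165, - 1285, - 1209, -
    2640, - 262] else [4019, - 3687, 1787, - 2937, - 568]) else (if e123 then [7234, 1509,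
    2117, 1572, - 33] else [6431, 168, 1347, 1186, 153]))))"

definition B2_V3_tff :: "bool \<Rightarrow> bool \<Rightarrow> bool \<Rightarrow> bool
    \<Rightarrow> int list" where "B2_V3_tff c3 e013 e023 e123 = (if c3 then (if e013 then (if
    e023 then (if e123 then [- 4663, - 5312, - 717] else [- 2368, 2629, 2392]) else (if e123
    then [- 4071, - 1395, - 997] else [- 4145, 2897, 1355])) else (if e023 then (if e123 then
    [- 2516, 3917, 997] else [- 444, 0, 797]) else (if e123 then [- 3257, 2414, - 757] else [-
    2813, 54, - 399]))) else (if e013 then (if e023 then (if e123 then [3923, - 3809, 957] else
    [4515, - 4239, 2073]) else (if e123 then [5773, 1717, - 319] else [5107, 2200, 518])) else
    (if e023 then (if e123 then [6587, - 161, 917] else [6809, 215, 1116]) else (if e123 then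
    [7327, 1663, - 3946] else [6365, 1073, 678]))))"

definition B2_V3_fft :: "bool \<Rightarrow> bool \<Rightarrow> bool \<Rightarrow> bool
    \<Rightarrow> int list" where "B2_V3_fft c3 e013 e023 e123 = (if c3 then (if e013 then (if
    e023 then (if e123 then [0, 0, 0, 0, 0, 0] else [- 4306, 0, 5469, 0, - 2731, - 1904]) else
    (if e123 then [- 522, 112, - 1618, 1601, - 595, - 468] else [217, 0, 770, - 1100, 525,
    281])) else (if e023 then (if e123 then [- 522, - 112, - 1618, - 1601, - 595, - 468] else
    [217, 0, 770, 1100, 525, 281]) else (if e123 then [87, 0, - 6393, 0, 2696, - 3090] else
    [1261, 0, - 2157, 0, 1015, 250]))) else (if e013 then (if e023 then (if e123 then [0, 0, 0,
    0, 0, 0] else [609, 0, 3081, 0, - 245, 468]) else (if e123 then [1827, 2324, - 1618, -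
    1132, - 3466, - 281] else [- 2262, 3710, 385, 647, 3221, 531])) else (if e023 then (if e123
    then [1827, - 2324, - 1618, 1132, - 3466, - 281] else [- 2262, - 3710, 385, - 647, 3221,
    531]) else (if e123 then [- 3219, 0, - 7626, 0, - 1891, 1810] else [3175, 0, 1926, 0, 2276,
    62]))))"

definition B2_V3_fff :: "bool \<Rightarrow> bool \<Rightarrow> bool \<Rightarrow> bool
    \<Rightarrow> int list" where "B2_V3_fff c3 e013 e023 e123 = (if c3 then (if e013 then (if
    e023 then (if e123 then [0, - 548, 121, 510, - 755] else [0, - 782, - 48, - 3511, - 208])
    else (if e123 then [64, 1486, 48, - 283, - 221] else [128, 704, 169, - 1359, - 208])) else
    (if e023 then (if e123 then [- 64, 1486, 48, - 283, - 221] else [- 128, 704, 169, - 1359, -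
    208]) else (if e123 then [0, 5240, 97, 3228, 404] else [0, 1877, 145, 340, - 234]))) else
    (if e013 then (if e023 then (if e123 then [0, - 7743, 990, 2378, - 352] else [0, - 1643, -
    676, - 5040, 1289]) else (if e123 then [295, - 2425, - 193, 1869, 508] else [1268, 1486,
    24, - 2888, - 430])) else (if e023 then (if e123 then [- 295, - 2425, - 193, 1869, 508]
    else [- 1268, 1486, 24, - 2888, - 430]) else (if e123 then [0, 1408, - 1329, 5606, 0] else
    [0, 2581, 2392, 1076, 664]))))"

definition B2_V3 :: "bool \<Rightarrow> bool \<Rightarrow> bool \<Rightarrow> bool
    \<Rightarrow> bool \<Rightarrow> bool \<Rightarrow> bool \<Rightarrow> int list" where
    "B2_V3 c1 c2 e012 c3 e013 e023 e123 = (if c1 then (if c2 then (if e012 then B2_V3_ttt c3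
    e013 e023 e123 else B2_V3_ttf c3 e013 e023 e123) else (if e012 then B2_V3_tft c3 e013 e023
    e123 else B2_V3_tff c3 e013 e023 e123)) else (if c2 then [] else (if e012 then B2_V3_fft c3
    e013 e023 e123 else B2_V3_fff c3 e013 e023 e123)))"

lemmas B2_V3_eval = B2_V3_ttt_def B2_V3_ttf_def B2_V3_tft_def B2_V3_tff_def B2_V3_fft_def B2_V3_fff_def B2_V3_def

definition B2_V1 :: "bool \<Rightarrow> bool \<Rightarrow> bool \<Rightarrow> int list" where
    "B2_V1 p q e = (if p then (if e then [4572, - 1259] else [2032, 2492]) else (if q then (if
    e then [- 2725, - 252] else [- 2401, - 126]) else (if e then [- 3556, 50] else [46, 25])))"

definition B2 :: rcert where "B2 = \<lparr> rcol = False, rlo = 210, rup = 255, rq =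
    defect_weight, rV3 = B2_V3, rV1 = B2_V1, rdeg = (\<lambda>p q e. (if p then (if e then
    15257 else 64) else (if q then (if e then 0 else 5717) else (if e then 4981 else 13450)))),
    rloc = (\<lambda>p q e. 0), rhi = (\<lambda>p q e. (if p then 0 else (if q then (if e then
    0 else 5157) else (if e then 0 else 163)))), rlohi = 39, rdeg1 = (\<lambda>c d e. (if c
    then (if d then (if e then 12997 else 13896) else (if e then 27295 else 17324)) else (if d
    then (if e then 29837 else 2248) else (if e then 38489 else 6)))), req = (\<lambda>c d e.
    (if c then (if d then (if e then 6 else 3) else (if e then 0 else 4)) else (if d then (if e
    then 0 else 4) else (if e then 6 else 9135)))), rtri = (\<lambda>c. (if c then 12778 else
    19800)) \<rparr>"

lemmas B2_sel = rcert_sel[OF B2_def]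

lemma B2_check0: "all10 (rcheck B2 False False False False)"
  by (simp only: all_defs B2_sel B2_V1_def B2_V3_eval bool_eval int_eval pattern_eval rooted_eval cong: if_weak_cong)

lemma B2_check1: "all10 (rcheck B2 False False False True)"
  by (simp only: all_defs B2_sel B2_V1_def B2_V3_eval bool_eval int_eval pattern_eval rooted_eval cong: if_weak_cong)

lemma B2_check2: "all10 (rcheck B2 False False True True)"
  by (simp only: all_defs B2_sel B2_V1_def B2_V3_eval bool_eval int_eval pattern_eval rooted_eval cong: if_weak_cong)

lemma B2_check3: "all10 (rcheck B2 False True True True)"
  by (simp only: all_defs B2_sel B2_V1_def B2_V3_eval bool_eval int_eval pattern_eval rooted_eval cong: if_weak_cong)

lemma B2_check4: "all10 (rcheck B2 True True True True)"
  by (simp only: all_defs B2_sel B2_V1_def B2_V3_eval bool_eval int_eval pattern_eval rooted_eval cong: if_weak_cong)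

lemmas B2_check = rcheck_sortedI[OF B2_check0 B2_check1 B2_check2 B2_check3 B2_check4]

lemma B2_nonneg:
  "0 \<le> rdeg B2 p q e" "0 \<le> rloc B2 p q e" "0 \<le> rhi B2 p q e" "0 \<le> rlohi B2"
  "0 \<le> rdeg1 B2 p q e" "0 \<le> req B2 p q e" "0 \<le> rtri B2 p"
  by (simp_all add: B2_sel)

section \<open>Certificate data: the two averaged inequalities\<close>

definition GF_V3_tttt :: "bool \<Rightarrow> bool \<Rightarrow> bool \<Rightarrow> bool
    \<Rightarrow> int list" where "GF_V3_tttt c3 e013 e023 e123 = (if c3 then (if e013 then (if
    e023 then (if e123 then [0, 0] else [- 11856, 18775]) else (if e123 then [- 11856, - 6314]
    else [- 20547, 7376])) else (if e023 then (if e123 then [- 11856, - 12461] else [- 20547,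
    3744]) else (if e123 then [- 20547, - 11120] else [- 16326, 0]))) else (if e013 then (if
    e023 then (if e123 then [0, 0] else [24830, 13914]) else (if e123 then [24830, - 4694] else
    [21913, 14864])) else (if e023 then (if e123 then [24830, - 9220] else [21913, 7488]) else
    (if e123 then [21913, - 22352] else [15581, 0]))))"

definition GF_V3_tttf :: "bool \<Rightarrow> bool \<Rightarrow> bool \<Rightarrow> bool
    \<Rightarrow> int list" where "GF_V3_tttf c3 e013 e023 e123 = (if c3 then (if e013 then (if
    e023 then (if e123 then [13273, 0, 0, - 3620] else [- 8329, - 9860, 5531, - 489]) else (if
    e123 then [- 8329, 5953, - 3402, - 489] else [7300, 4930, 747, 398])) else (if e023 then
    (if e123 then [- 8329, 3907, - 2129, - 489] else [7300, 7473, 1203, 398]) else (if e123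
    then [7300, - 12403, - 1950, 398] else [6073, 0, 0, 389]))) else (if e013 then (if e023
    then (if e123 then [- 10552, 0, 0, - 661] else [- 5907, 12341, 664, - 335]) else (if e123
    then [- 5907, - 7442, - 401, - 335] else [8030, 2078, 1645, 407])) else (if e023 then (if
    e123 then [- 5907, - 4899, - 249, - 335] else [8030, 3163, 2613, 407]) else (if e123 then
    [8030, - 5209, - 4259, 407] else [5840, 0, 0, 371]))))"

definition GF_V3_ttft :: "bool \<Rightarrow> bool \<Rightarrow> bool \<Rightarrow> bool
    \<Rightarrow> int list" where "GF_V3_ttft c3 e013 e023 e123 = (if c3 then (if e013 then (if
    e023 then (if e123 then [0, 0, 0, 0] else [- 1197, 15291, 1438, - 3432]) else (if e123 then
    [- 1197, - 15291, 1438, - 3432] else [12915, 0, - 30284, - 2222])) else (if e023 then (if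
    e123 then [- 13041, 0, 2423, - 317] else [- 8568, 10895, - 12568, 1587]) else (if e123 then
    [- 8568, - 10895, - 12568, 1587] else [- 1953, 0, - 19987, - 146]))) else (if e013 then (if
    e023 then (if e123 then [0, 0, 0, 0] else [13293, 8983, 11508, - 549]) else (if e123 then
    [13293, - 8983, 11508, - 549] else [22239, 0, - 3785, 541])) else (if e023 then (if e123
    then [- 25200, 0, 3861, - 1544] else [- 6363, 12003, - 3104, 309]) else (if e123 then [-
    6363, - 12003, - 3104, 309] else [5607, 0, 1514, 1905]))))"

definition GF_V3_ttff :: "bool \<Rightarrow> bool \<Rightarrow> bool \<Rightarrow> bool
    \<Rightarrow> int list" where "GF_V3_ttff c3 e013 e023 e123 = (if c3 then (if e013 then (if
    e023 then (if e123 then [- 41512, 10230, 5620, 0] else [- 20445, 3087, - 1945, 6153]) else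
    (if e123 then [- 20445, 3087, - 1945, - 6153] else [7057, 35275, - 14411, 0])) else (if
    e023 then (if e123 then [9859, - 17020, - 2954, 0] else [2387, 1323, 2846, 5094]) else (if
    e123 then [2387, 1323, 2846, - 5094] else [5915, 12611, 6953, 0]))) else (if e013 then (if
    e023 then (if e123 then [- 14010, - 18343, - 10087, 0] else [- 1557, - 2117, - 4683, 5982])
    else (if e123 then [- 1557, - 2117, - 4683, - 5982] else [11001, - 4057, - 8106, 0])) else
    (if e023 then (if e123 then [- 17227, 7496, 3387, 0] else [19718, 6085, 2990, 11448]) else
    (if e123 then [19718, 6085, 2990, - 11448] else [19511, 3087, 5368, 0]))))"

definition GF_V3_tfft :: "bool \<Rightarrow> bool \<Rightarrow> bool \<Rightarrow> bool
    \<Rightarrow> int list" where "GF_V3_tfft c3 e013 e023 e123 = (if c3 then (if e013 then (if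
    e023 then (if e123 then [0, 0, 0, 0] else [0, 8901, - 32359, 1615]) else (if e123 then
    [9047, - 6506, - 5986, 1486] else [8062, 5175, - 890, 106])) else (if e023 then (if e123
    then [- 9047, - 6506, - 5986, 1486] else [- 8062, 5175, - 890, 106]) else (if e123 then [0,
    - 3815, 27424, 1268] else [0, - 1094, 15694, - 113]))) else (if e013 then (if e023 then (if
    e123 then [0, 0, 0, 0] else [0, - 8369, - 3883, - 3018]) else (if e123 then [9485, - 9256,
    4449, 905] else [14592, 8753, 7523, - 2596])) else (if e023 then (if e123 then [- 9485, -
    9256, 4449, 905] else [- 14592, 8753, 7523, - 2596]) else (if e123 then [0, 11829, 19820,
    2724] else [0, 11237, 2265, 1170]))))"

definition GF_V3_tfff :: "bool \<Rightarrow> bool \<Rightarrow> bool \<Rightarrow> bool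
    \<Rightarrow> int list" where "GF_V3_tfff c3 e013 e023 e123 = (if c3 then (if e013 then (if
    e023 then (if e123 then [- 52699, 0, 3020, - 3426, - 1342] else [- 11330, 0, 749, 1758, -
    2167]) else (if e123 then [4611, 7214, 499, 15191, 5469] else [13965, 7464, - 3032, - 180,
    - 3328])) else (if e023 then (if e123 then [4611, - 7214, 499, 15191, 5469] else [13965, -
    7464, - 3032, - 180, - 3328]) else (if e123 then [- 1713, 0, - 2699, - 18030, 10320] else
    [14097, 0, 2901, - 1713, - 748]))) else (if e013 then (if e023 then (if e123 then [- 27667,
    0, - 3781, 8610, 2348] else [5138, 0, - 4090, 856, - 9081]) else (if e123 then [- 10276,
    4158, 1106, - 6130, - 335] else [18708, 10019, 4756, - 2479, - 1625])) else (if e023 then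
    (if e123 then [- 10276, - 4158, 1106, - 6130, - 335] else [18708, - 10019, 4756, - 2479, -
    1625]) else (if e123 then [16995, 0, - 2937, - 7212, 1832] else [20684, 0, 642, 992,
    5315]))))"

definition GF_V3_ffft :: "bool \<Rightarrow> bool \<Rightarrow> bool \<Rightarrow> bool
    \<Rightarrow> int list" where "GF_V3_ffft c3 e013 e023 e123 = (if c3 then (if e013 then (if
    e023 then (if e123 then [0, 0, 0] else [- 8539, - 3272, 9108]) else (if e123 then [- 8539,
    9338, 9108] else [7390, 9270, - 5920])) else (if e023 then (if e123 then [- 8539, - 6066,
    9108] else [7390, - 14313, - 5920]) else (if e123 then [7390, 5044, - 5920] else [1532, 0,
    1503]))) else (if e013 then (if e023 then (if e123 then [0, 0, 0] else [- 8562, - 6475, -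
    7673]) else (if e123 then [- 8562, 18539, - 7673] else [9012, 17721, 5191])) else (if e023
    then (if e123 then [- 8562, - 11996, - 7673] else [9012, - 27263, 5191]) else (if e123 then
    [9012, 9542, 5191] else [5903, 0, 4098]))))"

definition GF_V3_ffff :: "bool \<Rightarrow> bool \<Rightarrow> bool \<Rightarrow> bool
    \<Rightarrow> int list" where "GF_V3_ffff c3 e013 e023 e123 = (if c3 then (if e013 then (if
    e023 then (if e123 then [- 5817, 0, - 8511] else [1040, 3257, - 3563]) else (if e123 then
    [1040, - 116, - 3563] else [3948, 10740, 1188])) else (if e023 then (if e123 then [1040, -
    3141, - 3563] else [3948, 388, 1188]) else (if e123 then [3948, - 11166, 1188] else [1599,
    0, 3464]))) else (if e013 then (if e023 then (if e123 then [- 2985, 0, - 39584] else [-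
    2273, 6397, - 10984]) else (if e123 then [- 2273, - 233, - 10984] else [- 7704, 14966,
    11875])) else (if e023 then (if e123 then [- 2273, - 6165, - 10984] else [- 7704, 543,
    11875]) else (if e123 then [- 7704, - 15509, 11875] else [1618, 0, 14151]))))"

definition GF_V3 :: "bool \<Rightarrow> bool \<Rightarrow> bool \<Rightarrow> bool
    \<Rightarrow> bool \<Rightarrow> bool \<Rightarrow> bool \<Rightarrow> bool \<Rightarrow>
    int list" where "GF_V3 c0 c1 c2 e012 c3 e013 e023 e123 = (if c0 then (if c1 then (if c2
    then (if e012 then GF_V3_tttt c3 e013 e023 e123 else GF_V3_tttf c3 e013 e023 e123) else (if
    e012 then GF_V3_ttft c3 e013 e023 e123 else GF_V3_ttff c3 e013 e023 e123)) else (if c2 then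
    [] else (if e012 then GF_V3_tfft c3 e013 e023 e123 else GF_V3_tfff c3 e013 e023 e123)))
    else (if c1 then [] else (if c2 then [] else (if e012 then GF_V3_ffft c3 e013 e023 e123
    else GF_V3_ffff c3 e013 e023 e123))))"

lemmas GF_V3_eval = GF_V3_tttt_def GF_V3_tttf_def GF_V3_ttft_def GF_V3_ttff_def GF_V3_tfft_def GF_V3_tfff_def GF_V3_ffft_def GF_V3_ffff_def GF_V3_def

text \<open>Uses the bound 370 in A but only nonnegativity in B (\<open>uxB = 0\<close>), because
  the bound in B is itself derived from this inequality. The factor 25059 scales the
  objective.\<close>

definition GF :: ucert where "GF = \<lparr> uobj = (\<lambda>a b c e. 25059 * defect_weight a b
    c e), uxA = 370, uxB = 0, uV3 = GF_V3, uV1 = (\<lambda>c p q e. (if c then (if p then (if e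
    then [2518] else [3394]) else (if q then (if e then [- 6132] else [- 1588]) else (if e then
    [- 1779] else [10950]))) else (if p then (if e then [18] else [211]) else (if q then (if e
    then [- 364] else [112]) else (if e then [- 2349] else [1580]))))), udeg = (\<lambda>c p q
    e. (if c then (if p then (if e then 0 else 120170) else (if q then (if e then 82358 else
    124174) else (if e then 537 else 243173))) else (if p then (if e then 1706 else 58077) else
    (if q then (if e then 168846 else 163362) else (if e then 295180 else 399854))))), uloc =
    (\<lambda>c p q e. (if c then 0 else (if p then (if e then 0 else 202975) else (if q then
    (if e then 99985 else 0) else 0)))), ux = (\<lambda>c p q e. (if c then (if p then (if e
    then 1268785 else 0) else (if q then 0 else (if e then 368928 else 0))) else 0)), ual =
    (\<lambda>p q. (if p then 29 else (if q then 1167 else 67395))) \<rparr>"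

lemmas GF_sel = ucert_sel[OF GF_def]

lemma GF_check0: "all10 (ucheck GF False False False False False)"
  by (simp only: all_defs GF_sel GF_V3_eval bool_eval int_eval pattern_eval unrooted_eval cong: if_weak_cong)

lemma GF_check1: "all10 (ucheck GF False False False False True)"
  by (simp only: all_defs GF_sel GF_V3_eval bool_eval int_eval pattern_eval unrooted_eval cong: if_weak_cong)

lemma GF_check2: "all10 (ucheck GF False False False True True)"
  by (simp only: all_defs GF_sel GF_V3_eval bool_eval int_eval pattern_eval unrooted_eval cong: if_weak_cong)

lemma GF_check3: "all10 (ucheck GF False False True True True)"
  by (simp only: all_defs GF_sel GF_V3_eval bool_eval int_eval pattern_eval unrooted_eval cong: if_weak_cong)

lemma GF_check4: "all10 (ucheck GF False True True True True)"
  by (simp only: all_defs GF_sel GF_V3_eval bool_eval int_eval pattern_eval unrooted_eval cong: if_weak_cong)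

lemma GF_check5: "all10 (ucheck GF True True True True True)"
  by (simp only: all_defs GF_sel GF_V3_eval bool_eval int_eval pattern_eval unrooted_eval cong: if_weak_cong)

lemmas GF_check = ucheck_sortedI[OF GF_check0 GF_check1 GF_check2 GF_check3 GF_check4 GF_check5]

lemma GF_nonneg:
  "0 \<le> udeg GF c p q e" "0 \<le> uloc GF c p q e" "0 \<le> ux GF c p q e" "0 \<le> ual GF p q"
  by (simp_all add: GF_sel)

definition FIN_V3_tttt :: "bool \<Rightarrow> bool \<Rightarrow> bool \<Rightarrow> bool
    \<Rightarrow> int list" where "FIN_V3_tttt c3 e013 e023 e123 = (if c3 then (if e013 then
    (if e023 then (if e123 then [0, 0, 0] else [- 1054, 1164, 137]) else (if e123 then [- 1054,
    - 431, - 65] else [- 1203, 525, - 97])) else (if e023 then (if e123 then [- 1054, - 734, -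
    72] else [- 1203, 310, - 88]) else (if e123 then [- 1203, - 835, 185] else [- 1343, 0,
    0]))) else (if e013 then (if e023 then (if e123 then [0, 0, 0] else [1989, 989, - 219])
    else (if e123 then [1989, - 363, 104] else [1810, 848, 82])) else (if e023 then (if e123
    then [1989, - 626, 115] else [1810, 498, 74]) else (if e123 then [1810, - 1346, - 157] else
    [1591, 0, 0]))))"

definition FIN_V3_tttf :: "bool \<Rightarrow> bool \<Rightarrow> bool \<Rightarrow> bool
    \<Rightarrow> int list" where "FIN_V3_tttf c3 e013 e023 e123 = (if c3 then (if e013 then
    (if e023 then (if e123 then [0, 0, 0] else [- 291, - 743, - 753]) else (if e123 then [429,
    - 743, 897] else [251, 41, - 63])) else (if e023 then (if e123 then [- 138, - 743, - 143]
    else [- 774, 41, 399]) else (if e123 then [523, 41, - 336] else [0, 0, 0]))) else (if e013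
    then (if e023 then (if e123 then [0, 0, 0] else [- 518, 0, 386]) else (if e123 then [764,
    0, - 457] else [320, 561, 45])) else (if e023 then (if e123 then [- 246, 0, 72] else [-
    986, 561, - 282]) else (if e123 then [665, 561, 238] else [0, 0, 0]))))"

definition FIN_V3_ttft :: "bool \<Rightarrow> bool \<Rightarrow> bool \<Rightarrow> bool
    \<Rightarrow> int list" where "FIN_V3_ttft c3 e013 e023 e123 = (if c3 then (if e013 then
    (if e023 then (if e123 then [0, 0, 0] else [- 1608, 1054, 256]) else (if e123 then [- 1608,
    - 1054, 256] else [- 1632, 0, - 145])) else (if e023 then (if e123 then [0, 0, 0] else [73,
    632, - 803]) else (if e123 then [73, - 632, - 803] else [- 481, 0, - 1384]))) else (if e013
    then (if e023 then (if e123 then [0, 0, 0] else [16, 390, 810]) else (if e123 then [16, -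
    390, 810] else [0, 0, 0])) else (if e023 then (if e123 then [269, 0, 491] else [890, 885, -
    187]) else (if e123 then [890, - 885, - 187] else [1126, 0, 187]))))"

definition FIN_V3_ttff :: "bool \<Rightarrow> bool \<Rightarrow> bool \<Rightarrow> bool
    \<Rightarrow> int list" where "FIN_V3_ttff c3 e013 e023 e123 = (if c3 then (if e013 then
    (if e023 then (if e123 then [283, 0, - 1382, - 2726] else [- 189, 561, - 550, - 1281]) else
    (if e123 then [- 189, - 561, - 550, - 1281] else [1718, 0, 2159, - 1745])) else (if e023
    then (if e123 then [- 619, 0, 615, 682] else [- 765, 538, 518, - 300]) else (if e123 then
    [- 765, - 538, 518, - 300] else [- 438, 0, 853, - 900]))) else (if e013 then (if e023 then
    (if e123 then [490, 0, - 907, 954] else [954, 672, - 648, 382]) else (if e123 then [954, -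
    672, - 648, 382] else [567, 0, - 637, 695])) else (if e023 then (if e123 then [335, 0, -
    896, 191] else [490, 649, 367, 1172]) else (if e123 then [490, - 649, 367, 1172] else [60,
    0, 302, 1077]))))"

definition FIN_V3_tfft :: "bool \<Rightarrow> bool \<Rightarrow> bool \<Rightarrow> bool
    \<Rightarrow> int list" where "FIN_V3_tfft c3 e013 e023 e123 = (if c3 then (if e013 then
    (if e023 then (if e123 then [0, 0, 0, 0, 0] else [- 133, 0, - 182, 0, - 3118]) else (if
    e123 then [- 330, 305, 93, 209, - 62] else [178, 357, - 100, - 144, - 94])) else (if e023
    then (if e123 then [- 330, - 305, 93, - 209, - 62] else [178, - 357, - 100, 144, - 94])
    else (if e123 then [- 173, 0, - 208, 0, 2292] else [- 82, 0, - 124, 0, 1232]))) else (if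
    e013 then (if e023 then (if e123 then [0, 0, 0, 0, 0] else [176, 0, 249, 0, 218]) else (if
    e123 then [- 254, 452, 137, - 201, 109] else [379, 341, - 93, 228, 140])) else (if e023
    then (if e123 then [- 254, - 452, 137, 201, 109] else [379, - 341, - 93, - 228, 140]) else
    (if e123 then [- 287, 0, - 434, 0, 16] else [13, 0, 17, 0, 16]))))"

definition FIN_V3_tfff :: "bool \<Rightarrow> bool \<Rightarrow> bool \<Rightarrow> bool
    \<Rightarrow> int list" where "FIN_V3_tfff c3 e013 e023 e123 = (if c3 then (if e013 then
    (if e023 then (if e123 then [0, - 2931] else [0, 0]) else (if e123 then [378, 879] else
    [195, 1759])) else (if e023 then (if e123 then [- 378, 879] else [- 195, 1759]) else (if
    e123 then [0, 879] else [0, 1861]))) else (if e013 then (if e023 then (if e123 then [0, -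
    176] else [0, 352]) else (if e123 then [397, - 117] else [795, 147])) else (if e023 then
    (if e123 then [- 397, - 117] else [- 795, 147]) else [0, 0])))"

definition FIN_V3_ffft :: "bool \<Rightarrow> bool \<Rightarrow> bool \<Rightarrow> bool
    \<Rightarrow> int list" where "FIN_V3_ffft c3 e013 e023 e123 = (if c3 then (if e013 then
    (if e023 then (if e123 then [0] else [- 335]) else (if e123 then [- 335] else [296])) else
    (if e023 then (if e123 then [- 335] else [296]) else (if e123 then [296] else [0]))) else
    [0])"

definition FIN_V3 :: "bool \<Rightarrow> bool \<Rightarrow> bool \<Rightarrow> bool
    \<Rightarrow> bool \<Rightarrow> bool \<Rightarrow> bool \<Rightarrow> bool \<Rightarrow>
    int list" where "FIN_V3 c0 c1 c2 e012 c3 e013 e023 e123 = (if c0 then (if c1 then (if c2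
    then (if e012 then FIN_V3_tttt c3 e013 e023 e123 else FIN_V3_tttf c3 e013 e023 e123) else
    (if e012 then FIN_V3_ttft c3 e013 e023 e123 else FIN_V3_ttff c3 e013 e023 e123)) else (if
    c2 then [] else (if e012 then FIN_V3_tfft c3 e013 e023 e123 else FIN_V3_tfff c3 e013 e023
    e123))) else (if c1 then [] else (if c2 then [] else (if e012 then FIN_V3_ffft c3 e013 e023
    e123 else []))))"

lemmas FIN_V3_eval = FIN_V3_tttt_def FIN_V3_tttf_def FIN_V3_ttft_def FIN_V3_ttff_def FIN_V3_tfft_def FIN_V3_tfff_def FIN_V3_ffft_def FIN_V3_def

text \<open>With both bounds 370 and 255 at hand the objective is \<open>defect\<close> itself,
  scaled by 500. It is tight: in the iterated construction its mean is 0.\<close>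

definition FIN :: ucert where "FIN = \<lparr> uobj = (\<lambda>a b c e. 500 * defect a b c e),
    uxA = 370, uxB = 255, uV3 = FIN_V3, uV1 = (\<lambda>c p q e. []), udeg = (\<lambda>c p q e.
    (if c then (if p then 0 else (if q then (if e then 0 else 1) else (if e then 524 else 0)))
    else (if p then (if e then 0 else 472) else (if q then (if e then 305 else 0) else 0)))),
    uloc = (\<lambda>c p q e. 0), ux = (\<lambda>c p q e. (if c then (if p then (if e then 6276
    else 0) else (if q then (if e then 0 else 5) else (if e then 65 else 0))) else (if p then
    (if e then 0 else 23) else (if q then (if e then 3170 else 0) else 0)))), ual = (\<lambda>p
    q. 0) \<rparr>"

lemmas FIN_sel = ucert_sel[OF FIN_def]

lemma FIN_check0: "all10 (ucheck FIN False False False False False)"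
  by (simp only: all_defs FIN_sel FIN_V3_eval bool_eval int_eval pattern_eval unrooted_eval cong: if_weak_cong)

lemma FIN_check1: "all10 (ucheck FIN False False False False True)"
  by (simp only: all_defs FIN_sel FIN_V3_eval bool_eval int_eval pattern_eval unrooted_eval cong: if_weak_cong)

lemma FIN_check2: "all10 (ucheck FIN False False False True True)"
  by (simp only: all_defs FIN_sel FIN_V3_eval bool_eval int_eval pattern_eval unrooted_eval cong: if_weak_cong)

lemma FIN_check3: "all10 (ucheck FIN False False True True True)"
  by (simp only: all_defs FIN_sel FIN_V3_eval bool_eval int_eval pattern_eval unrooted_eval cong: if_weak_cong)

lemma FIN_check4: "all10 (ucheck FIN False True True True True)"
  by (simp only: all_defs FIN_sel FIN_V3_eval bool_eval int_eval pattern_eval unrooted_eval cong: if_weak_cong)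

lemma FIN_check5: "all10 (ucheck FIN True True True True True)"
  by (simp only: all_defs FIN_sel FIN_V3_eval bool_eval int_eval pattern_eval unrooted_eval cong: if_weak_cong)

lemmas FIN_check = ucheck_sortedI[OF FIN_check0 FIN_check1 FIN_check2 FIN_check3 FIN_check4 FIN_check5]

lemma FIN_nonneg:
  "0 \<le> udeg FIN c p q e" "0 \<le> uloc FIN c p q e" "0 \<le> ux FIN c p q e" "0 \<le> ual FIN p q"
  by (simp_all add: FIN_sel)

section \<open>Evaluation of the six-vertex certificate\<close>

lemma N6_check_TT: "all8 (N6_prefix True True)"
  by (simp only: all_defs N6_prefix_def N6_mid_def N6_leaf_def prefix_lexmin_def lexmin6_def lexle.simps
    has_K4_def has_C5_def has_F1_def some_F2_def allowed6_def N6_S_def N6_kernel_eval N6_V_eval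
    N6_W0_def N6_W1_def N6_W2_def N6_W3_def N6_degree_def N6_deg_def N6_obj_def N6_obj_aux_def
    pair_overlap_def two_def dot.simps add2.simps mul2.simps bool_eval int_eval cong: if_weak_cong)

lemma N6_check_TF: "all8 (N6_prefix True False)"
  by (simp only: all_defs N6_prefix_def N6_mid_def N6_leaf_def prefix_lexmin_def lexmin6_def lexle.simps
    has_K4_def has_C5_def has_F1_def some_F2_def allowed6_def N6_S_def N6_kernel_eval N6_V_eval
    N6_W0_def N6_W1_def N6_W2_def N6_W3_def N6_degree_def N6_deg_def N6_obj_def N6_obj_aux_def
    pair_overlap_def two_def dot.simps add2.simps mul2.simps bool_eval int_eval cong: if_weak_cong)

lemma N6_check_FT: "all8 (N6_prefix False True)"
  by (simp only: all_defs N6_prefix_def N6_mid_def N6_leaf_def prefix_lexmin_def lexmin6_def lexle.simps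
    has_K4_def has_C5_def has_F1_def some_F2_def allowed6_def N6_S_def N6_kernel_eval N6_V_eval
    N6_W0_def N6_W1_def N6_W2_def N6_W3_def N6_degree_def N6_deg_def N6_obj_def N6_obj_aux_def
    pair_overlap_def two_def dot.simps add2.simps mul2.simps bool_eval int_eval cong: if_weak_cong)

lemma N6_check_FF: "all8 (N6_prefix False False)"
  by (simp only: all_defs N6_prefix_def N6_mid_def N6_leaf_def prefix_lexmin_def lexmin6_def lexle.simps
    has_K4_def has_C5_def has_F1_def some_F2_def allowed6_def N6_S_def N6_kernel_eval N6_V_eval
    N6_W0_def N6_W1_def N6_W2_def N6_W3_def N6_degree_def N6_deg_def N6_obj_def N6_obj_aux_def
    pair_overlap_def two_def dot.simps add2.simps mul2.simps bool_eval int_eval cong: if_weak_cong)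

lemma N6_check: "all10 N6_prefix"
  unfolding all10_def all9_def using N6_check_TT N6_check_TF N6_check_FT N6_check_FF by blast

section \<open>Optimal weights and the density bound\<close>

locale optimal_trigraph = trigraph V w E for V :: "'v set" and w E +
  fixes L :: real
  assumes w_pos: "v \<in> V \<Longrightarrow> 0 < w v"
    and E_irrefl: "\<not> E x x y"
    and link: "v \<in> V \<Longrightarrow> avg (\<lambda>x. avg (\<lambda>y. of_bool (E v x y))) = L"
    and sub_le: "avg (\<lambda>x. avg (\<lambda>y. avg (\<lambda>z. of_bool (E x y z \<and> B x \<and> B y \<and> B z)))) \<le>
      L * (avg (\<lambda>x. of_bool (B x))) ^ 3"
    and L_large: "4641 / 10000 < L"
begin

lemma avg_point: "v \<in> V \<Longrightarrow> avg (\<lambda>x. of_bool (x = v) * f x) = w v * f v"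
  using finite_V by (simp add: avg_def of_bool_def if_distrib[of "\<lambda>c. c * _"] if_distrib[of "\<lambda>c. _ * c"] sum.delta cong: if_cong)

lemma density: "avg (\<lambda>x. avg (\<lambda>y. avg (\<lambda>z. of_bool (E x y z)))) = L"
  using link by (simp cong: avg_cong)

lemma degree_avg:
  assumes "u \<in> V"
  shows "avg (\<lambda>x. avg (\<lambda>y. if E u x y then p else - q)) = (p + q) * L - q"
proof -
  have "(if E u x y then p else - q) = (p + q) * of_bool (E u x y) - q" for x y
    by simp
  then show ?thesis
    by (simp only: avg_diff avg_cmult avg_const link[OF assms])
qed

lemma degree_ge:
  assumes "u \<in> V"
  shows "0 \<le> avg (\<lambda>x. avg (\<lambda>y. if E u x y then 536 else - 464))"
    and "0 \<le> avg (\<lambda>x. avg (\<lambda>y. if E u x y then 5359 else - 4641))"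
  using L_large degree_avg[OF assms, of 536 464] degree_avg[OF assms, of 5359 4641] by simp_all

text \<open>An edge contains v at most once, so the change is exactly linear in \<open>w v\<close>,
  without higher-order terms. The factor 3 counts the positions of v in an ordered triple.\<close>

lemma cut_density_flip:
  assumes v: "v \<in> V"
  shows "cut_density (A(v := \<not> A v)) - cut_density A =
    3 * w v * (coloured.xdens V w E A (\<not> A v) v - coloured.xdens V w E A (A v) v) / 1000"
proof -
  interpret coloured V w E A ..
  define A' where "A' = A(v := \<not> A v)"
  define c where "c B x y z = (of_bool (E x y z \<and> two (B x) (B y) (B z)) :: real)" for B x y z
  define d where "d x y z = c A' x y z - c A x y z" for x y z
  have "d x y z = d y x z" for x y z
    by (simp only: d_def c_def E_swap12[of x y] two_commute(1)[of "A x" "A y"] two_commute(1)[of "A' x" "A' y"])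
  moreover have "d x y z = d x z y" for x y z
    by (simp only: d_def c_def E_swap23[of x y] two_commute(2)[of "A x" "A y"] two_commute(2)[of "A' x" "A' y"])
  ultimately have dsym: "d x y z = d y x z" "d x y z = d x z y" for x y z by blast+
  have dz: "d x y z = 0" if "x \<noteq> v" "y \<noteq> v" "z \<noteq> v" for x y z
    using that by (simp add: d_def c_def A'_def)
  have dd: "d x x z = 0" for x z by (simp add: d_def c_def E_irrefl)
  \<comment> \<open>A triple whose contribution changes contains v exactly once, and symmetry moves
    v to the front.\<close>
  have split: "d x y z = of_bool (x = v) * d v y z + of_bool (y = v) * d v x z + of_bool (z = v) * d v x y" for x y z
  proof (cases "x = v")
    case True
    then show ?thesis by (simp add: dd)
  next
    case x: False
    show ?thesis
    proof (cases "y = v")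
      case True
      have "d v x v = 0" using dsym(2)[of v x v] dd[of v x] by simp
      then show ?thesis using x True dsym(1)[of x v z] by simp
    next
      case y: False
      have "d x y v = d v x y" using dsym(2)[of x y v] dsym(1)[of x v y] by simp
      then show ?thesis using x y dz[of x y z] by (cases "z = v") simp_all
    qed
  qed
  have "cut_density A' - cut_density A = avg (\<lambda>x. avg (\<lambda>y. avg (\<lambda>z. d x y z)))"
    unfolding cut_density_def d_def c_def avg_diff ..
  also have "\<dots> = avg (\<lambda>x. avg (\<lambda>y. avg (\<lambda>z. of_bool (x = v) * d v y z)))
      + avg (\<lambda>x. avg (\<lambda>y. avg (\<lambda>z. of_bool (y = v) * d v x z)))
      + avg (\<lambda>x. avg (\<lambda>y. avg (\<lambda>z. of_bool (z = v) * d v x y)))"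
    by (subst split) (simp only: avg_add)
  also have "\<dots> = 3 * (w v * avg (\<lambda>x. avg (\<lambda>y. d v x y)))"
    by (simp add: avg_cmult avg_point[OF v])
  also have "d v x y = (real_of_int (xind (\<not> A v) (A x \<and> A y) (A x \<or> A y) (E v x y))
      - real_of_int (xind (A v) (A x \<and> A y) (A x \<or> A y) (E v x y))) / 1000" for x y
  proof (cases "E v x y")
    case True
    then have "x \<noteq> v" "y \<noteq> v" using E_irrefl E_swap23 E_swap12 by metis+
    then show ?thesis using True
      by (cases "A v"; cases "A x"; cases "A y") (simp_all add: d_def c_def A'_def xind_def two_def)
  qed (simp add: d_def c_def xind_def)
  then have "avg (\<lambda>x. avg (\<lambda>y. d v x y)) = (xdens (\<not> A v) v - xdens (A v) v) / 1000"
    unfolding xdens_def by (simp only: avg_diff divide_inverse avg_cmult_right)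
  finally show ?thesis unfolding A'_def by (simp only: mult.assoc times_divide_eq_right)
qed

text \<open>A cut of maximal density exists among the finitely many subsets of V. No flip improves
  it, and since \<open>w v\<close> is positive this becomes an inequality between the two link
  densities at v.\<close>

lemma exists_optimal_cut:
  assumes "403 / 1000 \<le> cut_density A0"
  shows "\<exists>A. 403 / 1000 \<le> cut_density A \<and>
    (\<forall>v\<in>V. coloured.xdens V w E A (\<not> A v) v \<le> coloured.xdens V w E A (A v) v)"
proof -
  let ?c = "\<lambda>S. cut_density (\<lambda>x. x \<in> S)"
  have cong: "cut_density A = cut_density A'" if "\<And>x. x \<in> V \<Longrightarrow> A x = A' x" for A A'
    unfolding cut_density_def using that by (intro avg_cong) auto
  have fin: "finite (?c ` Pow V)" using finite_V by simp
  then have "Max (?c ` Pow V) \<in> ?c ` Pow V" by (intro Max_in) auto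
  then obtain S where S: "?c S = Max (?c ` Pow V)" by auto
  define A where "A x \<longleftrightarrow> x \<in> S" for x
  have max: "cut_density B \<le> cut_density A" for B
  proof -
    have "cut_density B = ?c {x \<in> V. B x}" by (rule cong) auto
    also have "\<dots> \<le> ?c S" unfolding S by (intro Max_ge[OF fin] imageI) auto
    finally show ?thesis by (simp add: A_def[abs_def])
  qed
  show ?thesis
  proof (intro exI conjI ballI)
    show "403 / 1000 \<le> cut_density A" using assms max[of A0] by linarith
  next
    fix v assume v: "v \<in> V"
    have "3 * w v * (coloured.xdens V w E A (\<not> A v) v - coloured.xdens V w E A (A v) v) / 1000 \<le> 0"
      using cut_density_flip[OF v, of A] max[of "A(v := \<not> A v)"] by simp
    then show "coloured.xdens V w E A (\<not> A v) v \<le> coloured.xdens V w E A (A v) v"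
      using w_pos[OF v] by (simp add: mult_le_0_iff)
  qed
qed

lemma xdens_nonneg: "0 \<le> coloured.xdens V w E A r v"
proof -
  interpret coloured V w E A ..
  show ?thesis unfolding xdens_def by (intro avg_nonneg) (simp add: xind_def)
qed

text \<open>The bounds are bootstrapped: the cut density controls the vertices of A, this gives the
  inequality for \<open>defect_weight\<close>, which controls the vertices of B, and both bounds
  together give the inequality for \<open>defect\<close>.\<close>

lemma missing_ge_bad:
  obtains A where "0 < cut_density A"
    and "0 \<le> avg (\<lambda>x. avg (\<lambda>y. avg (\<lambda>z. real_of_int (defect (A x) (A y) (A z) (E x y z)))))"
proof -
  have "0 < avg (\<lambda>x. avg (\<lambda>y. avg (\<lambda>z. of_bool (E x y z))))"
    unfolding density using L_large by simp
  then obtain A0 where "403 / 1000 \<le> cut_density A0"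
    using exists_large_cut[OF nsum_nonpos[OF N6_check] degree_ge(2)] by blast
  then obtain A where cut: "403 / 1000 \<le> cut_density A"
    and loc: "\<And>v. v \<in> V \<Longrightarrow> coloured.xdens V w E A (\<not> A v) v \<le> coloured.xdens V w E A (A v) v"
    using exists_optimal_cut by blast
  interpret coloured V w E A ..
  note deg = degree_ge(1)
  \<comment> \<open>Taking the first vertex of the triple as root identifies the cut density with
    the mean AAB link density.\<close>
  have cutx: "1000 * of_bool (E x y z \<and> two (A x) (A y) (A z)) =
      real_of_int (xind (A x) (A y \<and> A z) (A y \<or> A z) (E x y z))" for x y z
    by (cases "A x"; cases "A y"; cases "A z") (simp_all add: xind_def two_def)
  have "avg (\<lambda>u. xdens (A u) u) = 1000 * cut_density A"
    unfolding xdens_def cut_density_def avg_cmult[symmetric] cutx ..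
  then have al: "403 \<le> avg (\<lambda>u. xdens (A u) u)" using cut by simp
  have "real_of_int (cut_weight (A x) (A y) (A z) (E x y z)) =
      1000 * of_bool (E x y z \<and> two (A x) (A y) (A z)) - 403" for x y z
    by (simp add: cut_weight_def)
  then have "avg (\<lambda>x. avg (\<lambda>y. avg (\<lambda>z. real_of_int (cut_weight (A x) (A y) (A z) (E x y z))))) =
      1000 * cut_density A - 403"
    unfolding cut_density_def by (simp only: avg_diff avg_cmult avg_const)
  then have tri: "0 \<le> avg (\<lambda>x. avg (\<lambda>y. avg (\<lambda>z. real_of_int (cut_weight (A x) (A y) (A z) (E x y z)))))"
    using cut by simp
  have csym: "cut_weight a b c e = cut_weight b a c e" "cut_weight a b c e = cut_weight a c b e"
    "defect a b c e = defect b a c e" "defect a b c e = defect a c b e"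
    "defect_weight a b c e = defect_weight b a c e" "defect_weight a b c e = defect_weight a c b e" for a b c e
    by (cases a; cases b; cases c; simp add: cut_weight_def defect_def defect_weight_def two_def)+
  have xA: "370 \<le> xdens True v" if v: "v \<in> V" "A v" for v
  proof (rule ccontr)
    assume "\<not> 370 \<le> xdens True v"
    then have lt: "xdens True v \<le> 370" by simp
    have l: "xdens (\<not> True) v \<le> xdens True v" using loc[OF v(1)] v(2) by simp
    \<comment> \<open>Each excluded interval supplies the lower end \<open>rlo\<close> of the
      next.\<close>
    have 1: "\<not> xdens True v \<le> 190"
    proof
      assume "xdens True v \<le> 190"
      then show False
        using rooted_contradiction[OF v(1) A1_nonneg csym(1,2)[folded A1_sel(4)] A1_check deg link, unfolded A1_sel]
          l tri xdens_nonneg[of A True v] by simp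
    qed
    have 2: "\<not> xdens True v \<le> 300"
    proof
      assume "xdens True v \<le> 300"
      then show False
        using rooted_contradiction[OF v(1) A2_nonneg csym(1,2)[folded A2_sel(4)] A2_check deg link, unfolded A2_sel]
          l tri 1 by simp
    qed
    show False
      using rooted_contradiction[OF v(1) A3_nonneg csym(1,2)[folded A3_sel(4)] A3_check deg link, unfolded A3_sel]
        l tri 2 lt by simp
  qed
  have "0 \<le> avg (\<lambda>x. avg (\<lambda>y. avg (\<lambda>z. real_of_int (uobj GF (A x) (A y) (A z) (E x y z)))))"
  proof (rule unrooted_inequality[OF GF_nonneg _ _ GF_check deg loc _ al])
    show "uobj GF a b c e = uobj GF b a c e" "uobj GF a b c e = uobj GF a c b e" for a b c e
      unfolding GF_sel using csym(5,6) by metis+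
    show "real_of_int (if A u then uxA GF else uxB GF) \<le> xdens (A u) u" if "u \<in> V" for u
      using xA[OF that] xdens_nonneg[of A False u] by (simp add: GF_sel)
  qed
  then have gf: "0 \<le> avg (\<lambda>x. avg (\<lambda>y. avg (\<lambda>z. real_of_int (defect_weight (A x) (A y) (A z) (E x y z)))))"
    unfolding GF_sel of_int_mult avg_cmult by (simp add: zero_le_mult_iff)
  have xB: "255 \<le> xdens False v" if v: "v \<in> V" "\<not> A v" for v
  proof (rule ccontr)
    assume "\<not> 255 \<le> xdens False v"
    then have lt: "xdens False v \<le> 255" by simp
    have l: "xdens (\<not> False) v \<le> xdens False v" using loc[OF v(1)] v(2) by simp
    have 1: "\<not> xdens False v \<le> 210"
    proof
      assume "xdens False v \<le> 210"
      then show False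
        using rooted_contradiction[OF v(1) B1_nonneg csym(5,6)[folded B1_sel(4)] B1_check deg link, unfolded B1_sel]
          l gf xdens_nonneg[of A False v] by simp
    qed
    show False
      using rooted_contradiction[OF v(1) B2_nonneg csym(5,6)[folded B2_sel(4)] B2_check deg link, unfolded B2_sel]
        l gf 1 lt by simp
  qed
  have "0 \<le> avg (\<lambda>x. avg (\<lambda>y. avg (\<lambda>z. real_of_int (uobj FIN (A x) (A y) (A z) (E x y z)))))"
  proof (rule unrooted_inequality[OF FIN_nonneg _ _ FIN_check deg loc _ al])
    show "uobj FIN a b c e = uobj FIN b a c e" "uobj FIN a b c e = uobj FIN a c b e" for a b c e
      unfolding FIN_sel using csym(3,4) by metis+
    show "real_of_int (if A u then uxA FIN else uxB FIN) \<le> xdens (A u) u" if "u \<in> V" for u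
      using xA[OF that] xB[OF that] by (simp add: FIN_sel)
  qed
  then have "0 \<le> avg (\<lambda>x. avg (\<lambda>y. avg (\<lambda>z. real_of_int (defect (A x) (A y) (A z) (E x y z)))))"
    unfolding FIN_sel of_int_mult avg_cmult by (simp add: zero_le_mult_iff)
  then show thesis using cut by (intro that[of A]) simp_all
qed

theorem L_le: "L \<le> 2 * sqrt 3 - 3"
proof -
  obtain A where cut: "0 < cut_density A"
    and def: "0 \<le> avg (\<lambda>x. avg (\<lambda>y. avg (\<lambda>z. real_of_int (defect (A x) (A y) (A z) (E x y z)))))"
    by (rule missing_ge_bad)
  define a where "a = avg (\<lambda>x. of_bool (A x))"
  define b where "b = avg (\<lambda>x. of_bool (\<not> A x))"
  have "a + b = avg (\<lambda>x. of_bool (A x) + of_bool (\<not> A x))" unfolding a_def b_def avg_add ..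
  also have "\<dots> = avg (\<lambda>x. 1)" by (intro avg_cong) simp
  finally have ab: "a + b = 1" by simp
  have a0: "0 < a"
  proof -
    have "0 \<le> a" unfolding a_def by (intro avg_nonneg) simp
    \<comment> \<open>Needed to cancel the factor a = 1 - b below.\<close>
    moreover have "a \<noteq> 0" using cut cut_density_le[of A] unfolding a_def by auto
    ultimately show ?thesis by simp
  qed
  have b0: "0 \<le> b" unfolding b_def by (intro avg_nonneg) simp
  let ?e = "\<lambda>x y z. of_bool (E x y z) :: real"
  let ?B = "\<lambda>x y z. of_bool (E x y z \<and> \<not> A x \<and> \<not> A y \<and> \<not> A z) :: real"
  let ?t = "\<lambda>x y z. of_bool (A x) * of_bool (A y) * of_bool (\<not> A z) + of_bool (A x) * of_bool (\<not> A y) * of_bool (A z)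
      + of_bool (\<not> A x) * of_bool (A y) * of_bool (A z) :: real"
  \<comment> \<open>An edge lies inside B, is one of the AAB triples that are not missing, or is of
    type AAA or ABB; \<open>defect\<close> records both the missing triples and the edges of the
    last kind.\<close>
  have pt: "?e x y z = ?B x y z + ?t x y z - 1 / 1000 * real_of_int (defect (A x) (A y) (A z) (E x y z))" for x y z
    by (cases "A x"; cases "A y"; cases "A z"; cases "E x y z") (simp_all add: defect_def two_def)
  have tt: "avg (\<lambda>x. avg (\<lambda>y. avg (\<lambda>z. ?t x y z))) = 3 * a\<^sup>2 * b"
    unfolding avg_add avg_cmult avg_cmult_right a_def[symmetric] b_def[symmetric]
    by (simp add: power2_eq_square)
  have "L = avg (\<lambda>x. avg (\<lambda>y. avg (\<lambda>z. ?e x y z)))" unfolding density ..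
  also have "\<dots> = avg (\<lambda>x. avg (\<lambda>y. avg (\<lambda>z. ?B x y z))) + 3 * a\<^sup>2 * b
      - 1 / 1000 * avg (\<lambda>x. avg (\<lambda>y. avg (\<lambda>z. real_of_int (defect (A x) (A y) (A z) (E x y z)))))"
    unfolding pt avg_diff avg_cmult tt[symmetric] by (simp only: avg_add)
  also have "\<dots> \<le> L * b ^ 3 + 3 * a\<^sup>2 * b"
    using sub_le[of "\<lambda>x. \<not> A x"] def unfolding b_def by simp
  finally have "L * (1 - b ^ 3) \<le> 3 * a\<^sup>2 * b" by (simp add: algebra_simps)
  moreover have a: "a = 1 - b" using ab by simp
  moreover have "1 - b ^ 3 = a * (1 + b + b\<^sup>2)"
    unfolding a by (simp add: algebra_simps power2_eq_square power3_eq_cube)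
  ultimately have "a * (L * (1 + b + b\<^sup>2)) \<le> a * (3 * (1 - b) * b)"
    by (simp add: power2_eq_square mult_ac)
  then have le: "L * (1 + b + b\<^sup>2) \<le> 3 * (1 - b) * b" using a0 by simp
  define s where "s = sqrt 3"
  have s: "s * s = 3" "0 \<le> s" by (simp_all add: s_def)
  have ss: "s * (s * c) = 3 * c" for c using s(1) by (simp flip: mult.assoc)
  have sq: "3 * (1 - b) * b \<le> (2 * s - 3) * (1 + b + b\<^sup>2)"
  proof -
    \<comment> \<open>The double root b = (\<surd>3 - 1) / 2 is the optimal measure of B.\<close>
    have "(2 * s - 3) * (1 + b + b\<^sup>2) - 3 * (1 - b) * b = 2 * s * (b - (s - 1) / 2)\<^sup>2"
      by (simp add: power2_eq_square field_simps ss)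
    then show ?thesis using s(2) by (smt (verit) mult_nonneg_nonneg zero_le_power2)
  qed
  have "0 < 1 + b + b\<^sup>2" using b0 by (simp add: add_pos_nonneg)
  moreover have "L * (1 + b + b\<^sup>2) \<le> (2 * s - 3) * (1 + b + b\<^sup>2)" using le sq by linarith
  ultimately show ?thesis unfolding s_def by (simp only: mult_le_cancel_right)
qed

end

section \<open>The Lagrangian of a finite 3-graph\<close>

lemma sqrt3_bound: "4641 / 10000 \<le> 2 * sqrt 3 - 3"
proof -
  have "173205 / 100000 \<le> sqrt 3" by (intro real_le_rsqrt) (simp add: power2_eq_square)
  then show ?thesis by simp
qed

text \<open>Maximal weights on the simplex give every vertex of the support the same link density.\<close>

theorem lagrangian_bound:
  fixes V0 :: "'v set" and E :: "'v \<Rightarrow> 'v \<Rightarrow> 'v \<Rightarrow> bool"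
  assumes fin: "finite V0"
    and sym: "\<And>x y z. E x y z = E y x z" "\<And>x y z. E x y z = E x z y"
    and irrefl: "\<And>x y. \<not> E x x y"
    and no_K4: "\<And>a b c d. \<not> (E a b c \<and> E a b d \<and> E a c d \<and> E b c d)"
    and no_C5_or_no_F2:
      "(\<forall>a b c d e. \<not> (E a b c \<and> E b c d \<and> E c d e \<and> E d e a \<and> E e a b)) \<or>
       (\<forall>a b c d e f. \<not> (E a b c \<and> E a c d \<and> E a d e \<and> E a e f \<and> E a f b \<and> E b c d))"
    and w: "\<And>x. x \<in> V0 \<Longrightarrow> 0 \<le> w x" "sum w V0 = 1"
  shows "(\<Sum>x\<in>V0. w x * (\<Sum>y\<in>V0. w y * (\<Sum>z\<in>V0. w z * of_bool (E x y z)))) \<le> 2 * sqrt 3 - 3"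
proof -
  define J where "J w f = (\<Sum>x\<in>V0. w x * f x)" for w f :: "'v \<Rightarrow> real"
  define e where "e x y z = (of_bool (E x y z) :: real)" for x y z
  define P where "P w = J w (\<lambda>x. J w (\<lambda>y. J w (\<lambda>z. e x y z)))" for w
  \<comment> \<open>Fixing the functions to be 0 outside \<open>V0\<close> places the simplex inside
    a product of compact sets, so Tychonoff's theorem applies.\<close>
  define \<Delta> where "\<Delta> = {w \<in> PiE UNIV (\<lambda>x. if x \<in> V0 then {0..1::real} else {0}). sum w V0 = 1}"
  have J_add: "J w (\<lambda>x. f x + g x) = J w f + J w g" for w f g
    by (simp add: J_def distrib_left sum.distrib)
  have J_cmult: "J w (\<lambda>x. c * f x) = c * J w f" for w c f
    by (simp add: J_def sum_distrib_left algebra_simps)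
  have J_zero: "J w (\<lambda>x. 0) = 0" for w by (simp add: J_def)
  have J_cong: "J w f = J w' f'" if "\<And>x. x \<in> V0 \<Longrightarrow> w x = w' x" "\<And>x. x \<in> V0 \<Longrightarrow> f x = f' x" for w w' f f'
    unfolding J_def using that by (intro sum.cong) auto
  have compact: "compact \<Delta>"
  proof -
    have "compactin (product_topology (\<lambda>x::'v. euclidean) UNIV) (PiE UNIV (\<lambda>x. if x \<in> V0 then {0..1::real} else {0}))"
      unfolding compactin_PiE by (simp add: compactin_euclidean_iff)
    then have "compact (PiE UNIV (\<lambda>x::'v. if x \<in> V0 then {0..1::real} else {0}))"
      by (simp only: compactin_euclidean_iff euclidean_product_topology)
    moreover have "closed {w :: 'v \<Rightarrow> real. sum w V0 = 1}"
      by (intro closed_Collect_eq continuous_on_sum continuous_on_const continuous_on_product_coordinates)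
    moreover have "\<Delta> = PiE UNIV (\<lambda>x. if x \<in> V0 then {0..1} else {0}) \<inter> {w. sum w V0 = 1}"
      by (auto simp: \<Delta>_def)
    ultimately show ?thesis by (simp only: compact_Int_closed)
  qed
  have cont: "continuous_on \<Delta> P"
  proof -
    have c: "continuous_on \<Delta> (\<lambda>w. w x)" for x
      by (rule continuous_on_subset[OF continuous_on_product_coordinates subset_UNIV])
    show ?thesis
      unfolding P_def J_def by (intro continuous_on_sum continuous_on_mult continuous_on_const c)
  qed
  \<comment> \<open>\<open>P\<close> does not see values outside \<open>V0\<close>, so the maximum
    over \<open>\<Delta>\<close> bounds all probability weights on \<open>V0\<close>.\<close>
  have \<Delta>I: "P u \<le> P u'" if u: "\<And>x. x \<in> V0 \<Longrightarrow> 0 \<le> u x" "sum u V0 = 1"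
    and max: "\<And>v. v \<in> \<Delta> \<Longrightarrow> P v \<le> P u'" for u u'
  proof -
    let ?u = "\<lambda>x. if x \<in> V0 then u x else 0"
    have "u x \<le> 1" if "x \<in> V0" for x
      using member_le_sum[OF that, of u] u fin by simp
    moreover have "sum ?u V0 = 1" unfolding u(2)[symmetric] by (intro sum.cong) auto
    ultimately have "?u \<in> \<Delta>" unfolding \<Delta>_def using u(1) by (simp add: PiE_UNIV_domain Pi_iff)
    moreover have "J ?u f = J u f" for f unfolding J_def by (intro sum.cong) auto
    then have "P u = P ?u" unfolding P_def by (simp only:)
    ultimately show ?thesis using max by simp
  qed
  have "\<Delta> \<noteq> {}"
  proof -
    have "u x \<le> 1" if "x \<in> V0" "u = w" for x u
      using member_le_sum[OF that(1), of w] that(2) w fin by simp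
    moreover have "(\<Sum>x\<in>V0. if x \<in> V0 then w x else 0) = 1" unfolding w(2)[symmetric] by (intro sum.cong) auto
    ultimately have "(\<lambda>x. if x \<in> V0 then w x else 0) \<in> \<Delta>"
      unfolding \<Delta>_def using w(1) by (simp add: PiE_UNIV_domain Pi_iff)
    then show ?thesis by blast
  qed
  then obtain u where u: "u \<in> \<Delta>" and max: "\<And>v. v \<in> \<Delta> \<Longrightarrow> P v \<le> P u"
    using continuous_attains_sup[OF compact _ cont] by blast
  define L where "L = P u"
  have u0: "0 \<le> u x" for x
  proof -
    have "u x \<in> (if x \<in> V0 then {0..1} else {0})"
      using u unfolding \<Delta>_def PiE_UNIV_domain by blast
    then show ?thesis by (simp split: if_splits)
  qed
  have u1: "sum u V0 = 1" using u by (simp add: \<Delta>_def)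
  have Jconst: "J u (\<lambda>_. c) = c" for c
    using u1 by (simp add: J_def flip: sum_distrib_right)
  have PL: "P v \<le> L" if "\<And>x. x \<in> V0 \<Longrightarrow> 0 \<le> v x" "sum v V0 = 1" for v
    unfolding L_def using \<Delta>I[OF that max] .
  have e0: "0 \<le> e x y z" "e x x z = 0" "e z x x = 0" "e x z x = 0" for x y z
  proof -
    have "\<not> E x x z" "\<not> E z x x" "\<not> E x z x"
      using irrefl[of x z] sym(1)[of z x x] sym(2)[of x z x] by metis+
    then show "0 \<le> e x y z" "e x x z = 0" "e z x x = 0" "e x z x = 0" by (simp_all only: e_def) simp_all
  qed
  have esym1: "e x y z = e y x z" for x y z by (simp only: e_def sym(1)[of x y])
  have esym2: "e x y z = e x z y" for x y z by (simp only: e_def sym(2)[of x y])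
  have Jnn: "0 \<le> J u f" if "\<And>x. 0 \<le> f x" for f
    unfolding J_def using u0 that by (intro sum_nonneg mult_nonneg_nonneg) auto
  define D where "D v = J u (\<lambda>y. J u (\<lambda>z. e v y z))" for v
  have D0: "0 \<le> D v" for v unfolding D_def by (intro Jnn e0)
  \<comment> \<open>First-order condition: moving a small mass t to v changes \<open>P\<close> at
    rate 3 (D v - L), which cannot be positive at a maximum.\<close>
  have D_le: "D v \<le> L" if v: "v \<in> V0" for v
  proof (rule ccontr)
    assume "\<not> D v \<le> L"
    then have gt: "L < D v" by simp
    have L0: "0 \<le> L" unfolding L_def P_def by (intro Jnn e0)
    \<comment> \<open>This t makes the correction 6 t D v equal to 3/2 of the gap D v - L, while the
      linear gain is three times the gap.\<close>
    define t where "t = (D v - L) / (4 * D v)"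
    have t: "0 < t" "t \<le> 1 / 4" "4 * t * D v = D v - L" unfolding t_def using gt L0 by (auto simp: field_simps)
    define u' where "u' x = (1 - t) * u x + t * of_bool (x = v)" for x
    have Ju': "J u' f = (1 - t) * J u f + t * f v" for f
    proof -
      have "J u' f = (\<Sum>x\<in>V0. (1 - t) * (u x * f x) + t * (if x = v then f x else 0))"
        unfolding J_def u'_def by (intro sum.cong) (auto simp: algebra_simps)
      also have "\<dots> = (1 - t) * J u f + t * f v"
        using v fin by (simp add: sum.distrib J_def flip: sum_distrib_left)
      finally show ?thesis .
    qed
    have "sum u' V0 = J u' (\<lambda>_. 1)" by (simp add: J_def)
    then have "sum u' V0 = 1" by (simp add: Ju' Jconst)
    moreover have "0 \<le> u' x" for x unfolding u'_def using t u0[of x] by simp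
    ultimately have "P u' \<le> L" by (intro PL)
    \<comment> \<open>Terms with v in two positions vanish by irreflexivity.\<close>
    moreover have "P u' = (1 - t) ^ 3 * L + 3 * t * (1 - t)\<^sup>2 * D v"
    proof -
      have s: "J u (\<lambda>x. J u (\<lambda>y. e x y v)) = D v" "J u (\<lambda>x. J u (\<lambda>y. e x v y)) = D v"
      proof -
        have "e x y v = e v x y" for x y using esym2[of x y v] esym1[of x v y] by simp
        then show "J u (\<lambda>x. J u (\<lambda>y. e x y v)) = D v" unfolding D_def by (simp only:)
        show "J u (\<lambda>x. J u (\<lambda>y. e x v y)) = D v" unfolding D_def by (simp only: esym1[of _ v])
      qed
      have "e v v = (\<lambda>z. 0)" by (intro ext e0)
      then have z: "J u (e v v) = 0" by (simp only: J_zero)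
      have "P u' = (1 - t) * J u (\<lambda>x. (1 - t) * J u (\<lambda>y. (1 - t) * J u (e x y) + t * e x y v)
            + t * ((1 - t) * J u (e x v) + t * e x v v))
          + t * ((1 - t) * J u (\<lambda>y. (1 - t) * J u (e v y) + t * e v y v) + t * ((1 - t) * J u (e v v) + t * e v v v))"
        unfolding P_def Ju' ..
      also have "\<dots> = (1 - t) * ((1 - t) * ((1 - t) * L + t * D v) + t * ((1 - t) * D v)) + t * ((1 - t) * ((1 - t) * D v))"
        unfolding L_def P_def by (simp only: J_add J_cmult s D_def[symmetric] z e0 mult_zero_right add_0_right J_zero)
      finally show ?thesis by (simp add: algebra_simps power2_eq_square power3_eq_cube)
    qed
    ultimately have "(1 - t) ^ 3 * L + 3 * t * (1 - t)\<^sup>2 * D v \<le> L" by simp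
    then have "t * (3 * (D v - L) - t * (6 * D v - 3 * L) + t * t * (3 * D v - L)) \<le> 0"
      by (simp add: algebra_simps power2_eq_square power3_eq_cube)
    moreover have "0 < 3 * (D v - L) - t * (6 * D v - 3 * L) + t * t * (3 * D v - L)"
    proof -
      have "t * (6 * D v - 3 * L) \<le> 6 * (t * D v)" using t L0 by (simp add: algebra_simps)
      moreover have "0 \<le> t * t * (3 * D v - L)" using t gt L0 by (intro mult_nonneg_nonneg) auto
      moreover have "6 * (t * D v) = 3 / 2 * (D v - L)" using t(3) by simp
      ultimately show ?thesis using gt by simp
    qed
    ultimately show False using t(1) by (simp add: mult_le_0_iff)
  qed
  show ?thesis
  proof (cases "4641 / 10000 < L")
    case False
    \<comment> \<open>For L at most 0.4641 the claim is already true, as 2 \<surd>3 - 3 is slightly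
      larger; the certificates treat only larger L.\<close>
    have "P w \<le> L" by (rule PL) (use w in auto)
    then show ?thesis using False sqrt3_bound unfolding P_def J_def e_def by linarith
  next
    case True
    \<comment> \<open>Passing to the support makes all weights positive, as the flipping argument
      requires.\<close>
    define V where "V = {x \<in> V0. 0 < u x}"
    have V: "V \<subseteq> V0" by (auto simp: V_def)
    have out: "u x = 0" if "x \<in> V0 - V" for x using that u0[of x] by (auto simp: V_def)
    have sumV: "(\<Sum>x\<in>V. u x * f x) = J u f" for f
      unfolding J_def using V out fin by (intro sum.mono_neutral_left) auto
    interpret weighted V u
    proof
      show "finite V" using V fin finite_subset by blast
      show "sum u V = 1" using sumV[of "\<lambda>_. 1"] Jconst[of 1] by simp
    qed (use u0 in auto)
    have avg_J: "avg f = J u f" for f unfolding avg_def by (rule sumV)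
    have eq: "D v = L" if "v \<in> V" for v
    proof -
      have "J u D = L" unfolding L_def P_def D_def ..
      then have "J u (\<lambda>x. L + (- 1) * D x) = 0"
        by (simp only: J_add J_cmult Jconst)
      then have "(\<Sum>x\<in>V0. u x * (L - D x)) = 0" by (simp add: J_def)
      \<comment> \<open>\<open>D\<close> never exceeds \<open>L\<close> and has mean
        \<open>L\<close>, so it equals \<open>L\<close> wherever the weight is positive.\<close>
      then have "\<forall>x\<in>V0. u x * (L - D x) = 0"
        using fin u0 D_le by (subst (asm) sum_nonneg_eq_0_iff) auto
      then show ?thesis using that by (auto simp: V_def)
    qed
    have "optimal_trigraph V u E L"
    proof unfold_locales
      fix v assume "v \<in> V"
      then show "0 < u v" by (simp add: V_def)
      show "avg (\<lambda>x. avg (\<lambda>y. of_bool (E v x y))) = L"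
        using eq[OF \<open>v \<in> V\<close>] unfolding avg_J D_def e_def .
    next
      fix B :: "'v \<Rightarrow> bool"
      define b where "b = avg (\<lambda>x. of_bool (B x))"
      have b0: "0 \<le> b" unfolding b_def by (intro avg_nonneg) simp
      define S where "S = avg (\<lambda>x. avg (\<lambda>y. avg (\<lambda>z. of_bool (E x y z \<and> B x \<and> B y \<and> B z))))"
      \<comment> \<open>The weights restricted to B and divided by b form a probability weight
        again; as \<open>P\<close> is homogeneous of degree 3, maximality of L gives the bound L
        times the cube of b.\<close>
      define q where "q x = u x * of_bool (B x)" for x
      have Jq: "J q f = J u (\<lambda>x. of_bool (B x) * f x)" for f
        unfolding J_def q_def by (simp add: mult.assoc)
      have Pq: "P q = S"
      proof -
        have "P q = J u (\<lambda>x. J u (\<lambda>y. J u (\<lambda>z. of_bool (B x) * (of_bool (B y) * (of_bool (B z) * e x y z)))))"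
          unfolding P_def Jq J_cmult ..
        also have "\<dots> = S"
          unfolding S_def avg_J e_def by (intro J_cong refl) auto
        finally show ?thesis .
      qed
      have "S \<le> L * b ^ 3"
      proof (cases "b = 0")
        case True
        have "S \<le> avg (\<lambda>x. avg (\<lambda>y. avg (\<lambda>z. of_bool (B x))))"
          unfolding S_def by (intro avg_mono) auto
        then show ?thesis using True by (simp add: b_def)
      next
        case False
        then have b: "0 < b" using b0 by simp
        define q' where "q' x = inverse b * q x" for x
        have Jq': "J q' f = inverse b * J q f" for f
          unfolding J_def q'_def by (simp add: sum_distrib_left mult.assoc)
        have "sum q' V0 = J q' (\<lambda>_. 1)" by (simp add: J_def)
        also have "\<dots> = inverse b * J u (\<lambda>x. of_bool (B x))" unfolding Jq' Jq by simp
        also have "\<dots> = 1" using b unfolding b_def avg_J by simp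
        finally have "P q' \<le> L" using b u0 by (intro PL) (auto simp: q'_def q_def)
        moreover have "P q' = inverse b ^ 3 * S"
          unfolding Pq[symmetric] P_def Jq' J_cmult by (simp add: power3_eq_cube)
        ultimately show ?thesis using b by (simp add: field_simps)
      qed
      then show "avg (\<lambda>x. avg (\<lambda>y. avg (\<lambda>z. of_bool (E x y z \<and> B x \<and> B y \<and> B z)))) \<le> L * avg (\<lambda>x. of_bool (B x)) ^ 3"
        by (simp only: S_def b_def)
    next
      show "E x y z = E y x z" "E x y z = E x z y" "\<not> E x x y" for x y z
        by (rule sym irrefl)+
      show "\<not> (E a b c \<and> E a b d \<and> E a c d \<and> E b c d)" for a b c d by (rule no_K4)
    qed (fact no_C5_or_no_F2 True)+
    then have "L \<le> 2 * sqrt 3 - 3" by (rule optimal_trigraph.L_le)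
    moreover have "P w \<le> L" by (rule PL) (use w in auto)
    ultimately show ?thesis unfolding P_def J_def e_def by linarith
  qed
qed

section \<open>Random sampling\<close>

context weighted
begin

lemma avgs_eq_const:
  assumes "\<And>\<psi>. (\<And>i. i \<notin> set is \<Longrightarrow> \<psi> i = \<phi> i) \<Longrightarrow> g \<psi> = c"
  shows "avgs is g \<phi> = c"
  using assms
proof (induction "is" arbitrary: \<phi>)
  case Nil
  then show ?case by simp
next
  case (Cons i js)
  have "avgs js g (\<phi>(i := x)) = c" for x
  proof (rule Cons.IH)
    fix \<psi> assume "\<And>k. k \<notin> set js \<Longrightarrow> \<psi> k = (\<phi>(i := x)) k"
    then show "g \<psi> = c" by (intro Cons.prems) simp
  qed
  then show ?case by simp
qed

lemma avgs_append: "avgs (is @ js) g \<phi> = avgs is (\<lambda>\<psi>. avgs js g \<psi>) \<phi>"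
  by (induction "is" arbitrary: \<phi>) simp_all

text \<open>Coordinates on which g does not depend average out. A sample of m vertices thus reduces
  to the few that an edge or a bad tuple involves.\<close>

lemma avgs_marginal:
  assumes "distinct is" "distinct js" "set js \<subseteq> set is"
    and g: "\<And>\<phi> \<psi>. (\<And>j. j \<in> set js \<Longrightarrow> \<phi> j = \<psi> j) \<Longrightarrow> g \<phi> = g \<psi>"
  shows "avgs is g \<phi> = avgs js g \<phi>"
proof -
  let ?r = "filter (\<lambda>i. i \<notin> set js) is"
  have "avgs is g \<phi> = avgs (js @ ?r) g \<phi>"
    using assms(1-3) by (intro avgs_perm) auto
  also have "\<dots> = avgs js (\<lambda>\<psi>. avgs ?r g \<psi>) \<phi>" by (rule avgs_append)
  also have "(\<lambda>\<psi>. avgs ?r g \<psi>) = g"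
  proof (rule ext, rule avgs_eq_const)
    fix \<psi> \<psi>' :: "nat \<Rightarrow> 'v"
    assume "\<And>i. i \<notin> set ?r \<Longrightarrow> \<psi>' i = \<psi> i"
    then show "g \<psi>' = g \<psi>" by (intro g) simp
  qed
  finally show ?thesis .
qed

lemma avgs_sum:
  "finite A \<Longrightarrow> avgs is (\<lambda>\<phi>. \<Sum>a\<in>A. g a \<phi>) \<phi> = (\<Sum>a\<in>A. avgs is (g a) \<phi>)"
  by (induction A rule: finite_induct) (simp_all add: avgs_add)

end

text \<open>Bonferroni: 1 - [i = j] - [i = k] - [j = k] is at most the indicator that i, j, k are
  distinct.\<close>

lemma sum_distinct_triples:
  "real m ^ 3 - 3 * real m ^ 2 \<le> (\<Sum>i<m. \<Sum>j<m. \<Sum>k<m. of_bool (i \<noteq> j \<and> i \<noteq> k \<and> j \<noteq> k))"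
proof -
  have d: "(\<Sum>k<m. of_bool (k = j) :: real) = 1" "(\<Sum>k<m. of_bool (j = k) :: real) = 1" if "j < m" for j
    using that by (simp_all add: of_bool_def if_distrib sum.delta sum.delta')
  have "real m ^ 3 - 3 * real m ^ 2 =
      (\<Sum>i<m. \<Sum>j<m. \<Sum>k<m. 1 - of_bool (i = j) - of_bool (i = k) - of_bool (j = k))"
    by (simp add: sum_subtractf d power2_eq_square power3_eq_cube flip: sum_distrib_left)
      (simp add: algebra_simps)
  also have "\<dots> \<le> (\<Sum>i<m. \<Sum>j<m. \<Sum>k<m. of_bool (i \<noteq> j \<and> i \<noteq> k \<and> j \<noteq> k))"
    by (intro sum_mono) auto
  finally show ?thesis .
qed

text \<open>A homomorphic image of \<open>F2\<close> that is not a copy either contains a complete 4-set or consists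
  of five vertices \<open>a, b, c, d, e\<close> with edges \<open>abc, acd, ade, ace, bcd\<close>. Two such configurations that differ
  only in \<open>c\<close> together form a copy of \<open>F2\<close>, so a random 5-tuple is one with probability at most
  \<open>1 / n\<close>. Hence a random blow-up of bounded size almost surely satisfies the hypotheses of
  \<open>lagrangian_bound\<close>.\<close>

theorem sampling_bound:
  fixes V :: "'v set" and E :: "'v \<Rightarrow> 'v \<Rightarrow> 'v \<Rightarrow> bool"
  assumes fin: "finite V" "V \<noteq> {}"
    and sym: "\<And>x y z. E x y z = E y x z" "\<And>x y z. E x y z = E x z y"
    and irrefl: "\<And>x y. \<not> E x x y"
    and no_K4: "\<And>a b c d. \<not> (E a b c \<and> E a b d \<and> E a c d \<and> E b c d)"
    and no_C5_or_no_F2: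
      "(\<forall>a b c d e. \<not> (E a b c \<and> E b c d \<and> E c d e \<and> E d e a \<and> E e a b)) \<or>
       (\<forall>a b c d e f. distinct [a, b, c, d, e, f] \<longrightarrow>
          \<not> (E a b c \<and> E a c d \<and> E a d e \<and> E a e f \<and> E a f b \<and> E b c d))"
  shows "(real m ^ 3 - 3 * real m ^ 2) *
      ((\<Sum>x\<in>V. \<Sum>y\<in>V. \<Sum>z\<in>V. of_bool (E x y z)) / real (card V) ^ 3) \<le>
    (2 * sqrt 3 - 3) * real m ^ 3 + real m ^ 8 / real (card V)"
proof -
  let ?L = "2 * sqrt 3 - 3" and ?n = "real (card V)"
  have n: "0 < ?n" using fin by (simp add: card_gt_0_iff)
  interpret weighted V "\<lambda>_. 1 / ?n"
    by unfold_locales (use fin n in auto)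
  define D where "D = avg (\<lambda>x. avg (\<lambda>y. avg (\<lambda>z. of_bool (E x y z))))"
  have D: "(\<Sum>x\<in>V. \<Sum>y\<in>V. \<Sum>z\<in>V. of_bool (E x y z)) / ?n ^ 3 = D"
    unfolding D_def avg_def by (simp add: power3_eq_cube flip: sum_distrib_left sum_divide_distrib)
  have D0: "0 \<le> D" unfolding D_def by (intro avg_nonneg) simp
  have L0: "0 \<le> ?L" using real_le_rsqrt[of "3/2" 3] by (simp add: power2_eq_square)
  have dist: "x \<noteq> y \<and> x \<noteq> z \<and> y \<noteq> z" if "E x y z" for x y z
    using that irrefl sym by metis
  have "(real m ^ 3 - 3 * real m ^ 2) * D \<le> ?L * real m ^ 3 + real m ^ 8 / ?n"
    using no_C5_or_no_F2
  proof
    assume *: "\<forall>a b c d e. \<not> (E a b c \<and> E b c d \<and> E c d e \<and> E d e a \<and> E e a b)"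
    \<comment> \<open>A homomorphic image of the five-cycle is a copy, since any two of its vertices
      share an edge. Uniform weights on V therefore suffice, without sampling.\<close>
    have "D \<le> ?L"
      unfolding D_def avg_def
      by (rule lagrangian_bound[OF fin(1) sym irrefl no_K4 disjI1[OF *]]) (use fin n in auto)
    then have "real m ^ 3 * D \<le> real m ^ 3 * ?L" by (intro mult_left_mono) auto
    moreover have "(real m ^ 3 - 3 * real m ^ 2) * D \<le> real m ^ 3 * D"
      using D0 by (intro mult_right_mono) auto
    moreover have "0 \<le> real m ^ 8 / ?n" using n by simp
    ultimately show ?thesis unfolding mult.commute[of ?L] by linarith
  next
    assume noF2: "\<forall>a b c d e f. distinct [a, b, c, d, e, f] \<longrightarrow>
          \<not> (E a b c \<and> E a c d \<and> E a d e \<and> E a e f \<and> E a f b \<and> E b c d)"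
    define bad where "bad a b c d e \<longleftrightarrow> E a b c \<and> E a c d \<and> E a d e \<and> E a c e \<and> E b c d" for a b c d e
    have bad_dist: "distinct [a, b, d, e, c]" if "bad a b c d e" for a b c d e
    proof -
      have "b \<noteq> e" using that no_K4[of a b c d] sym unfolding bad_def by metis
      then show ?thesis using that unfolding bad_def by (auto dest: dist)
    qed
    have bad_unique: "c = c'" if "bad a b c d e" "bad a b c' d e" for a b c c' d e
    proof (rule ccontr)
      assume "c \<noteq> c'"
      then have "distinct [a, b, c, d, e, c']" using that[THEN bad_dist] by auto
      moreover have "E a e c'" "E a c' b" using that sym unfolding bad_def by metis+
      ultimately show False using noF2 that(1) unfolding bad_def by metis
    qed
    have F2_bad: "\<exists>p q r s t. {p, q, r, s, t} \<subseteq> {a, b, c, d, e, f} \<and> bad p q r s t"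
      if F: "E a b c" "E a c d" "E a d e" "E a e f" "E a f b" "E b c d" for a b c d e f
    proof -
      have "b \<noteq> e" using F no_K4[of a b c d] sym by metis
      moreover have "d \<noteq> f" using F no_K4[of a b c d] sym by metis
      \<comment> \<open>The pairs of vertices of \<open>F2\<close> in no common edge are be, df, ce
        and cf; identifying b with e or d with f would complete the 4-set abcd.\<close>
      ultimately have "c = e \<or> c = f"
        using F[THEN dist] F noF2[rule_format, of a b c d e f] by auto
      then show ?thesis
      proof
        assume "c = f"
        then have "bad a b c d e" using F sym unfolding bad_def by metis
        then show ?thesis by blast
      next
        assume "c = e"
        then have "bad a d c b f" using F sym unfolding bad_def by metis
        then show ?thesis by blast
      qed
    qed
    define T where "T = {..<m} \<times> {..<m} \<times> {..<m} \<times> {..<m} \<times> {..<m}"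
    define B where "B = (\<lambda>(p, q, r, s, t) (\<phi> :: nat \<Rightarrow> 'v). of_bool (bad (\<phi> p) (\<phi> q) (\<phi> r) (\<phi> s) (\<phi> t)) :: real)"
    have finT: "finite T" and cardT: "real (card T) = real m ^ 5"
      by (simp_all add: T_def card_cartesian_product eval_nat_numeral)
    have B0: "0 \<le> B x \<phi>" for x \<phi> by (cases x) (simp add: B_def)
    \<comment> \<open>If no sampled 5-tuple is bad, the sampled 3-graph with weights 1/m obeys the
      Lagrangian bound; otherwise the number of bad tuples is at least 1 and the trivial bound, the
      cube of m, applies.\<close>
    have sample: "(\<Sum>i<m. \<Sum>j<m. \<Sum>k<m. of_bool (E (\<phi> i) (\<phi> j) (\<phi> k))) \<le>
        real m ^ 3 * ?L + real m ^ 3 * (\<Sum>x\<in>T. B x \<phi>)" for \<phi> :: "nat \<Rightarrow> 'v"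
    proof (cases "m > 0 \<and> (\<forall>x\<in>T. B x \<phi> = 0)")
      case True
      then have m: "0 < m" and B: "\<And>x. x \<in> T \<Longrightarrow> B x \<phi> = 0" by auto
      have nobad: "\<not> bad (\<phi> p) (\<phi> q) (\<phi> r) (\<phi> s) (\<phi> t)"
        if "p < m" "q < m" "r < m" "s < m" "t < m" for p q r s t
        using B[of "(p, q, r, s, t)"] that by (auto simp: T_def B_def)
      have nobad': "\<not> bad p q r s t" if "{p, q, r, s, t} \<subseteq> \<phi> ` {..<m}" for p q r s t
      proof -
        have "\<exists>i<m. x = \<phi> i" if "x \<in> \<phi> ` {..<m}" for x using that by blast
        with that obtain p' q' r' s' t' where "p = \<phi> p'" "p' < m" "q = \<phi> q'" "q' < m"
          "r = \<phi> r'" "r' < m" "s = \<phi> s'" "s' < m" "t = \<phi> t'" "t' < m"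
          unfolding insert_subset by metis
        then show ?thesis using nobad[of p' q' r' s' t'] by simp
      qed
      define E' where "E' i j k \<longleftrightarrow> i < m \<and> j < m \<and> k < m \<and> E (\<phi> i) (\<phi> j) (\<phi> k)" for i j k
      have "(\<Sum>i<m. 1 / real m * (\<Sum>j<m. 1 / real m * (\<Sum>k<m. 1 / real m * of_bool (E' i j k)))) \<le> ?L"
      proof (rule lagrangian_bound)
        show "E' x y z = E' y x z" for x y z unfolding E'_def using sym(1)[of "\<phi> x"] by blast
        show "E' x y z = E' x z y" for x y z unfolding E'_def using sym(2)[of "\<phi> x"] by blast
        show "\<not> E' x x y" for x y unfolding E'_def using irrefl by blast
        show "\<not> (E' a b c \<and> E' a b d \<and> E' a c d \<and> E' b c d)" for a b c d
          unfolding E'_def using no_K4 by blast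
        have "\<not> (E' a b c \<and> E' a c d \<and> E' a d e \<and> E' a e f \<and> E' a f b \<and> E' b c d)" for a b c d e f
        proof
          assume A: "E' a b c \<and> E' a c d \<and> E' a d e \<and> E' a e f \<and> E' a f b \<and> E' b c d"
          then have F: "E (\<phi> a) (\<phi> b) (\<phi> c)" "E (\<phi> a) (\<phi> c) (\<phi> d)" "E (\<phi> a) (\<phi> d) (\<phi> e)"
            "E (\<phi> a) (\<phi> e) (\<phi> f)" "E (\<phi> a) (\<phi> f) (\<phi> b)" "E (\<phi> b) (\<phi> c) (\<phi> d)"
            and lt: "a < m" "b < m" "c < m" "d < m" "e < m" "f < m"
            unfolding E'_def by simp_all
          from F2_bad[OF F] obtain p q r s t where
            sub: "{p, q, r, s, t} \<subseteq> {\<phi> a, \<phi> b, \<phi> c, \<phi> d, \<phi> e, \<phi> f}" and bad: "bad p q r s t"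
            by (elim exE conjE)
          have "{\<phi> a, \<phi> b, \<phi> c, \<phi> d, \<phi> e, \<phi> f} \<subseteq> \<phi> ` {..<m}"
            using lt by blast
          with sub have "{p, q, r, s, t} \<subseteq> \<phi> ` {..<m}" by (rule order_trans)
          then show False using nobad'[of p q r s t] bad by simp
        qed
        then show "(\<forall>a b c d e. \<not> (E' a b c \<and> E' b c d \<and> E' c d e \<and> E' d e a \<and> E' e a b)) \<or>
          (\<forall>a b c d e f. \<not> (E' a b c \<and> E' a c d \<and> E' a d e \<and> E' a e f \<and> E' a f b \<and> E' b c d))"
          by blast
      qed (use m in auto)
      then have "(\<Sum>i<m. \<Sum>j<m. \<Sum>k<m. of_bool (E' i j k)) / real m ^ 3 \<le> ?L"
        by (simp add: power3_eq_cube del: sum_of_bool_eq flip: sum_distrib_left sum_divide_distrib)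
      also have "(\<Sum>i<m. \<Sum>j<m. \<Sum>k<m. of_bool (E' i j k)) =
          (\<Sum>i<m. \<Sum>j<m. \<Sum>k<m. of_bool (E (\<phi> i) (\<phi> j) (\<phi> k)) :: real)"
        by (intro sum.cong refl) (simp add: E'_def)
      finally have "(\<Sum>i<m. \<Sum>j<m. \<Sum>k<m. of_bool (E (\<phi> i) (\<phi> j) (\<phi> k))) \<le> ?L * real m ^ 3"
        using m by (subst (asm) pos_divide_le_eq) simp_all
      moreover have "(\<Sum>x\<in>T. B x \<phi>) = 0" using B by simp
      ultimately show ?thesis by (simp only: mult.commute[of ?L] mult_zero_right add_0_right)
    next
      case False
      have "(\<Sum>i<m. \<Sum>j<m. \<Sum>k<m. of_bool (E (\<phi> i) (\<phi> j) (\<phi> k)) :: real) \<le> (\<Sum>i<m. \<Sum>j<m. \<Sum>k<m. 1)"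
        by (intro sum_mono) simp
      also have "\<dots> = real m ^ 3" by (simp add: power3_eq_cube)
      finally have 1: "(\<Sum>i<m. \<Sum>j<m. \<Sum>k<m. of_bool (E (\<phi> i) (\<phi> j) (\<phi> k)) :: real) \<le> real m ^ 3" .
      have "real m ^ 3 * 1 \<le> real m ^ 3 * (\<Sum>x\<in>T. B x \<phi>)" 
      proof (cases "m = 0")
        case True
        then show ?thesis by simp
      next
        case m: False
        with False obtain x where x: "x \<in> T" "B x \<phi> \<noteq> 0" by auto
        then have "B x \<phi> = 1" by (cases x) (auto simp: B_def)
        moreover have "B x \<phi> \<le> (\<Sum>x\<in>T. B x \<phi>)"
          using finT x B0 by (intro member_le_sum) auto
        ultimately show ?thesis by (intro mult_left_mono) auto
      qed
      moreover have "0 \<le> real m ^ 3 * ?L" using L0 by (intro mult_nonneg_nonneg) auto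
      ultimately show ?thesis using 1 by linarith
    qed
    obtain v where v: "v \<in> V" using fin by blast
    let ?\<phi> = "\<lambda>_ :: nat. v" and ?is = "[0..<m]"
    \<comment> \<open>Repeated indices contribute 0 by irreflexivity; a triple of distinct indices
      is an edge with probability D.\<close>
    have edge: "avgs ?is (\<lambda>\<phi>. of_bool (E (\<phi> i) (\<phi> j) (\<phi> k))) ?\<phi> = of_bool (i \<noteq> j \<and> i \<noteq> k \<and> j \<noteq> k) * D"
      if "i < m" "j < m" "k < m" for i j k
    proof (cases "i \<noteq> j \<and> i \<noteq> k \<and> j \<noteq> k")
      case True
      then have "avgs ?is (\<lambda>\<phi>. of_bool (E (\<phi> i) (\<phi> j) (\<phi> k))) ?\<phi> =
          avgs [i, j, k] (\<lambda>\<phi>. of_bool (E (\<phi> i) (\<phi> j) (\<phi> k))) ?\<phi>"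
        using that by (intro avgs_marginal) auto
      then show ?thesis using True by (simp add: D_def)
    next
      case False
      then have "\<not> E (\<phi> i) (\<phi> j) (\<phi> k)" for \<phi> using dist by blast
      then show ?thesis using False by simp
    qed
    have badp: "avgs ?is (B x) ?\<phi> \<le> 1 / ?n" if "x \<in> T" for x
    proof -
      obtain p q r s t where x: "x = (p, q, r, s, t)" by (cases x)
      have lt: "p < m" "q < m" "r < m" "s < m" "t < m" using that by (auto simp: T_def x)
      show ?thesis
      proof (cases "distinct [p, q, s, t, r]")
        case True
        \<comment> \<open>For given a, b, d, e at most one c makes the tuple bad, and a random
          vertex hits it with probability at most 1/n.\<close>
        have one: "avg (\<lambda>c. of_bool (bad a b c d e)) \<le> 1 / ?n" for a b d e
        proof -
          have "card (V \<inter> {c. bad a b c d e}) \<le> 1"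
            using bad_unique fin(1) by (auto simp: card_le_Suc0_iff_eq)
          moreover have "avg (\<lambda>c. of_bool (bad a b c d e)) = real (card (V \<inter> {c. bad a b c d e})) / ?n"
            unfolding avg_def using fin(1) by (simp flip: sum_divide_distrib)
          ultimately show ?thesis using n by (simp add: divide_right_mono)
        qed
        have "avgs ?is (B x) ?\<phi> = avgs [p, q, s, t, r] (B x) ?\<phi>"
        proof (rule avgs_marginal)
          fix \<phi> \<psi> :: "nat \<Rightarrow> 'v" assume "\<And>j. j \<in> set [p, q, s, t, r] \<Longrightarrow> \<phi> j = \<psi> j"
          then show "B x \<phi> = B x \<psi>" by (simp add: B_def x)
        qed (use True lt in auto)
        also have "\<dots> = avg (\<lambda>a. avg (\<lambda>b. avg (\<lambda>d. avg (\<lambda>e. avg (\<lambda>c. of_bool (bad a b c d e))))))"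
          using True by (simp add: B_def x)
        also have "\<dots> \<le> avg (\<lambda>a. avg (\<lambda>b. avg (\<lambda>d. avg (\<lambda>e. 1 / ?n))))"
          by (intro avg_mono one)
        finally show ?thesis by simp
      next
        case False
        then have "\<not> bad (\<phi> p) (\<phi> q) (\<phi> r) (\<phi> s) (\<phi> t)" for \<phi>
          using bad_dist[of "\<phi> p" "\<phi> q" "\<phi> r" "\<phi> s" "\<phi> t"] by auto
        then have "B x = (\<lambda>\<phi>. 0)" by (simp add: B_def x)
        then show ?thesis using n by simp
      qed
    qed
    have "(real m ^ 3 - 3 * real m ^ 2) * D \<le> (\<Sum>i<m. \<Sum>j<m. \<Sum>k<m. of_bool (i \<noteq> j \<and> i \<noteq> k \<and> j \<noteq> k)) * D"
      using D0 by (intro mult_right_mono sum_distinct_triples)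
    also have "\<dots> = avgs ?is (\<lambda>\<phi>. \<Sum>i<m. \<Sum>j<m. \<Sum>k<m. of_bool (E (\<phi> i) (\<phi> j) (\<phi> k))) ?\<phi>"
      unfolding sum_distrib_right by (simp add: avgs_sum edge del: sum_of_bool_eq)
    also have "\<dots> \<le> avgs ?is (\<lambda>\<phi>. real m ^ 3 * ?L + real m ^ 3 * (\<Sum>x\<in>T. B x \<phi>)) ?\<phi>"
      by (intro avgs_mono sample)
    also have "\<dots> = real m ^ 3 * ?L + real m ^ 3 * (\<Sum>x\<in>T. avgs ?is (B x) ?\<phi>)"
      by (simp only: avgs_add avgs_cmult avgs_sum[OF finT] avgs_const)
    also have "(\<Sum>x\<in>T. avgs ?is (B x) ?\<phi>) \<le> (\<Sum>x\<in>T. 1 / ?n)"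
      by (intro sum_mono badp)
    also have "\<dots> = real m ^ 5 / ?n" using cardT by simp
    also have "real m ^ 3 * ?L + real m ^ 3 * (real m ^ 5 / ?n) = ?L * real m ^ 3 + real m ^ 8 / ?n"
      by (simp flip: power_add)
    finally show ?thesis by (simp add: mult_left_mono)
  qed
  then show ?thesis unfolding D .
qed

section \<open>Turan numbers and their limit\<close>

lemma of_nat_choose_3: "6 * real (n choose 3) = real n * (real n - 1) * (real n - 2)"
proof -
  have 2: "2 * real (n choose 2) = real n * (real n - 1)" for n
  proof (induction n)
    case (Suc n)
    have "Suc n choose 2 = n + (n choose 2)" by (simp add: numeral_2_eq_2)
    then have "2 * real (Suc n choose 2) = 2 * real n + 2 * real (n choose 2)" by simp
    also have "\<dots> = real (Suc n) * (real (Suc n) - 1)" unfolding Suc.IH by (simp add: algebra_simps)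
    finally show ?case .
  qed simp
  show ?thesis
  proof (induction n)
    case (Suc n)
    have "Suc n choose 3 = (n choose 2) + (n choose 3)" by (simp add: numeral_3_eq_3 numeral_2_eq_2)
    then have "6 * real (Suc n choose 3) = 3 * (2 * real (n choose 2)) + 6 * real (n choose 3)" by simp
    also have "\<dots> = real (Suc n) * (real (Suc n) - 1) * (real (Suc n) - 2)"
      unfolding 2 Suc.IH by (simp add: algebra_simps)
    finally show ?case .
  qed simp
qed

lemma three_graph_edge:
  assumes "three_graph H" "{x, y, z} \<in> edges H"
  shows "x \<noteq> y" "x \<noteq> z" "y \<noteq> z" "x \<in> verts H" "y \<in> verts H" "z \<in> verts H"
proof -
  have "\<forall>e\<in>edges H. e \<subseteq> verts H \<and> card e = 3" using assms(1) by (simp add: three_graph_def)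
  from bspec[OF this assms(2)] have V: "{x, y, z} \<subseteq> verts H" and c: "card {x, y, z} = 3" by blast+
  have "distinct [x, y, z]" by (rule card_distinct) (use c in simp)
  then show "x \<noteq> y" "x \<noteq> z" "y \<noteq> z" by simp_all
  show "x \<in> verts H" "y \<in> verts H" "z \<in> verts H" using V by simp_all
qed

lemma finite_edges: "three_graph H \<Longrightarrow> finite (edges H)"
  unfolding three_graph_def by (rule finite_subset[of _ "Pow (verts H)"]) auto

text \<open>Each edge comes from six ordered triples, and the sets \<open>S e\<close> of triples
  belonging to different edges are disjoint.\<close>

lemma ordered_edges:
  assumes "three_graph H"
  shows "6 * real (card (edges H)) \<le>
    (\<Sum>x\<in>verts H. \<Sum>y\<in>verts H. \<Sum>z\<in>verts H. of_bool ({x, y, z} \<in> edges H))"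
proof -
  let ?V = "verts H"
  let ?V3 = "?V \<times> ?V \<times> ?V"
  have fin: "finite ?V" using assms by (simp add: three_graph_def)
  define g where "g = (\<lambda>(x, y, z). {x, y, z :: 'a})"
  define S where "S e = {t \<in> ?V3. g t = e}" for e
  have finS: "finite (S e)" for e using fin by (simp add: S_def)
  have six: "6 \<le> card (S e)" if "e \<in> edges H" for e
  proof -
    have "card e = 3" "e \<subseteq> ?V" using that assms by (auto simp: three_graph_def)
    then obtain a b c where e: "e = {a, b, c}" "a \<noteq> b" "a \<noteq> c" "b \<noteq> c" by (auto simp: card_3_iff)
    have "{(a, b, c), (a, c, b), (b, a, c), (b, c, a), (c, a, b), (c, b, a)} \<subseteq> S e"
      using \<open>e \<subseteq> ?V\<close> unfolding S_def g_def e(1) by auto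
    from card_mono[OF finS this] show ?thesis using e by simp
  qed
  have "6 * card (edges H) = (\<Sum>e\<in>edges H. 6)" by simp
  also have "\<dots> \<le> (\<Sum>e\<in>edges H. card (S e))" by (intro sum_mono six)
  also have "\<dots> = card (\<Union>e\<in>edges H. S e)"
    using finite_edges[OF assms] finS by (subst card_UN_disjoint) (auto simp: S_def)
  also have "(\<Union>e\<in>edges H. S e) = ?V3 \<inter> {t. g t \<in> edges H}"
    by (auto simp: S_def)
  finally have "6 * real (card (edges H)) \<le> real (card (?V3 \<inter> {t. g t \<in> edges H}))"
    by linarith
  also have "\<dots> = (\<Sum>t\<in>?V3. of_bool (g t \<in> edges H))"
    using fin by (simp add: sum_of_bool_eq)
  also have "\<dots> = (\<Sum>x\<in>?V. \<Sum>y\<in>?V. \<Sum>z\<in>?V. of_bool ({x, y, z} \<in> edges H))"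
    by (simp add: g_def sum.cartesian_product split_def)
  finally show ?thesis .
qed

lemma finite_turan_set:
  "finite {card (edges H) | H :: nat hgraph. three_graph H \<and> card (verts H) = n \<and> free_of \<F> H}"
proof (rule finite_subset)
  show "{card (edges H) | H :: nat hgraph. three_graph H \<and> card (verts H) = n \<and> free_of \<F> H} \<subseteq> {..2 ^ n}"
  proof
    fix k assume "k \<in> {card (edges H) | H :: nat hgraph. three_graph H \<and> card (verts H) = n \<and> free_of \<F> H}"
    then obtain H :: "nat hgraph" where H: "three_graph H" "card (verts H) = n" and k: "k = card (edges H)"
      by blast
    have "card (edges H) \<le> card (Pow (verts H))"
      using H(1) by (intro card_mono) (auto simp: three_graph_def)
    then show "k \<in> {..2 ^ n}" using H by (simp add: k three_graph_def card_Pow)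
  qed
qed simp

lemma card_edges_le_turan_number:
  "three_graph H \<Longrightarrow> free_of \<F> H \<Longrightarrow> card (edges H) \<le> turan_number (card (verts H)) \<F>" for H :: "nat hgraph"
  unfolding turan_number_def by (intro Max_ge finite_turan_set) blast

text \<open>The edgeless graph shows that the maximum is taken over a nonempty set, provided that
  every forbidden graph has an edge.\<close>

lemma turan_number_attained:
  assumes "\<And>F. F \<in> \<F> \<Longrightarrow> edges F \<noteq> {}"
  obtains H :: "nat hgraph" where "three_graph H" "card (verts H) = n" "free_of \<F> H"
    "card (edges H) = turan_number n \<F>"
proof -
  let ?S = "{card (edges H) | H :: nat hgraph. three_graph H \<and> card (verts H) = n \<and> free_of \<F> H}"
  have "three_graph ({..<n}, {})" by (simp add: three_graph_def)
  moreover have "free_of \<F> ({..<n}, {})"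
    using assms unfolding free_of_def contains_copy_def by fastforce
  ultimately have "card (edges ({..<n}, {} :: nat set set)) \<in> ?S"
    by (intro CollectI exI[of _ "({..<n}, {})"]) simp
  then have "Max ?S \<in> ?S" by (intro Max_in finite_turan_set) blast
  then obtain H :: "nat hgraph" where "three_graph H" "card (verts H) = n" "free_of \<F> H"
    "Max ?S = card (edges H)" by blast
  then show thesis by (intro that) (simp_all add: turan_number_def)
qed

text \<open>Double counting over deleted vertices: an edge of an extremal graph on n + 1 vertices
  survives n + 1 - 3 deletions, and each deletion leaves an admissible graph on n vertices.\<close>

lemma turan_number_Suc:
  assumes ne: "\<And>F. F \<in> \<F> \<Longrightarrow> edges F \<noteq> {}"
  shows "(n - 2) * turan_number (Suc n) \<F> \<le> Suc n * turan_number n \<F>"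
proof -
  obtain H :: "nat hgraph" where H: "three_graph H" "card (verts H) = Suc n" "free_of \<F> H"
    "card (edges H) = turan_number (Suc n) \<F>" using turan_number_attained[OF ne] by metis
  let ?V = "verts H" and ?K = "edges H"
  have finV: "finite ?V" and finK: "finite ?K"
    using H(1) finite_edges[OF H(1)] unfolding three_graph_def by blast+
  have del: "card {e \<in> ?K. v \<notin> e} \<le> turan_number n \<F>" if v: "v \<in> ?V" for v
  proof -
    let ?H = "(?V - {v}, {e \<in> ?K. v \<notin> e})"
    have "three_graph ?H" using H(1) by (auto simp: three_graph_def)
    moreover have "free_of \<F> ?H"
      unfolding free_of_def
    proof (intro ballI notI)
      fix F assume F: "F \<in> \<F>" "contains_copy ?H F"
      then have "contains_copy H F" unfolding contains_copy_def by auto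
      then show False using H(3) F(1) unfolding free_of_def by blast
    qed
    ultimately show ?thesis
      using card_edges_le_turan_number[of ?H \<F>] v H(2) finV by simp
  qed
  have "(n - 2) * card ?K = (\<Sum>e\<in>?K. card (?V - e))"
  proof -
    have "card (?V - e) = n - 2" if "e \<in> ?K" for e
    proof -
      have "e \<subseteq> ?V" "card e = 3" using that H(1) by (auto simp: three_graph_def)
      then show ?thesis using finite_subset[OF _ finV, of e] H(2) by (simp add: card_Diff_subset)
    qed
    then show ?thesis by simp
  qed
  also have "\<dots> = (\<Sum>e\<in>?K. \<Sum>v\<in>?V. if v \<notin> e then 1 else 0)"
  proof (intro sum.cong refl)
    fix e
    have "?V - e = {v \<in> ?V. v \<notin> e}" by auto
    then show "card (?V - e) = (\<Sum>v\<in>?V. if v \<notin> e then 1 else 0)"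
      by (simp only: card_eq_sum sum.inter_filter[OF finV])
  qed
  also have "\<dots> = (\<Sum>v\<in>?V. \<Sum>e\<in>?K. if v \<notin> e then 1 else 0)" by (rule sum.swap)
  also have "\<dots> = (\<Sum>v\<in>?V. card {e \<in> ?K. v \<notin> e})"
    by (simp only: card_eq_sum sum.inter_filter[OF finK])
  also have "\<dots> \<le> (\<Sum>v\<in>?V. turan_number n \<F>)" by (intro sum_mono del)
  finally show ?thesis using H(2,4) by simp
qed

text \<open>\<open>lim\<close> carries information only for a convergent sequence. By the deletion
  inequality the ratios decrease from n = 3 on, where the binomial coefficient is positive.\<close>

lemma turan_density_LIMSEQ:
  assumes ne: "\<And>F. F \<in> \<F> \<Longrightarrow> edges F \<noteq> {}"
  shows "(\<lambda>n. real (turan_number n \<F>) / real (n choose 3)) \<longlonglongrightarrow> turan_density \<F>"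
proof -
  let ?a = "\<lambda>n. real (turan_number n \<F>) / real (n choose 3)"
  have step: "?a (Suc n) \<le> ?a n" if n: "3 \<le> n" for n
  proof -
    let ?x = "real (turan_number (Suc n) \<F>)" and ?y = "real (turan_number n \<F>)" and ?n = "real n"
    have pos: "0 < ?n - 2" "0 < ?n" "0 < ?n - 1" using n by auto
    have "real ((n - 2) * turan_number (Suc n) \<F>) \<le> real (Suc n * turan_number n \<F>)"
      using turan_number_Suc[OF ne] by (intro of_nat_mono)
    then have xy: "(?n - 2) * ?x \<le> (?n + 1) * ?y" using n by (simp add: of_nat_diff algebra_simps)
    have c: "real (n choose 3) = ?n * (?n - 1) * (?n - 2) / 6"
      "real (Suc n choose 3) = (?n + 1) * ?n * (?n - 1) / 6"
      using of_nat_choose_3[of n] of_nat_choose_3[of "Suc n"] by (simp_all add: algebra_simps)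
    have "?x * ((?n * (?n - 1)) * (?n - 2)) \<le> ?y * ((?n * (?n - 1)) * (?n + 1))"
      using mult_left_mono[OF xy, of "?n * (?n - 1)"] pos by (simp add: mult_ac)
    then show ?thesis unfolding c using pos by (simp add: divide_simps mult_ac)
  qed
  have "decseq (\<lambda>n. ?a (n + 3))" 
  proof (rule decseq_SucI)
    show "?a (Suc n + 3) \<le> ?a (n + 3)" for n unfolding add_Suc by (rule step) simp
  qed
  then obtain l where "(\<lambda>n. ?a (n + 3)) \<longlonglongrightarrow> l"
    by (rule decseq_convergent[where B = 0]) auto
  then have "?a \<longlonglongrightarrow> l" by (rule LIMSEQ_offset)
  then show ?thesis unfolding turan_density_def by (simp add: limI)
qed

section \<open>Copies of the forbidden graphs\<close>

lemma contains_copyI: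
  fixes xs :: "'a list"
  assumes "distinct xs" "set xs \<subseteq> verts H" and V: "verts F = {1..length xs}"
    and "\<And>X. X \<in> edges F \<Longrightarrow> (\<lambda>i. xs ! (i - 1)) ` X \<in> edges H"
  shows "contains_copy H F"
  unfolding contains_copy_def V
\<comment> \<open>Vertices of F are numbered from 1, list positions from 0.\<close>
proof (rule exI[of _ "\<lambda>i. xs ! (i - 1)"], intro conjI ballI)
  have "inj_on (\<lambda>i. i - 1) {1..length xs}" by (rule inj_on_diff_nat) simp
  moreover have "inj_on ((!) xs) ((\<lambda>i. i - 1) ` {1..length xs})"
    by (rule inj_on_nth[OF assms(1)]) auto
  ultimately show "inj_on (\<lambda>i. xs ! (i - 1)) {1..length xs}"
    using comp_inj_on[of "\<lambda>i. i - 1" "{1..length xs}" "(!) xs"] by (simp add: comp_def)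
  show "(\<lambda>i. xs ! (i - 1)) ` {1..length xs} \<subseteq> verts H"
  proof
    fix x assume "x \<in> (\<lambda>i. xs ! (i - 1)) ` {1..length xs}"
    then obtain i where i: "i \<in> {1..length xs}" "x = xs ! (i - 1)" by (rule imageE)
    have "i - 1 < length xs" using i(1) by auto
    then have "x \<in> set xs" unfolding i(2) by (rule nth_mem)
    then show "x \<in> verts H" using assms(2) by (rule rev_subsetD)
  qed
  show "(\<lambda>i. xs ! (i - 1)) ` X \<in> edges H" if "X \<in> edges F" for X using assms(4)[OF that] .
qed

lemma K4_copy:
  assumes "three_graph H" "free_of \<F> H" "C43 \<in> \<F>"
  shows "\<not> ({a, b, c} \<in> edges H \<and> {a, b, d} \<in> edges H \<and> {a, c, d} \<in> edges H \<and> {b, c, d} \<in> edges H)"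
proof
  assume *: "{a, b, c} \<in> edges H \<and> {a, b, d} \<in> edges H \<and> {a, c, d} \<in> edges H \<and> {b, c, d} \<in> edges H"
  have d: "distinct [a, b, c, d]"
    using * three_graph_edge[OF assms(1), of a b c]
      three_graph_edge[OF assms(1), of a b d]
      three_graph_edge[OF assms(1), of a c d]
      three_graph_edge[OF assms(1), of b c d]
    by simp
  have v: "a \<in> verts H" "b \<in> verts H" "c \<in> verts H" "d \<in> verts H"
    using * three_graph_edge[OF assms(1), of a b c]
      three_graph_edge[OF assms(1), of a b d]
      three_graph_edge[OF assms(1), of a c d]
      three_graph_edge[OF assms(1), of b c d]
    by simp_all
  \<comment> \<open>\<open>C43\<close> has all 3-subsets as edges; each is the complement of one
    vertex, which yields the explicit list.\<close>
  have ed: "X \<in> {{1, 2, 3}, {1, 2, 4}, {1, 3, 4}, {2, 3, 4}}" if X: "X \<in> edges C43" for X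
  proof -
    have sub: "X \<subseteq> {1..4}" and card: "card X = 3" using X by (simp_all add: C43_def)
    have V4: "{1..4::nat} = {1, 2, 3, 4}" by auto
    have "card ({1..4} - X) = 1" using sub card finite_subset[OF sub] by (simp add: card_Diff_subset)
    then obtain i where i: "{1..4} - X = {i}" by (rule card_1_singletonE)
    have "X = {1..4} - ({1..4} - X)" using sub by (simp add: double_diff)
    then have e: "X = {1, 2, 3, 4} - {i}" unfolding i by (simp only: V4)
    have "i \<in> {1..4} - X" unfolding i by simp
    then have "i \<in> {1, 2, 3, 4}" unfolding V4 by (rule DiffD1)
    then consider "i = 1" | "i = 2" | "i = 3" | "i = 4" by (elim insertE emptyE)
    then show ?thesis unfolding e by cases (simp_all add: insert_Diff_if)
  qed
  have "contains_copy H C43"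
  proof (rule contains_copyI)
    show "distinct [a, b, c, d]" by (rule d)
    show "set [a, b, c, d] \<subseteq> verts H" using v by simp
    show "verts C43 = {1..length [a, b, c, d]}" by (simp add: C43_def)
    fix X assume "X \<in> edges C43"
    then have "X \<in> {{1, 2, 3}, {1, 2, 4}, {1, 3, 4}, {2, 3, 4}}" by (rule ed)
    then show "(\<lambda>i. [a, b, c, d] ! (i - 1)) ` X \<in> edges H"
      using * by (elim insertE emptyE) (simp_all add: insert_commute)
  qed
  then show False using assms(2,3) unfolding free_of_def by blast
qed

text \<open>Any two of the five vertices lie in a common edge, so the edges alone force them to be
  distinct.\<close>

lemma C5_copy:
  assumes "three_graph H" "free_of \<F> H" "C53 \<in> \<F>"
  shows "\<not> ({a, b, c} \<in> edges H \<and> {b, c, d} \<in> edges H \<and> {c, d, e} \<in> edges H \<and> {d, e, a} \<in> edges H \<and> {e, a, b} \<in> edges H)"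
proof
  assume *: "{a, b, c} \<in> edges H \<and> {b, c, d} \<in> edges H \<and> {c, d, e} \<in> edges H \<and> {d, e, a} \<in> edges H \<and> {e, a, b} \<in> edges H"
  have d: "distinct [a, b, c, d, e]"
    using * three_graph_edge[OF assms(1), of a b c]
      three_graph_edge[OF assms(1), of b c d]
      three_graph_edge[OF assms(1), of c d e]
      three_graph_edge[OF assms(1), of d e a]
      three_graph_edge[OF assms(1), of e a b]
    by simp
  have v: "a \<in> verts H" "b \<in> verts H" "c \<in> verts H" "d \<in> verts H" "e \<in> verts H"
    using * three_graph_edge[OF assms(1), of a b c]
      three_graph_edge[OF assms(1), of b c d]
      three_graph_edge[OF assms(1), of c d e]
      three_graph_edge[OF assms(1), of d e a]
      three_graph_edge[OF assms(1), of e a b]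
    by simp_all
  have "contains_copy H C53"
  proof (rule contains_copyI)
    show "distinct [a, b, c, d, e]" by (rule d)
    show "set [a, b, c, d, e] \<subseteq> verts H" using v by simp
    show "verts C53 = {1..length [a, b, c, d, e]}" by (simp add: C53_def)
    fix X assume "X \<in> edges C53"
    then have "X \<in> {{1, 2, 3}, {2, 3, 4}, {3, 4, 5}, {4, 5, 1}, {5, 1, 2}}" by (simp only: C53_def snd_conv)
    then show "(\<lambda>i. [a, b, c, d, e] ! (i - 1)) ` X \<in> edges H"
      using * by (elim insertE emptyE) (simp_all add: insert_commute)
  qed
  then show False using assms(2,3) unfolding free_of_def by blast
qed

text \<open>Distinctness is a hypothesis here, as some pairs of vertices of \<open>F2\<close> share
  no edge.\<close>

lemma F2_copy:
  assumes "three_graph H" "free_of \<F> H" "F2 \<in> \<F>" "distinct [a, b, c, d, e, f]"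
  shows "\<not> ({a, b, c} \<in> edges H \<and> {a, c, d} \<in> edges H \<and> {a, d, e} \<in> edges H \<and> {a, e, f} \<in> edges H \<and> {a, f, b} \<in> edges H \<and> {b, c, d} \<in> edges H)"
proof
  assume *: "{a, b, c} \<in> edges H \<and> {a, c, d} \<in> edges H \<and> {a, d, e} \<in> edges H \<and> {a, e, f} \<in> edges H \<and> {a, f, b} \<in> edges H \<and> {b, c, d} \<in> edges H"
  note d = assms(4)
  have v: "a \<in> verts H" "b \<in> verts H" "c \<in> verts H" "d \<in> verts H" "e \<in> verts H" "f \<in> verts H"
    using * three_graph_edge[OF assms(1), of a b c]
      three_graph_edge[OF assms(1), of a c d]
      three_graph_edge[OF assms(1), of a d e]
      three_graph_edge[OF assms(1), of a e f]
      three_graph_edge[OF assms(1), of a f b]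
      three_graph_edge[OF assms(1), of b c d]
    by simp_all
  have "contains_copy H F2"
  proof (rule contains_copyI)
    show "distinct [a, b, c, d, e, f]" by (rule d)
    show "set [a, b, c, d, e, f] \<subseteq> verts H" using v by simp
    show "verts F2 = {1..length [a, b, c, d, e, f]}" by (simp add: F2_def)
    fix X assume "X \<in> edges F2"
    then have "X \<in> {{1, 2, 3}, {1, 3, 4}, {1, 4, 5}, {1, 5, 6}, {1, 6, 2}, {2, 3, 4}}" by (simp only: F2_def snd_conv)
    then show "(\<lambda>i. [a, b, c, d, e, f] ! (i - 1)) ` X \<in> edges H"
      using * by (elim insertE emptyE) (simp_all add: insert_commute)
  qed
  then show False using assms(2,3) unfolding free_of_def by blast
qed

section \<open>The bound on the Turan density\<close>

lemma edge_bound: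
  fixes \<C> :: "nat hgraph set" and H :: "nat hgraph"
  assumes \<C>: "\<C> = {C43, C53} \<or> \<C> = {C43, F1, F2}"
    and H: "three_graph H" "free_of \<C> H" "0 < card (verts H)"
  shows "(real m ^ 3 - 3 * real m ^ 2) * (6 * real (card (edges H)) / real (card (verts H)) ^ 3) \<le>
    (2 * sqrt 3 - 3) * real m ^ 3 + real m ^ 8 / real (card (verts H))"
proof -
  let ?n = "real (card (verts H))"
  define s where "s = (\<Sum>x\<in>verts H. \<Sum>y\<in>verts H. \<Sum>z\<in>verts H. of_bool ({x, y, z} \<in> edges H) :: real)"
  have bound: "(real m ^ 3 - 3 * real m ^ 2) * (s / ?n ^ 3) \<le> (2 * sqrt 3 - 3) * real m ^ 3 + real m ^ 8 / ?n"
    unfolding s_def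
  proof (rule sampling_bound)
    show "finite (verts H)" "verts H \<noteq> {}" using H(3) card_gt_0_iff by blast+
    show "({x, y, z} \<in> edges H) = ({y, x, z} \<in> edges H)" "({x, y, z} \<in> edges H) = ({x, z, y} \<in> edges H)" for x y z
      by (simp_all add: insert_commute)
    show "{x, x, y} \<notin> edges H" for x y using three_graph_edge(1)[OF H(1), of x x y] by blast
    show "\<not> ({a, b, c} \<in> edges H \<and> {a, b, d} \<in> edges H \<and> {a, c, d} \<in> edges H \<and> {b, c, d} \<in> edges H)" for a b c d
      by (rule K4_copy[OF H(1,2)]) (use \<C> in blast)
    show "(\<forall>a b c d e. \<not> ({a, b, c} \<in> edges H \<and> {b, c, d} \<in> edges H \<and> {c, d, e} \<in> edges H \<and>
          {d, e, a} \<in> edges H \<and> {e, a, b} \<in> edges H)) \<or>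
       (\<forall>a b c d e f. distinct [a, b, c, d, e, f] \<longrightarrow>
          \<not> ({a, b, c} \<in> edges H \<and> {a, c, d} \<in> edges H \<and> {a, d, e} \<in> edges H \<and>
            {a, e, f} \<in> edges H \<and> {a, f, b} \<in> edges H \<and> {b, c, d} \<in> edges H))"
      using \<C>
    proof
      assume "\<C> = {C43, C53}"
      then have "C53 \<in> \<C>" by simp
      then show ?thesis using C5_copy[OF H(1,2)] by blast
    next
      assume "\<C> = {C43, F1, F2}"
      then have "F2 \<in> \<C>" by simp
      then show ?thesis using F2_copy[OF H(1,2)] by blast
    qed
  qed
  show ?thesis
  proof (cases "3 \<le> m")
    case True
    have "3 * real m ^ 2 \<le> real m * real m ^ 2" using True by (intro mult_right_mono) auto
    then have "0 \<le> real m ^ 3 - 3 * real m ^ 2" by (simp add: power3_eq_cube power2_eq_square)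
    moreover have "6 * real (card (edges H)) \<le> s" unfolding s_def by (rule ordered_edges[OF H(1)])
    ultimately have "(real m ^ 3 - 3 * real m ^ 2) * (6 * real (card (edges H)) / ?n ^ 3) \<le>
        (real m ^ 3 - 3 * real m ^ 2) * (s / ?n ^ 3)"
      by (intro mult_left_mono divide_right_mono) auto
    then show ?thesis using bound by simp
  next
    case False
    \<comment> \<open>For m < 3 the first factor is nonpositive and would reverse the comparison of
      edges with ordered triples; but then the left-hand side is at most 0.\<close>
    have "real m * real m ^ 2 \<le> 3 * real m ^ 2" using False by (intro mult_right_mono) auto
    then have "(real m ^ 3 - 3 * real m ^ 2) * (6 * real (card (edges H)) / ?n ^ 3) \<le> 0"
      by (intro mult_nonpos_nonneg) (simp_all add: power3_eq_cube power2_eq_square)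
    moreover have "0 \<le> 2 * sqrt 3 - 3" using real_le_rsqrt[of "3/2" 3] by (simp add: power2_eq_square)
    then have "0 \<le> (2 * sqrt 3 - 3) * real m ^ 3 + real m ^ 8 / ?n" by simp
    ultimately show ?thesis by linarith
  qed
qed

theorem theorem2p4:
  fixes \<C> :: "nat hgraph set"
  assumes "\<C> = {C43, C53} \<or> \<C> = {C43, F1, F2}"
  shows "turan_density \<C> \<le> 2 * sqrt 3 - 3"
proof -
  let ?L = "2 * sqrt 3 - 3" and ?d = "turan_density \<C>"
  have "edges C43 \<noteq> {}"
  proof -
    have "{1, 2, 3} \<in> edges C43" by (simp add: C43_def)
    then show ?thesis by blast
  qed
  then have ne: "edges F \<noteq> {}" if "F \<in> \<C>" for F
    using that assms by (auto simp: C53_def F1_def F2_def)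
  \<comment> \<open>The quotient of 6 (n choose 3) by the cube of n, which tends to 1.\<close>
  let ?q = "\<lambda>n. (1 - 1 / real n) * (1 - 2 / real n)"
  have dens: "(\<lambda>n. real (turan_number n \<C>) / real (n choose 3)) \<longlonglongrightarrow> ?d"
    by (rule turan_density_LIMSEQ[OF ne])
  have q: "?q \<longlonglongrightarrow> (1 - 0) * (1 - 0)"
    by (intro tendsto_intros lim_const_over_n)
  \<comment> \<open>For a fixed sample size m the error term, the eighth power of m over n, vanishes
    as n grows; only afterwards does m tend to infinity.\<close>
  have step: "(real m ^ 3 - 3 * real m ^ 2) * ?d \<le> ?L * real m ^ 3" for m
  proof -
    have "(\<lambda>n. (real m ^ 3 - 3 * real m ^ 2) * (real (turan_number n \<C>) / real (n choose 3) * ?q n))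
        \<longlonglongrightarrow> (real m ^ 3 - 3 * real m ^ 2) * (?d * ((1 - 0) * (1 - 0)))"
      by (intro tendsto_mult tendsto_const dens q)
    moreover have "(\<lambda>n. ?L * real m ^ 3 + real m ^ 8 / real n) \<longlonglongrightarrow> ?L * real m ^ 3 + 0"
      by (intro tendsto_add tendsto_const lim_const_over_n)
    moreover have "(real m ^ 3 - 3 * real m ^ 2) * (real (turan_number n \<C>) / real (n choose 3) * ?q n)
        \<le> ?L * real m ^ 3 + real m ^ 8 / real n" if n: "3 \<le> n" for n
    proof -
      obtain H :: "nat hgraph" where H: "three_graph H" "card (verts H) = n" "free_of \<C> H"
        "card (edges H) = turan_number n \<C>" using turan_number_attained[OF ne] by metis
      have c: "real (n choose 3) = real n * (real n - 1) * (real n - 2) / 6"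
        using of_nat_choose_3[of n] by simp
      have "real (turan_number n \<C>) / real (n choose 3) * ?q n = 6 * real (turan_number n \<C>) / real n ^ 3"
        unfolding c using n by (simp add: divide_simps power3_eq_cube)
      then show ?thesis using edge_bound[OF assms H(1,3), of m] H(2,4) n by simp
    qed
    ultimately have "(real m ^ 3 - 3 * real m ^ 2) * (?d * ((1 - 0) * (1 - 0))) \<le> ?L * real m ^ 3 + 0"
      by (intro LIMSEQ_le) blast+
    then show ?thesis by simp
  qed
  have "(1 - 3 / real m) * ?d \<le> ?L" if "1 \<le> m" for m
  proof -
    have "real m ^ 3 * ((1 - 3 / real m) * ?d) = (real m ^ 3 - 3 * real m ^ 2) * ?d"
      using that by (simp add: field_simps power3_eq_cube power2_eq_square)
    also have "\<dots> \<le> real m ^ 3 * ?L" using step[of m] by (simp only: mult.commute)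
    finally show ?thesis using that by (simp only: mult_le_cancel_left) simp
  qed
  moreover have "(\<lambda>m. (1 - 3 / real m) * ?d) \<longlonglongrightarrow> (1 - 0) * ?d"
    by (intro tendsto_intros lim_const_over_n)
  ultimately have "(1 - 0) * ?d \<le> ?L" by (intro LIMSEQ_le_const2) blast+
  then show ?thesis by simp
qed

end
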